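(* Let $(G,\omega)$ be a saturated $p$-valued group with ordered basis $(g_1,\dots,g_d)$. Then there is a unique dagger group $\mathbb{G}$ over $\mathbb{Q}_p$ such that (a) $\mathbb{G}=\mathrm{Sp}(\mathbb{Q}_p\langle Z_1,\dots,Z_d\rangle^\dagger)$ as a dagger space over $\mathbb{Q}_p$; (b) the map $\varphi\mapsto g_1^{\varphi(Z_1)}\cdots g_d^{\varphi(Z_d)}$ gives an isomorphism of abstract groups $$\mathbb{G}(\mathbb{Q}_p)=\mathrm{Hom}_{\mathbb{Q}_p\text{-alg}}(\mathbb{Q}_p\langle Z_1,\dots,Z_d\rangle^\dagger,\mathbb{Q}_p)\overset{\sim}{\longrightarrow}G.$$ Moreover, if $(g_1',\dots,g_d')$ is another ordered basis for $(G,\omega)$ with associated dagger group $\mathbb{G}'$, then there is a unique isomorphism of dagger groups $\mathbb{G}\overset{\sim}{\longrightarrow}\mathbb{G}'$ such that the induced isomorphism $\mathbb{G}(\mathbb{Q}_p)\to\mathbb{G}'(\mathbb{Q}_p)$, composed with the isomorphism $\mathbb{G}'(\mathbb{Q}_p)\to G$ from (b) for $(g_1',\dots,g_d')$, equals the isomorphism $\mathbb{G}(\mathbb{Q}_p)\to G$ from (b) for $(g_1,\dots,g_d)$.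
   Context: $p$ is a prime; $v$ is the $p$-adic valuation on $\mathbb{Z}_p$ with $v(p)=1$, $v(0)=\infty$. A $p$-valued group $(G,\omega)$ is a pro-$p$ group $G$ with a function $\omega:G\setminus\{1\}\to(0,\infty)$ (convention $\omega(1)=\infty$) such that for all $g,h\in G$: (a) $\omega(g)>\frac{1}{p-1}$; (b) $\omega(g^{-1}h)\ge\min\{\omega(g),\omega(h)\}$; (c) $\omega([g,h])\ge\omega(g)+\omega(h)$; (d) $\omega(g^p)=\omega(g)+1$; and such that the topology of $G$ is defined by $\omega$ (the subgroups $\{g:\omega(g)\ge\nu\}$, $\nu>0$, form a neighborhood basis of $1$). It is saturated if $\omega(g)>\frac{p}{p-1}$ implies that $g$ is a $p$-th power in $G$. An ordered basis is a sequence $(g_1,\dots,g_d)$ in $G$ such that $\mathbb{Z}_p^d\to G$, $x\mapsto g_1^{x_1}\cdots g_d^{x_d}$, is a homeomorphism and $\omega(g_1^{x_1}\cdots g_d^{x_d})=\min_i\{\omega(g_i)+v(x_i)\}$. The Washnitzer algebra $W_n=\mathbb{Q}_p\langle Z_1,\dots,Z_n\rangle^\dagger$ is the algebra of power series $\sum_{\alpha\in\mathbb{N}_0^n}c_\alpha Z^\alpha\in\mathbb{Q}_p[[Z_1,\dots,Z_n]]$ such that $|c_\alpha|r^{|\alpha|}\to0$ as $|\alpha|\to\infty$ for some $r>1$. A dagger algebra over $\mathbb{Q}_p$ is a $\mathbb{Q}_p$-algebra isomorphic to some $W_n/I$. Dagger spaces (Grosse-Klönne) are locally $G$-ringed spaces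 admissibly covered by affinoid dagger spaces $\mathrm{Sp}(A)$ ($A$ a dagger algebra; underlying set the maximal ideals of $A$). Morphisms of affinoid dagger spaces $\mathrm{Sp}(B)\to\mathrm{Sp}(A)$ are the same as $\mathbb{Q}_p$-algebra homomorphisms $A\to B$. The product of $\mathrm{Sp}(A_1)$ and $\mathrm{Sp}(A_2)$ over $\mathrm{Sp}(\mathbb{Q}_p)$ is $\mathrm{Sp}(A_1\otimes^\dagger_{\mathbb{Q}_p}A_2)$, where $W_m\otimes^\dagger W_n=W_{m+n}$. A dagger group over $\mathbb{Q}_p$ is a group object in the category of dagger spaces over $\mathbb{Q}_p$; for $\mathrm{Sp}(A)$ this amounts to algebra homomorphisms $m^*:A\to A\otimes^\dagger A$, $e^*:A\to\mathbb{Q}_p$, $i^*:A\to A$ satisfying the usual (Hopf algebra) diagrams, and $\mathrm{Hom}_{\mathbb{Q}_p\text{-alg}}(A,\mathbb{Q}_p)$ then becomes a group. *)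

theory Defs
  imports "HOL-Analysis.Analysis" "HOL-Algebra.Coset" "HOL-Algebra.Module" "HOL-Computational_Algebra.Primes" "HOL-Library.Poly_Mapping"
begin

text \<open>
  The prime \<open>p\<close> is the cardinality of a type, so that the field of \<open>p\<close>-adic numbers can be a type:
  the completion of the rationals with respect to the \<open>p\<close>-adic absolute value, that is,
  Cauchy sequences modulo null sequences.
\<close>

class prime_card = assumes prime_card: "prime (CARD('a))"

definition rat_padic_abs :: "nat \<Rightarrow> rat \<Rightarrow> real" where
  "rat_padic_abs p x =
    (if x = 0 then 0
     else real p ^ multiplicity (int p) (snd (quotient_of x)) /
          real p ^ multiplicity (int p) (fst (quotient_of x)))"

context
  fixes p :: nat
  assumes p: "prime p"
begin

lemma rat_padic_abs_frac:
  assumes "a \<noteq> 0" "b \<noteq> 0"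
  shows "rat_padic_abs p (of_int a / of_int b) =
    real p ^ multiplicity (int p) b / real p ^ multiplicity (int p) a"
proof -
  obtain c d where cd: "quotient_of (of_int a / of_int b) = (c, d)" by fastforce
  have d: "d > 0" using quotient_of_denom_pos[OF cd] .
  have eq: "(of_int a / of_int b :: rat) = of_int c / of_int d" using quotient_of_div[OF cd] .
  have c: "c \<noteq> 0" using eq assms by auto
  have "(of_int (a * d) :: rat) = of_int (c * b)" using eq assms d by (simp add: field_simps)
  hence "a * d = c * b" by (simp only: of_int_eq_iff)
  hence "multiplicity (int p) (a * d) = multiplicity (int p) (c * b)" by simp
  hence m: "multiplicity (int p) a + multiplicity (int p) d = multiplicity (int p) c + multiplicity (int p) b"
    using assms c d p by (simp add: prime_elem_multiplicity_mult_distrib)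
  have "real p ^ multiplicity (int p) a * real p ^ multiplicity (int p) d =
        real p ^ multiplicity (int p) c * real p ^ multiplicity (int p) b"
    using m by (metis power_add)
  thus ?thesis using assms cd p prime_gt_0_nat[OF p]
    by (simp add: rat_padic_abs_def field_simps)
qed

lemma rat_frac: obtains a b :: int where "x = (of_int a / of_int b :: rat)" "b \<noteq> 0"
  by (metis quotient_of_div prod.exhaust quotient_of_denom_pos less_irrefl)

lemma rat_padic_abs_nonneg: "rat_padic_abs p x \<ge> 0"
  by (simp add: rat_padic_abs_def)

lemma rat_padic_abs_zero [simp]: "rat_padic_abs p 0 = 0"
  by (simp add: rat_padic_abs_def)

lemma rat_padic_abs_eq_0_iff [simp]: "rat_padic_abs p x = 0 \<longleftrightarrow> x = 0"
  using prime_gt_0_nat[OF p] by (simp add: rat_padic_abs_def)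

lemma rat_padic_abs_one [simp]: "rat_padic_abs p 1 = 1"
  using rat_padic_abs_frac[of 1 1] by simp

lemma rat_padic_abs_mult: "rat_padic_abs p (x * y) = rat_padic_abs p x * rat_padic_abs p y"
proof (cases "x = 0 \<or> y = 0")
  case False
  obtain a b where x: "x = of_int a / of_int b" "b \<noteq> 0" by (rule rat_frac)
  obtain c d where y: "y = of_int c / of_int d" "d \<noteq> 0" by (rule rat_frac)
  have ac: "a \<noteq> 0" "c \<noteq> 0" using x y False by auto
  have "x * y = of_int (a * c) / of_int (b * d)" by (simp add: x y)
  hence "rat_padic_abs p (x * y) =
      real p ^ multiplicity (int p) (b * d) / real p ^ multiplicity (int p) (a * c)"
    using rat_padic_abs_frac[of "a * c" "b * d"] ac x y by simp
  also have "\<dots> = rat_padic_abs p x * rat_padic_abs p y"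
    using ac x y p rat_padic_abs_frac[of a b] rat_padic_abs_frac[of c d]
    by (simp add: prime_elem_multiplicity_mult_distrib power_add)
  finally show ?thesis .
qed auto

lemma rat_padic_abs_minus [simp]: "rat_padic_abs p (- x) = rat_padic_abs p x"
proof -
  have "multiplicity (int p) (- 1) = 0" using prime_gt_1_nat[OF p] by (intro not_dvd_imp_multiplicity_0) simp
  hence "rat_padic_abs p (-1) = 1"
    using rat_padic_abs_frac[of "-1" 1] by simp
  thus ?thesis using rat_padic_abs_mult[of "-1" x] by simp
qed

lemma rat_padic_abs_inverse: "rat_padic_abs p (inverse x) = inverse (rat_padic_abs p x)"
proof (cases "x = 0")
  case False
  hence "rat_padic_abs p x * rat_padic_abs p (inverse x) = 1"
    using rat_padic_abs_mult[of x "inverse x"] by simp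
  thus ?thesis by (simp add: inverse_unique)
qed simp

lemma rat_padic_abs_add: "rat_padic_abs p (x + y) \<le> max (rat_padic_abs p x) (rat_padic_abs p y)"
proof -
  have key: "rat_padic_abs p (x + y) \<le> rat_padic_abs p y"
    if le: "rat_padic_abs p x \<le> rat_padic_abs p y" for x y
  proof (cases "y = 0 \<or> x = 0 \<or> x + y = 0")
    case True
    thus ?thesis using le rat_padic_abs_nonneg[of x] rat_padic_abs_nonneg[of y]
      by (metis add.right_neutral add.left_neutral rat_padic_abs_eq_0_iff order_refl order_antisym)
  next
    case False
    obtain a b where x: "x = of_int a / of_int b" "b \<noteq> 0" by (rule rat_frac)
    obtain c d where y: "y = of_int c / of_int d" "d \<noteq> 0" by (rule rat_frac)
    define m where "m = multiplicity (int p)"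
    define A B where "A = a * d" and "B = c * b"
    have nz: "a \<noteq> 0" "c \<noteq> 0" "A \<noteq> 0" "B \<noteq> 0" using x y False by (auto simp: A_def B_def)
    have x': "x = of_int A / of_int (b * d)" and y': "y = of_int B / of_int (b * d)"
      using x y by (auto simp: A_def B_def)
    have s: "x + y = of_int (A + B) / of_int (b * d)"
      by (simp add: x' y' add_divide_distrib)
    have AB: "A + B \<noteq> 0" using False s by auto
    have bd: "b * d \<noteq> 0" using x y by simp
    have p1: "real p > 1" using prime_gt_1_nat[OF p] by simp
    have conv: "m B \<le> m z" if "z \<noteq> 0"
      "real p ^ m (b * d) / real p ^ m z \<le> real p ^ m (b * d) / real p ^ m B" for z
    proof -
      have "real p ^ m B \<le> real p ^ m z"
        using that p1 by (simp add: field_simps)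
      thus ?thesis using p1 by simp
    qed
    have "m B \<le> m A"
      using le rat_padic_abs_frac[OF nz(3) bd] rat_padic_abs_frac[OF nz(4) bd] nz
      unfolding x' y' m_def[symmetric] by (intro conv) simp_all
    hence "int p ^ m B dvd A" "int p ^ m B dvd B"
      unfolding m_def by (auto intro: multiplicity_dvd')
    hence "int p ^ m B dvd A + B" by simp
    hence "m B \<le> m (A + B)"
      unfolding m_def using AB p by (intro multiplicity_geI) (auto simp: prime_gt_1_int)
    hence "real p ^ m B \<le> real p ^ m (A + B)" using p1 by simp
    hence "real p ^ m (b * d) / real p ^ m (A + B) \<le> real p ^ m (b * d) / real p ^ m B"
      using p1 by (simp add: field_simps)
    thus ?thesis
      unfolding s by (simp only: y' rat_padic_abs_frac[OF AB bd] rat_padic_abs_frac[OF nz(4) bd] m_def)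
  qed
  show ?thesis
  proof (cases "rat_padic_abs p x \<le> rat_padic_abs p y")
    case True thus ?thesis using key[of x y] by simp
  next
    case False thus ?thesis using key[of y x] by (simp add: add.commute)
  qed
qed

end

definition rat_padic_null :: "nat \<Rightarrow> (nat \<Rightarrow> rat) \<Rightarrow> bool" where
  "rat_padic_null p X \<longleftrightarrow> (\<lambda>n. rat_padic_abs p (X n)) \<longlonglongrightarrow> 0"

definition rat_padic_Cauchy :: "nat \<Rightarrow> (nat \<Rightarrow> rat) \<Rightarrow> bool" where
  "rat_padic_Cauchy p X \<longleftrightarrow> (\<forall>e>0. \<exists>N. \<forall>m\<ge>N. \<forall>n\<ge>N. rat_padic_abs p (X m - X n) < e)"

context
  fixes p :: nat
  assumes p: "prime p"
begin

lemma rat_padic_abs_diff: "rat_padic_abs p (x - y) \<le> max (rat_padic_abs p x) (rat_padic_abs p y)"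
  using rat_padic_abs_add[OF p, of x "- y"] p by simp

lemma rat_padic_abs_commute: "rat_padic_abs p (x - y) = rat_padic_abs p (y - x)"
  using rat_padic_abs_minus[OF p, of "x - y"] by simp

lemma rat_padic_abs_triangle: "\<bar>rat_padic_abs p x - rat_padic_abs p y\<bar> \<le> rat_padic_abs p (x - y)"
  using rat_padic_abs_add[OF p, of "x - y" y] rat_padic_abs_add[OF p, of "y - x" x]
    rat_padic_abs_commute[of x y] rat_padic_abs_nonneg[OF p, of x]
    rat_padic_abs_nonneg[OF p, of y] rat_padic_abs_nonneg[OF p, of "x - y"]
  by simp

lemma rat_padic_abs_isosceles:
  "rat_padic_abs p (x - y) < rat_padic_abs p y \<Longrightarrow> rat_padic_abs p x = rat_padic_abs p y"
  using rat_padic_abs_add[OF p, of "x - y" y] rat_padic_abs_diff[of x "x - y"] by simp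

lemma rat_padic_null_iff:
  "rat_padic_null p X \<longleftrightarrow> (\<forall>e>0. \<exists>N. \<forall>n\<ge>N. rat_padic_abs p (X n) < e)"
  by (simp add: rat_padic_null_def LIMSEQ_iff rat_padic_abs_nonneg[OF p])

lemma rat_padic_null_add:
  assumes "rat_padic_null p X" "rat_padic_null p Y"
  shows "rat_padic_null p (\<lambda>n. X n + Y n)"
  unfolding rat_padic_null_def
proof (rule Lim_null_comparison)
  show "(\<lambda>n. max (rat_padic_abs p (X n)) (rat_padic_abs p (Y n))) \<longlonglongrightarrow> 0"
    using tendsto_max[OF assms[unfolded rat_padic_null_def]] by simp
qed (simp add: rat_padic_abs_nonneg[OF p] rat_padic_abs_add[OF p])

lemma rat_padic_null_minus: "rat_padic_null p X \<Longrightarrow> rat_padic_null p (\<lambda>n. - X n)"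
  by (simp add: rat_padic_null_def rat_padic_abs_minus[OF p])

lemma rat_padic_null_diff:
  "rat_padic_null p X \<Longrightarrow> rat_padic_null p Y \<Longrightarrow> rat_padic_null p (\<lambda>n. X n - Y n)"
  using rat_padic_null_add[of X "\<lambda>n. - Y n"] rat_padic_null_minus[of Y] by simp

lemma rat_padic_Cauchy_const: "rat_padic_Cauchy p (\<lambda>_. c)"
  by (simp add: rat_padic_Cauchy_def rat_padic_abs_zero[OF p])

lemma rat_padic_Cauchy_add:
  assumes "rat_padic_Cauchy p X" "rat_padic_Cauchy p Y"
  shows "rat_padic_Cauchy p (\<lambda>n. X n + Y n)"
  unfolding rat_padic_Cauchy_def
proof (intro allI impI)
  fix e :: real assume e: "e > 0"
  obtain N1 where N1: "\<forall>m\<ge>N1. \<forall>n\<ge>N1. rat_padic_abs p (X m - X n) < e"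
    using assms(1) e unfolding rat_padic_Cauchy_def by blast
  obtain N2 where N2: "\<forall>m\<ge>N2. \<forall>n\<ge>N2. rat_padic_abs p (Y m - Y n) < e"
    using assms(2) e unfolding rat_padic_Cauchy_def by blast
  have "rat_padic_abs p (X m + Y m - (X n + Y n)) < e" if mn: "m \<ge> max N1 N2" "n \<ge> max N1 N2" for m n
  proof -
    have "rat_padic_abs p (X m - X n) < e" "rat_padic_abs p (Y m - Y n) < e"
      using N1 N2 mn by auto
    thus ?thesis
      using rat_padic_abs_add[OF p, of "X m - X n" "Y m - Y n"] by (simp add: add_diff_add)
  qed
  thus "\<exists>N. \<forall>m\<ge>N. \<forall>n\<ge>N. rat_padic_abs p (X m + Y m - (X n + Y n)) < e" by blast
qed

lemma rat_padic_Cauchy_minus: "rat_padic_Cauchy p X \<Longrightarrow> rat_padic_Cauchy p (\<lambda>n. - X n)"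
  by (simp add: rat_padic_Cauchy_def rat_padic_abs_commute)

lemma rat_padic_Cauchy_bounded:
  assumes "rat_padic_Cauchy p X"
  obtains B where "B > 0" "\<And>n. rat_padic_abs p (X n) \<le> B"
proof -
  obtain N where N: "\<forall>m\<ge>N. \<forall>n\<ge>N. rat_padic_abs p (X m - X n) < 1"
    using assms unfolding rat_padic_Cauchy_def by (meson zero_less_one)
  define B where "B = Max (insert 1 ((\<lambda>n. rat_padic_abs p (X n)) ` {..N}))"
  have 1: "B \<ge> 1" and 2: "\<And>n. n \<le> N \<Longrightarrow> rat_padic_abs p (X n) \<le> B"
    unfolding B_def by (rule Max_ge; simp)+
  have "rat_padic_abs p (X n) \<le> B" for n
  proof (cases "n \<le> N")
    case False
    hence "rat_padic_abs p (X n - X N) < 1" using N by simp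
    thus ?thesis using rat_padic_abs_add[OF p, of "X n - X N" "X N"] 1 2[of N] by simp
  qed (rule 2)
  thus ?thesis using that[of B] 1 by simp
qed

lemma rat_padic_null_mult:
  assumes "rat_padic_null p X" "rat_padic_Cauchy p Y"
  shows "rat_padic_null p (\<lambda>n. X n * Y n)"
proof -
  obtain B where B: "B > 0" "\<And>n. rat_padic_abs p (Y n) \<le> B"
    using rat_padic_Cauchy_bounded[OF assms(2)] by blast
  show ?thesis unfolding rat_padic_null_def
  proof (rule Lim_null_comparison)
    show "(\<lambda>n. rat_padic_abs p (X n) * B) \<longlonglongrightarrow> 0"
      using tendsto_mult_right[OF assms(1)[unfolded rat_padic_null_def], of B] by simp
  qed (simp add: rat_padic_abs_nonneg[OF p] rat_padic_abs_mult[OF p] mult_left_mono B)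
qed

lemma rat_padic_Cauchy_mult:
  assumes "rat_padic_Cauchy p X" "rat_padic_Cauchy p Y"
  shows "rat_padic_Cauchy p (\<lambda>n. X n * Y n)"
  unfolding rat_padic_Cauchy_def
proof (intro allI impI)
  fix e :: real assume e: "e > 0"
  obtain A where A: "A > 0" "\<And>n. rat_padic_abs p (X n) \<le> A"
    using rat_padic_Cauchy_bounded[OF assms(1)] by blast
  obtain B where B: "B > 0" "\<And>n. rat_padic_abs p (Y n) \<le> B"
    using rat_padic_Cauchy_bounded[OF assms(2)] by blast
  obtain N1 where N1: "\<forall>m\<ge>N1. \<forall>n\<ge>N1. rat_padic_abs p (X m - X n) < e / B"
    using assms(1) e B unfolding rat_padic_Cauchy_def by (meson divide_pos_pos)
  obtain N2 where N2: "\<forall>m\<ge>N2. \<forall>n\<ge>N2. rat_padic_abs p (Y m - Y n) < e / A"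
    using assms(2) e A unfolding rat_padic_Cauchy_def by (meson divide_pos_pos)
  have "rat_padic_abs p (X m * Y m - X n * Y n) < e" if mn: "m \<ge> max N1 N2" "n \<ge> max N1 N2" for m n
  proof -
    have "rat_padic_abs p (X m - X n) * rat_padic_abs p (Y m) \<le> rat_padic_abs p (X m - X n) * B"
      by (intro mult_left_mono B rat_padic_abs_nonneg[OF p])
    also have "\<dots> < e" using N1 mn B by (simp add: pos_less_divide_eq)
    finally have 1: "rat_padic_abs p ((X m - X n) * Y m) < e" by (simp add: rat_padic_abs_mult[OF p])
    have "rat_padic_abs p (X n) * rat_padic_abs p (Y m - Y n) \<le> A * rat_padic_abs p (Y m - Y n)"
      by (intro mult_right_mono A rat_padic_abs_nonneg[OF p])
    also have "\<dots> < e" using N2 mn A by (simp add: pos_less_divide_eq mult.commute)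
    finally have 2: "rat_padic_abs p (X n * (Y m - Y n)) < e" by (simp add: rat_padic_abs_mult[OF p])
    have "X m * Y m - X n * Y n = (X m - X n) * Y m + X n * (Y m - Y n)"
      by (simp add: algebra_simps)
    thus ?thesis
      using rat_padic_abs_add[OF p, of "(X m - X n) * Y m" "X n * (Y m - Y n)"] 1 2 by simp
  qed
  thus "\<exists>N. \<forall>m\<ge>N. \<forall>n\<ge>N. rat_padic_abs p (X m * Y m - X n * Y n) < e" by blast
qed

lemma rat_padic_Cauchy_not_null:
  assumes "rat_padic_Cauchy p X" "\<not> rat_padic_null p X"
  obtains c N where "c > 0" "\<And>n. n \<ge> N \<Longrightarrow> rat_padic_abs p (X n) = c"
proof -
  obtain e where e: "e > 0" "\<And>N. \<exists>n\<ge>N. rat_padic_abs p (X n) \<ge> e"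
    using assms(2) unfolding rat_padic_null_iff not_all not_ex not_imp not_less by blast
  obtain N where N: "\<forall>m\<ge>N. \<forall>n\<ge>N. rat_padic_abs p (X m - X n) < e"
    using assms(1) e(1) unfolding rat_padic_Cauchy_def by blast
  obtain k where k: "k \<ge> N" "rat_padic_abs p (X k) \<ge> e" using e(2) by blast
  have "rat_padic_abs p (X n) = rat_padic_abs p (X k)" if "n \<ge> N" for n
    using less_le_trans[OF N[rule_format, OF that k(1)] k(2)] by (rule rat_padic_abs_isosceles)
  moreover have "rat_padic_abs p (X k) > 0" using e(1) k(2) by linarith
  ultimately show ?thesis by (intro that[of "rat_padic_abs p (X k)" N])
qed

lemma rat_padic_Cauchy_inverse:
  assumes "rat_padic_Cauchy p X" "\<not> rat_padic_null p X"
  shows "rat_padic_Cauchy p (\<lambda>n. inverse (X n))"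
  unfolding rat_padic_Cauchy_def
proof (intro allI impI)
  fix e :: real assume e: "e > 0"
  obtain c N where c: "c > 0" "\<And>n. n \<ge> N \<Longrightarrow> rat_padic_abs p (X n) = c"
    using rat_padic_Cauchy_not_null[OF assms] by metis
  obtain N1 where N1: "\<forall>m\<ge>N1. \<forall>n\<ge>N1. rat_padic_abs p (X m - X n) < e * (c * c)"
    using assms(1) e c unfolding rat_padic_Cauchy_def by (meson mult_pos_pos)
  have "rat_padic_abs p (inverse (X m) - inverse (X n)) < e"
    if mn: "m \<ge> max N N1" "n \<ge> max N N1" for m n
  proof -
    have "X m \<noteq> 0" "X n \<noteq> 0" using c mn p by (metis max.bounded_iff rat_padic_abs_zero less_irrefl)+
    hence "inverse (X m) - inverse (X n) = inverse (X m) * (X n - X m) * inverse (X n)"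
      by (rule inverse_diff_inverse[THEN trans]) (simp add: algebra_simps)
    moreover have "rat_padic_abs p (inverse (X m) * (X n - X m) * inverse (X n)) =
        rat_padic_abs p (X n - X m) / (c * c)"
      using c(2)[of m] c(2)[of n] mn
      by (simp only: rat_padic_abs_mult[OF p] rat_padic_abs_inverse[OF p]) (simp add: divide_inverse)
    ultimately have "rat_padic_abs p (inverse (X m) - inverse (X n)) =
        rat_padic_abs p (X n - X m) / (c * c)" by simp
    thus ?thesis using N1 mn c by (simp add: pos_divide_less_eq)
  qed
  thus "\<exists>N. \<forall>m\<ge>N. \<forall>n\<ge>N. rat_padic_abs p (inverse (X m) - inverse (X n)) < e" by blast
qed

lemma rat_padic_abs_convergent:
  assumes "rat_padic_Cauchy p X"
  shows "convergent (\<lambda>n. rat_padic_abs p (X n))"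
  unfolding Cauchy_convergent_iff[symmetric] Cauchy_def dist_real_def
  using assms rat_padic_abs_triangle unfolding rat_padic_Cauchy_def by (meson le_less_trans)

lemma rat_padic_abs_lim_cong:
  assumes "rat_padic_Cauchy p X" "rat_padic_null p (\<lambda>n. X n - Y n)"
  shows "lim (\<lambda>n. rat_padic_abs p (Y n)) = lim (\<lambda>n. rat_padic_abs p (X n))"
proof (rule limI)
  have "(\<lambda>n. rat_padic_abs p (X n) - rat_padic_abs p (Y n)) \<longlonglongrightarrow> 0"
    by (rule Lim_null_comparison[OF _ assms(2)[unfolded rat_padic_null_def]])
      (simp add: rat_padic_abs_triangle)
  from tendsto_diff[OF rat_padic_abs_convergent[OF assms(1), unfolded convergent_LIMSEQ_iff] this]
  show "(\<lambda>n. rat_padic_abs p (Y n)) \<longlonglongrightarrow> lim (\<lambda>n. rat_padic_abs p (X n))" by simp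
qed

end


typedef 'p padic_seq = "{X. rat_padic_Cauchy CARD('p::prime_card) X}"
  using rat_padic_Cauchy_const[OF prime_card] by blast

setup_lifting type_definition_padic_seq

lift_definition padic_seq_const :: "rat \<Rightarrow> 'p::prime_card padic_seq" is "\<lambda>c _. c"
  by (rule rat_padic_Cauchy_const[OF prime_card])

lift_definition padic_seq_add :: "'p::prime_card padic_seq \<Rightarrow> 'p padic_seq \<Rightarrow> 'p padic_seq"
  is "\<lambda>X Y n. X n + Y n"
  by (rule rat_padic_Cauchy_add[OF prime_card])

lift_definition padic_seq_minus :: "'p::prime_card padic_seq \<Rightarrow> 'p padic_seq" is "\<lambda>X n. - X n"
  by (rule rat_padic_Cauchy_minus[OF prime_card])

lift_definition padic_seq_mult :: "'p::prime_card padic_seq \<Rightarrow> 'p padic_seq \<Rightarrow> 'p padic_seq"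
  is "\<lambda>X Y n. X n * Y n"
  by (rule rat_padic_Cauchy_mult[OF prime_card])

lift_definition padic_seq_inverse :: "'p::prime_card padic_seq \<Rightarrow> 'p padic_seq"
  is "\<lambda>X. if rat_padic_null CARD('p) X then (\<lambda>_. 0) else (\<lambda>n. inverse (X n))"
  using rat_padic_Cauchy_const[OF prime_card] rat_padic_Cauchy_inverse[OF prime_card] by auto

lift_definition padic_seq_norm :: "'p::prime_card padic_seq \<Rightarrow> real"
  is "\<lambda>X. lim (\<lambda>n. rat_padic_abs CARD('p) (X n))" .

lift_definition padic_seq_rel :: "'p::prime_card padic_seq \<Rightarrow> 'p padic_seq \<Rightarrow> bool"
  is "\<lambda>X Y. rat_padic_null CARD('p) (\<lambda>n. X n - Y n)" .

quotient_type 'p padic = "'p::prime_card padic_seq" / padic_seq_rel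
proof (rule equivpI)
  show "reflp (padic_seq_rel :: 'p padic_seq \<Rightarrow> _)"
    by (rule reflpI, transfer) (simp add: rat_padic_null_def rat_padic_abs_zero prime_card)
  show "symp (padic_seq_rel :: 'p padic_seq \<Rightarrow> _)"
    by (rule sympI, transfer, drule rat_padic_null_minus[OF prime_card]) simp
  show "transp (padic_seq_rel :: 'p padic_seq \<Rightarrow> _)"
    by (rule transpI, transfer, drule (1) rat_padic_null_add[OF prime_card]) simp
qed

lemma padic_seq_rel_eventually:
  assumes "eventually (\<lambda>n. Rep_padic_seq x n = Rep_padic_seq y n) sequentially"
  shows "padic_seq_rel x y"
  unfolding padic_seq_rel.rep_eq rat_padic_null_def
  by (rule tendsto_eventually[OF eventually_mono[OF assms]]) (simp add: rat_padic_abs_zero prime_card)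

lemma padic_seq_nonzero:
  fixes x :: "'p::prime_card padic_seq"
  assumes "\<not> rat_padic_null CARD('p) (Rep_padic_seq x)"
  shows "eventually (\<lambda>n. Rep_padic_seq x n \<noteq> 0) sequentially"
proof -
  have "rat_padic_Cauchy CARD('p) (Rep_padic_seq x)" using Rep_padic_seq by blast
  then obtain c N where c: "c > 0" "\<And>n. n \<ge> N \<Longrightarrow> rat_padic_abs CARD('p) (Rep_padic_seq x n) = c"
    using rat_padic_Cauchy_not_null[OF prime_card _ assms] by metis
  hence "Rep_padic_seq x n \<noteq> 0" if "n \<ge> N" for n
    using that c by (metis rat_padic_abs_zero[OF prime_card] less_irrefl)
  thus ?thesis unfolding eventually_sequentially by blast
qed

instantiation padic :: (prime_card) field
begin

lift_definition zero_padic :: "'a padic" is "padic_seq_const 0" .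

lift_definition one_padic :: "'a padic" is "padic_seq_const 1" .

lift_definition plus_padic :: "'a padic \<Rightarrow> 'a padic \<Rightarrow> 'a padic" is padic_seq_add
  by (transfer, drule (1) rat_padic_null_add[OF prime_card]) (simp add: add_diff_add)

lift_definition uminus_padic :: "'a padic \<Rightarrow> 'a padic" is padic_seq_minus
  by (transfer, drule rat_padic_null_minus[OF prime_card]) (simp add: algebra_simps)

definition minus_padic :: "'a padic \<Rightarrow> 'a padic \<Rightarrow> 'a padic" where
  "minus_padic x y = x + - y"

lift_definition times_padic :: "'a padic \<Rightarrow> 'a padic \<Rightarrow> 'a padic" is padic_seq_mult
proof transfer
  fix X X' Y Y' :: "nat \<Rightarrow> rat"
  let ?p = "CARD('a)"
  assume c: "rat_padic_Cauchy ?p X" "rat_padic_Cauchy ?p X'" "rat_padic_Cauchy ?p Y" "rat_padic_Cauchy ?p Y'"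
    and n: "rat_padic_null ?p (\<lambda>n. X n - X' n)" "rat_padic_null ?p (\<lambda>n. Y n - Y' n)"
  have "rat_padic_null ?p (\<lambda>n. (X n - X' n) * Y n)" "rat_padic_null ?p (\<lambda>n. (Y n - Y' n) * X' n)"
    using rat_padic_null_mult[OF prime_card] c n by auto
  hence "rat_padic_null ?p (\<lambda>n. (X n - X' n) * Y n + (Y n - Y' n) * X' n)"
    by (rule rat_padic_null_add[OF prime_card])
  thus "rat_padic_null ?p (\<lambda>n. X n * Y n - X' n * Y' n)" by (simp add: algebra_simps)
qed

lift_definition inverse_padic :: "'a padic \<Rightarrow> 'a padic" is padic_seq_inverse
proof -
  fix x y :: "'a padic_seq"
  let ?p = "CARD('a)" and ?X = "Rep_padic_seq x" and ?Y = "Rep_padic_seq y"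
  note p = prime_card[where 'a = 'a]
  assume "padic_seq_rel x y"
  hence xy: "rat_padic_null ?p (\<lambda>n. ?X n - ?Y n)" by (simp add: padic_seq_rel.rep_eq)
  have iff: "rat_padic_null ?p ?X \<longleftrightarrow> rat_padic_null ?p ?Y"
    using rat_padic_null_diff[OF p _ xy, of ?X] rat_padic_null_add[OF p xy, of ?Y] by auto
  show "padic_seq_rel (padic_seq_inverse x) (padic_seq_inverse y)"
  proof (cases "rat_padic_null ?p ?X")
    case True
    thus ?thesis using iff
      by (intro padic_seq_rel_eventually) (simp add: padic_seq_inverse.rep_eq)
  next
    case False
    have nY: "\<not> rat_padic_null ?p ?Y" using False iff by simp
    have c: "rat_padic_Cauchy ?p ?X" "rat_padic_Cauchy ?p ?Y" using Rep_padic_seq by blast+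
    have "rat_padic_null ?p (\<lambda>n. (?X n - ?Y n) * (- (inverse (?X n) * inverse (?Y n))))"
      by (intro rat_padic_null_mult[OF p] rat_padic_Cauchy_mult[OF p] rat_padic_Cauchy_minus[OF p]
          rat_padic_Cauchy_inverse[OF p] xy c False nY)
    moreover have "eventually (\<lambda>n. rat_padic_abs ?p ((?X n - ?Y n) * (- (inverse (?X n) * inverse (?Y n)))) =
        rat_padic_abs ?p (inverse (?X n) - inverse (?Y n))) sequentially"
      using padic_seq_nonzero[OF False] padic_seq_nonzero[OF nY]
      by eventually_elim
        (rule arg_cong[of _ _ "rat_padic_abs ?p"], simp add: inverse_eq_divide diff_frac_eq, simp add: field_simps)
    ultimately have "rat_padic_null ?p (\<lambda>n. inverse (?X n) - inverse (?Y n))"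
      unfolding rat_padic_null_def by (rule Lim_transform_eventually)
    thus ?thesis using False nY by (simp add: padic_seq_rel.rep_eq padic_seq_inverse.rep_eq)
  qed
qed

definition divide_padic :: "'a padic \<Rightarrow> 'a padic \<Rightarrow> 'a padic" where
  "divide_padic x y = x * inverse y"

instance
proof
  fix x y z :: "'a padic"
  note seq = padic_seq_add.rep_eq padic_seq_mult.rep_eq padic_seq_minus.rep_eq padic_seq_const.rep_eq
  show "x + y + z = x + (y + z)"
    by transfer (rule padic_seq_rel_eventually, simp add: seq algebra_simps)
  show "x + y = y + x"
    by transfer (rule padic_seq_rel_eventually, simp add: seq algebra_simps)
  show "0 + x = x"
    by transfer (rule padic_seq_rel_eventually, simp add: seq)
  show "- x + x = 0"
    by transfer (rule padic_seq_rel_eventually, simp add: seq)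
  show "x - y = x + - y" by (simp add: minus_padic_def)
  show "x * y * z = x * (y * z)"
    by transfer (rule padic_seq_rel_eventually, simp add: seq algebra_simps)
  show "x * y = y * x"
    by transfer (rule padic_seq_rel_eventually, simp add: seq algebra_simps)
  show "1 * x = x"
    by transfer (rule padic_seq_rel_eventually, simp add: seq)
  show "(x + y) * z = x * z + y * z"
    by transfer (rule padic_seq_rel_eventually, simp add: seq algebra_simps)
  show "(0 :: 'a padic) \<noteq> 1"
    by transfer (simp add: padic_seq_rel.rep_eq seq rat_padic_null_def rat_padic_abs_minus
        rat_padic_abs_one prime_card LIMSEQ_const_iff)
  show "x div y = x * inverse y" by (simp add: divide_padic_def)
  show "inverse (0 :: 'a padic) = 0"
    by transfer (rule padic_seq_rel_eventually, simp add: seq padic_seq_inverse.rep_eq)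
  show "x \<noteq> 0 \<Longrightarrow> inverse x * x = 1"
  proof transfer
    fix x :: "'a padic_seq"
    assume "\<not> padic_seq_rel x (padic_seq_const 0)"
    hence n: "\<not> rat_padic_null CARD('a) (Rep_padic_seq x)"
      by (simp add: padic_seq_rel.rep_eq seq)
    have "eventually (\<lambda>n. inverse (Rep_padic_seq x n) * Rep_padic_seq x n = 1) sequentially"
      using padic_seq_nonzero[OF n] by eventually_elim simp
    thus "padic_seq_rel (padic_seq_mult (padic_seq_inverse x) x) (padic_seq_const 1)"
      using n by (intro padic_seq_rel_eventually) (simp add: seq padic_seq_inverse.rep_eq)
  qed
qed

end

lift_definition padic_norm :: "'p::prime_card padic \<Rightarrow> real" is padic_seq_norm
  by transfer (simp add: rat_padic_abs_lim_cong prime_card)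

lemma padic_seq_norm_LIMSEQ:
  "(\<lambda>n. rat_padic_abs CARD('p) (Rep_padic_seq x n)) \<longlonglongrightarrow> padic_seq_norm (x :: 'p::prime_card padic_seq)"
  using rat_padic_abs_convergent[OF prime_card] Rep_padic_seq[of x]
  by (simp add: padic_seq_norm.rep_eq convergent_LIMSEQ_iff)

lemma padic_norm_eq_0_iff: "padic_norm (x :: 'p::prime_card padic) = 0 \<longleftrightarrow> x = 0"
proof transfer
  fix x :: "'p padic_seq"
  have "padic_seq_rel x (padic_seq_const 0) \<longleftrightarrow>
      (\<lambda>n. rat_padic_abs CARD('p) (Rep_padic_seq x n)) \<longlonglongrightarrow> 0"
    by (simp add: padic_seq_rel.rep_eq padic_seq_const.rep_eq rat_padic_null_def)
  thus "padic_seq_norm x = 0 \<longleftrightarrow> padic_seq_rel x (padic_seq_const 0)"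
    using padic_seq_norm_LIMSEQ[of x] LIMSEQ_unique by metis
qed

lemma padic_norm_minus: "padic_norm (- x :: 'p::prime_card padic) = padic_norm x"
proof transfer
  fix x :: "'p padic_seq"
  show "padic_seq_norm (padic_seq_minus x) = padic_seq_norm x"
    by (simp add: padic_seq_norm.rep_eq padic_seq_minus.rep_eq rat_padic_abs_minus prime_card)
qed

lemma padic_norm_add: "padic_norm (x + y :: 'p::prime_card padic) \<le> max (padic_norm x) (padic_norm y)"
proof transfer
  fix x y :: "'p padic_seq"
  show "padic_seq_norm (padic_seq_add x y) \<le> max (padic_seq_norm x) (padic_seq_norm y)"
    by (rule LIMSEQ_le[OF padic_seq_norm_LIMSEQ tendsto_max[OF padic_seq_norm_LIMSEQ padic_seq_norm_LIMSEQ]])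
      (simp add: padic_seq_add.rep_eq rat_padic_abs_add prime_card)
qed

lemma padic_norm_nonneg: "padic_norm (x :: 'p::prime_card padic) \<ge> 0"
  using padic_norm_add[of x "- x"] padic_norm_eq_0_iff[of "0 :: 'p padic"]
  by (simp add: padic_norm_minus)

instantiation padic :: (prime_card) metric_space
begin

definition dist_padic :: "'a padic \<Rightarrow> 'a padic \<Rightarrow> real" where
  "dist_padic x y = padic_norm (x - y)"

definition uniformity_padic :: "('a padic \<times> 'a padic) filter" where
  "uniformity_padic = (INF e\<in>{0<..}. principal {(x, y). dist x y < e})"

definition open_padic :: "'a padic set \<Rightarrow> bool" where
  "open_padic U \<longleftrightarrow> (\<forall>x\<in>U. eventually (\<lambda>(x', y). x' = x \<longrightarrow> y \<in> U) uniformity)"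

instance
proof
  fix x y z :: "'a padic"
  show "dist x y = 0 \<longleftrightarrow> x = y"
    by (simp add: dist_padic_def padic_norm_eq_0_iff)
  have "padic_norm (x - y) \<le> max (padic_norm (x - z)) (padic_norm (z - y))"
    using padic_norm_add[of "x - z" "z - y"] by simp
  also have "padic_norm (z - y) = padic_norm (y - z)" using padic_norm_minus[of "z - y"] by simp
  finally show "dist x y \<le> dist x z + dist y z"
    using padic_norm_nonneg[of "x - z"] padic_norm_nonneg[of "y - z"]
    by (simp add: dist_padic_def max_def split: if_splits)
qed (simp_all add: uniformity_padic_def open_padic_def)

end

definition padic_ints :: "'p::prime_card padic set" where
  "padic_ints = {x. padic_norm x \<le> 1}"

definition padic_val :: "'p::prime_card padic \<Rightarrow> ereal" where
  "padic_val x = (if x = 0 then \<infinity> else ereal (- log (real CARD('p)) (padic_norm x)))"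


section \<open>Saturated \<open>p\<close>-valued groups and ordered bases\<close>

definition is_topological_group :: "('g, 'm) monoid_scheme \<Rightarrow> 'g topology \<Rightarrow> bool" where
  "is_topological_group G T \<longleftrightarrow>
    group G \<and> topspace T = carrier G \<and>
    continuous_map (prod_topology T T) T (\<lambda>(x, y). x \<otimes>\<^bsub>G\<^esub> y) \<and>
    continuous_map T T (\<lambda>x. inv\<^bsub>G\<^esub> x)"

text \<open>
  A profinite group is a compact Hausdorff topological group whose open subgroups form a
  neighbourhood basis of the identity.
\<close>

definition pro_p_group :: "nat \<Rightarrow> ('g, 'm) monoid_scheme \<Rightarrow> 'g topology \<Rightarrow> bool" where
  "pro_p_group p G T \<longleftrightarrow>
    is_topological_group G T \<and> compact_space T \<and> Hausdorff_space T \<and>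
    (\<forall>U. openin T U \<and> \<one>\<^bsub>G\<^esub> \<in> U \<longrightarrow> (\<exists>H. subgroup H G \<and> openin T H \<and> H \<subseteq> U)) \<and>
    (\<forall>N. N \<lhd> G \<and> openin T N \<longrightarrow> (\<exists>k. card (rcosets\<^bsub>G\<^esub> N) = p ^ k))"

definition p_valued_group ::
    "nat \<Rightarrow> ('g, 'm) monoid_scheme \<Rightarrow> 'g topology \<Rightarrow> ('g \<Rightarrow> ereal) \<Rightarrow> bool" where
  "p_valued_group p G T \<omega> \<longleftrightarrow>
    pro_p_group p G T \<and>
    \<omega> \<one>\<^bsub>G\<^esub> = \<infinity> \<and>
    (\<forall>g\<in>carrier G - {\<one>\<^bsub>G\<^esub>}. 0 < \<omega> g \<and> \<omega> g < \<infinity>) \<and>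
    (\<forall>g\<in>carrier G. \<omega> g > ereal (1 / (real p - 1))) \<and>
    (\<forall>g\<in>carrier G. \<forall>h\<in>carrier G. \<omega> (inv\<^bsub>G\<^esub> g \<otimes>\<^bsub>G\<^esub> h) \<ge> min (\<omega> g) (\<omega> h)) \<and>
    (\<forall>g\<in>carrier G. \<forall>h\<in>carrier G.
      \<omega> (g \<otimes>\<^bsub>G\<^esub> h \<otimes>\<^bsub>G\<^esub> inv\<^bsub>G\<^esub> g \<otimes>\<^bsub>G\<^esub> inv\<^bsub>G\<^esub> h) \<ge> \<omega> g + \<omega> h) \<and>
    (\<forall>g\<in>carrier G. \<omega> (g [^]\<^bsub>G\<^esub> p) = \<omega> g + 1) \<and>
    (\<forall>\<nu>::real. \<nu> > 0 \<longrightarrow>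
      (\<exists>U. openin T U \<and> \<one>\<^bsub>G\<^esub> \<in> U \<and> U \<subseteq> {g\<in>carrier G. \<omega> g \<ge> ereal \<nu>})) \<and>
    (\<forall>U. openin T U \<and> \<one>\<^bsub>G\<^esub> \<in> U \<longrightarrow>
      (\<exists>\<nu>::real. \<nu> > 0 \<and> {g\<in>carrier G. \<omega> g \<ge> ereal \<nu>} \<subseteq> U))"

definition saturated :: "nat \<Rightarrow> ('g, 'm) monoid_scheme \<Rightarrow> ('g \<Rightarrow> ereal) \<Rightarrow> bool" where
  "saturated p G \<omega> \<longleftrightarrow>
    (\<forall>g\<in>carrier G. \<omega> g > ereal (real p / (real p - 1)) \<longrightarrow> (\<exists>h\<in>carrier G. g = h [^]\<^bsub>G\<^esub> p))"

text \<open>\<open>g\<^sup>x\<close> for a \<open>p\<close>-adic integer \<open>x\<close> is the limit of \<open>g\<^sup>a\<close> as the integer \<open>a\<close> tends to \<open>x\<close>.\<close>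

definition padic_pow ::
    "('g, 'm) monoid_scheme \<Rightarrow> 'g topology \<Rightarrow> 'g \<Rightarrow> 'p::prime_card padic \<Rightarrow> 'g" where
  "padic_pow G T g x =
    (THE h. h \<in> carrier G \<and>
      (\<forall>a :: nat \<Rightarrow> int. (\<lambda>n. of_int (a n)) \<longlonglongrightarrow> x \<longrightarrow>
        limitin T (\<lambda>n. g [^]\<^bsub>G\<^esub> a n) h sequentially))"

text \<open>Factors are multiplied in increasing order of the index, which runs over \<open>0, \<dots>, d - 1\<close>.\<close>

definition padic_pow_prod ::
    "('g, 'm) monoid_scheme \<Rightarrow> 'g topology \<Rightarrow> nat \<Rightarrow> (nat \<Rightarrow> 'g) \<Rightarrow> (nat \<Rightarrow> 'p::prime_card padic) \<Rightarrow> 'g"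
where
  "padic_pow_prod G T d g x =
    foldr (\<lambda>i h. padic_pow G T (g i) (x i) \<otimes>\<^bsub>G\<^esub> h) [0..<d] \<one>\<^bsub>G\<^esub>"

definition ordered_basis ::
    "'p::prime_card itself \<Rightarrow> ('g, 'm) monoid_scheme \<Rightarrow> 'g topology \<Rightarrow> ('g \<Rightarrow> ereal) \<Rightarrow>
     nat \<Rightarrow> (nat \<Rightarrow> 'g) \<Rightarrow> bool" where
  "ordered_basis _ G T \<omega> d g \<longleftrightarrow>
    (\<forall>i<d. g i \<in> carrier G) \<and>
    homeomorphic_map (product_topology (\<lambda>_. top_of_set (padic_ints :: 'p padic set)) {..<d}) T
      (padic_pow_prod G T d g) \<and>
    (\<forall>x\<in>{..<d} \<rightarrow>\<^sub>E (padic_ints :: 'p padic set).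
      \<omega> (padic_pow_prod G T d g x) = (INF i\<in>{..<d}. \<omega> (g i) + padic_val (x i)))"


section \<open>Washnitzer algebras\<close>

text \<open>
  Power series are families of coefficients; the variables of the algebra of index \<open>n\<close> are
  \<open>Z\<^sub>0, \<dots>, Z\<^sub>n\<^sub>-\<^sub>1\<close>, so coefficients at multi-indices involving any other variable vanish.
\<close>

type_synonym multi_index = "nat \<Rightarrow>\<^sub>0 nat"
type_synonym 'p padic_series = "multi_index \<Rightarrow> 'p padic"

definition total_degree :: "multi_index \<Rightarrow> nat" where
  "total_degree \<alpha> = (\<Sum>i\<in>Poly_Mapping.keys \<alpha>. Poly_Mapping.lookup \<alpha> i)"

definition washnitzer :: "nat \<Rightarrow> ('p::prime_card padic, 'p padic_series) module" where
  "washnitzer n = \<lparr>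
    carrier = {c. (\<forall>\<alpha>. \<not> Poly_Mapping.keys \<alpha> \<subseteq> {..<n} \<longrightarrow> c \<alpha> = 0) \<and>
      (\<exists>r>1. ((\<lambda>\<alpha>. padic_norm (c \<alpha>) * r ^ total_degree \<alpha>) \<longlongrightarrow> 0)
        (filtercomap total_degree at_top))},
    monoid.mult = (\<lambda>b c \<gamma>. \<Sum>(\<alpha>, \<beta>)\<in>{(\<alpha>, \<beta>). \<alpha> + \<beta> = \<gamma>}. b \<alpha> * c \<beta>),
    one = (\<lambda>\<alpha>. if \<alpha> = 0 then 1 else 0),
    zero = (\<lambda>_. 0),
    add = (\<lambda>b c \<alpha>. b \<alpha> + c \<alpha>),
    smult = (\<lambda>a c \<alpha>. a * c \<alpha>)\<rparr>"

definition washnitzer_var :: "nat \<Rightarrow> 'p::prime_card padic_series" where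
  "washnitzer_var i = (\<lambda>\<alpha>. if \<alpha> = Poly_Mapping.single i 1 then 1 else 0)"

definition padic_algebra :: "('p::prime_card padic, 'p padic) module" where
  "padic_algebra = \<lparr>carrier = UNIV, monoid.mult = (*), one = 1, zero = 0, add = (+), smult = (*)\<rparr>"

text \<open>
  Homomorphisms are extensional functions, so that equality of homomorphisms is equality on the
  carrier.
\<close>

definition algebra_hom ::
    "('k, 'a, 'm) module_scheme \<Rightarrow> ('k, 'b, 'n) module_scheme \<Rightarrow> ('a \<Rightarrow> 'b) set" where
  "algebra_hom A B =
    {\<phi> \<in> ring_hom A B \<inter> extensional (carrier A).
      \<forall>c. \<forall>f\<in>carrier A. \<phi> (c \<odot>\<^bsub>A\<^esub> f) = c \<odot>\<^bsub>B\<^esub> \<phi> f}"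

text \<open>
  The dagger tensor product of \<open>washnitzer m\<close> and \<open>washnitzer n\<close> is \<open>washnitzer (m + n)\<close>;
  \<open>dagger_inl\<close> and \<open>dagger_inr\<close> are the maps \<open>f \<mapsto> f \<otimes> 1\<close> and \<open>f \<mapsto> 1 \<otimes> f\<close>, which identify the
  variables of the factors with the first \<open>m\<close> and the last \<open>n\<close> variables.
\<close>

definition dagger_inl :: "nat \<Rightarrow> nat \<Rightarrow> 'p::prime_card padic_series \<Rightarrow> 'p padic_series" where
  "dagger_inl m n = (\<lambda>f\<in>carrier (washnitzer m). f)"

definition dagger_inr :: "nat \<Rightarrow> nat \<Rightarrow> 'p::prime_card padic_series \<Rightarrow> 'p padic_series" where
  "dagger_inr m n = (\<lambda>f\<in>carrier (washnitzer n). \<lambda>\<alpha>.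
    if Poly_Mapping.keys \<alpha> \<subseteq> {m..} then f (Poly_Mapping.map_key (\<lambda>i. i + m) \<alpha>) else 0)"

text \<open>
  The homomorphism \<open>f \<otimes> g \<mapsto> \<phi> f * \<psi> g\<close> given by the universal property of the dagger tensor
  product, that is, the comorphism of the morphism into a product with components \<open>\<phi>\<close> and \<open>\<psi>\<close>.
\<close>

definition dagger_copair ::
    "nat \<Rightarrow> nat \<Rightarrow> ('p::prime_card padic, 'b) module \<Rightarrow>
     ('p padic_series \<Rightarrow> 'b) \<Rightarrow> ('p padic_series \<Rightarrow> 'b) \<Rightarrow> 'p padic_series \<Rightarrow> 'b" where
  "dagger_copair m n B \<phi> \<psi> =
    (THE \<xi>. \<xi> \<in> algebra_hom (washnitzer (m + n)) B \<and>
      compose (carrier (washnitzer m)) \<xi> (dagger_inl m n) = \<phi> \<and>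
      compose (carrier (washnitzer n)) \<xi> (dagger_inr m n) = \<psi>)"

definition dagger_tensor_hom ::
    "nat \<Rightarrow> nat \<Rightarrow> nat \<Rightarrow> nat \<Rightarrow> ('p::prime_card padic_series \<Rightarrow> 'p padic_series) \<Rightarrow>
     ('p padic_series \<Rightarrow> 'p padic_series) \<Rightarrow> 'p padic_series \<Rightarrow> 'p padic_series" where
  "dagger_tensor_hom m n m' n' \<phi> \<psi> =
    dagger_copair m n (washnitzer (m' + n'))
      (compose (carrier (washnitzer m)) (dagger_inl m' n') \<phi>)
      (compose (carrier (washnitzer n)) (dagger_inr m' n') \<psi>)"


section \<open>Dagger groups\<close>

text \<open>
  A dagger group with underlying dagger space \<open>Sp (washnitzer d)\<close> is given by the comorphisms of
  multiplication, unit section and inversion.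
\<close>

record 'p dagger_group =
  comult :: "'p padic_series \<Rightarrow> 'p padic_series"
  counit :: "'p padic_series \<Rightarrow> 'p padic"
  antipode :: "'p padic_series \<Rightarrow> 'p padic_series"

definition is_dagger_group :: "nat \<Rightarrow> 'p::prime_card dagger_group \<Rightarrow> bool" where
  "is_dagger_group d H \<longleftrightarrow>
   (let A = washnitzer d; AA = washnitzer (d + d);
        idA = (\<lambda>f\<in>carrier A. f);
        trivA = compose (carrier A) (\<lambda>c. c \<odot>\<^bsub>A\<^esub> \<one>\<^bsub>A\<^esub>) (counit H)
    in comult H \<in> algebra_hom A AA \<and>
       counit H \<in> algebra_hom A padic_algebra \<and>
       antipode H \<in> algebra_hom A A \<and>
       compose (carrier A) (dagger_tensor_hom d d (d + d) d (comult H) idA) (comult H) =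
         compose (carrier A) (dagger_tensor_hom d d d (d + d) idA (comult H)) (comult H) \<and>
       compose (carrier A) (dagger_copair d d A trivA idA) (comult H) = idA \<and>
       compose (carrier A) (dagger_copair d d A idA trivA) (comult H) = idA \<and>
       compose (carrier A) (dagger_copair d d A (antipode H) idA) (comult H) = trivA \<and>
       compose (carrier A) (dagger_copair d d A idA (antipode H)) (comult H) = trivA)"

definition rational_points :: "nat \<Rightarrow> 'p::prime_card dagger_group \<Rightarrow> ('p padic_series \<Rightarrow> 'p padic) monoid"
where
  "rational_points d H = \<lparr>
    carrier = algebra_hom (washnitzer d) padic_algebra,
    monoid.mult = (\<lambda>\<phi> \<psi>.
      compose (carrier (washnitzer d)) (dagger_copair d d padic_algebra \<phi> \<psi>) (comult H)),
    one = counit H\<rparr>"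

definition dagger_group_hom ::
    "nat \<Rightarrow> 'p::prime_card dagger_group \<Rightarrow> nat \<Rightarrow> 'p dagger_group \<Rightarrow>
     ('p padic_series \<Rightarrow> 'p padic_series) set" \<comment> \<open>by comorphisms, so in the opposite direction\<close>
where
  "dagger_group_hom d H d' H' =
    {\<theta> \<in> algebra_hom (washnitzer d') (washnitzer d).
      compose (carrier (washnitzer d')) (comult H) \<theta> =
      compose (carrier (washnitzer d')) (dagger_tensor_hom d' d' d d \<theta> \<theta>) (comult H')}"

definition dagger_group_iso ::
    "nat \<Rightarrow> 'p::prime_card dagger_group \<Rightarrow> nat \<Rightarrow> 'p dagger_group \<Rightarrow>
     ('p padic_series \<Rightarrow> 'p padic_series) set" where
  "dagger_group_iso d H d' H' =
    {\<theta> \<in> dagger_group_hom d H d' H'. \<exists>\<eta>\<in>dagger_group_hom d' H' d H.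
      compose (carrier (washnitzer d)) \<theta> \<eta> = (\<lambda>f\<in>carrier (washnitzer d). f) \<and>
      compose (carrier (washnitzer d')) \<eta> \<theta> = (\<lambda>f\<in>carrier (washnitzer d'). f)}"

definition points_map ::
    "('g, 'm) monoid_scheme \<Rightarrow> 'g topology \<Rightarrow> nat \<Rightarrow> (nat \<Rightarrow> 'g) \<Rightarrow>
     ('p::prime_card padic_series \<Rightarrow> 'p padic) \<Rightarrow> 'g" where
  "points_map G T d g \<phi> = padic_pow_prod G T d g (\<lambda>i. \<phi> (washnitzer_var i))"

definition associated_dagger_group ::
    "('g, 'm) monoid_scheme \<Rightarrow> 'g topology \<Rightarrow> nat \<Rightarrow> (nat \<Rightarrow> 'g) \<Rightarrow> 'p::prime_card dagger_group \<Rightarrow> bool"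
where
  "associated_dagger_group G T d g H \<longleftrightarrow>
    is_dagger_group d H \<and> points_map G T d g \<in> iso (rational_points d H) G"

end

theory Submission
  imports Defs
begin

text \<open>
  Every algebra homomorphism from \<open>W\<^sub>n\<close> to the \<open>p\<close>-adic numbers is evaluation at a point with \<open>p\<close>-adic
  integral coordinates, and an overconvergent series is determined by its values at these points.
  Hence homomorphisms between Washnitzer algebras, and identities between them, can be read off on points:
  the group \<open>G\<close> leaves no choice for the structure maps, and the Hopf algebra diagrams follow from the
  group laws. What remains is analyticity: for \<open>h\<^sub>1, \<dots>, h\<^sub>m\<close> in \<open>G\<close>, the coordinates of
  \<open>h\<^sub>1\<close> to the \<open>x\<^sub>1\<close> times \<open>\<dots>\<close> times \<open>h\<^sub>m\<close> to the \<open>x\<^sub>m\<close> are overconvergent series in \<open>x\<close> with integral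
  coefficients. Multiplication, inversion and change of basis are all of this form.

  The Mahler coefficients of the \<open>i\<close>-th coordinate are its iterated differences, that is, the values of
  its linear extension to the group ring at words in the elements \<open>h\<^sub>j - 1\<close>. Rewriting a word of weight \<open>w\<close>
  into sorted words in the basis, modulo heavier words, shows that such a value has valuation at least
  \<open>w - \<omega> (g\<^sub>i)\<close>; the rewriting converges because long words are \<open>p\<close>-adically small. All weights exceed
  \<open>1 / (p - 1)\<close>, so the bound beats the factorials in the Mahler series and gives overconvergence.
  Saturation forces \<open>\<omega> (g\<^sub>i) \<le> p / (p - 1)\<close>, which makes the coefficients integral.
\<close>

section \<open>The field of p-adic numbers\<close>

text \<open>The bound on iterated differences cannot come from rewriting alone: sorting a word
  produces ever heavier words, and the relations do not stop this. A qualitative statement provides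
  the stop: modulo p^N a coordinate factors through a quotient by an open normal subgroup, and there
  the augmentation ideal is nilpotent, because the filtration by \<omega> has central steps of
  exponent p. The quantitative bound then descends from very heavy words in steps of fixed size,
  with the number p counted as a letter of weight 1, matching \<omega>(h^p) = \<omega>(h) + 1. The
  step is min \<omega>(g_i) - 1/(p-1). It is positive by axiom (a), bounds from below the weight
  gained in expanding h^p - 1, and is the rate that remains after Legendre's bound v(n!) <=
  (n-1)/(p-1) is subtracted. A second obstacle is that homomorphisms are purely algebraic, so
  continuity is not given. Units repair this: 1 - c Z_i is invertible in W_n for |c| < 1, which
  forces images of variables to be integral and so lets them be substituted into overconvergent
  series.\<close>

lemma card_prime_gt_1: "1 < CARD('p::prime_card)"
  using prime_gt_1_nat[OF prime_card[where 'a = 'p]] .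

lemma real_card_prime_gt_1: "1 < real CARD('p::prime_card)"
  using card_prime_gt_1[where 'p = 'p] by simp

lemma padic_norm_0 [simp]: "padic_norm (0 :: 'p::prime_card padic) = 0"
  by (simp add: padic_norm_eq_0_iff)

lemma padic_norm_mult: "padic_norm (x * y :: 'p::prime_card padic) = padic_norm x * padic_norm y"
proof transfer
  fix x y :: "'p padic_seq"
  show "padic_seq_norm (padic_seq_mult x y) = padic_seq_norm x * padic_seq_norm y"
    using tendsto_mult[OF padic_seq_norm_LIMSEQ[of x] padic_seq_norm_LIMSEQ[of y]]
    by (intro LIMSEQ_unique[OF padic_seq_norm_LIMSEQ])
      (simp add: padic_seq_mult.rep_eq rat_padic_abs_mult prime_card)
qed

lemma padic_norm_1 [simp]: "padic_norm (1 :: 'p::prime_card padic) = 1"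
  using padic_norm_mult[of 1 "1 :: 'p padic"] by (simp add: padic_norm_eq_0_iff)

lemma padic_norm_power: "padic_norm ((x :: 'p::prime_card padic) ^ n) = padic_norm x ^ n"
  by (induction n) (simp_all add: padic_norm_mult)

lemma padic_norm_inverse: "padic_norm (inverse x :: 'p::prime_card padic) = inverse (padic_norm x)"
proof (cases "x = 0")
  case False
  hence "padic_norm x * padic_norm (inverse x) = 1"
    using padic_norm_mult[of x "inverse x"] by simp
  thus ?thesis by (simp add: inverse_unique)
qed simp

lemma padic_norm_divide: "padic_norm (x / y :: 'p::prime_card padic) = padic_norm x / padic_norm y"
  by (simp add: divide_inverse padic_norm_mult padic_norm_inverse)

lemma padic_norm_diff: "padic_norm (x - y :: 'p::prime_card padic) \<le> max (padic_norm x) (padic_norm y)"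
  using padic_norm_add[of x "- y"] by (simp add: padic_norm_minus)

lemma padic_norm_diff_commute: "padic_norm (x - y :: 'p::prime_card padic) = padic_norm (y - x)"
  using padic_norm_minus[of "x - y"] by simp

lemma padic_norm_add_le:
  "padic_norm x \<le> B \<Longrightarrow> padic_norm y \<le> B \<Longrightarrow> padic_norm (x + y :: 'p::prime_card padic) \<le> B"
  using padic_norm_add[of x y] by simp

lemma padic_norm_diff_le:
  "padic_norm x \<le> B \<Longrightarrow> padic_norm y \<le> B \<Longrightarrow> padic_norm (x - y :: 'p::prime_card padic) \<le> B"
  using padic_norm_diff[of x y] by simp

lemma padic_norm_sum_le:
  assumes "\<And>i. i \<in> A \<Longrightarrow> padic_norm (f i) \<le> B" "0 \<le> B"
  shows "padic_norm (\<Sum>i\<in>A. f i :: 'p::prime_card padic) \<le> B"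
  using assms by (induction A rule: infinite_finite_induct) (auto intro: padic_norm_add_le)

lemma padic_norm_isosceles:
  assumes "padic_norm y < padic_norm (x :: 'p::prime_card padic)"
  shows "padic_norm (x + y) = padic_norm x"
  using padic_norm_add[of x y] padic_norm_diff[of "x + y" y] assms by auto

lemma padic_norm_of_nat_le_1 [simp]: "padic_norm (of_nat n :: 'p::prime_card padic) \<le> 1"
  by (induction n) (auto intro: padic_norm_add_le)

lemma padic_norm_of_int_le_1 [simp]: "padic_norm (of_int n :: 'p::prime_card padic) \<le> 1"
  by (cases n) (auto simp: padic_norm_minus padic_norm_diff_le simp del: of_nat_Suc)

section \<open>The embedded rationals and the norms of integers\<close>

definition padic_of_rat :: "rat \<Rightarrow> 'p::prime_card padic" where
  "padic_of_rat c = abs_padic (padic_seq_const c)"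

lemma padic_of_rat_0: "padic_of_rat 0 = 0" and padic_of_rat_1: "padic_of_rat 1 = 1"
  by (simp_all add: padic_of_rat_def zero_padic_def one_padic_def)

lemma padic_of_rat_add: "padic_of_rat (a + b) = padic_of_rat a + padic_of_rat b"
  unfolding padic_of_rat_def plus_padic.abs_eq
  by (rule arg_cong[of _ _ abs_padic]) (simp add: Rep_padic_seq_inject[symmetric] padic_seq_add.rep_eq padic_seq_const.rep_eq)

lemma padic_of_rat_mult: "padic_of_rat (a * b) = padic_of_rat a * padic_of_rat b"
  unfolding padic_of_rat_def times_padic.abs_eq
  by (rule arg_cong[of _ _ abs_padic]) (simp add: Rep_padic_seq_inject[symmetric] padic_seq_mult.rep_eq padic_seq_const.rep_eq)

lemma padic_of_rat_minus: "padic_of_rat (- a) = - padic_of_rat a"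
  using padic_of_rat_add[of a "- a"] by (simp add: padic_of_rat_0 eq_neg_iff_add_eq_0 add.commute)

lemma padic_of_rat_of_nat: "padic_of_rat (of_nat n) = of_nat n"
  by (induction n) (simp_all add: padic_of_rat_0 padic_of_rat_1 padic_of_rat_add)

lemma padic_of_rat_of_int: "padic_of_rat (of_int n) = of_int n"
proof (cases "n \<ge> 0")
  case True
  thus ?thesis by (metis padic_of_rat_of_nat of_int_of_nat_eq zero_le_imp_eq_int)
next
  case False
  then obtain m where "n = - int m" by (metis nle_le zero_le_imp_eq_int neg_0_le_iff_le equation_minus_iff)
  thus ?thesis by (simp add: padic_of_rat_minus padic_of_rat_of_nat)
qed

lemma padic_norm_abs_padic: "padic_norm (abs_padic X) = padic_seq_norm X"
  by (simp add: padic_norm.abs_eq)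

lemma padic_norm_of_rat: "padic_norm (padic_of_rat c :: 'p::prime_card padic) = rat_padic_abs CARD('p) c"
  by (simp add: padic_of_rat_def padic_norm_abs_padic padic_seq_norm.rep_eq padic_seq_const.rep_eq)

lemma padic_norm_of_int:
  assumes "n \<noteq> 0"
  shows "padic_norm (of_int n :: 'p::prime_card padic) = 1 / real CARD('p) ^ multiplicity (int CARD('p)) n"
  using rat_padic_abs_frac[OF prime_card[where 'a = 'p], of n 1] assms
  by (simp add: padic_norm_of_rat flip: padic_of_rat_of_int)

lemma padic_norm_of_nat:
  assumes "n \<noteq> 0"
  shows "padic_norm (of_nat n :: 'p::prime_card padic) = 1 / real CARD('p) ^ multiplicity CARD('p) n"
proof -
  have "multiplicity (int CARD('p)) (int n) = multiplicity CARD('p) n"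
  proof (rule multiplicity_eqI)
    show "int CARD('p) ^ multiplicity CARD('p) n dvd int n"
      unfolding of_nat_power[symmetric] of_nat_dvd_iff by (rule multiplicity_dvd)
    show "\<not> int CARD('p) ^ Suc (multiplicity CARD('p) n) dvd int n"
      unfolding of_nat_power[symmetric] of_nat_dvd_iff
      using assms card_prime_gt_1[where 'p = 'p] by (subst power_dvd_iff_le_multiplicity) auto
  qed
  thus ?thesis using padic_norm_of_int[of "int n", where 'p = 'p] assms by simp
qed

lemma padic_norm_p: "padic_norm (of_nat CARD('p) :: 'p::prime_card padic) = 1 / real CARD('p)"
  using padic_norm_of_nat[of "CARD('p)", where 'p = 'p] card_prime_gt_1[where 'p = 'p]
  by (simp add: multiplicity_self)

instance padic :: (prime_card) field_char_0
proof
  have "n = 0" if "of_nat n = (0 :: 'a padic)" for n :: nat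
    using padic_norm_of_nat[of n, where 'p = 'a] that real_card_prime_gt_1[where 'p = 'a] by auto
  hence *: "m = n" if "m \<le> n" "of_nat m = (of_nat n :: 'a padic)" for m n
    using that of_nat_diff[OF that(1), where 'a = "'a padic"] by (metis diff_self diff_diff_cancel diff_zero)
  show "inj (of_nat :: nat \<Rightarrow> 'a padic)"
  proof (rule injI)
    fix m n :: nat assume "of_nat m = (of_nat n :: 'a padic)"
    thus "m = n" using *[of m n] *[of n m] by (cases "m \<le> n") auto
  qed
qed

lemma padic_norm_of_nat_le_iff:
  "padic_norm (of_nat n :: 'p::prime_card padic) \<le> 1 / real CARD('p) ^ j \<longleftrightarrow> CARD('p) ^ j dvd n"
proof (cases "n = 0")
  case False
  have "1 / real CARD('p) ^ m \<le> 1 / real CARD('p) ^ j \<longleftrightarrow> j \<le> m" for m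
    using real_card_prime_gt_1[where 'p = 'p] by (simp add: field_simps)
  thus ?thesis
    using False padic_norm_of_nat[OF False, where 'p = 'p] card_prime_gt_1[where 'p = 'p]
    by (simp add: power_dvd_iff_le_multiplicity)
qed (use real_card_prime_gt_1[where 'p = 'p] in simp)

section \<open>Density of the rationals and natural numbers, discreteness of the norm\<close>

lemma padic_approx_rat:
  assumes "e > 0"
  shows "\<exists>r. padic_norm (x - padic_of_rat r :: 'p::prime_card padic) < e"
proof -
  obtain X where x: "x = abs_padic X" using Quotient_abs_rep[OF Quotient_padic, of x] by metis
  have "rat_padic_Cauchy CARD('p) (Rep_padic_seq X)" using Rep_padic_seq by blast
  then obtain N where N: "\<And>m n. m \<ge> N \<Longrightarrow> n \<ge> N \<Longrightarrow>
      rat_padic_abs CARD('p) (Rep_padic_seq X m - Rep_padic_seq X n) < e / 2"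
    unfolding rat_padic_Cauchy_def using assms by (metis half_gt_zero)
  define Y where "Y = padic_seq_add X (padic_seq_minus (padic_seq_const (Rep_padic_seq X N)))"
  have "x - padic_of_rat (Rep_padic_seq X N) = abs_padic Y"
    unfolding x padic_of_rat_def Y_def minus_padic_def uminus_padic.abs_eq plus_padic.abs_eq ..
  \<comment> \<open>The strict bound e / 2 on the tail becomes weak in the limit and is still below
    e.\<close>
  moreover have "padic_seq_norm Y \<le> e / 2"
    by (rule LIMSEQ_le_const2[OF padic_seq_norm_LIMSEQ])
      (use N in \<open>auto simp: Y_def padic_seq_add.rep_eq padic_seq_minus.rep_eq padic_seq_const.rep_eq intro!: exI[of _ N] less_imp_le\<close>)
  ultimately have "padic_norm (x - padic_of_rat (Rep_padic_seq X N)) < e"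
    using assms by (simp add: padic_norm_abs_padic)
  thus ?thesis by blast
qed

text \<open>A rational r with |x - r| < |x| has |r| = |x| by the isosceles property, and on
  rationals the nonzero values of the norm are powers of p.\<close>

lemma padic_norm_discrete:
  assumes "x \<noteq> (0 :: 'p::prime_card padic)"
  shows "\<exists>k::int. padic_norm x = real CARD('p) powr of_int k"
proof -
  have "padic_norm x > 0" using assms padic_norm_nonneg[of x] padic_norm_eq_0_iff[of x] by simp
  then obtain r where r: "padic_norm (x - padic_of_rat r) < padic_norm x" using padic_approx_rat by blast
  hence "padic_norm (padic_of_rat r :: 'p padic) = padic_norm x"
    using padic_norm_isosceles[of "padic_of_rat r - x" x]
    by (simp add: padic_norm_diff_commute)
  hence nr: "padic_norm x = rat_padic_abs CARD('p) r" by (simp add: padic_norm_of_rat)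
  obtain a b :: int where ab: "r = of_int a / of_int b" "b \<noteq> 0" by (rule rat_frac[OF prime_card[where 'a = 'p]])
  have a: "a \<noteq> 0" using ab nr \<open>padic_norm x > 0\<close> by (auto simp: rat_padic_abs_zero prime_card)
  have "padic_norm x = real CARD('p) powr
      of_int (int (multiplicity (int CARD('p)) b) - int (multiplicity (int CARD('p)) a))"
    unfolding nr ab(1) rat_padic_abs_frac[OF prime_card a ab(2)]
    using real_card_prime_gt_1[where 'p = 'p] by (simp add: powr_diff powr_realpow)
  thus ?thesis by blast
qed

text \<open>No power of p lies strictly between 1 and p. This is how a strict bound by p on the
  Mahler coefficients later becomes integrality.\<close>

lemma padic_norm_less_p_imp_le_1:
  assumes "padic_norm (x :: 'p::prime_card padic) < real CARD('p)"
  shows "padic_norm x \<le> 1"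
proof (cases "x = 0")
  case False
  then obtain k :: int where k: "padic_norm x = real CARD('p) powr of_int k"
    using padic_norm_discrete by blast
  have "real CARD('p) powr of_int k < real CARD('p) powr 1"
    using assms k by simp
  hence "k \<le> 0" using real_card_prime_gt_1[where 'p = 'p] by (subst (asm) powr_less_cancel_iff) auto
  thus ?thesis unfolding k using real_card_prime_gt_1[where 'p = 'p] powr_mono[of "of_int k" 0 "real CARD('p)"] by simp
qed simp

text \<open>Weights are real numbers while valuations are integers, so a real exponent may be
  rounded for free.\<close>

lemma padic_norm_le_powr_ceiling:
  assumes "padic_norm (x :: 'p::prime_card padic) \<le> real CARD('p) powr (- s)"
  shows "padic_norm x \<le> real CARD('p) powr (- of_int \<lceil>s\<rceil>)"
proof (cases "x = 0")
  case False
  then obtain k :: int where k: "padic_norm x = real CARD('p) powr of_int k"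
    using padic_norm_discrete by blast
  hence "of_int k \<le> - s" using assms real_card_prime_gt_1[where 'p = 'p] by simp
  hence "s \<le> of_int (- k)" by simp
  hence "\<lceil>s\<rceil> \<le> - k" by (simp only: ceiling_le_iff)
  thus ?thesis unfolding k using real_card_prime_gt_1[where 'p = 'p] by simp
qed simp

text \<open>A close rational a / b is itself integral, so p does not divide b and b can be inverted
  modulo p^j; this turns a / b into a natural number modulo p^j.\<close>

lemma padic_ints_approx_nat:
  assumes "x \<in> (padic_ints :: 'p::prime_card padic set)"
  shows "\<exists>n. padic_norm (x - of_nat n) \<le> 1 / real CARD('p) ^ j"
proof -
  let ?p = "CARD('p)"
  have e: "1 / real ?p ^ j > 0" using real_card_prime_gt_1[where 'p = 'p] by simp
  have e1: "1 / real ?p ^ j \<le> 1" using real_card_prime_gt_1[where 'p = 'p] by simp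
  obtain r where r: "padic_norm (x - padic_of_rat r) < 1 / real ?p ^ j"
    using padic_approx_rat[OF e] by blast
  obtain a b where ab: "quotient_of r = (a, b)" by fastforce
  have b: "b > 0" using quotient_of_denom_pos[OF ab] .
  have cop: "coprime a b" using quotient_of_coprime[OF ab] .
  have rab: "r = of_int a / of_int b" using quotient_of_div[OF ab] .
  have eq: "padic_of_rat r * of_int b = (of_int a :: 'p padic)"
    using b unfolding rab padic_of_rat_of_int[symmetric] padic_of_rat_mult[symmetric] by simp
  have nr: "padic_norm (padic_of_rat r :: 'p padic) \<le> 1"
    using padic_norm_diff[of x "x - padic_of_rat r"] r e1 assms by (auto simp: padic_ints_def)
  \<comment> \<open>In lowest terms, p dividing b would make a a unit, while a = (a / b) b would
    have norm below 1.\<close>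
  have nb: "\<not> int ?p dvd b"
  proof
    assume pb: "int ?p dvd b"
    have "\<not> int ?p dvd a"
      using coprime_common_divisor[OF cop _ pb] card_prime_gt_1[where 'p = 'p] by (auto simp: zdvd1_eq)
    hence a: "a \<noteq> 0" "padic_norm (of_int a :: 'p padic) = 1"
      using padic_norm_of_int[of a, where 'p = 'p] by (auto simp: not_dvd_imp_multiplicity_0)
    have "padic_norm (of_int b :: 'p padic) < 1"
    proof -
      have "multiplicity (int ?p) b \<ge> 1"
        using pb b card_prime_gt_1[where 'p = 'p] by (intro multiplicity_geI) auto
      hence "1 < real ?p ^ multiplicity (int ?p) b"
        using real_card_prime_gt_1[where 'p = 'p] by (simp add: one_less_power)
      thus ?thesis using b padic_norm_of_int[of b, where 'p = 'p] by (simp add: divide_less_eq)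
    qed
    moreover have "padic_norm (padic_of_rat r :: 'p padic) * padic_norm (of_int b :: 'p padic) = 1"
      using eq a(2) padic_norm_mult[of "padic_of_rat r" "of_int b :: 'p padic"] by simp
    ultimately show False
      using nr padic_norm_nonneg[of "of_int b :: 'p padic"]
        mult_right_mono[OF nr, of "padic_norm (of_int b :: 'p padic)"] by simp
  qed
  have "coprime b (int ?p ^ j)"
    using nb prime_imp_coprime[of "int ?p" b] prime_card[where 'a = 'p]
    by (simp add: coprime_commute)
  then obtain c v where "c * b + v * int ?p ^ j = 1"
    using bezout_int[of b "int ?p ^ j"] by (auto simp: coprime_iff_gcd_eq_1)
  hence "b * c - 1 = int ?p ^ j * (- v)" by (simp add: algebra_simps)
  hence c: "int ?p ^ j dvd b * c - 1" by (metis dvd_triv_left)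
  \<comment> \<open>c inverts b modulo p^j, so a c represents a / b; reduction modulo p^j makes it
    non-negative.\<close>
  define n where "n = nat (a * c mod int ?p ^ j)"
  have pj: "int ?p ^ j > 0" using card_prime_gt_1[where 'p = 'p] by simp
  have n: "int n = a * c mod int ?p ^ j" unfolding n_def using pj by simp
  have dv: "int ?p ^ j dvd a - b * int n"
  proof -
    have "int ?p ^ j dvd a * c - int n" unfolding n by (simp add: minus_mod_eq_mult_div)
    hence "int ?p ^ j dvd b * (a * c - int n) - a * (b * c - 1)"
      using c by (simp add: dvd_mult dvd_diff[OF dvd_mult dvd_mult])
    thus ?thesis by (simp add: algebra_simps)
  qed
  have nb1: "padic_norm (of_int b :: 'p padic) = 1"
    using b nb padic_norm_of_int[of b, where 'p = 'p] by (simp add: not_dvd_imp_multiplicity_0)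
  obtain k where k: "a - b * int n = int ?p ^ j * k" using dv by blast
  have "(padic_of_rat r - of_nat n) * of_int b = (of_int (a - b * int n) :: 'p padic)"
    using eq by (simp add: algebra_simps)
  also have "\<dots> = of_nat ?p ^ j * of_int k" unfolding k by simp
  finally have "padic_norm (padic_of_rat r - of_nat n :: 'p padic) = padic_norm (of_nat ?p ^ j * of_int k :: 'p padic)"
    using nb1 by (metis padic_norm_mult mult.right_neutral)
  also have "\<dots> \<le> 1 / real ?p ^ j"
    using real_card_prime_gt_1[where 'p = 'p] padic_norm_of_int_le_1[of k, where 'p = 'p]
    by (simp add: padic_norm_mult padic_norm_power padic_norm_p power_one_over field_simps)
  finally have "padic_norm (x - of_nat n) \<le> 1 / real ?p ^ j"
    using r padic_norm_add_le[of "x - padic_of_rat r" "1 / real ?p ^ j" "padic_of_rat r - of_nat n"] by simp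
  thus ?thesis by blast
qed

section \<open>Topology and completeness\<close>

lemma padic_tendsto_iff:
  "(f \<longlongrightarrow> (l :: 'p::prime_card padic)) F \<longleftrightarrow> ((\<lambda>x. padic_norm (f x - l)) \<longlongrightarrow> 0) F"
  by (simp add: tendsto_dist_iff[of f l] dist_padic_def)

lemma prime_powers_tendsto_0: "(\<lambda>n. 1 / real CARD('p::prime_card) ^ n) \<longlonglongrightarrow> 0"
  using LIMSEQ_inverse_realpow_zero[OF real_card_prime_gt_1[where 'p = 'p]] by (simp add: inverse_eq_divide)

lemma padic_ints_limit_nat:
  assumes "x \<in> (padic_ints :: 'p::prime_card padic set)"
  obtains a :: "nat \<Rightarrow> nat" where "(\<lambda>n. of_nat (a n)) \<longlonglongrightarrow> x"
proof -
  have "\<forall>j. \<exists>n. padic_norm (x - of_nat n) \<le> 1 / real CARD('p) ^ j"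
    using padic_ints_approx_nat[OF assms] by blast
  then obtain a where a: "\<And>j. padic_norm (x - of_nat (a j)) \<le> 1 / real CARD('p) ^ j" by metis
  have "(\<lambda>n. of_nat (a n)) \<longlonglongrightarrow> x"
    unfolding padic_tendsto_iff
    by (rule Lim_null_comparison[OF _ prime_powers_tendsto_0[where 'p = 'p]])
      (use a in \<open>auto simp: padic_norm_nonneg padic_norm_diff_commute[of _ x]\<close>)
  thus ?thesis by (rule that)
qed

instance padic :: (prime_card) topological_ab_group_add
proof
  fix a b :: "'a padic"
  have f: "(fst \<longlongrightarrow> a) (nhds a \<times>\<^sub>F nhds b)" "(snd \<longlongrightarrow> b) (nhds a \<times>\<^sub>F nhds b)"
    by (rule filterlim_fst filterlim_snd)+
  show "((\<lambda>x. fst x + snd x) \<longlongrightarrow> a + b) (nhds a \<times>\<^sub>F nhds b)"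
    unfolding padic_tendsto_iff
  proof (rule Lim_null_comparison)
    show "((\<lambda>x. max (padic_norm (fst x - a)) (padic_norm (snd x - b))) \<longlongrightarrow> 0) (nhds a \<times>\<^sub>F nhds b)"
      using tendsto_max[OF f(1)[unfolded padic_tendsto_iff] f(2)[unfolded padic_tendsto_iff]] by simp
  qed (auto intro!: always_eventually simp: padic_norm_nonneg add_diff_add padic_norm_add)
  show "(uminus \<longlongrightarrow> - a) (nhds a)"
    using filterlim_ident[of "nhds a"] unfolding padic_tendsto_iff
    by (subst padic_norm_minus[symmetric]) (simp add: padic_norm_diff_commute)
qed

instance padic :: (prime_card) topological_semigroup_mult
proof
  fix a b :: "'a padic"
  have f: "((\<lambda>x. padic_norm (fst x - a)) \<longlongrightarrow> 0) (nhds a \<times>\<^sub>F nhds b)"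
    "((\<lambda>x. padic_norm (snd x - b)) \<longlongrightarrow> 0) (nhds a \<times>\<^sub>F nhds b)"
    unfolding padic_tendsto_iff[symmetric] by (rule filterlim_fst filterlim_snd)+
  let ?g = "\<lambda>x. padic_norm (fst x - a) * padic_norm (snd x - b) +
      (padic_norm a * padic_norm (snd x - b) + padic_norm (fst x - a) * padic_norm b)"
  show "((\<lambda>x. fst x * snd x) \<longlongrightarrow> a * b) (nhds a \<times>\<^sub>F nhds b)"
    unfolding padic_tendsto_iff
  proof (rule Lim_null_comparison)
    show "(?g \<longlongrightarrow> 0) (nhds a \<times>\<^sub>F nhds b)"
      using tendsto_add[OF tendsto_mult[OF f] tendsto_add[OF tendsto_mult_left[OF f(2), of "padic_norm a"]
        tendsto_mult_right[OF f(1), of "padic_norm b"]]] by simp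
    show "\<forall>\<^sub>F x in nhds a \<times>\<^sub>F nhds b. norm (padic_norm (fst x * snd x - a * b)) \<le> ?g x"
    proof (intro always_eventually allI)
      fix x :: "'a padic \<times> 'a padic"
      have "fst x * snd x - a * b = (fst x - a) * (snd x - b) + (a * (snd x - b) + (fst x - a) * b)"
        by (simp add: algebra_simps)
      moreover have "padic_norm (u + (v + w)) \<le> padic_norm u + (padic_norm v + padic_norm w)" for u v w :: "'a padic"
        using padic_norm_add[of u "v + w"] padic_norm_add[of v w] padic_norm_nonneg[of u]
          padic_norm_nonneg[of v] padic_norm_nonneg[of w] by linarith
      ultimately show "norm (padic_norm (fst x * snd x - a * b)) \<le> ?g x"
        by (metis padic_norm_mult padic_norm_nonneg real_norm_def abs_of_nonneg)
    qed
  qed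
qed

text \<open>Choose rationals r n within 1 / (n + 1) of X n. They form a Cauchy sequence of
  rationals, hence represent an element of the completion, and X converges to it.\<close>

instance padic :: (prime_card) complete_space
proof
  fix X :: "nat \<Rightarrow> 'a padic"
  assume X: "Cauchy X"
  have "\<forall>n. \<exists>r. padic_norm (X n - padic_of_rat r) < 1 / real (Suc n)"
    by (intro allI padic_approx_rat) simp
  then obtain r where r: "\<And>n. padic_norm (X n - padic_of_rat (r n)) < 1 / real (Suc n)" by metis
  have lim: "(\<lambda>n. padic_norm (X n - padic_of_rat (r n))) \<longlonglongrightarrow> 0"
    by (rule Lim_null_comparison[OF _ LIMSEQ_Suc[OF lim_1_over_n]])
      (use r in \<open>auto intro!: always_eventually less_imp_le simp: padic_norm_nonneg\<close>)
  have cau: "rat_padic_Cauchy CARD('a) r"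
    unfolding rat_padic_Cauchy_def
  proof (intro allI impI)
    fix e :: real assume e: "e > 0"
    obtain N1 where N1: "\<And>m n. m \<ge> N1 \<Longrightarrow> n \<ge> N1 \<Longrightarrow> dist (X m) (X n) < e"
      using X e unfolding Cauchy_def by blast
    obtain N2 where N2: "\<And>n. n \<ge> N2 \<Longrightarrow> padic_norm (X n - padic_of_rat (r n)) < e"
      using lim e by (auto simp: LIMSEQ_iff padic_norm_nonneg)
    have "rat_padic_abs CARD('a) (r m - r n) < e" if mn: "m \<ge> max N1 N2" "n \<ge> max N1 N2" for m n
    proof -
      have "rat_padic_abs CARD('a) (r m - r n) = padic_norm (padic_of_rat (r m) - padic_of_rat (r n) :: 'a padic)"
        by (simp add: padic_of_rat_minus flip: padic_norm_of_rat padic_of_rat_add[of "r m" "- r n", simplified])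
      also have "padic_of_rat (r m) - padic_of_rat (r n) =
          (X m - X n) + ((X n - padic_of_rat (r n)) - (X m - padic_of_rat (r m)))" by simp
      also have "padic_norm \<dots> \<le> max (padic_norm (X m - X n))
          (max (padic_norm (X n - padic_of_rat (r n))) (padic_norm (X m - padic_of_rat (r m))))"
        by (meson max.mono order.trans order_refl padic_norm_add padic_norm_diff)
      also have "\<dots> < e" using N1[of m n] N2[of m] N2[of n] mn by (simp add: dist_padic_def)
      finally show ?thesis .
    qed
    thus "\<exists>N. \<forall>m\<ge>N. \<forall>n\<ge>N. rat_padic_abs CARD('a) (r m - r n) < e" by blast
  qed
  define Y where "Y = (Abs_padic_seq r :: 'a padic_seq)"
  have Y: "Rep_padic_seq Y = r" unfolding Y_def using cau by (simp add: Abs_padic_seq_inverse)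
  have lim2: "(\<lambda>n. padic_norm (padic_of_rat (r n) - abs_padic Y)) \<longlonglongrightarrow> 0"
  proof (rule LIMSEQ_I)
    fix e :: real assume e: "e > 0"
    then obtain N where N: "\<And>m n. m \<ge> N \<Longrightarrow> n \<ge> N \<Longrightarrow> rat_padic_abs CARD('a) (r m - r n) < e / 2"
      using cau unfolding rat_padic_Cauchy_def by (metis half_gt_zero)
    have "padic_norm (padic_of_rat (r n) - abs_padic Y) < e" if n: "n \<ge> N" for n
    proof -
      define Z where "Z = padic_seq_add (padic_seq_const (r n)) (padic_seq_minus Y)"
      have "padic_of_rat (r n) - abs_padic Y = abs_padic Z"
        unfolding padic_of_rat_def Z_def minus_padic_def uminus_padic.abs_eq plus_padic.abs_eq ..
      moreover have "padic_seq_norm Z \<le> e / 2"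
        by (rule LIMSEQ_le_const2[OF padic_seq_norm_LIMSEQ])
          (use N n in \<open>auto simp: Z_def Y padic_seq_add.rep_eq padic_seq_minus.rep_eq padic_seq_const.rep_eq intro!: exI[of _ N] less_imp_le\<close>)
      ultimately show ?thesis using e by (simp add: padic_norm_abs_padic)
    qed
    thus "\<exists>N. \<forall>n\<ge>N. norm (padic_norm (padic_of_rat (r n) - abs_padic Y) - 0) < e"
      by (auto simp: padic_norm_nonneg)
  qed
  have "X \<longlonglongrightarrow> abs_padic Y"
    unfolding padic_tendsto_iff
  proof (rule Lim_null_comparison)
    show "(\<lambda>n. max (padic_norm (X n - padic_of_rat (r n))) (padic_norm (padic_of_rat (r n) - abs_padic Y))) \<longlonglongrightarrow> 0"
      using tendsto_max[OF lim lim2] by simp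
    have "padic_norm (X n - abs_padic Y) \<le> max (padic_norm (X n - padic_of_rat (r n))) (padic_norm (padic_of_rat (r n) - abs_padic Y))" for n
      using padic_norm_add[of "X n - padic_of_rat (r n)" "padic_of_rat (r n) - abs_padic Y"] by simp
    thus "\<forall>\<^sub>F n in sequentially. norm (padic_norm (X n - abs_padic Y)) \<le>
        max (padic_norm (X n - padic_of_rat (r n))) (padic_norm (padic_of_rat (r n) - abs_padic Y))"
      by (simp add: padic_norm_nonneg)
  qed
  thus "convergent X" by (auto simp: convergent_def)
qed

lemma padic_ints_0 [simp]: "0 \<in> padic_ints" and padic_ints_1 [simp]: "1 \<in> padic_ints"
  and padic_ints_of_nat [simp]: "of_nat n \<in> padic_ints"
  by (simp_all add: padic_ints_def)

lemma padic_ints_add: "x \<in> padic_ints \<Longrightarrow> y \<in> padic_ints \<Longrightarrow> x + y \<in> padic_ints"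
  and padic_ints_minus: "x \<in> padic_ints \<Longrightarrow> - x \<in> padic_ints"
  by (simp_all add: padic_ints_def padic_norm_add_le padic_norm_minus)

section \<open>Unconditional sums of p-adic numbers\<close>

lemma padic_ints_diff: "x \<in> padic_ints \<Longrightarrow> y \<in> padic_ints \<Longrightarrow> x - y \<in> padic_ints"
  by (simp add: padic_ints_def padic_norm_diff_le)

lemma padic_has_sum_norm_le:
  assumes "(f has_sum s) A" "\<And>a. a \<in> A \<Longrightarrow> padic_norm (f a :: 'p::prime_card padic) \<le> B" "0 \<le> B"
  shows "padic_norm s \<le> B"
proof (rule field_le_epsilon)
  fix e :: real assume "e > 0"
  then obtain F where F: "finite F" "F \<subseteq> A" "dist (sum f F) s \<le> e"
    using has_sum_finite_approximation[OF assms(1)] by blast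
  have "padic_norm (sum f F) \<le> B" using F assms by (intro padic_norm_sum_le) auto
  moreover have "padic_norm s \<le> max (padic_norm (sum f F)) (padic_norm (sum f F - s))"
    using padic_norm_diff[of "sum f F" "sum f F - s"] by simp
  ultimately show "padic_norm s \<le> B + e"
    using F(3) \<open>e > 0\<close> assms(3) by (auto simp: dist_padic_def)
qed

text \<open>In a complete ultrametric field a family is unconditionally summable as soon as its
  terms tend to 0. The sums over the finite level sets \<open>B n\<close> converge to the
  value.\<close>

lemma padic_summable:
  assumes "\<And>e. e > 0 \<Longrightarrow> finite {a\<in>A. padic_norm (f a :: 'p::prime_card padic) \<ge> e}"
  shows "f summable_on A"
proof -
  define B where "B n = {a\<in>A. padic_norm (f a) \<ge> 1 / real (Suc n)}" for n
  have fin: "finite (B n)" for n unfolding B_def by (rule assms) simp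
  have mono: "B m \<subseteq> B n" if "m \<le> n" for m n
  proof -
    have "1 / real (Suc n) \<le> 1 / real (Suc m)" using that by (simp add: frac_le)
    thus ?thesis unfolding B_def by (auto intro: order_trans)
  qed
  \<comment> \<open>Outside \<open>B n\<close> every term has norm at most 1 / (n + 1), and an
    ultrametric sum is no larger than its largest term.\<close>
  have key: "padic_norm (sum f F - sum f (B n)) \<le> 1 / real (Suc n)" if "finite F" "B n \<subseteq> F" "F \<subseteq> A" for F n
  proof -
    have "sum f F - sum f (B n) = sum f (F - B n)" using that by (simp add: sum_diff)
    moreover have "padic_norm (f a) \<le> 1 / real (Suc n)" if "a \<in> F - B n" for a
      using that \<open>F \<subseteq> A\<close> by (force simp: B_def)
    ultimately show ?thesis by (metis padic_norm_sum_le zero_le_divide_1_iff of_nat_0_le_iff)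
  qed
  have small: "\<exists>N. \<forall>n\<ge>N. 1 / real (Suc n) < e" if e: "e > 0" for e
  proof -
    obtain N where N: "1 / real (Suc N) < e" using nat_approx_posE[OF e] by blast
    have "1 / real (Suc n) < e" if "n \<ge> N" for n
      using N that by (meson frac_le le_less_trans less_or_eq_imp_le of_nat_0_less_iff of_nat_le_iff order_refl zero_le_one zero_less_Suc Suc_le_mono)
    thus ?thesis by blast
  qed
  have "Cauchy (\<lambda>n. sum f (B n))"
    unfolding Cauchy_altdef
  proof (intro allI impI)
    fix e :: real assume "e > 0"
    then obtain N where N: "\<forall>n\<ge>N. 1 / real (Suc n) < e" using small by blast
    have "dist (sum f (B m)) (sum f (B n)) < e" if "m \<ge> N" "n > m" for m n
    proof -
      have "padic_norm (sum f (B n) - sum f (B m)) \<le> 1 / real (Suc m)"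
        using that mono[of m n] fin[of n] by (intro key) (auto simp: B_def)
      also have "\<dots> < e" using N that by blast
      finally show ?thesis by (simp add: dist_padic_def padic_norm_diff_commute)
    qed
    thus "\<exists>M. \<forall>m\<ge>M. \<forall>n>m. dist (sum f (B m)) (sum f (B n)) < e" by blast
  qed
  then obtain s where s: "(\<lambda>n. sum f (B n)) \<longlonglongrightarrow> s" by (metis Cauchy_convergent_iff convergent_def)
  have "(f has_sum s) A"
    unfolding has_sum_def tendsto_iff eventually_finite_subsets_at_top
  proof (intro allI impI)
    fix e :: real assume e: "e > 0"
    obtain N1 where N1: "\<forall>n\<ge>N1. 1 / real (Suc n) < e" using small[OF e] by blast
    obtain N2 where N2: "\<forall>n\<ge>N2. dist (sum f (B n)) s < e" using s e unfolding lim_sequentially by blast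
    define n where "n = max N1 N2"
    have n: "1 / real (Suc n) < e" "padic_norm (sum f (B n) - s) < e"
      using N1 N2 unfolding n_def dist_padic_def by auto
    have "dist (sum f F) s < e" if "finite F" "F \<subseteq> A" "B n \<subseteq> F" for F
      using key[OF that(1,3,2)] n padic_norm_add[of "sum f F - sum f (B n)" "sum f (B n) - s"]
      by (simp add: dist_padic_def)
    moreover have "B n \<subseteq> A" unfolding B_def by blast
    ultimately show "\<exists>X. finite X \<and> X \<subseteq> A \<and> (\<forall>Y. finite Y \<and> X \<subseteq> Y \<and> Y \<subseteq> A \<longrightarrow> dist (sum f Y) s < e)"
      using fin by blast
  qed
  thus ?thesis by (auto simp: summable_on_def)
qed

section \<open>Multi-indices and coefficient bounds\<close>

lemma keys_add_multi_index:
  "Poly_Mapping.keys (\<alpha> + \<beta> :: multi_index) = Poly_Mapping.keys \<alpha> \<union> Poly_Mapping.keys \<beta>"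
  by (intro Set.set_eqI) (simp add: in_keys_iff lookup_add)

lemma total_degree_eq_sum:
  assumes "finite K" "Poly_Mapping.keys \<alpha> \<subseteq> K"
  shows "total_degree \<alpha> = (\<Sum>i\<in>K. Poly_Mapping.lookup \<alpha> i)"
  unfolding total_degree_def by (rule sum.mono_neutral_left) (use assms in \<open>simp_all add: in_keys_iff\<close>)

lemma total_degree_0 [simp]: "total_degree 0 = 0"
  by (simp add: total_degree_def)

lemma total_degree_single [simp]: "total_degree (Poly_Mapping.single i k) = k"
  by (simp add: total_degree_def)

lemma total_degree_add [simp]: "total_degree (\<alpha> + \<beta>) = total_degree \<alpha> + total_degree \<beta>"
proof -
  define K where "K = Poly_Mapping.keys \<alpha> \<union> Poly_Mapping.keys \<beta>"
  have K: "finite K" "Poly_Mapping.keys (\<alpha> + \<beta>) \<subseteq> K" "Poly_Mapping.keys \<alpha> \<subseteq> K" "Poly_Mapping.keys \<beta> \<subseteq> K"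
    by (simp_all add: K_def keys_add_multi_index)
  show ?thesis
    by (simp only: total_degree_eq_sum[OF K(1,2)] total_degree_eq_sum[OF K(1,3)]
        total_degree_eq_sum[OF K(1,4)] lookup_add sum.distrib)
qed

lemma lookup_le_total_degree: "Poly_Mapping.lookup \<alpha> i \<le> total_degree \<alpha>"
proof -
  have "(\<Sum>j\<in>{i}. Poly_Mapping.lookup \<alpha> j) \<le> (\<Sum>j\<in>insert i (Poly_Mapping.keys \<alpha>). Poly_Mapping.lookup \<alpha> j)"
    by (rule sum_mono2) auto
  thus ?thesis
    by (subst total_degree_eq_sum[of "insert i (Poly_Mapping.keys \<alpha>)" \<alpha>]) (auto simp del: sum.insert_if)
qed

lemma multi_index_split:
  assumes "i \<in> Poly_Mapping.keys (\<alpha> :: multi_index)"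
  obtains \<alpha>' where "\<alpha> = \<alpha>' + Poly_Mapping.single i 1"
proof
  show "\<alpha> = (\<alpha> - Poly_Mapping.single i 1) + Poly_Mapping.single i 1"
    using assms by (intro poly_mapping_eqI) (auto simp: lookup_add lookup_minus lookup_single when_def in_keys_iff)
qed

lemma multi_index_induct [case_names zero add]:
  assumes "P 0" "\<And>\<alpha> i. P \<alpha> \<Longrightarrow> P (\<alpha> + Poly_Mapping.single i 1)"
  shows "P (\<alpha> :: multi_index)"
proof (induction "total_degree \<alpha>" arbitrary: \<alpha>)
  case 0
  have "\<alpha> = 0" by (rule poly_mapping_eqI) (use 0 lookup_le_total_degree[of \<alpha>] in auto)
  thus ?case using assms by simp
next
  case (Suc d)
  hence "Poly_Mapping.keys \<alpha> \<noteq> {}" by (auto simp: total_degree_def)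
  then obtain i \<alpha>' where a: "\<alpha> = \<alpha>' + Poly_Mapping.single i 1" using multi_index_split by blast
  thus ?case using Suc assms by auto
qed

lemma finite_multi_index_degree:
  "finite {\<alpha> :: multi_index. Poly_Mapping.keys \<alpha> \<subseteq> {..<n} \<and> total_degree \<alpha> \<le> D}" (is "finite ?S")
proof (rule inj_on_finite)
  let ?f = "\<lambda>\<alpha> :: multi_index. restrict (Poly_Mapping.lookup \<alpha>) {..<n}"
  show "inj_on ?f ?S"
  proof (rule inj_onI, rule poly_mapping_eqI)
    fix \<alpha> \<beta> :: multi_index and i
    assume a: "\<alpha> \<in> ?S" "\<beta> \<in> ?S" "?f \<alpha> = ?f \<beta>"
    show "Poly_Mapping.lookup \<alpha> i = Poly_Mapping.lookup \<beta> i"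
    proof (cases "i < n")
      case True thus ?thesis using fun_cong[OF a(3), of i] by simp
    next
      case False
      hence "i \<notin> Poly_Mapping.keys \<alpha>" "i \<notin> Poly_Mapping.keys \<beta>" using a(1,2) by auto
      thus ?thesis by (simp add: in_keys_iff)
    qed
  qed
  show "?f ` ?S \<subseteq> {..<n} \<rightarrow>\<^sub>E {..D}"
    by (intro image_subsetI) (simp add: restrict_PiE_iff order_trans[OF lookup_le_total_degree])
  show "finite ({..<n} \<rightarrow>\<^sub>E {..D})" by (intro finite_PiE) auto
qed

lemma finite_multi_index_sums: "finite {(\<alpha>, \<beta>). \<alpha> + \<beta> = (\<gamma> :: multi_index)}"
proof -
  obtain n where n: "Poly_Mapping.keys \<gamma> \<subseteq> {..<n}" by (metis finite_keys finite_nat_bounded)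
  let ?S = "{\<alpha> :: multi_index. Poly_Mapping.keys \<alpha> \<subseteq> {..<n} \<and> total_degree \<alpha> \<le> total_degree \<gamma>}"
  have "{(\<alpha>, \<beta>). \<alpha> + \<beta> = \<gamma>} \<subseteq> ?S \<times> ?S"
    using n by (auto simp: keys_add_multi_index)
  thus ?thesis by (rule finite_subset) (intro finite_cartesian_product finite_multi_index_degree)
qed

text \<open>In finitely many variables each degree has finitely many multi-indices, and the bound
  drops below e from some degree on. The summability arguments for power series draw their
  finiteness from here.\<close>

lemma finite_multi_index_geometric:
  fixes s e A :: real
  assumes "0 \<le> s" "s < 1" "0 < e"
  shows "finite {\<alpha> :: multi_index. Poly_Mapping.keys \<alpha> \<subseteq> {..<n} \<and> e \<le> A * s ^ total_degree \<alpha>}"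
proof -
  have "(\<lambda>k. A * s ^ k) \<longlonglongrightarrow> A * 0" using assms by (intro tendsto_mult_left LIMSEQ_realpow_zero) auto
  hence "eventually (\<lambda>k. A * s ^ k < e) sequentially" using assms(3) by (intro order_tendstoD) auto
  then obtain D where D: "\<And>k. k \<ge> D \<Longrightarrow> A * s ^ k < e" by (auto simp: eventually_sequentially)
  have "total_degree \<alpha> \<le> D" if "e \<le> A * s ^ total_degree \<alpha>" for \<alpha>
    using D[of "total_degree \<alpha>"] that by (cases "D \<le> total_degree \<alpha>") auto
  thus ?thesis
    by (intro finite_subset[OF _ finite_multi_index_degree[of n D]]) auto
qed

section \<open>Monomials, supports and geometric coefficient bounds\<close>

definition monom_val :: "(nat \<Rightarrow> 'a::comm_monoid_mult) \<Rightarrow> multi_index \<Rightarrow> 'a" where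
  "monom_val x \<alpha> = (\<Prod>i\<in>Poly_Mapping.keys \<alpha>. x i ^ Poly_Mapping.lookup \<alpha> i)"

lemma monom_val_eq_prod:
  assumes "finite K" "Poly_Mapping.keys \<alpha> \<subseteq> K"
  shows "monom_val x \<alpha> = (\<Prod>i\<in>K. x i ^ Poly_Mapping.lookup \<alpha> i)"
  unfolding monom_val_def by (rule prod.mono_neutral_left) (use assms in \<open>simp_all add: in_keys_iff\<close>)

lemma monom_val_0 [simp]: "monom_val x 0 = 1"
  by (simp add: monom_val_def)

lemma monom_val_single [simp]: "monom_val x (Poly_Mapping.single i k) = x i ^ k"
  by (simp add: monom_val_def)

lemma monom_val_add: "monom_val x (\<alpha> + \<beta>) = monom_val x \<alpha> * monom_val x \<beta>"
proof -
  define K where "K = Poly_Mapping.keys \<alpha> \<union> Poly_Mapping.keys \<beta>"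
  have K: "finite K" "Poly_Mapping.keys (\<alpha> + \<beta>) \<subseteq> K" "Poly_Mapping.keys \<alpha> \<subseteq> K" "Poly_Mapping.keys \<beta> \<subseteq> K"
    by (simp_all add: K_def keys_add_multi_index)
  show ?thesis
    by (simp only: monom_val_eq_prod[OF K(1,2)] monom_val_eq_prod[OF K(1,3)]
        monom_val_eq_prod[OF K(1,4)] lookup_add power_add prod.distrib)
qed

text \<open>Coordinates from n on are left free, so that points of different dimensions share a type
  and forgetting the last coordinates is the identity.\<close>

definition padic_points :: "nat \<Rightarrow> (nat \<Rightarrow> 'p::prime_card padic) set" where
  "padic_points n = {x. \<forall>i<n. x i \<in> padic_ints}"

definition supported :: "nat \<Rightarrow> 'p::prime_card padic_series \<Rightarrow> bool" where
  "supported n f \<longleftrightarrow> (\<forall>\<alpha>. \<not> Poly_Mapping.keys \<alpha> \<subseteq> {..<n} \<longrightarrow> f \<alpha> = 0)"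

text \<open>A rate s < 1 means convergence on a polydisc of radius larger than 1, with A absorbing
  the low degrees; s = 1 bounds the Gauss norm by A.\<close>

definition coeff_bound :: "'p::prime_card padic_series \<Rightarrow> real \<Rightarrow> real \<Rightarrow> bool" where
  "coeff_bound f s A \<longleftrightarrow> (\<forall>\<alpha>. padic_norm (f \<alpha>) \<le> A * s ^ total_degree \<alpha>)"

definition eval_series :: "'p::prime_card padic_series \<Rightarrow> (nat \<Rightarrow> 'p padic) \<Rightarrow> 'p padic" where
  "eval_series f x = (\<Sum>\<^sub>\<infinity>\<alpha>. f \<alpha> * monom_val x \<alpha>)"

lemma monom_val_norm_le_1:
  assumes "x \<in> padic_points n" "Poly_Mapping.keys \<alpha> \<subseteq> {..<n}"
  shows "padic_norm (monom_val x \<alpha> :: 'p::prime_card padic) \<le> 1"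
proof -
  have "padic_norm (\<Prod>i\<in>K. x i ^ Poly_Mapping.lookup \<alpha> i) \<le> 1" if "finite K" "K \<subseteq> {..<n}" for K
    using that
  proof (induction K)
    case (insert i K)
    have "padic_norm (x i) ^ Poly_Mapping.lookup \<alpha> i \<le> 1"
      using insert assms(1) by (intro power_le_one) (auto simp: padic_points_def padic_ints_def padic_norm_nonneg)
    thus ?case using insert by (simp add: padic_norm_mult padic_norm_power mult_le_one padic_norm_nonneg)
  qed simp
  thus ?thesis using assms(2) by (simp add: monom_val_def)
qed

lemma coeff_bound_nonneg: "coeff_bound f s A \<Longrightarrow> 0 \<le> A"
  using padic_norm_nonneg[of "f 0"] unfolding coeff_bound_def
  by (metis mult.right_neutral order_trans power_0 total_degree_0)

lemma coeff_bound_mono: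
  assumes "coeff_bound f s A" "0 \<le> s" "s \<le> t" "A \<le> B"
  shows "coeff_bound f t B"
  unfolding coeff_bound_def
proof
  fix \<alpha>
  have "A * s ^ total_degree \<alpha> \<le> B * t ^ total_degree \<alpha>"
    using assms coeff_bound_nonneg[OF assms(1)] by (intro mult_mono power_mono) auto
  thus "padic_norm (f \<alpha>) \<le> B * t ^ total_degree \<alpha>"
    using assms(1) unfolding coeff_bound_def by (meson order_trans)
qed

lemma coeff_bound_1: "coeff_bound f 1 A \<longleftrightarrow> (\<forall>\<alpha>. padic_norm (f \<alpha>) \<le> A)"
  by (simp add: coeff_bound_def)

text \<open>Convergence to 0 at a radius r > 1 is traded for geometric bounds, which multiply well.
  From a rate s the radius 1 / sqrt s is safe, since the remaining factor (sqrt s)^n still tends to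
  0.\<close>

lemma in_washnitzer_iff:
  "f \<in> carrier (washnitzer n) \<longleftrightarrow> supported n f \<and> (\<exists>A s. 0 < s \<and> s < 1 \<and> coeff_bound f s A)"
proof
  assume f: "f \<in> carrier (washnitzer n)"
  hence sup: "supported n f" by (simp add: washnitzer_def supported_def)
  obtain r where r: "r > 1"
    "((\<lambda>\<alpha>. padic_norm (f \<alpha>) * r ^ total_degree \<alpha>) \<longlongrightarrow> 0) (filtercomap total_degree at_top)"
    using f by (auto simp: washnitzer_def)
  have "\<forall>\<^sub>F \<alpha> in filtercomap total_degree at_top. padic_norm (f \<alpha>) * r ^ total_degree \<alpha> < 1"
    by (rule order_tendstoD(2)[OF r(2)]) simp
  then obtain D where D: "\<And>\<alpha>. total_degree \<alpha> \<ge> D \<Longrightarrow> padic_norm (f \<alpha>) * r ^ total_degree \<alpha> < 1"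
    by (auto simp: eventually_filtercomap eventually_at_top_linorder)
  \<comment> \<open>The finitely many supported monomials of degree at most D are absorbed into the
    constant A.\<close>
  let ?S = "{\<alpha> :: multi_index. Poly_Mapping.keys \<alpha> \<subseteq> {..<n} \<and> total_degree \<alpha> \<le> D}"
  define A where "A = Max (insert 1 ((\<lambda>\<alpha>. padic_norm (f \<alpha>) * r ^ total_degree \<alpha>) ` ?S))"
  have fin: "finite (insert 1 ((\<lambda>\<alpha>. padic_norm (f \<alpha>) * r ^ total_degree \<alpha>) ` ?S))"
    using finite_multi_index_degree by blast
  have A1: "1 \<le> A" unfolding A_def by (rule Max_ge[OF fin]) simp
  have "padic_norm (f \<alpha>) * r ^ total_degree \<alpha> \<le> A" for \<alpha>
  proof (cases "\<alpha> \<in> ?S")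
    case True thus ?thesis unfolding A_def by (intro Max_ge[OF fin]) blast
  next
    case False
    show ?thesis
    proof (cases "Poly_Mapping.keys \<alpha> \<subseteq> {..<n}")
      case True thus ?thesis using False D[of \<alpha>] A1 by simp
    next
      case False thus ?thesis using sup A1 by (simp add: supported_def)
    qed
  qed
  hence "coeff_bound f (1 / r) A"
    using r(1) by (simp add: coeff_bound_def power_one_over field_simps)
  moreover have "0 < 1 / r" "1 / r < 1" using r(1) by auto
  ultimately show "supported n f \<and> (\<exists>A s. 0 < s \<and> s < 1 \<and> coeff_bound f s A)" using sup by blast
next
  assume f: "supported n f \<and> (\<exists>A s. 0 < s \<and> s < 1 \<and> coeff_bound f s A)"
  then obtain A s where s: "0 < s" "s < 1" "coeff_bound f s A" by blast
  define r where "r = 1 / sqrt s"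
  have ss: "0 < sqrt s" "sqrt s < 1" using s by auto
  have r: "r > 1" unfolding r_def using ss by simp
  have "((\<lambda>\<alpha>. padic_norm (f \<alpha>) * r ^ total_degree \<alpha>) \<longlongrightarrow> 0) (filtercomap total_degree at_top)"
  proof (rule Lim_null_comparison)
    have "(\<lambda>k. A * sqrt s ^ k) \<longlonglongrightarrow> A * 0" using ss by (intro tendsto_mult_left LIMSEQ_realpow_zero) auto
    hence "(\<lambda>k. A * sqrt s ^ k) \<longlonglongrightarrow> 0" by simp
    from filterlim_compose[OF this filterlim_filtercomap]
    show "((\<lambda>\<alpha>. A * sqrt s ^ total_degree \<alpha>) \<longlongrightarrow> 0) (filtercomap total_degree at_top)" .
    have "padic_norm (f \<alpha>) * r ^ total_degree \<alpha> \<le> A * sqrt s ^ total_degree \<alpha>" for \<alpha>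
    proof -
      have "padic_norm (f \<alpha>) * r ^ total_degree \<alpha> \<le> (A * s ^ total_degree \<alpha>) * r ^ total_degree \<alpha>"
        using s r unfolding coeff_bound_def by (intro mult_right_mono) auto
      also have "\<dots> = A * (s * r) ^ total_degree \<alpha>" by (simp add: power_mult_distrib)
      also have "s * r = sqrt s" using s by (simp add: r_def real_div_sqrt)
      finally show ?thesis .
    qed
    thus "\<forall>\<^sub>F \<alpha> in filtercomap total_degree at_top.
        norm (padic_norm (f \<alpha>) * r ^ total_degree \<alpha>) \<le> A * sqrt s ^ total_degree \<alpha>"
      using r by (intro always_eventually) (simp add: padic_norm_nonneg)
  qed
  thus "f \<in> carrier (washnitzer n)" using f r by (auto simp: washnitzer_def supported_def)
qed

lemma in_washnitzerI:
  "supported n f \<Longrightarrow> 0 < s \<Longrightarrow> s < 1 \<Longrightarrow> coeff_bound f s A \<Longrightarrow> f \<in> carrier (washnitzer n)"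
  by (auto simp: in_washnitzer_iff)

lemma in_washnitzerE:
  assumes "f \<in> carrier (washnitzer n)"
  obtains A s where "supported n f" "0 < s" "s < 1" "coeff_bound f s A"
  using assms by (auto simp: in_washnitzer_iff)

section \<open>Evaluation of overconvergent series\<close>

lemma eval_has_sum:
  assumes "f \<in> carrier (washnitzer n)" "x \<in> padic_points n"
  shows "((\<lambda>\<alpha>. f \<alpha> * monom_val x \<alpha>) has_sum eval_series f x) UNIV"
proof -
  obtain A s where s: "supported n f" "0 < s" "s < 1" "coeff_bound f s A"
    using assms(1) by (rule in_washnitzerE)
  have "(\<lambda>\<alpha>. f \<alpha> * monom_val x \<alpha>) summable_on UNIV"
  proof (rule padic_summable)
    fix e :: real assume e: "e > 0"
    have "Poly_Mapping.keys \<alpha> \<subseteq> {..<n} \<and> e \<le> A * s ^ total_degree \<alpha>"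
      if "e \<le> padic_norm (f \<alpha> * monom_val x \<alpha>)" for \<alpha>
    proof
      show k: "Poly_Mapping.keys \<alpha> \<subseteq> {..<n}"
        using that e s(1) unfolding supported_def by (metis mult_zero_left not_le padic_norm_0)
      have "padic_norm (f \<alpha>) * padic_norm (monom_val x \<alpha>) \<le> padic_norm (f \<alpha>)"
        using mult_left_mono[OF monom_val_norm_le_1[OF assms(2) k], of "padic_norm (f \<alpha>)"]
        by (simp add: padic_norm_nonneg)
      thus "e \<le> A * s ^ total_degree \<alpha>"
        using that s(4) unfolding coeff_bound_def padic_norm_mult by (meson order_trans)
    qed
    thus "finite {\<alpha> \<in> UNIV. e \<le> padic_norm (f \<alpha> * monom_val x \<alpha>)}"
      by (intro finite_subset[OF _ finite_multi_index_geometric[of s e n A]]) (use s e in auto)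
  qed
  thus ?thesis unfolding eval_series_def by (rule has_sum_infsum)
qed

lemma eval_series_norm_le:
  assumes "f \<in> carrier (washnitzer n)" "x \<in> padic_points n" "\<And>\<alpha>. padic_norm (f \<alpha>) \<le> B"
  shows "padic_norm (eval_series f x) \<le> B"
proof (rule padic_has_sum_norm_le[OF eval_has_sum[OF assms(1,2)]])
  show B: "0 \<le> B" using assms(3)[of 0] padic_norm_nonneg[of "f 0"] by linarith
  fix \<alpha>
  show "padic_norm (f \<alpha> * monom_val x \<alpha>) \<le> B"
  proof (cases "Poly_Mapping.keys \<alpha> \<subseteq> {..<n}")
    case True
    thus ?thesis using mult_mono[OF assms(3)[of \<alpha>] monom_val_norm_le_1[OF assms(2) True]] B
      by (simp add: padic_norm_mult padic_norm_nonneg)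
  next
    case False
    hence "f \<alpha> = 0" using assms(1) by (auto simp: in_washnitzer_iff supported_def)
    thus ?thesis using B by simp
  qed
qed

lemma eval_in_padic_ints:
  "f \<in> carrier (washnitzer n) \<Longrightarrow> x \<in> padic_points n \<Longrightarrow> coeff_bound f 1 1 \<Longrightarrow> eval_series f x \<in> padic_ints"
  using eval_series_norm_le[of f n x 1] by (simp add: padic_ints_def coeff_bound_1)

lemma monom_val_cong: "(\<And>i. i \<in> Poly_Mapping.keys \<alpha> \<Longrightarrow> x i = y i) \<Longrightarrow> monom_val x \<alpha> = monom_val y \<alpha>"
  by (auto simp: monom_val_def intro: prod.cong)

lemma eval_series_cong:
  assumes "f \<in> carrier (washnitzer n)" "\<And>i. i < n \<Longrightarrow> x i = y i"
  shows "eval_series f x = eval_series f y"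
  unfolding eval_series_def
proof (rule infsum_cong)
  fix \<alpha>
  show "f \<alpha> * monom_val x \<alpha> = f \<alpha> * monom_val y \<alpha>"
  proof (cases "Poly_Mapping.keys \<alpha> \<subseteq> {..<n}")
    case True thus ?thesis using assms(2) by (auto intro!: monom_val_cong)
  next
    case False thus ?thesis using assms(1) by (auto simp: in_washnitzer_iff supported_def)
  qed
qed

section \<open>Sums, scalar multiples and products of series\<close>

lemma washnitzer_mult:
  "(f \<otimes>\<^bsub>washnitzer n\<^esub> g) \<gamma> = (\<Sum>(\<alpha>, \<beta>)\<in>{(\<alpha>, \<beta>). \<alpha> + \<beta> = \<gamma>}. f \<alpha> * g \<beta>)"
  by (simp add: washnitzer_def)

lemma washnitzer_add: "f \<oplus>\<^bsub>washnitzer n\<^esub> g = (\<lambda>\<alpha>. f \<alpha> + g \<alpha>)"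
  and washnitzer_smult: "c \<odot>\<^bsub>washnitzer n\<^esub> f = (\<lambda>\<alpha>. c * f \<alpha>)"
  and washnitzer_one: "\<one>\<^bsub>washnitzer n\<^esub> = (\<lambda>\<alpha>. if \<alpha> = 0 then 1 else 0)"
  by (simp_all add: washnitzer_def)

lemma supported_mult: "supported n f \<Longrightarrow> supported n g \<Longrightarrow> supported n (f \<otimes>\<^bsub>washnitzer m\<^esub> g)"
  unfolding supported_def washnitzer_mult
  by (intro allI impI sum.neutral) (auto simp: keys_add_multi_index Un_subset_iff simp del: subset_iff; blast)

lemma coeff_bound_mult:
  assumes "coeff_bound f s A" "coeff_bound g s B" "0 \<le> s"
  shows "coeff_bound (f \<otimes>\<^bsub>washnitzer m\<^esub> g) s (A * B)"
  unfolding coeff_bound_def washnitzer_mult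
proof (intro allI padic_norm_sum_le, clarify)
  note AB = coeff_bound_nonneg[OF assms(1)] coeff_bound_nonneg[OF assms(2)]
  fix \<gamma> show "0 \<le> A * B * s ^ total_degree \<gamma>" using assms(3) AB by simp
  fix \<alpha> \<beta> :: multi_index
  have "padic_norm (f \<alpha>) * padic_norm (g \<beta>) \<le> (A * s ^ total_degree \<alpha>) * (B * s ^ total_degree \<beta>)"
    using assms AB unfolding coeff_bound_def by (intro mult_mono) (auto simp: padic_norm_nonneg)
  thus "padic_norm (f \<alpha> * g \<beta>) \<le> A * B * s ^ total_degree (\<alpha> + \<beta>)"
    by (simp add: padic_norm_mult power_add mult_ac)
qed

lemma washnitzer_common_bound:
  assumes "f \<in> carrier (washnitzer n)" "g \<in> carrier (washnitzer n)"
  obtains s A where "0 < s" "s < 1" "coeff_bound f s A" "coeff_bound g s A"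
proof -
  obtain A s where s: "0 < s" "s < 1" "coeff_bound f s A" using assms(1) by (rule in_washnitzerE)
  obtain B t where t: "0 < t" "t < 1" "coeff_bound g t B" using assms(2) by (rule in_washnitzerE)
  show ?thesis
    by (rule that[of "max s t" "max A B"])
      (use s t in \<open>auto intro: coeff_bound_mono[OF s(3)] coeff_bound_mono[OF t(3)]\<close>)
qed

lemma washnitzer_mult_closed:
  assumes "f \<in> carrier (washnitzer n)" "g \<in> carrier (washnitzer n)"
  shows "f \<otimes>\<^bsub>washnitzer m\<^esub> g \<in> carrier (washnitzer n)"
proof -
  obtain s A where s: "0 < s" "s < 1" "coeff_bound f s A" "coeff_bound g s A"
    using assms by (rule washnitzer_common_bound)
  show ?thesis
    by (rule in_washnitzerI[OF supported_mult s(1,2) coeff_bound_mult])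
      (use s assms in \<open>auto simp: in_washnitzer_iff\<close>)
qed

lemma washnitzer_add_closed:
  assumes "f \<in> carrier (washnitzer n)" "g \<in> carrier (washnitzer n)"
  shows "(\<lambda>\<alpha>. f \<alpha> + g \<alpha>) \<in> carrier (washnitzer n)"
proof -
  obtain s A where s: "0 < s" "s < 1" "coeff_bound f s A" "coeff_bound g s A"
    using assms by (rule washnitzer_common_bound)
  show ?thesis
    by (rule in_washnitzerI[OF _ s(1,2), of _ _ A])
      (use s assms in \<open>auto simp: in_washnitzer_iff supported_def coeff_bound_def intro!: padic_norm_add_le\<close>)
qed

lemma washnitzer_smult_closed:
  assumes "f \<in> carrier (washnitzer n)"
  shows "(\<lambda>\<alpha>. c * f \<alpha>) \<in> carrier (washnitzer n)"
proof -
  obtain A s where s: "supported n f" "0 < s" "s < 1" "coeff_bound f s A" using assms by (rule in_washnitzerE)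
  show ?thesis
    by (rule in_washnitzerI[OF _ s(2,3), of _ _ "padic_norm c * A"])
      (use s in \<open>auto simp: supported_def coeff_bound_def padic_norm_mult mult.assoc intro!: mult_left_mono padic_norm_nonneg\<close>)
qed

lemma coeff_bound_single:
  assumes "f = (\<lambda>\<alpha>. if \<alpha> = \<beta> then c else 0)" "0 < s"
  shows "coeff_bound f s (padic_norm c / s ^ total_degree \<beta>)"
  unfolding coeff_bound_def assms(1) using assms(2) by (auto simp: padic_norm_nonneg)

lemma washnitzer_const_closed: "(\<lambda>\<alpha>. if \<alpha> = 0 then c else 0) \<in> carrier (washnitzer n)"
  by (rule in_washnitzerI[OF _ _ _ coeff_bound_single[OF refl], where s = "1/2"]) (auto simp: supported_def)

lemma washnitzer_one_closed: "\<one>\<^bsub>washnitzer m\<^esub> \<in> carrier (washnitzer n)"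
  unfolding washnitzer_one by (rule washnitzer_const_closed)

lemma washnitzer_var_closed: "i < n \<Longrightarrow> washnitzer_var i \<in> carrier (washnitzer n)"
  by (rule in_washnitzerI[OF _ _ _ coeff_bound_single[OF washnitzer_var_def], where s = "1/2"])
    (auto simp: supported_def washnitzer_var_def)

lemma eval_const: "eval_series (\<lambda>\<alpha>. if \<alpha> = 0 then c else 0) x = c"
  unfolding eval_series_def
  by (rule infsumI, rule has_sum_finite_neutralI[of "{0}"]) auto

lemma eval_one: "eval_series (\<one>\<^bsub>washnitzer n\<^esub>) x = 1"
  unfolding washnitzer_one by (rule eval_const)

lemma eval_var: "eval_series (washnitzer_var i) x = x i"
  unfolding eval_series_def washnitzer_var_def
  by (rule infsumI, rule has_sum_finite_neutralI[of "{Poly_Mapping.single i 1}"]) auto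

lemma eval_add:
  assumes "f \<in> carrier (washnitzer n)" "g \<in> carrier (washnitzer n)" "x \<in> padic_points n"
  shows "eval_series (\<lambda>\<alpha>. f \<alpha> + g \<alpha>) x = eval_series f x + eval_series g x"
  using has_sum_add[OF eval_has_sum[OF assms(1,3)] eval_has_sum[OF assms(2,3)]]
  unfolding eval_series_def[of "\<lambda>\<alpha>. f \<alpha> + g \<alpha>"]
  by (intro infsumI) (simp add: algebra_simps)

lemma eval_smult:
  assumes "f \<in> carrier (washnitzer n)" "x \<in> padic_points n"
  shows "eval_series (\<lambda>\<alpha>. c * f \<alpha>) x = c * eval_series f x"
  using has_sum_cmult_right[OF eval_has_sum[OF assms], of c]
  unfolding eval_series_def[of "\<lambda>\<alpha>. c * f \<alpha>"]
  by (intro infsumI) (simp add: algebra_simps)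

lemma decaying_imp_bounded:
  assumes "\<And>e. e > 0 \<Longrightarrow> finite {a. e \<le> w a}"
  shows "\<exists>B>0. \<forall>a. w a \<le> (B :: real)"
proof -
  let ?S = "insert 1 (w ` {a. 1 \<le> w a})"
  have fin: "finite ?S" using assms[of 1] by simp
  have "1 \<le> Max ?S" by (rule Max_ge[OF fin]) simp
  moreover have "w a \<le> Max ?S" for a
  proof (cases "1 \<le> w a")
    case True thus ?thesis by (intro Max_ge[OF fin]) simp
  qed (use \<open>1 \<le> Max ?S\<close> in simp)
  ultimately show ?thesis by (intro exI[of _ "Max ?S"]) simp
qed

text \<open>If u and v are bounded by B and C, a product of size at least e forces u a >= e / C and
  v b >= e / B, so the large terms lie in a finite rectangle.\<close>

lemma padic_summable_product:
  assumes "\<And>e. e > 0 \<Longrightarrow> finite {a. e \<le> u a}" "\<And>e. e > 0 \<Longrightarrow> finite {b. e \<le> v b}"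
    "\<And>a. 0 \<le> u a" "\<And>b. 0 \<le> v b" "\<And>a b. padic_norm (f (a, b)) \<le> u a * v b"
  shows "f summable_on UNIV"
proof (rule padic_summable)
  obtain B where B: "B > 0" "\<And>a. u a \<le> B" using decaying_imp_bounded[OF assms(1)] by blast
  obtain C where C: "C > 0" "\<And>a. v a \<le> C" using decaying_imp_bounded[OF assms(2)] by blast
  fix e :: real assume e: "e > 0"
  have "{ab \<in> UNIV. e \<le> padic_norm (f ab)} \<subseteq> {a. e / C \<le> u a} \<times> {b. e / B \<le> v b}"
  proof
    fix ab assume "ab \<in> {ab \<in> UNIV. e \<le> padic_norm (f ab)}"
    moreover obtain a b where ab: "ab = (a, b)" by fastforce
    ultimately have "e \<le> padic_norm (f (a, b))" by simp
    hence *: "e \<le> u a * v b" using assms(5)[of a b] by linarith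
    have "u a * v b \<le> u a * C" using C assms(3) by (intro mult_left_mono)
    moreover have "u a * v b \<le> B * v b" using B assms(4) by (intro mult_right_mono)
    ultimately show "ab \<in> {a. e / C \<le> u a} \<times> {b. e / B \<le> v b}"
      using * B C by (simp add: ab field_simps)
  qed
  thus "finite {ab \<in> UNIV. e \<le> padic_norm (f ab)}"
    by (rule finite_subset) (use assms(1)[of "e / C"] assms(2)[of "e / B"] e B C in auto)
qed

lemma coeff_decay:
  assumes "f \<in> carrier (washnitzer n)" "e > 0"
  shows "finite {\<alpha>. e \<le> padic_norm (f \<alpha>)}"
proof -
  obtain A s where s: "supported n f" "0 < s" "s < 1" "coeff_bound f s A" using assms(1) by (rule in_washnitzerE)
  have "Poly_Mapping.keys \<alpha> \<subseteq> {..<n} \<and> e \<le> A * s ^ total_degree \<alpha>" if "e \<le> padic_norm (f \<alpha>)" for \<alpha>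
  proof
    show "Poly_Mapping.keys \<alpha> \<subseteq> {..<n}"
      using that s(1) assms(2) unfolding supported_def by (metis not_le padic_norm_0)
    show "e \<le> A * s ^ total_degree \<alpha>" using that s(4) unfolding coeff_bound_def by (meson order_trans)
  qed
  thus ?thesis
    by (intro finite_subset[OF _ finite_multi_index_geometric[of s e n A]]) (use s assms in auto)
qed

text \<open>The double family of products of terms is summable; its sum is computed once row by row
  and once along the finite antidiagonals \<alpha> + \<beta> = \<gamma>.\<close>

lemma eval_mult:
  assumes f: "f \<in> carrier (washnitzer n)" and g: "g \<in> carrier (washnitzer n)" and x: "x \<in> padic_points n"
  shows "eval_series (f \<otimes>\<^bsub>washnitzer m\<^esub> g) x = eval_series f x * eval_series g x"
proof -
  define h where "h = (\<lambda>(\<alpha>, \<beta>). (f \<alpha> * monom_val x \<alpha>) * (g \<beta> * monom_val x \<beta>))"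
  have term_le: "padic_norm (k \<alpha> * monom_val x \<alpha>) \<le> padic_norm (k \<alpha>)"
    if "k \<in> carrier (washnitzer n)" for k \<alpha>
  proof (cases "Poly_Mapping.keys \<alpha> \<subseteq> {..<n}")
    case True
    thus ?thesis using mult_left_mono[OF monom_val_norm_le_1[OF x True], of "padic_norm (k \<alpha>)"]
      by (simp add: padic_norm_mult padic_norm_nonneg)
  next
    case False thus ?thesis using that by (auto simp: in_washnitzer_iff supported_def)
  qed
  have "h summable_on UNIV"
    by (rule padic_summable_product[of "\<lambda>\<alpha>. padic_norm (f \<alpha>)" "\<lambda>\<alpha>. padic_norm (g \<alpha>)"])
      (use coeff_decay f g in \<open>auto simp: h_def padic_norm_mult[of "_ * _" "_ * _"] padic_norm_nonneg intro!: mult_mono term_le\<close>)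
  then obtain S where S: "(h has_sum S) UNIV" by (auto simp: summable_on_def)
  have "((\<lambda>\<alpha>. (f \<alpha> * monom_val x \<alpha>) * eval_series g x) has_sum S) UNIV"
  proof (rule has_sum_SigmaD[where B = "\<lambda>_. UNIV"])
    show "(h has_sum S) (UNIV \<times> UNIV)" using S by simp
    show "((\<lambda>y. h (\<alpha>, y)) has_sum (f \<alpha> * monom_val x \<alpha>) * eval_series g x) UNIV" for \<alpha>
      unfolding h_def using has_sum_cmult_right[OF eval_has_sum[OF g x]] by simp
  qed
  moreover have "((\<lambda>\<alpha>. (f \<alpha> * monom_val x \<alpha>) * eval_series g x) has_sum eval_series f x * eval_series g x) UNIV"
    by (rule has_sum_cmult_left[OF eval_has_sum[OF f x]])
  ultimately have S2: "S = eval_series f x * eval_series g x" by (rule has_sum_unique)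
  have "((\<lambda>\<gamma>. (f \<otimes>\<^bsub>washnitzer m\<^esub> g) \<gamma> * monom_val x \<gamma>) has_sum S) UNIV"
  proof (rule has_sum_SigmaD[where B = "\<lambda>\<gamma>. {(\<alpha>, \<beta>). \<alpha> + \<beta> = \<gamma>}" and f = "\<lambda>(\<gamma>, ab). h ab"])
    have "bij_betw snd (SIGMA \<gamma>:UNIV. {(\<alpha>, \<beta>). \<alpha> + \<beta> = \<gamma>}) (UNIV :: (multi_index \<times> multi_index) set)"
      by (rule bij_betwI[of _ _ _ "\<lambda>(\<alpha>, \<beta>). (\<alpha> + \<beta>, (\<alpha>, \<beta>))"]) auto
    from has_sum_reindex_bij_betw[OF this, of h S] S
    show "((\<lambda>(\<gamma>, ab). h ab) has_sum S) (SIGMA \<gamma>:UNIV. {(\<alpha>, \<beta>). \<alpha> + \<beta> = \<gamma>})"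
      by (simp add: case_prod_unfold)
    fix \<gamma> :: multi_index
    show "((\<lambda>y. case (\<gamma>, y) of (\<gamma>, ab) \<Rightarrow> h ab) has_sum (f \<otimes>\<^bsub>washnitzer m\<^esub> g) \<gamma> * monom_val x \<gamma>)
        {(\<alpha>, \<beta>). \<alpha> + \<beta> = \<gamma>}"
    proof (rule has_sum_finiteI[OF finite_multi_index_sums])
      show "(f \<otimes>\<^bsub>washnitzer m\<^esub> g) \<gamma> * monom_val x \<gamma> =
          (\<Sum>y\<in>{(\<alpha>, \<beta>). \<alpha> + \<beta> = \<gamma>}. case (\<gamma>, y) of (\<gamma>, ab) \<Rightarrow> h ab)"
        unfolding washnitzer_mult sum_distrib_right
        by (rule sum.cong) (auto simp: h_def monom_val_add mult_ac)
    qed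
  qed
  thus ?thesis unfolding eval_series_def[of "f \<otimes>\<^bsub>washnitzer m\<^esub> g"] S2 by (rule infsumI)
qed

section \<open>Families of series, composition and the identity theorem\<close>

text \<open>The coefficients of the sum are taken termwise. A rate s common to all members makes the
  double family in k and \<beta> summable, so evaluation may be interchanged with the sum.
  Substitution and Mahler series both arise this way.\<close>

lemma family_sum:
  fixes H :: "'k \<Rightarrow> 'p::prime_card padic_series" and \<epsilon> :: "'k \<Rightarrow> real"
  assumes supp: "\<And>k. supported n (H k)" and bound: "\<And>k. coeff_bound (H k) s (\<epsilon> k)"
    and s: "0 < s" "s < 1" and decay: "\<And>e. e > 0 \<Longrightarrow> finite {k. e \<le> \<epsilon> k}"
  obtains S where "S \<in> carrier (washnitzer n)"
    "\<And>x. x \<in> padic_points n \<Longrightarrow> ((\<lambda>k. eval_series (H k) x) has_sum eval_series S x) UNIV"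
    "\<And>B. (\<And>k. coeff_bound (H k) 1 B) \<Longrightarrow> coeff_bound S 1 B"
proof
  define S where "S \<beta> = (\<Sum>\<^sub>\<infinity>k. H k \<beta>)" for \<beta>
  have e0: "0 \<le> \<epsilon> k" for k using coeff_bound_nonneg[OF bound] .
  have sp: "s ^ j \<le> 1" for j using s by (intro power_le_one) auto
  have Hle: "padic_norm (H k \<beta>) \<le> \<epsilon> k" for k \<beta>
  proof -
    have "\<epsilon> k * s ^ total_degree \<beta> \<le> \<epsilon> k * 1" using e0 sp by (intro mult_left_mono)
    thus ?thesis using bound[of k] unfolding coeff_bound_def by (metis mult.right_neutral order_trans)
  qed
  have Ssum: "((\<lambda>k. H k \<beta>) has_sum S \<beta>) UNIV" for \<beta>
  proof -
    have "(\<lambda>k. H k \<beta>) summable_on UNIV"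
    proof (rule padic_summable)
      fix e :: real assume "e > 0"
      thus "finite {k \<in> UNIV. e \<le> padic_norm (H k \<beta>)}"
        by (intro finite_subset[OF _ decay[of e]]) (use Hle in \<open>auto intro: order_trans\<close>)
    qed
    thus ?thesis unfolding S_def by (rule has_sum_infsum)
  qed
  obtain E where E: "E > 0" "\<And>k. \<epsilon> k \<le> E" using decaying_imp_bounded[OF decay] by blast
  have Ssupp: "supported n S"
    unfolding supported_def
  proof (intro allI impI)
    fix \<alpha> :: multi_index assume "\<not> Poly_Mapping.keys \<alpha> \<subseteq> {..<n}"
    hence "H k \<alpha> = 0" for k using supp unfolding supported_def by blast
    thus "S \<alpha> = 0" by (simp add: S_def)
  qed
  have Sb: "coeff_bound S s E"
    unfolding coeff_bound_def
  proof
    fix \<beta>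
    show "padic_norm (S \<beta>) \<le> E * s ^ total_degree \<beta>"
    proof (rule padic_has_sum_norm_le[OF Ssum])
      fix k
      have "\<epsilon> k * s ^ total_degree \<beta> \<le> E * s ^ total_degree \<beta>" using E s by (intro mult_right_mono) auto
      thus "padic_norm (H k \<beta>) \<le> E * s ^ total_degree \<beta>"
        using bound[of k] unfolding coeff_bound_def by (meson order_trans)
    qed (use E s in simp)
  qed
  show SW: "S \<in> carrier (washnitzer n)" by (rule in_washnitzerI[OF Ssupp s Sb])
  show "coeff_bound S 1 B" if "\<And>k. coeff_bound (H k) 1 B" for B
    unfolding coeff_bound_1
    using padic_has_sum_norm_le[OF Ssum] that coeff_bound_nonneg[OF that] by (auto simp: coeff_bound_1)
  fix x :: "nat \<Rightarrow> 'p padic" assume x: "x \<in> padic_points n"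
  \<comment> \<open>The decay in \<beta> alone. It is 0 off the first n variables, since otherwise
    infinitely many multi-indices share a positive degree.\<close>
  define v where "v \<beta> = (if Poly_Mapping.keys \<beta> \<subseteq> {..<n} then s ^ total_degree \<beta> else 0)" for \<beta> :: multi_index
  define h where "h = (\<lambda>(k, \<beta>). H k \<beta> * monom_val x \<beta>)"
  have HW: "H k \<in> carrier (washnitzer n)" for k by (rule in_washnitzerI[OF supp s bound])
  have "h summable_on UNIV"
  proof (rule padic_summable_product[of \<epsilon> v])
    fix e :: real assume e: "e > 0"
    have "{\<beta>. e \<le> v \<beta>} \<subseteq> {\<beta>. Poly_Mapping.keys \<beta> \<subseteq> {..<n} \<and> e \<le> 1 * s ^ total_degree \<beta>}"
      using e by (auto simp: v_def split: if_splits)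
    thus "finite {\<beta>. e \<le> v \<beta>}"
      by (rule finite_subset) (use s e in \<open>intro finite_multi_index_geometric, auto\<close>)
  next
    fix k \<beta>
    show "padic_norm (h (k, \<beta>)) \<le> \<epsilon> k * v \<beta>"
    proof (cases "Poly_Mapping.keys \<beta> \<subseteq> {..<n}")
      case True
      have "padic_norm (H k \<beta>) * padic_norm (monom_val x \<beta>) \<le> (\<epsilon> k * s ^ total_degree \<beta>) * 1"
        using bound[of k] monom_val_norm_le_1[OF x True] e0 s unfolding coeff_bound_def
        by (intro mult_mono) (auto simp: padic_norm_nonneg)
      thus ?thesis using True by (simp add: h_def v_def padic_norm_mult)
    next
      case False
      hence "H k \<beta> = 0" using supp unfolding supported_def by blast
      thus ?thesis using False by (simp add: h_def v_def)
    qed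
  qed (use decay e0 s in \<open>auto simp: v_def\<close>)
  then obtain T where T: "(h has_sum T) (UNIV \<times> UNIV)" by (auto simp: summable_on_def)
  have 1: "((\<lambda>k. eval_series (H k) x) has_sum T) UNIV"
    by (rule has_sum_SigmaD[OF T]) (use eval_has_sum[OF HW x] in \<open>simp add: h_def\<close>)
  have "((\<lambda>\<beta>. S \<beta> * monom_val x \<beta>) has_sum T) UNIV"
  proof (rule has_sum_SigmaD)
    show "((\<lambda>(\<beta>, k). h (k, \<beta>)) has_sum T) (UNIV \<times> UNIV)" using T by (rule has_sum_swap[THEN iffD1])
    show "((\<lambda>k. case (\<beta>, k) of (\<beta>, k) \<Rightarrow> h (k, \<beta>)) has_sum S \<beta> * monom_val x \<beta>) UNIV" for \<beta>
      using has_sum_cmult_left[OF Ssum] by (simp add: h_def)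
  qed
  hence "T = eval_series S x" using eval_has_sum[OF SW x] has_sum_unique by blast
  thus "((\<lambda>k. eval_series (H k) x) has_sum eval_series S x) UNIV" using 1 by simp
qed

section \<open>Substitution of integral series\<close>

lemma coeff_bound_one: "0 < s \<Longrightarrow> coeff_bound (\<one>\<^bsub>washnitzer n\<^esub>) s 1"
  using coeff_bound_single[OF washnitzer_one, of s] by simp

text \<open>At a fixed rate s the bounds are multiplicative, so a monomial of degree n costs
  \<rho>^n.\<close>

lemma monom_series:
  assumes F: "\<And>i. i < n \<Longrightarrow> F i \<in> carrier (washnitzer m)" "\<And>i. i < n \<Longrightarrow> coeff_bound (F i) s \<rho>"
    and s: "0 < s"
  shows "Poly_Mapping.keys \<alpha> \<subseteq> {..<n} \<Longrightarrow> \<exists>P\<in>carrier (washnitzer m). coeff_bound P s (\<rho> ^ total_degree \<alpha>) \<and>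
    (\<forall>x\<in>padic_points m. eval_series P x = monom_val (\<lambda>i. eval_series (F i) x) \<alpha>)"
proof (induction \<alpha> rule: multi_index_induct)
  case zero
  show ?case
    by (rule bexI[of _ "\<one>\<^bsub>washnitzer m\<^esub>"]) (use s in \<open>auto simp: eval_one coeff_bound_one washnitzer_one_closed\<close>)
next
  case (add \<alpha> i)
  hence i: "i < n" and k: "Poly_Mapping.keys \<alpha> \<subseteq> {..<n}" by (auto simp: keys_add_multi_index)
  obtain P where P: "P \<in> carrier (washnitzer m)" "coeff_bound P s (\<rho> ^ total_degree \<alpha>)"
    "\<And>x. x \<in> padic_points m \<Longrightarrow> eval_series P x = monom_val (\<lambda>i. eval_series (F i) x) \<alpha>"
    using add.IH[OF k] by blast
  show ?case
  proof (intro bexI[of _ "P \<otimes>\<^bsub>washnitzer m\<^esub> F i"] conjI ballI)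
    show "coeff_bound (P \<otimes>\<^bsub>washnitzer m\<^esub> F i) s (\<rho> ^ total_degree (\<alpha> + Poly_Mapping.single i 1))"
      using coeff_bound_mult[OF P(2) F(2)[OF i]] s by (simp add: mult.commute)
    show "P \<otimes>\<^bsub>washnitzer m\<^esub> F i \<in> carrier (washnitzer m)"
      by (rule washnitzer_mult_closed[OF P(1) F(1)[OF i]])
  qed (simp add: eval_mult[OF P(1) F(1)[OF i]] P(3) monom_val_add)
qed

text \<open>For a coefficient y in degree n, |y| <= 1 gives |y|^k <= |y| <= A s^n; once A <=
  \<rho>^k, a k-th root yields \<rho> (s^(1/k))^n. So an integral overconvergent series stays
  bounded by any prescribed \<rho> > 1 on a slightly larger polydisc.\<close>

lemma coeff_bound_interpolate:
  assumes "coeff_bound f s A" "0 < s" "s < 1" "coeff_bound f 1 1" "1 < \<rho>"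
  obtains t where "0 < t" "t < 1" "coeff_bound f t \<rho>"
proof -
  obtain k where k: "max A 1 < \<rho> ^ k" using real_arch_pow[OF assms(5)] by blast
  have k0: "k > 0" using k by (cases k) auto
  define t where "t = root k s"
  have t: "0 < t" "t < 1" "t ^ k = s" unfolding t_def using assms k0 by (auto simp: real_root_lt_1_iff)
  have "coeff_bound f t \<rho>"
    unfolding coeff_bound_def
  proof
    fix \<alpha>
    let ?y = "padic_norm (f \<alpha>)"
    have "?y ^ k \<le> ?y ^ 1"
      using assms(4) k0 padic_norm_nonneg[of "f \<alpha>"] by (intro power_decreasing) (auto simp: coeff_bound_1)
    also have "\<dots> \<le> A * s ^ total_degree \<alpha>" using assms(1) by (simp add: coeff_bound_def)
    also have "\<dots> \<le> \<rho> ^ k * s ^ total_degree \<alpha>" using k assms by (intro mult_right_mono) auto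
    also have "\<dots> = (\<rho> * t ^ total_degree \<alpha>) ^ k"
      unfolding t(3)[symmetric] by (simp add: power_mult_distrib mult.commute flip: power_mult)
    finally have "?y ^ Suc (k - 1) \<le> (\<rho> * t ^ total_degree \<alpha>) ^ Suc (k - 1)" using k0 by simp
    thus "?y \<le> \<rho> * t ^ total_degree \<alpha>"
      by (rule power_le_imp_le_base) (use t assms in auto)
  qed
  thus ?thesis using that t by blast
qed

text \<open>A monomial of degree n in the F i may grow like \<rho>^n, which the decay t^n of f
  absorbs when t \<rho> < 1. Integrality of the F i makes such a \<rho> > 1 available.\<close>

lemma compose_series:
  assumes f: "f \<in> carrier (washnitzer n)"
    and F: "\<And>i. i < n \<Longrightarrow> F i \<in> carrier (washnitzer m)" "\<And>i. i < n \<Longrightarrow> coeff_bound (F i) 1 1"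
  shows "\<exists>h\<in>carrier (washnitzer m). \<forall>x\<in>padic_points m. eval_series h x = eval_series f (\<lambda>i. eval_series (F i) x)"
proof -
  obtain B t where t: "supported n f" "0 < t" "t < 1" "coeff_bound f t B" using f by (rule in_washnitzerE)
  \<comment> \<open>Leaves t \<rho> = sqrt t as the rate of the composed family.\<close>
  define \<rho> where "\<rho> = 1 / sqrt t"
  have \<rho>: "\<rho> > 1" "t * \<rho> = sqrt t" "0 < sqrt t" "sqrt t < 1"
    using t by (auto simp: \<rho>_def real_div_sqrt)
  have "\<exists>s. 0 < s \<and> s < 1 \<and> coeff_bound (F i) s \<rho>" if "i < n" for i
    using F(1)[OF that, unfolded in_washnitzer_iff] coeff_bound_interpolate[OF _ _ _ F(2)[OF that] \<rho>(1)] by metis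
  then obtain \<sigma> where \<sigma>: "\<And>i. i < n \<Longrightarrow> 0 < \<sigma> i \<and> \<sigma> i < 1 \<and> coeff_bound (F i) (\<sigma> i) \<rho>" by metis
  \<comment> \<open>Inserting 1/2 keeps the set nonempty when n = 0.\<close>
  define s where "s = Max (insert (1/2) (\<sigma> ` {..<n}))"
  have s: "0 < s" "s < 1" unfolding s_def using \<sigma> by (subst Max_gr_iff Max_less_iff; auto)+
  have Fs: "coeff_bound (F i) s \<rho>" if "i < n" for i
  proof (rule coeff_bound_mono)
    show "coeff_bound (F i) (\<sigma> i) \<rho>" "0 \<le> \<sigma> i" using \<sigma>[OF that] by auto
    show "\<sigma> i \<le> s" unfolding s_def using that by (intro Max_ge) auto
  qed simp
  have "\<exists>P. Poly_Mapping.keys \<alpha> \<subseteq> {..<n} \<longrightarrow> P \<in> carrier (washnitzer m) \<and> coeff_bound P s (\<rho> ^ total_degree \<alpha>) \<and>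
    (\<forall>x\<in>padic_points m. eval_series P x = monom_val (\<lambda>i. eval_series (F i) x) \<alpha>)" for \<alpha>
    using monom_series[of n F m s \<rho> \<alpha>, OF F(1) Fs s(1)] by blast
  then obtain P where P: "\<And>\<alpha>. Poly_Mapping.keys \<alpha> \<subseteq> {..<n} \<Longrightarrow> P \<alpha> \<in> carrier (washnitzer m)"
    "\<And>\<alpha>. Poly_Mapping.keys \<alpha> \<subseteq> {..<n} \<Longrightarrow> coeff_bound (P \<alpha>) s (\<rho> ^ total_degree \<alpha>)"
    "\<And>\<alpha> x. Poly_Mapping.keys \<alpha> \<subseteq> {..<n} \<Longrightarrow> x \<in> padic_points m \<Longrightarrow>
      eval_series (P \<alpha>) x = monom_val (\<lambda>i. eval_series (F i) x) \<alpha>"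
    by metis
  define H where "H \<alpha> = (if Poly_Mapping.keys \<alpha> \<subseteq> {..<n} then (\<lambda>\<beta>. f \<alpha> * P \<alpha> \<beta>) else (\<lambda>_. 0))" for \<alpha>
  define \<epsilon> where "\<epsilon> \<alpha> = (if Poly_Mapping.keys \<alpha> \<subseteq> {..<n} then B * sqrt t ^ total_degree \<alpha> else 0)" for \<alpha> :: multi_index
  have B0: "0 \<le> B" using coeff_bound_nonneg[OF t(4)] .
  obtain S where S: "S \<in> carrier (washnitzer m)"
    "\<And>x. x \<in> padic_points m \<Longrightarrow> ((\<lambda>k. eval_series (H k) x) has_sum eval_series S x) UNIV"
  proof (rule family_sum[of m H s \<epsilon>])
    show "supported m (H \<alpha>)" for \<alpha> using P(1)[of \<alpha>] by (auto simp: H_def supported_def in_washnitzer_iff)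
    show "coeff_bound (H \<alpha>) s (\<epsilon> \<alpha>)" for \<alpha>
    proof (cases "Poly_Mapping.keys \<alpha> \<subseteq> {..<n}")
      case True
      have "padic_norm (f \<alpha>) * padic_norm (P \<alpha> \<beta>) \<le> (B * t ^ total_degree \<alpha>) * (\<rho> ^ total_degree \<alpha> * s ^ total_degree \<beta>)" for \<beta>
        using t(4) P(2)[OF True] B0 t(2) unfolding coeff_bound_def
        by (intro mult_mono) (auto simp: padic_norm_nonneg)
      also have "(B * t ^ total_degree \<alpha>) * (\<rho> ^ total_degree \<alpha> * s ^ total_degree \<beta>) =
          \<epsilon> \<alpha> * s ^ total_degree \<beta>" for \<beta>
        using True by (simp add: \<epsilon>_def power_mult_distrib flip: \<rho>(2))
      finally show ?thesis using True by (simp add: coeff_bound_def H_def padic_norm_mult)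
    qed (simp add: H_def \<epsilon>_def coeff_bound_def)
    fix e :: real assume e: "e > 0"
    have "{\<alpha>. e \<le> \<epsilon> \<alpha>} \<subseteq> {\<alpha>. Poly_Mapping.keys \<alpha> \<subseteq> {..<n} \<and> e \<le> B * sqrt t ^ total_degree \<alpha>}"
      using e by (auto simp: \<epsilon>_def split: if_splits)
    thus "finite {\<alpha>. e \<le> \<epsilon> \<alpha>}"
      by (rule finite_subset) (use \<rho> e in \<open>intro finite_multi_index_geometric, auto\<close>)
  qed (use s in auto)
  have "eval_series S x = eval_series f (\<lambda>i. eval_series (F i) x)" if x: "x \<in> padic_points m" for x
  proof (rule has_sum_unique[OF S(2)[OF x]])
    have y: "(\<lambda>i. eval_series (F i) x) \<in> padic_points n"
      using eval_in_padic_ints[OF F(1) x F(2)] by (simp add: padic_points_def)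
    have "eval_series (H \<alpha>) x = f \<alpha> * monom_val (\<lambda>i. eval_series (F i) x) \<alpha>" for \<alpha>
    proof (cases "Poly_Mapping.keys \<alpha> \<subseteq> {..<n}")
      case True
      thus ?thesis using P x by (simp add: H_def eval_smult[OF P(1) x])
    next
      case False
      hence "f \<alpha> = 0" using t(1) unfolding supported_def by blast
      thus ?thesis using False by (simp add: H_def eval_series_def)
    qed
    thus "((\<lambda>k. eval_series (H k) x) has_sum eval_series f (\<lambda>i. eval_series (F i) x)) UNIV"
      using eval_has_sum[OF f y] by simp
  qed
  thus ?thesis using S(1) by blast
qed

text \<open>At y = p^j the lowest nonzero term c_l y^l must be cancelled by terms of order at least
  l + 1, so |c_l| <= A |y|, and j is arbitrary.\<close>

lemma one_variable_identity:
  fixes c :: "nat \<Rightarrow> 'p::prime_card padic"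
  assumes A: "\<And>k. padic_norm (c k) \<le> A" and z: "\<And>y. y \<in> padic_ints \<Longrightarrow> ((\<lambda>k. c k * y ^ k) has_sum 0) UNIV"
  shows "c k = 0"
proof (rule ccontr)
  assume "c k \<noteq> 0"
  define l where "l = (LEAST k. c k \<noteq> 0)"
  have l: "c l \<noteq> 0" unfolding l_def using \<open>c k \<noteq> 0\<close> by (rule LeastI)
  have less: "c j = 0" if "j < l" for j using not_less_Least[of j "\<lambda>k. c k \<noteq> 0"] that unfolding l_def by blast
  have A0: "0 \<le> A" using A[of 0] padic_norm_nonneg[of "c 0"] by linarith
  have "padic_norm (c l) \<le> A * (1 / real CARD('p) ^ j)" for j
  proof -
    define y where "y = (of_nat (CARD('p) ^ j) :: 'p padic)"
    have ny: "padic_norm y = 1 / real CARD('p) ^ j"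
      by (simp add: y_def padic_norm_power padic_norm_p power_one_over)
    have y0: "0 < padic_norm y" "padic_norm y \<le> 1" unfolding ny using real_card_prime_gt_1[where 'p = 'p] by auto
    have yz: "y \<in> padic_ints" unfolding y_def by (rule padic_ints_of_nat)
    have s1: "((\<lambda>k. if k = l then c l * y ^ l else 0) has_sum c l * y ^ l) UNIV"
      by (rule has_sum_finite_neutralI[of "{l}"]) auto
    have "((\<lambda>k. c k * y ^ k + - (if k = l then c l * y ^ l else 0)) has_sum 0 + - (c l * y ^ l)) UNIV"
      by (rule has_sum_add[OF z[OF yz]], subst has_sum_uminus) (use s1 in simp)
    hence "padic_norm (0 + - (c l * y ^ l)) \<le> A * padic_norm y ^ Suc l"
    proof (rule padic_has_sum_norm_le)
      fix k
      show "padic_norm (c k * y ^ k + - (if k = l then c l * y ^ l else 0)) \<le> A * padic_norm y ^ Suc l"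
      proof (cases "k > l")
        case True
        have "padic_norm (c k) * padic_norm y ^ k \<le> A * padic_norm y ^ Suc l"
          using True A A0 y0 by (intro mult_mono power_decreasing) auto
        thus ?thesis using True by (simp add: padic_norm_mult padic_norm_power)
      next
        case False
        hence "k = l \<or> k < l" by auto
        thus ?thesis using less A0 y0 by auto
      qed
    qed (use A0 y0 in simp)
    hence "padic_norm (c l) * padic_norm y ^ l \<le> (A * padic_norm y) * padic_norm y ^ l"
      by (simp add: padic_norm_minus padic_norm_mult padic_norm_power mult_ac)
    hence "padic_norm (c l) \<le> A * padic_norm y"
      by (rule mult_right_le_imp_le) (use y0 in simp)
    thus ?thesis unfolding ny .
  qed
  hence "padic_norm (c l) \<le> 0"
    by (intro LIMSEQ_le_const[OF tendsto_mult_right_zero[OF prime_powers_tendsto_0[where 'p = 'p]]]) auto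
  thus False using l padic_norm_nonneg[of "c l"] padic_norm_eq_0_iff[of "c l"] by simp
qed

lemma multi_index_last_variable:
  "bij_betw (\<lambda>(k, \<alpha>). \<alpha> + Poly_Mapping.single n k)
    (UNIV \<times> {\<alpha>. Poly_Mapping.keys \<alpha> \<subseteq> {..<n}}) {\<alpha> :: multi_index. Poly_Mapping.keys \<alpha> \<subseteq> {..<Suc n}}"
proof (rule bij_betwI[of _ _ _ "\<lambda>\<alpha>. (Poly_Mapping.lookup \<alpha> n, \<alpha> - Poly_Mapping.single n (Poly_Mapping.lookup \<alpha> n))"], goal_cases)
  case 1
  show ?case by (auto simp: keys_add_multi_index less_Suc_eq split: if_splits)
next
  case 2
  show ?case
  proof (intro funcsetI, clarsimp)
    fix \<alpha> :: multi_index and i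
    assume "Poly_Mapping.keys \<alpha> \<subseteq> {..<Suc n}"
      and "i \<in> Poly_Mapping.keys (\<alpha> - Poly_Mapping.single n (Poly_Mapping.lookup \<alpha> n))"
    hence "i \<in> Poly_Mapping.keys \<alpha>" "i \<noteq> n"
      by (auto simp: in_keys_iff lookup_minus lookup_single when_def split: if_splits)
    thus "i < n" using \<open>Poly_Mapping.keys \<alpha> \<subseteq> {..<Suc n}\<close> by (force simp: less_Suc_eq)
  qed
next
  case (3 x)
  then obtain k \<alpha> where x: "x = (k, \<alpha>)" "Poly_Mapping.keys \<alpha> \<subseteq> {..<n}" by auto
  hence "Poly_Mapping.lookup \<alpha> n = 0" by (meson in_keys_iff lessThan_iff less_irrefl subsetD)
  thus ?case by (simp add: x lookup_add)
next
  case (4 \<alpha>)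
  show ?case
    by (simp, rule poly_mapping_eqI) (simp add: lookup_add lookup_minus lookup_single when_def)
qed

text \<open>Induction on the number of variables. Grouping by the exponent k of the last variable
  turns f, at a fixed point x of the first n, into a one-variable series with coefficients
  \<open>eval_series (g k) x\<close>; these vanish for all x, so each g k is 0.\<close>

lemma series_eq_0:
  "f \<in> carrier (washnitzer n) \<Longrightarrow> (\<And>x. x \<in> padic_points n \<Longrightarrow> eval_series f x = 0) \<Longrightarrow> f = (\<lambda>_. 0)"
proof (induction n arbitrary: f)
  case 0
  have supp: "f \<alpha> = 0" if "\<alpha> \<noteq> 0" for \<alpha>
    using 0(1) that by (auto simp: in_washnitzer_iff supported_def)
  have "((\<lambda>\<alpha>. f \<alpha> * monom_val (\<lambda>_. 0) \<alpha>) has_sum f 0) UNIV"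
    by (rule has_sum_finite_neutralI[of "{0}"]) (use supp in auto)
  hence "f 0 = 0" using 0(2)[of "\<lambda>_. 0"] by (simp add: eval_series_def infsumI padic_points_def)
  thus ?case using supp by (intro ext) metis
next
  case (Suc n)
  obtain A s where s: "supported (Suc n) f" "0 < s" "s < 1" "coeff_bound f s A"
    using Suc.prems(1) by (rule in_washnitzerE)
  have A0: "0 \<le> A" using coeff_bound_nonneg[OF s(4)] .
  define g where "g k \<alpha> = (if Poly_Mapping.keys \<alpha> \<subseteq> {..<n} then f (\<alpha> + Poly_Mapping.single n k) else 0)" for k \<alpha>
  have gb: "coeff_bound (g k) s A" for k
    unfolding coeff_bound_def
  proof
    fix \<alpha>
    have "A * s ^ (total_degree \<alpha> + k) \<le> A * s ^ total_degree \<alpha>"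
      using s A0 by (intro mult_left_mono power_decreasing) auto
    moreover have "padic_norm (f (\<alpha> + Poly_Mapping.single n k)) \<le> A * s ^ (total_degree \<alpha> + k)"
      using s(4)[unfolded coeff_bound_def, rule_format, of "\<alpha> + Poly_Mapping.single n k"] by simp
    ultimately show "padic_norm (g k \<alpha>) \<le> A * s ^ total_degree \<alpha>" using A0 s by (auto simp: g_def)
  qed
  have gW: "g k \<in> carrier (washnitzer n)" for k
    by (rule in_washnitzerI[OF _ s(2,3) gb]) (auto simp: supported_def g_def)
  have "g k = (\<lambda>_. 0)" for k
  proof (rule Suc.IH[OF gW])
    fix x :: "nat \<Rightarrow> 'a padic" assume x: "x \<in> padic_points n"
    show "eval_series (g k) x = 0"
    proof (rule one_variable_identity)
      show "padic_norm (eval_series (g k) x) \<le> A" for k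
        by (rule eval_series_norm_le[OF gW x])
          (use coeff_bound_mono[OF gb, of 1 A k] s in \<open>auto simp: coeff_bound_1\<close>)
      fix y :: "'a padic" assume y: "y \<in> padic_ints"
      define z where "z = x(n := y)"
      have z: "z \<in> padic_points (Suc n)" using x y by (auto simp: z_def padic_points_def less_Suc_eq)
      have "((\<lambda>\<alpha>. f \<alpha> * monom_val z \<alpha>) has_sum 0) UNIV"
        using eval_has_sum[OF Suc.prems(1) z] Suc.prems(2)[OF z] by simp
      also have "?this \<longleftrightarrow> ((\<lambda>\<alpha>. f \<alpha> * monom_val z \<alpha>) has_sum 0) {\<alpha>. Poly_Mapping.keys \<alpha> \<subseteq> {..<Suc n}}"
        by (rule has_sum_cong_neutral) (use s(1) in \<open>auto simp: supported_def\<close>)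
      also have "\<dots> \<longleftrightarrow> ((\<lambda>(k, \<alpha>). f (\<alpha> + Poly_Mapping.single n k) * monom_val z (\<alpha> + Poly_Mapping.single n k)) has_sum 0)
          (UNIV \<times> {\<alpha>. Poly_Mapping.keys \<alpha> \<subseteq> {..<n}})"
        by (subst has_sum_reindex_bij_betw[OF multi_index_last_variable, symmetric]) (simp add: case_prod_unfold)
      finally have *: "((\<lambda>(k, \<alpha>). f (\<alpha> + Poly_Mapping.single n k) * monom_val z (\<alpha> + Poly_Mapping.single n k)) has_sum 0)
          (UNIV \<times> {\<alpha>. Poly_Mapping.keys \<alpha> \<subseteq> {..<n}})" .
      show "((\<lambda>k. eval_series (g k) x * y ^ k) has_sum 0) UNIV"
      proof (rule has_sum_SigmaD[OF *])
        fix k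
        have "((\<lambda>\<alpha>. g k \<alpha> * monom_val x \<alpha> * y ^ k) has_sum eval_series (g k) x * y ^ k) UNIV"
          by (rule has_sum_cmult_left[OF eval_has_sum[OF gW x]])
        also have "?this \<longleftrightarrow> ((\<lambda>\<alpha>. f (\<alpha> + Poly_Mapping.single n k) * monom_val z (\<alpha> + Poly_Mapping.single n k)) has_sum
            eval_series (g k) x * y ^ k) {\<alpha>. Poly_Mapping.keys \<alpha> \<subseteq> {..<n}}"
        proof (rule has_sum_cong_neutral)
          fix \<alpha> :: multi_index assume "\<alpha> \<in> UNIV \<inter> {\<alpha>. Poly_Mapping.keys \<alpha> \<subseteq> {..<n}}"
          hence \<alpha>: "Poly_Mapping.keys \<alpha> \<subseteq> {..<n}" by simp
          hence "monom_val z \<alpha> = monom_val x \<alpha>" by (intro monom_val_cong) (auto simp: z_def)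
          thus "g k \<alpha> * monom_val x \<alpha> * y ^ k = f (\<alpha> + Poly_Mapping.single n k) * monom_val z (\<alpha> + Poly_Mapping.single n k)"
            using \<alpha> by (simp add: g_def monom_val_add z_def)
        qed (auto simp: g_def)
        finally show "((\<lambda>\<alpha>. case (k, \<alpha>) of (k, \<alpha>) \<Rightarrow> f (\<alpha> + Poly_Mapping.single n k) * monom_val z (\<alpha> + Poly_Mapping.single n k)) has_sum
            eval_series (g k) x * y ^ k) {\<alpha>. Poly_Mapping.keys \<alpha> \<subseteq> {..<n}}" by simp
      qed
    qed
  qed
  hence g0: "f (\<alpha> + Poly_Mapping.single n k) = 0" if "Poly_Mapping.keys \<alpha> \<subseteq> {..<n}" for k \<alpha>
    using that by (metis g_def)
  show ?case
  proof
    fix \<alpha>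
    show "f \<alpha> = 0"
    proof (cases "Poly_Mapping.keys \<alpha> \<subseteq> {..<Suc n}")
      case True
      hence "\<alpha> \<in> (\<lambda>(k, \<alpha>). \<alpha> + Poly_Mapping.single n k) ` (UNIV \<times> {\<alpha>. Poly_Mapping.keys \<alpha> \<subseteq> {..<n}})"
        using multi_index_last_variable[of n] by (simp add: bij_betw_def)
      thus ?thesis using g0 by auto
    qed (use s(1) in \<open>auto simp: supported_def\<close>)
  qed
qed

lemma series_eqI:
  assumes "f \<in> carrier (washnitzer n)" "g \<in> carrier (washnitzer n)"
    "\<And>x. x \<in> padic_points n \<Longrightarrow> eval_series f x = eval_series g x"
  shows "f = g"
proof -
  have ng: "(\<lambda>\<alpha>. (-1) * g \<alpha>) \<in> carrier (washnitzer n)" by (rule washnitzer_smult_closed[OF assms(2)])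
  have "(\<lambda>\<alpha>. f \<alpha> + (-1) * g \<alpha>) = (\<lambda>_. 0)"
    by (rule series_eq_0[OF washnitzer_add_closed[OF assms(1) ng]])
      (simp only: eval_add[OF assms(1) ng] eval_smult[OF assms(2)] assms(3), simp)
  thus ?thesis by (auto simp: fun_eq_iff)
qed

section \<open>Homomorphisms of Washnitzer algebras\<close>

lemma var_mult:
  "(washnitzer_var i \<otimes>\<^bsub>washnitzer n\<^esub> g) (\<gamma> + Poly_Mapping.single i 1) = g \<gamma>"
  "i \<notin> Poly_Mapping.keys \<gamma> \<Longrightarrow> (washnitzer_var i \<otimes>\<^bsub>washnitzer n\<^esub> g) \<gamma> = 0"
proof -
  have "(washnitzer_var i \<otimes>\<^bsub>washnitzer n\<^esub> g) (\<gamma> + Poly_Mapping.single i 1) =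
      (\<Sum>(\<alpha>, \<beta>)\<in>{(Poly_Mapping.single i 1, \<gamma>)}. washnitzer_var i \<alpha> * g \<beta>)"
    unfolding washnitzer_mult
    by (rule sum.mono_neutral_right[OF finite_multi_index_sums])
      (auto simp: washnitzer_var_def add.commute add_left_cancel split: if_splits)
  thus "(washnitzer_var i \<otimes>\<^bsub>washnitzer n\<^esub> g) (\<gamma> + Poly_Mapping.single i 1) = g \<gamma>"
    by (simp add: washnitzer_var_def)
  show "(washnitzer_var i \<otimes>\<^bsub>washnitzer n\<^esub> g) \<gamma> = 0" if "i \<notin> Poly_Mapping.keys \<gamma>"
    unfolding washnitzer_mult
    by (rule sum.neutral) (use that in \<open>auto simp: washnitzer_var_def keys_add_multi_index\<close>)
qed

text \<open>The inverse of 1 - c Z_i, overconvergent as soon as |c| < 1.\<close>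

definition geometric_series :: "nat \<Rightarrow> 'p::prime_card padic \<Rightarrow> 'p padic_series" where
  "geometric_series i c = (\<lambda>\<alpha>. if Poly_Mapping.keys \<alpha> \<subseteq> {i} then c ^ Poly_Mapping.lookup \<alpha> i else 0)"

lemma geometric_series_closed:
  assumes "i < n" "padic_norm c < 1"
  shows "geometric_series i c \<in> carrier (washnitzer n)"
proof (rule in_washnitzerI[of _ _ "max (padic_norm c) (1/2)" 1])
  show "supported n (geometric_series i c)" using assms(1) by (auto simp: supported_def geometric_series_def)
  show "coeff_bound (geometric_series i c) (max (padic_norm c) (1/2)) 1"
    unfolding coeff_bound_def
  proof
    fix \<alpha> :: multi_index
    show "padic_norm (geometric_series i c \<alpha>) \<le> 1 * max (padic_norm c) (1/2) ^ total_degree \<alpha>"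
    proof (cases "Poly_Mapping.keys \<alpha> \<subseteq> {i}")
      case True
      hence "total_degree \<alpha> = Poly_Mapping.lookup \<alpha> i" by (simp add: total_degree_eq_sum[of "{i}"])
      thus ?thesis using True
        by (auto simp: geometric_series_def padic_norm_power padic_norm_nonneg intro!: power_mono)
    qed (simp add: geometric_series_def)
  qed
qed (use assms in auto)

text \<open>This is (1 - c Z_i) G = 1 in a form free of subtraction, so an algebra homomorphism
  transports it to any target directly.\<close>

lemma geometric_series_eq:
  "geometric_series i c =
    \<one>\<^bsub>washnitzer n\<^esub> \<oplus>\<^bsub>washnitzer n\<^esub> c \<odot>\<^bsub>washnitzer n\<^esub> (washnitzer_var i \<otimes>\<^bsub>washnitzer n\<^esub> geometric_series i c)"
proof
  fix \<gamma>
  show "geometric_series i c \<gamma> = (\<one>\<^bsub>washnitzer n\<^esub> \<oplus>\<^bsub>washnitzer n\<^esub>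
      c \<odot>\<^bsub>washnitzer n\<^esub> (washnitzer_var i \<otimes>\<^bsub>washnitzer n\<^esub> geometric_series i c)) \<gamma>"
  proof (cases "i \<in> Poly_Mapping.keys \<gamma>")
    case True
    then obtain \<delta> where \<delta>: "\<gamma> = \<delta> + Poly_Mapping.single i 1" by (rule multi_index_split)
    moreover have "\<gamma> \<noteq> 0" using True by auto
    ultimately show ?thesis
      by (auto simp: washnitzer_add washnitzer_smult washnitzer_one var_mult[simplified] geometric_series_def
          keys_add_multi_index lookup_add)
  next
    case False
    hence "Poly_Mapping.keys \<gamma> \<subseteq> {i} \<longleftrightarrow> Poly_Mapping.keys \<gamma> = {}" by blast
    hence "Poly_Mapping.keys \<gamma> \<subseteq> {i} \<longleftrightarrow> \<gamma> = 0" by simp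
    thus ?thesis using False
      by (simp add: washnitzer_add washnitzer_smult washnitzer_one var_mult geometric_series_def)
  qed
qed

lemma algebra_hom_closed: "\<phi> \<in> algebra_hom A B \<Longrightarrow> f \<in> carrier A \<Longrightarrow> \<phi> f \<in> carrier B"
  and algebra_hom_mult: "\<phi> \<in> algebra_hom A B \<Longrightarrow> f \<in> carrier A \<Longrightarrow> g \<in> carrier A \<Longrightarrow>
    \<phi> (f \<otimes>\<^bsub>A\<^esub> g) = \<phi> f \<otimes>\<^bsub>B\<^esub> \<phi> g"
  and algebra_hom_add: "\<phi> \<in> algebra_hom A B \<Longrightarrow> f \<in> carrier A \<Longrightarrow> g \<in> carrier A \<Longrightarrow>
    \<phi> (f \<oplus>\<^bsub>A\<^esub> g) = \<phi> f \<oplus>\<^bsub>B\<^esub> \<phi> g"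
  and algebra_hom_one: "\<phi> \<in> algebra_hom A B \<Longrightarrow> \<phi> \<one>\<^bsub>A\<^esub> = \<one>\<^bsub>B\<^esub>"
  and algebra_hom_smult: "\<phi> \<in> algebra_hom A B \<Longrightarrow> f \<in> carrier A \<Longrightarrow> \<phi> (c \<odot>\<^bsub>A\<^esub> f) = c \<odot>\<^bsub>B\<^esub> \<phi> f"
  and algebra_hom_ext: "\<phi> \<in> algebra_hom A B \<Longrightarrow> \<phi> \<in> extensional (carrier A)"
  by (auto simp: algebra_hom_def ring_hom_def)

lemma algebra_hom_eqI:
  assumes "\<phi> \<in> algebra_hom A B" "\<psi> \<in> algebra_hom A C" "\<And>f. f \<in> carrier A \<Longrightarrow> \<phi> f = \<psi> f"
  shows "\<phi> = \<psi>"
  using assms algebra_hom_ext by (metis extensionalityI)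

lemma geometric_series_hom:
  assumes "\<phi> \<in> algebra_hom (washnitzer n) B" "i < n" "padic_norm c < 1"
  shows "\<phi> (geometric_series i c) = \<one>\<^bsub>B\<^esub> \<oplus>\<^bsub>B\<^esub> c \<odot>\<^bsub>B\<^esub> (\<phi> (washnitzer_var i) \<otimes>\<^bsub>B\<^esub> \<phi> (geometric_series i c))"
proof -
  note g = geometric_series_closed[OF assms(2,3)] and v = washnitzer_var_closed[OF assms(2)]
  note vg = washnitzer_mult_closed[OF v g, of n]
  have "\<phi> (geometric_series i c) = \<phi> (\<one>\<^bsub>washnitzer n\<^esub> \<oplus>\<^bsub>washnitzer n\<^esub>
      c \<odot>\<^bsub>washnitzer n\<^esub> (washnitzer_var i \<otimes>\<^bsub>washnitzer n\<^esub> geometric_series i c))"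
    using geometric_series_eq[of i c n] by (rule arg_cong)
  also have "\<dots> = \<phi> \<one>\<^bsub>washnitzer n\<^esub> \<oplus>\<^bsub>B\<^esub>
      \<phi> (c \<odot>\<^bsub>washnitzer n\<^esub> (washnitzer_var i \<otimes>\<^bsub>washnitzer n\<^esub> geometric_series i c))"
    using washnitzer_smult_closed[OF vg, of c]
    by (intro algebra_hom_add[OF assms(1)]) (simp_all add: washnitzer_one_closed washnitzer_smult)
  finally show ?thesis
    by (simp only: algebra_hom_one[OF assms(1)] algebra_hom_smult[OF assms(1) vg] algebra_hom_mult[OF assms(1) v g])
qed

lemma point_hom:
  assumes "x \<in> padic_points n"
  shows "(\<lambda>f\<in>carrier (washnitzer n). eval_series f x) \<in> algebra_hom (washnitzer n) padic_algebra"
  using assms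
  by (auto simp: algebra_hom_def ring_hom_def padic_algebra_def washnitzer_add washnitzer_smult eval_one
      eval_add eval_smult eval_mult washnitzer_add_closed washnitzer_smult_closed washnitzer_mult_closed
      washnitzer_one_closed)

text \<open>If the image a of Z_i had norm above 1, then 1 - Z_i / a would be a unit of W_n mapped
  to 0.\<close>

lemma point_coordinate_integral:
  assumes \<phi>: "\<phi> \<in> algebra_hom (washnitzer n) (padic_algebra :: ('p::prime_card padic, 'p padic) module)" and i: "i < n"
  shows "\<phi> (washnitzer_var i) \<in> padic_ints"
proof (rule ccontr)
  define a where "a = \<phi> (washnitzer_var i)"
  assume "\<phi> (washnitzer_var i) \<notin> padic_ints"
  hence a: "padic_norm a > 1" by (simp add: padic_ints_def a_def)
  hence a0: "a \<noteq> 0" by auto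
  have c: "padic_norm (1 / a) < 1" using a by (simp add: padic_norm_divide)
  show False
    using geometric_series_hom[OF \<phi> i c] a0 by (simp add: padic_algebra_def a_def)
qed

text \<open>Split g into the monomials free of Z_k and those divisible by Z_k.\<close>

lemma sub_variable_divisible:
  assumes g: "g \<in> carrier (washnitzer n)" and k: "k < n"
  obtains q where "q \<in> carrier (washnitzer n)"
    "\<And>x. x \<in> padic_points n \<Longrightarrow> eval_series g x = eval_series g (x(k := 0)) + x k * eval_series q x"
proof
  define q where "q \<alpha> = g (\<alpha> + Poly_Mapping.single k 1)" for \<alpha>
  define g0 where "g0 \<alpha> = (if k \<in> Poly_Mapping.keys \<alpha> then 0 else g \<alpha>)" for \<alpha>
  obtain A s where s: "supported n g" "0 < s" "s < 1" "coeff_bound g s A" using g by (rule in_washnitzerE)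
  show qW: "q \<in> carrier (washnitzer n)"
  proof (rule in_washnitzerI[OF _ s(2,3)])
    show "supported n q" using s(1) by (auto simp: supported_def q_def keys_add_multi_index)
    show "coeff_bound q s (A * s)"
      unfolding coeff_bound_def
    proof
      fix \<alpha>
      show "padic_norm (q \<alpha>) \<le> A * s * s ^ total_degree \<alpha>"
        using s(4)[unfolded coeff_bound_def, rule_format, of "\<alpha> + Poly_Mapping.single k 1"]
        by (simp add: q_def mult_ac)
    qed
  qed
  have g0W: "g0 \<in> carrier (washnitzer n)"
    by (rule in_washnitzerI[OF _ s(2,3), of _ _ A])
      (use s coeff_bound_nonneg[OF s(4)] in \<open>auto simp: supported_def coeff_bound_def g0_def\<close>)
  note vW = washnitzer_var_closed[OF k]
  note vq = washnitzer_mult_closed[OF vW qW, of n]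
  have g_eq: "g = (\<lambda>\<alpha>. g0 \<alpha> + (washnitzer_var k \<otimes>\<^bsub>washnitzer n\<^esub> q) \<alpha>)"
  proof
    fix \<alpha>
    show "g \<alpha> = g0 \<alpha> + (washnitzer_var k \<otimes>\<^bsub>washnitzer n\<^esub> q) \<alpha>"
    proof (cases "k \<in> Poly_Mapping.keys \<alpha>")
      case True
      then obtain \<delta> where \<delta>: "\<alpha> = \<delta> + Poly_Mapping.single k 1" by (rule multi_index_split)
      show ?thesis using True unfolding \<delta> var_mult by (simp add: g0_def q_def)
    qed (simp add: g0_def var_mult)
  qed
  fix x :: "nat \<Rightarrow> 'a padic" assume x: "x \<in> padic_points n"
  have "eval_series g0 x = eval_series g (x(k := 0))"
    unfolding eval_series_def
  proof (rule infsum_cong)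
    fix \<alpha> :: multi_index
    show "g0 \<alpha> * monom_val x \<alpha> = g \<alpha> * monom_val (x(k := 0)) \<alpha>"
    proof (cases "k \<in> Poly_Mapping.keys \<alpha>")
      case True
      then obtain \<delta> where \<delta>: "\<alpha> = \<delta> + Poly_Mapping.single k 1" by (rule multi_index_split)
      show ?thesis using True by (simp add: g0_def) (simp add: \<delta> monom_val_add[of _ \<delta>] monom_val_single[of _ k 1, simplified])
    next
      case False
      hence "monom_val x \<alpha> = monom_val (x(k := 0)) \<alpha>" by (intro monom_val_cong) auto
      thus ?thesis using False by (simp add: g0_def)
    qed
  qed
  thus "eval_series g x = eval_series g (x(k := 0)) + x k * eval_series q x"
    by (subst g_eq, simp only: eval_add[OF g0W vq x] eval_mult[OF vW qW x] eval_var)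
qed

definition const_series :: "'p::prime_card padic \<Rightarrow> 'p padic_series" where
  "const_series c = (\<lambda>\<alpha>. if \<alpha> = 0 then c else 0)"

lemma const_series_closed: "const_series c \<in> carrier (washnitzer n)"
  unfolding const_series_def by (rule washnitzer_const_closed)

lemma eval_const_series [simp]: "eval_series (const_series c) x = c"
  unfolding const_series_def by (rule eval_const)

lemma coeff_bound_const_series: "c \<in> padic_ints \<Longrightarrow> coeff_bound (const_series c) 1 1"
  by (simp add: coeff_bound_1 const_series_def padic_ints_def)

lemma coeff_bound_var: "coeff_bound (washnitzer_var i) 1 1"
  by (simp add: coeff_bound_1 washnitzer_var_def)

text \<open>Substituting Z_k + a reduces the claim to a = 0; integrality of a keeps the substitution
  inside W_n, and Z_k - a undoes it.\<close>

lemma var_diff_divisible: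
  assumes g: "g \<in> carrier (washnitzer n)" and k: "k < n" and a: "a \<in> padic_ints"
  obtains q where "q \<in> carrier (washnitzer n)"
    "\<And>x. x \<in> padic_points n \<Longrightarrow> eval_series g x = eval_series g (x(k := a)) + (x k - a) * eval_series q x"
proof -
  define F where "F b = (\<lambda>i. if i = k then (\<lambda>\<alpha>. washnitzer_var k \<alpha> + const_series b \<alpha>) else washnitzer_var i)" for b :: "'a padic"
  have FW: "F b i \<in> carrier (washnitzer n)" if "i < n" for b i
    using that k by (auto simp: F_def washnitzer_var_closed const_series_closed intro!: washnitzer_add_closed)
  have Fb: "coeff_bound (F b i) 1 1" if "b \<in> padic_ints" for b i
    using that coeff_bound_var coeff_bound_const_series[of b]
    by (auto simp: F_def coeff_bound_1 intro!: padic_norm_add_le)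
  have Fe: "eval_series (F b i) x = (x(k := x k + b)) i" if "x \<in> padic_points n" for b i x
    using that k eval_add[OF washnitzer_var_closed[OF k] const_series_closed that]
    by (simp add: F_def eval_var)
  have trans: "\<exists>h\<in>carrier (washnitzer n). \<forall>x\<in>padic_points n. eval_series h x = eval_series f (x(k := x k + b))"
    if f: "f \<in> carrier (washnitzer n)" and b: "b \<in> padic_ints" for f and b :: "'a padic"
  proof -
    have eq: "(\<lambda>i. eval_series (F b i) x) = x(k := x k + b)" if "x \<in> padic_points n" for x
      by (rule ext) (rule Fe[OF that])
    obtain h where h: "h \<in> carrier (washnitzer n)"
      "\<And>x. x \<in> padic_points n \<Longrightarrow> eval_series h x = eval_series f (\<lambda>i. eval_series (F b i) x)"
      using compose_series[of f n "F b" n, OF f FW Fb[OF b]] by blast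
    show ?thesis
    proof (intro bexI[OF _ h(1)] ballI)
      fix x :: "nat \<Rightarrow> 'a padic" assume x: "x \<in> padic_points n"
      show "eval_series h x = eval_series f (x(k := x k + b))"
        unfolding eq[OF x, symmetric] by (rule h(2)[OF x])
    qed
  qed
  obtain h where h: "h \<in> carrier (washnitzer n)"
    "\<And>x. x \<in> padic_points n \<Longrightarrow> eval_series h x = eval_series g (x(k := x k + a))" using trans[OF g a] by blast
  obtain q where q: "q \<in> carrier (washnitzer n)"
    "\<And>x. x \<in> padic_points n \<Longrightarrow> eval_series h x = eval_series h (x(k := 0)) + x k * eval_series q x"
    using sub_variable_divisible[OF h(1) k] by blast
  obtain r where r: "r \<in> carrier (washnitzer n)"
    "\<And>x. x \<in> padic_points n \<Longrightarrow> eval_series r x = eval_series q (x(k := x k + - a))"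
    using trans[OF q(1) padic_ints_minus[OF a]] by blast
  show ?thesis
  proof (rule that[OF r(1)])
    fix x :: "nat \<Rightarrow> 'a padic" assume x: "x \<in> padic_points n"
    let ?y = "x(k := x k + - a)"
    have y: "?y \<in> padic_points n" "?y(k := 0) \<in> padic_points n"
      using x a by (auto simp: padic_points_def intro!: padic_ints_diff)
    show "eval_series g x = eval_series g (x(k := a)) + (x k - a) * eval_series r x"
      using q(2)[OF y(1)] h(2)[OF y(1)] h(2)[OF y(2)] r(2)[OF x] by simp
  qed
qed

text \<open>The kernel of \<phi> contains every Z_k - a_k with a_k = \<phi>(Z_k). Working modulo
  these, one variable at a time, turns f into a constant, on which \<phi> is known. The argument is
  algebraic because homomorphisms come without continuity.\<close>

lemma point_hom_eval:
  assumes \<phi>: "\<phi> \<in> algebra_hom (washnitzer n) (padic_algebra :: ('p::prime_card padic, 'p padic) module)"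
    and f: "f \<in> carrier (washnitzer n)"
  shows "\<phi> f = eval_series f (\<lambda>i. \<phi> (washnitzer_var i))"
proof -
  define a where "a i = \<phi> (washnitzer_var i)" for i
  have a: "a i \<in> padic_ints" if "i < n" for i
    unfolding a_def by (rule point_coordinate_integral[OF \<phi> that])
  have "\<exists>g\<in>carrier (washnitzer n). \<phi> f = \<phi> g \<and>
      (\<forall>x\<in>padic_points n. eval_series g x = eval_series f (\<lambda>i. if i < k then a i else x i))" if "k \<le> n" for k
    using that
  proof (induction k)
    case 0 show ?case using f by auto
  next
    case (Suc k)
    then obtain g where g: "g \<in> carrier (washnitzer n)" "\<phi> f = \<phi> g"
      "\<And>x. x \<in> padic_points n \<Longrightarrow> eval_series g x = eval_series f (\<lambda>i. if i < k then a i else x i)"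
      by auto
    have k: "k < n" using Suc.prems by simp
    obtain q where q: "q \<in> carrier (washnitzer n)"
      "\<And>x. x \<in> padic_points n \<Longrightarrow> eval_series g x = eval_series g (x(k := a k)) + (x k - a k) * eval_series q x"
      using var_diff_divisible[OF g(1) k a[OF k]] by blast
    define r where "r = washnitzer_var k \<otimes>\<^bsub>washnitzer n\<^esub> q"
    \<comment> \<open>t is (Z_k - a_k) q, which \<phi> sends to 0 whatever q is.\<close>
    define t where "t = (\<lambda>\<alpha>. r \<alpha> + (- a k) * q \<alpha>)"
    define h where "h = (\<lambda>\<alpha>. g \<alpha> + (-1) * t \<alpha>)"
    note v = washnitzer_var_closed[OF k]
    have rW: "r \<in> carrier (washnitzer n)" unfolding r_def by (rule washnitzer_mult_closed[OF v q(1)])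
    note aq = washnitzer_smult_closed[OF q(1), of "- a k"]
    have tW: "t \<in> carrier (washnitzer n)" unfolding t_def by (rule washnitzer_add_closed[OF rW aq])
    note mt = washnitzer_smult_closed[OF tW, of "-1"]
    have hW: "h \<in> carrier (washnitzer n)" unfolding h_def by (rule washnitzer_add_closed[OF g(1) mt])
    have "\<phi> t = \<phi> r + (- a k) * \<phi> q"
      using algebra_hom_add[OF \<phi> rW aq] algebra_hom_smult[OF \<phi> q(1), of "- a k"]
      by (simp add: t_def washnitzer_add washnitzer_smult padic_algebra_def)
    also have "\<phi> r = a k * \<phi> q"
      using algebra_hom_mult[OF \<phi> v q(1)] by (simp add: r_def padic_algebra_def a_def)
    finally have t0: "\<phi> t = 0" by simp
    have "\<phi> h = \<phi> g"
      using algebra_hom_add[OF \<phi> g(1) mt] algebra_hom_smult[OF \<phi> tW, of "-1"] t0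
      by (simp add: h_def washnitzer_add washnitzer_smult padic_algebra_def)
    moreover have "eval_series h x = eval_series f (\<lambda>i. if i < Suc k then a i else x i)" if x: "x \<in> padic_points n" for x
    proof -
      have x': "x(k := a k) \<in> padic_points n" using x a[OF k] by (auto simp: padic_points_def)
      have "eval_series t x = (x k - a k) * eval_series q x"
        unfolding t_def eval_add[OF rW aq x] eval_smult[OF q(1) x]
        by (simp add: r_def eval_mult[OF v q(1) x] eval_var algebra_simps)
      hence "eval_series h x = eval_series g (x(k := a k))"
        unfolding h_def eval_add[OF g(1) mt x] eval_smult[OF tW x] using q(2)[OF x] by simp
      also have "\<dots> = eval_series f (\<lambda>i. if i < k then a i else (x(k := a k)) i)" by (rule g(3)[OF x'])
      also have "(\<lambda>i. if i < k then a i else (x(k := a k)) i) = (\<lambda>i. if i < Suc k then a i else x i)"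
        by (auto simp: fun_eq_iff less_Suc_eq)
      finally show ?thesis .
    qed
    ultimately show ?case using hW g(2) by (intro bexI[of _ h]) auto
  qed
  then obtain g where g: "g \<in> carrier (washnitzer n)" "\<phi> f = \<phi> g"
    "\<And>x. x \<in> padic_points n \<Longrightarrow> eval_series g x = eval_series f (\<lambda>i. if i < n then a i else x i)"
    by blast
  define c where "c = eval_series f a"
  \<comment> \<open>After all n substitutions the function is constant on points, and the identity
    theorem makes the series constant.\<close>
  have "g = const_series c"
  proof (rule series_eqI[OF g(1) const_series_closed])
    fix x :: "nat \<Rightarrow> 'p padic" assume x: "x \<in> padic_points n"
    have "eval_series g x = eval_series f (\<lambda>i. if i < n then a i else x i)" by (rule g(3)[OF x])
    also have "\<dots> = c" unfolding c_def by (rule eval_series_cong[OF f]) simp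
    finally show "eval_series g x = eval_series (const_series c) x" by simp
  qed
  also have "const_series c = c \<odot>\<^bsub>washnitzer n\<^esub> \<one>\<^bsub>washnitzer n\<^esub>"
    by (auto simp: const_series_def washnitzer_smult washnitzer_one)
  finally have "\<phi> f = c"
    using g(2) algebra_hom_smult[OF \<phi> washnitzer_one_closed, of c n] algebra_hom_one[OF \<phi>]
    by (simp add: padic_algebra_def)
  thus ?thesis by (simp add: c_def a_def[abs_def])
qed

lemma point_hom_points:
  "\<phi> \<in> algebra_hom (washnitzer n) padic_algebra \<Longrightarrow> (\<lambda>i. \<phi> (washnitzer_var i)) \<in> padic_points n"
  by (simp add: padic_points_def point_coordinate_integral)

lemma compose_algebra_hom:
  assumes "\<phi> \<in> algebra_hom A B" "\<psi> \<in> algebra_hom B C"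
    "\<And>c f. f \<in> carrier A \<Longrightarrow> c \<odot>\<^bsub>A\<^esub> f \<in> carrier A"
    "\<And>f g. f \<in> carrier A \<Longrightarrow> g \<in> carrier A \<Longrightarrow> f \<otimes>\<^bsub>A\<^esub> g \<in> carrier A"
    "\<And>f g. f \<in> carrier A \<Longrightarrow> g \<in> carrier A \<Longrightarrow> f \<oplus>\<^bsub>A\<^esub> g \<in> carrier A" "\<one>\<^bsub>A\<^esub> \<in> carrier A"
  shows "compose (carrier A) \<psi> \<phi> \<in> algebra_hom A C"
  using assms(3-6) algebra_hom_closed[OF assms(1)] algebra_hom_closed[OF assms(2)]
  by (simp add: algebra_hom_def[of A C] ring_hom_def compose_def Pi_iff algebra_hom_mult[OF assms(1)] algebra_hom_mult[OF assms(2)]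
      algebra_hom_add[OF assms(1)] algebra_hom_add[OF assms(2)] algebra_hom_one[OF assms(1)] algebra_hom_one[OF assms(2)]
      algebra_hom_smult[OF assms(1)] algebra_hom_smult[OF assms(2)])

lemma compose_washnitzer_hom:
  assumes "\<phi> \<in> algebra_hom (washnitzer n) B" "\<psi> \<in> algebra_hom B C"
  shows "compose (carrier (washnitzer n)) \<psi> \<phi> \<in> algebra_hom (washnitzer n) C"
  by (rule compose_algebra_hom[OF assms])
    (auto simp: washnitzer_smult washnitzer_add washnitzer_one_closed
      intro!: washnitzer_smult_closed washnitzer_mult_closed washnitzer_add_closed)

text \<open>The morphism of affinoid spaces with comorphism \<psi>, on rational points; it reverses
  the order of composition.\<close>

definition hom_point_map ::
    "('p::prime_card padic_series \<Rightarrow> 'p padic_series) \<Rightarrow> (nat \<Rightarrow> 'p padic) \<Rightarrow> nat \<Rightarrow> 'p padic" where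
  "hom_point_map \<psi> x = (\<lambda>i. eval_series (\<psi> (washnitzer_var i)) x)"

text \<open>Composing \<psi> with evaluation at x gives a rational point, and all rational points
  are evaluations.\<close>

lemma
  assumes \<psi>: "\<psi> \<in> algebra_hom (washnitzer n) (washnitzer m)" and x: "x \<in> padic_points m"
  shows hom_point_map_points: "hom_point_map \<psi> x \<in> padic_points n"
    and hom_eval: "f \<in> carrier (washnitzer n) \<Longrightarrow> eval_series (\<psi> f) x = eval_series f (hom_point_map \<psi> x)"
proof -
  let ?\<phi> = "compose (carrier (washnitzer n)) (\<lambda>f\<in>carrier (washnitzer m). eval_series f x) \<psi>"
  have \<phi>: "?\<phi> \<in> algebra_hom (washnitzer n) padic_algebra"
    by (rule compose_washnitzer_hom[OF \<psi> point_hom[OF x]])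
  have e: "?\<phi> f = eval_series (\<psi> f) x" if "f \<in> carrier (washnitzer n)" for f
    using that algebra_hom_closed[OF \<psi> that] by (simp add: compose_def)
  have v: "?\<phi> (washnitzer_var i) = hom_point_map \<psi> x i" if "i < n" for i
    using e[OF washnitzer_var_closed[OF that]] by (simp add: hom_point_map_def)
  show "hom_point_map \<psi> x \<in> padic_points n"
    using point_hom_points[OF \<phi>] v by (simp add: padic_points_def)
  assume f: "f \<in> carrier (washnitzer n)"
  have "eval_series (\<psi> f) x = eval_series f (\<lambda>i. ?\<phi> (washnitzer_var i))"
    using point_hom_eval[OF \<phi> f] e[OF f] by simp
  also have "\<dots> = eval_series f (hom_point_map \<psi> x)"
    by (rule eval_series_cong[OF f v])
  finally show "eval_series (\<psi> f) x = eval_series f (hom_point_map \<psi> x)" .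
qed

text \<open>A series is determined by its values, and the values of the image of f only involve the
  images of the variables.\<close>

lemma washnitzer_hom_eqI:
  assumes \<phi>: "\<phi> \<in> algebra_hom (washnitzer n) (washnitzer m)" and \<psi>: "\<psi> \<in> algebra_hom (washnitzer n) (washnitzer m)"
    and eq: "\<And>x i. x \<in> padic_points m \<Longrightarrow> i < n \<Longrightarrow> hom_point_map \<phi> x i = hom_point_map \<psi> x i"
  shows "\<phi> = \<psi>"
proof (rule algebra_hom_eqI[OF \<phi> \<psi>])
  fix f :: "'a padic_series" assume f: "f \<in> carrier (washnitzer n)"
  show "\<phi> f = \<psi> f"
  proof (rule series_eqI)
    show "\<phi> f \<in> carrier (washnitzer m)" "\<psi> f \<in> carrier (washnitzer m)"
      by (rule algebra_hom_closed[OF \<phi> f], rule algebra_hom_closed[OF \<psi> f])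
    fix x :: "nat \<Rightarrow> 'a padic" assume x: "x \<in> padic_points m"
    show "eval_series (\<phi> f) x = eval_series (\<psi> f) x"
      unfolding hom_eval[OF \<phi> x f] hom_eval[OF \<psi> x f] by (rule eval_series_cong[OF f eq[OF x]])
  qed
qed

lemma point_hom_eqI:
  assumes "\<phi> \<in> algebra_hom (washnitzer n) padic_algebra" "\<psi> \<in> algebra_hom (washnitzer n) padic_algebra"
    "\<And>i. i < n \<Longrightarrow> \<phi> (washnitzer_var i) = \<psi> (washnitzer_var i)"
  shows "\<phi> = \<psi>"
proof (rule algebra_hom_eqI[OF assms(1,2)])
  fix f :: "'a padic_series" assume f: "f \<in> carrier (washnitzer n)"
  show "\<phi> f = \<psi> f"
    unfolding point_hom_eval[OF assms(1) f] point_hom_eval[OF assms(2) f] by (rule eval_series_cong[OF f assms(3)])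
qed

section \<open>Integrality of the images of variables\<close>

lemma multi_index_nonneg: "0 \<le> (\<alpha> :: multi_index)"
proof (cases "\<alpha> = 0")
  case False
  hence ex: "\<exists>k. Poly_Mapping.lookup \<alpha> k \<noteq> 0" by (metis poly_mapping_eqI lookup_zero)
  \<comment> \<open>The order on multi-indices is lexicographic, so the first nonzero exponent
    decides.\<close>
  define k where "k = (LEAST k. Poly_Mapping.lookup \<alpha> k \<noteq> 0)"
  have "Poly_Mapping.lookup \<alpha> k \<noteq> 0" unfolding k_def by (rule LeastI_ex[OF ex])
  moreover have "Poly_Mapping.lookup \<alpha> j = 0" if "j < k" for j
    using not_less_Least that unfolding k_def by blast
  ultimately have "0 < \<alpha>"
    unfolding less_poly_mapping.rep_eq less_fun_def by (intro exI[of _ k]) simp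
  thus ?thesis by simp
qed simp

lemma padic_norm_sum_less:
  assumes "finite A" "\<And>i. i \<in> A \<Longrightarrow> padic_norm (f i) < B" "0 < B"
  shows "padic_norm (\<Sum>i\<in>A. f i :: 'p::prime_card padic) < B"
  using assms
proof (induction A rule: finite_induct)
  case (insert a A)
  hence "padic_norm (f a) < B" "padic_norm (sum f A) < B" by auto
  thus ?case using insert.hyps padic_norm_add[of "f a" "sum f A"] by simp
qed simp

text \<open>Compare the coefficients of the leading monomials of the two factors modulo the maximal ideal.\<close>

lemma washnitzer_unit_reduction_const:
  assumes f: "f \<in> carrier (washnitzer n)" and g: "g \<in> carrier (washnitzer n)"
    and fg: "f \<otimes>\<^bsub>washnitzer n\<^esub> g = \<one>\<^bsub>washnitzer n\<^esub>" and b: "coeff_bound f 1 1"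
    and \<alpha>: "padic_norm (f \<alpha>) = 1"
  shows "\<alpha> = 0"
proof (rule ccontr)
  assume \<alpha>0: "\<alpha> \<noteq> 0"
  have "\<exists>\<beta>. g \<beta> \<noteq> 0"
  proof (rule ccontr)
    assume "\<not> ?thesis"
    hence "(f \<otimes>\<^bsub>washnitzer n\<^esub> g) 0 = 0" by (simp add: washnitzer_mult case_prod_unfold)
    thus False by (simp add: fg washnitzer_one)
  qed
  then obtain \<beta>0 where \<beta>0: "g \<beta>0 \<noteq> 0" by blast
  have pos: "0 < padic_norm (g \<beta>0)" using \<beta>0 padic_norm_nonneg[of "g \<beta>0"] padic_norm_eq_0_iff[of "g \<beta>0"] by simp
  define S where "S = {\<beta>. padic_norm (g \<beta>0) \<le> padic_norm (g \<beta>)}"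
  have S: "finite S" "\<beta>0 \<in> S" unfolding S_def using coeff_decay[OF g pos] by auto
  define M where "M = Max ((\<lambda>\<beta>. padic_norm (g \<beta>)) ` S)"
  have M: "M \<in> (\<lambda>\<beta>. padic_norm (g \<beta>)) ` S" unfolding M_def using S by (intro Max_in) auto
  have M0: "padic_norm (g \<beta>0) \<le> M" unfolding M_def using S by (intro Max_ge) auto
  have gM: "padic_norm (g \<beta>) \<le> M" for \<beta>
  proof (cases "\<beta> \<in> S")
    case True thus ?thesis unfolding M_def using S by (intro Max_ge) auto
  qed (use M0 in \<open>simp add: S_def\<close>)
  define T where "T = {\<beta>. padic_norm (g \<beta>) = M}"
  have "T \<subseteq> S" using M0 by (auto simp: T_def S_def)
  hence T: "finite T" "T \<noteq> {}" using S(1) M by (auto simp: T_def intro: finite_subset)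
  define U where "U = {\<alpha>. padic_norm (f \<alpha>) = 1}"
  have U: "finite U" "\<alpha> \<in> U" using coeff_decay[OF f, of 1] \<alpha> by (auto simp: U_def elim: rev_finite_subset)
  define a where "a = Max U"
  define c where "c = Max T"
  have a: "padic_norm (f a) = 1" and amax: "\<And>\<beta>. padic_norm (f \<beta>) = 1 \<Longrightarrow> \<beta> \<le> a"
    using Max_in[of U] Max_ge[of U] U unfolding a_def by (auto simp: U_def)
  have c: "padic_norm (g c) = M" and cmax: "\<And>\<beta>. padic_norm (g \<beta>) = M \<Longrightarrow> \<beta> \<le> c"
    using Max_in[of T] Max_ge[of T] T unfolding c_def by (auto simp: T_def)
  have "a \<noteq> 0" using amax[OF \<alpha>] \<alpha>0 multi_index_nonneg[of \<alpha>] by auto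
  hence ac: "a + c \<noteq> 0" by (metis keys_add_multi_index keys_eq_empty Un_empty)
  have Mpos: "0 < M" using M0 pos by linarith
  let ?P = "{(\<alpha>, \<beta>). \<alpha> + \<beta> = a + c}"
  \<comment> \<open>Maximality of a and c in the order leaves (a, c) as the only pair with this sum
    whose two factors both have maximal norm.\<close>
  have small: "padic_norm (f \<alpha>' * g \<beta>') < M" if "\<alpha>' + \<beta>' = a + c" "(\<alpha>', \<beta>') \<noteq> (a, c)" for \<alpha>' \<beta>'
  proof -
    have f1: "padic_norm (f \<alpha>') \<le> 1" using b by (simp add: coeff_bound_1)
    have "\<not> (padic_norm (f \<alpha>') = 1 \<and> padic_norm (g \<beta>') = M)"
    proof
      assume "padic_norm (f \<alpha>') = 1 \<and> padic_norm (g \<beta>') = M"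
      hence "\<alpha>' \<le> a" "\<beta>' \<le> c" using amax cmax by auto
      hence "\<alpha>' = a"
        using that(1) add_mono[of \<alpha>' a \<beta>' c] add_less_le_mono[of \<alpha>' a \<beta>' c] by (auto simp: order.order_iff_strict)
      thus False using that by auto
    qed
    then consider "padic_norm (f \<alpha>') < 1" | "padic_norm (g \<beta>') < M" using f1 gM[of \<beta>'] by fastforce
    thus ?thesis
    proof cases
      case 1
      have "padic_norm (f \<alpha>') * padic_norm (g \<beta>') \<le> padic_norm (f \<alpha>') * M"
        using gM by (intro mult_left_mono) (auto simp: padic_norm_nonneg)
      also have "\<dots> < 1 * M" using 1 Mpos by (intro mult_strict_right_mono)
      finally show ?thesis by (simp add: padic_norm_mult)
    next
      case 2
      have "padic_norm (f \<alpha>') * padic_norm (g \<beta>') \<le> 1 * padic_norm (g \<beta>')"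
        using f1 by (intro mult_right_mono) (auto simp: padic_norm_nonneg)
      thus ?thesis using 2 by (simp add: padic_norm_mult)
    qed
  qed
  have "(f \<otimes>\<^bsub>washnitzer n\<^esub> g) (a + c) = f a * g c + (\<Sum>(\<alpha>, \<beta>)\<in>?P - {(a, c)}. f \<alpha> * g \<beta>)"
    unfolding washnitzer_mult by (subst sum.remove[OF finite_multi_index_sums, of "(a, c)"]) auto
  moreover have "padic_norm (\<Sum>(\<alpha>, \<beta>)\<in>?P - {(a, c)}. f \<alpha> * g \<beta>) < M"
    by (rule padic_norm_sum_less) (use small Mpos finite_multi_index_sums[of "a + c"] in auto)
  moreover have "padic_norm (f a * g c) = M" using a c by (simp add: padic_norm_mult)
  ultimately have "padic_norm ((f \<otimes>\<^bsub>washnitzer n\<^esub> g) (a + c)) = M"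
    using padic_norm_isosceles by metis
  thus False using Mpos ac by (simp add: fg washnitzer_one)
qed

text \<open>Suppose the Gauss norm M of the image F of Z_i exceeds 1 and is attained at a. With c =
  1 / F a, the unit 1 - c Z_i goes to 1 - c F, a unit with integral coefficients whose reduction has
  a non-constant term. Units with integral coefficients have constant reduction, a
  contradiction.\<close>

lemma hom_var_coeff_bound:
  assumes \<psi>: "\<psi> \<in> algebra_hom (washnitzer n) (washnitzer m)" and i: "i < n"
  shows "coeff_bound (\<psi> (washnitzer_var i)) 1 1"
proof (rule ccontr)
  define F where "F = \<psi> (washnitzer_var i)"
  have FW: "F \<in> carrier (washnitzer m)"
    unfolding F_def by (rule algebra_hom_closed[OF \<psi> washnitzer_var_closed[OF i]])
  assume "\<not> coeff_bound (\<psi> (washnitzer_var i)) 1 1"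
  then obtain \<gamma> where \<gamma>: "1 < padic_norm (F \<gamma>)" by (auto simp: F_def coeff_bound_1 not_le)
  define S where "S = {\<beta>. padic_norm (F \<gamma>) \<le> padic_norm (F \<beta>)}"
  have S: "finite S" "\<gamma> \<in> S" unfolding S_def using coeff_decay[OF FW, of "padic_norm (F \<gamma>)"] \<gamma> by auto
  define M where "M = Max ((\<lambda>\<beta>. padic_norm (F \<beta>)) ` S)"
  have "M \<in> (\<lambda>\<beta>. padic_norm (F \<beta>)) ` S" unfolding M_def using S by (intro Max_in) auto
  then obtain a where a: "padic_norm (F a) = M" by auto
  have M0: "padic_norm (F \<gamma>) \<le> M" unfolding M_def using S by (intro Max_ge) auto
  have FM: "padic_norm (F \<beta>) \<le> M" for \<beta>
  proof (cases "\<beta> \<in> S")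
    case True thus ?thesis unfolding M_def using S by (intro Max_ge) auto
  qed (use M0 in \<open>simp add: S_def\<close>)
  have M1: "1 < M" using M0 \<gamma> by linarith
  have Fa: "F a \<noteq> 0" using a M1 by auto
  define c where "c = 1 / F a"
  have nc: "padic_norm c = 1 / M" by (simp add: c_def padic_norm_divide a)
  hence c1: "padic_norm c < 1" using M1 by simp
  \<comment> \<open>The constant term is the value at the origin, a coordinate of a rational point.
    Hence the large coefficient sits at an index other than 0.\<close>
  have F0: "padic_norm (F 0) \<le> 1"
  proof -
    have z: "(\<lambda>_. 0) \<in> (padic_points m :: (nat \<Rightarrow> 'a padic) set)" by (simp add: padic_points_def)
    have "((\<lambda>\<alpha>. F \<alpha> * monom_val (\<lambda>_. 0) \<alpha>) has_sum F 0) UNIV"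
    proof (rule has_sum_finite_neutralI[of "{0}"])
      fix \<alpha> :: multi_index assume "\<alpha> \<in> UNIV - {0}"
      then obtain j where "j \<in> Poly_Mapping.keys \<alpha>" by (metis Diff_iff all_not_in_conv keys_eq_empty singletonI)
      then obtain \<delta> where \<delta>: "\<alpha> = \<delta> + Poly_Mapping.single j 1" by (rule multi_index_split)
      show "F \<alpha> * monom_val (\<lambda>_. 0) \<alpha> = 0" unfolding \<delta> monom_val_add monom_val_single by simp
    qed auto
    hence "F 0 = hom_point_map \<psi> (\<lambda>_. 0) i"
      by (simp add: hom_point_map_def eval_series_def infsumI F_def)
    also have "\<dots> \<in> padic_ints" using hom_point_map_points[OF \<psi> z] i by (simp add: padic_points_def)
    finally show ?thesis by (simp add: padic_ints_def)
  qed
  define f where "f = (\<lambda>\<alpha>. const_series 1 \<alpha> + (- c) * F \<alpha>)"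
  define G where "G = \<psi> (geometric_series i c)"
  have GW: "G \<in> carrier (washnitzer m)"
    unfolding G_def by (rule algebra_hom_closed[OF \<psi> geometric_series_closed[OF i c1]])
  note cF = washnitzer_smult_closed[OF FW, of "- c"]
  have fW: "f \<in> carrier (washnitzer m)"
    unfolding f_def by (rule washnitzer_add_closed[OF const_series_closed cF])
  have G_eq: "G = (\<lambda>\<alpha>. const_series 1 \<alpha> + c * (F \<otimes>\<^bsub>washnitzer m\<^esub> G) \<alpha>)"
    using geometric_series_hom[OF \<psi> i c1]
    unfolding G_def[symmetric] F_def[symmetric] washnitzer_add washnitzer_smult washnitzer_one const_series_def .
  note FG = washnitzer_mult_closed[OF FW GW, of m]
  have "f \<otimes>\<^bsub>washnitzer m\<^esub> G = \<one>\<^bsub>washnitzer m\<^esub>"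
  proof (rule series_eqI[OF washnitzer_mult_closed[OF fW GW] washnitzer_one_closed])
    fix x :: "nat \<Rightarrow> 'a padic" assume x: "x \<in> padic_points m"
    have "eval_series G x = eval_series (\<lambda>\<alpha>. const_series 1 \<alpha> + c * (F \<otimes>\<^bsub>washnitzer m\<^esub> G) \<alpha>) x"
      using G_eq by simp
    also have "\<dots> = 1 + c * (eval_series F x * eval_series G x)"
      by (simp add: eval_add[OF const_series_closed washnitzer_smult_closed[OF FG] x] eval_smult[OF FG x] eval_mult[OF FW GW x])
    finally have "eval_series G x = 1 + c * (eval_series F x * eval_series G x)" .
    moreover have "eval_series f x = 1 + - c * eval_series F x"
      unfolding f_def by (simp only: eval_add[OF const_series_closed cF x] eval_smult[OF FW x] eval_const_series)
    ultimately have "eval_series f x * eval_series G x = 1"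
      by (simp add: ring_distribs) (metis add_diff_cancel_right' mult.assoc)
    thus "eval_series (f \<otimes>\<^bsub>washnitzer m\<^esub> G) x = eval_series (\<one>\<^bsub>washnitzer m\<^esub>) x"
      by (simp add: eval_mult[OF fW GW x] eval_one)
  qed
  moreover have "coeff_bound f 1 1"
    unfolding coeff_bound_1
  proof
    fix \<alpha>
    have "padic_norm (- c * F \<alpha>) \<le> 1"
      using FM[of \<alpha>] M1 by (simp add: padic_norm_mult padic_norm_minus nc)
    thus "padic_norm (f \<alpha>) \<le> 1"
      unfolding f_def by (intro padic_norm_add_le) (auto simp: const_series_def)
  qed
  moreover have a0: "a \<noteq> 0" using a F0 M1 by auto
  moreover have "padic_norm (f a) = 1"
    using a0 M1 by (simp add: f_def const_series_def padic_norm_minus padic_norm_mult nc a)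
  ultimately show False using washnitzer_unit_reduction_const[OF fW GW] by blast
qed

section \<open>Homomorphisms with prescribed action on points\<close>

lemma washnitzer_homI:
  assumes ext: "\<psi> \<in> extensional (carrier (washnitzer n))"
    and c: "\<And>f. f \<in> carrier (washnitzer n) \<Longrightarrow> \<psi> f \<in> carrier (washnitzer m)"
    and y: "\<And>x. x \<in> padic_points m \<Longrightarrow> y x \<in> padic_points n"
    and e: "\<And>f x. f \<in> carrier (washnitzer n) \<Longrightarrow> x \<in> padic_points m \<Longrightarrow> eval_series (\<psi> f) x = eval_series f (y x)"
  shows "\<psi> \<in> algebra_hom (washnitzer n) (washnitzer m)"
  unfolding algebra_hom_def
proof (intro CollectI conjI IntI allI ballI ring_hom_memI)
  show "\<psi> \<in> extensional (carrier (washnitzer n))" by (rule ext)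
  show "\<psi> f \<in> carrier (washnitzer m)" if "f \<in> carrier (washnitzer n)" for f
    by (rule c[OF that])
  show "\<psi> (f \<otimes>\<^bsub>washnitzer n\<^esub> g) = \<psi> f \<otimes>\<^bsub>washnitzer m\<^esub> \<psi> g"
    if fg: "f \<in> carrier (washnitzer n)" "g \<in> carrier (washnitzer n)" for f g
    by (rule series_eqI[of _ m])
      (use fg in \<open>simp_all add: c e washnitzer_mult_closed eval_mult[OF fg y] eval_mult[OF c[OF fg(1)] c[OF fg(2)]]\<close>)
  show "\<psi> (f \<oplus>\<^bsub>washnitzer n\<^esub> g) = \<psi> f \<oplus>\<^bsub>washnitzer m\<^esub> \<psi> g"
    if fg: "f \<in> carrier (washnitzer n)" "g \<in> carrier (washnitzer n)" for f g
    by (rule series_eqI[of _ m])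
      (use fg in \<open>simp_all add: washnitzer_add c e washnitzer_add_closed eval_add[OF fg y] eval_add[OF c[OF fg(1)] c[OF fg(2)]]\<close>)
  show "\<psi> \<one>\<^bsub>washnitzer n\<^esub> = \<one>\<^bsub>washnitzer m\<^esub>"
    by (rule series_eqI[of _ m]) (simp_all add: c e washnitzer_one_closed eval_one)
  show "\<psi> (a \<odot>\<^bsub>washnitzer n\<^esub> f) = a \<odot>\<^bsub>washnitzer m\<^esub> \<psi> f" if f: "f \<in> carrier (washnitzer n)" for a f
    by (rule series_eqI[of _ m])
      (use f in \<open>simp_all add: washnitzer_smult c e washnitzer_smult_closed eval_smult[OF f y] eval_smult[OF c[OF f]]\<close>)
qed

text \<open>By \<open>compose_series\<close> each f evaluated at the transformed points is again a
  series; the algebra laws hold because they hold at points.\<close>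

lemma washnitzer_hom_exists:
  fixes F :: "nat \<Rightarrow> 'p::prime_card padic_series"
  assumes F: "\<And>i. i < n \<Longrightarrow> F i \<in> carrier (washnitzer m)" "\<And>i. i < n \<Longrightarrow> coeff_bound (F i) 1 1"
  obtains \<psi> where "\<psi> \<in> algebra_hom (washnitzer n) (washnitzer m)" "\<And>i. i < n \<Longrightarrow> \<psi> (washnitzer_var i) = F i"
proof -
  let ?y = "\<lambda>x i. eval_series (F i) x"
  have y: "?y x \<in> padic_points n" if "x \<in> padic_points m" for x
    using eval_in_padic_ints[OF F(1) that F(2)] by (simp add: padic_points_def)
  have "\<exists>h. f \<in> carrier (washnitzer n) \<longrightarrow> h \<in> carrier (washnitzer m) \<and>
      (\<forall>x\<in>padic_points m. eval_series h x = eval_series f (?y x))" for f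
    using compose_series[of f n F m, OF _ F] by blast
  then obtain \<xi> where \<xi>: "\<And>f. f \<in> carrier (washnitzer n) \<Longrightarrow> \<xi> f \<in> carrier (washnitzer m)"
    "\<And>f x. f \<in> carrier (washnitzer n) \<Longrightarrow> x \<in> padic_points m \<Longrightarrow> eval_series (\<xi> f) x = eval_series f (?y x)"
    by metis
  define \<psi> where "\<psi> = restrict \<xi> (carrier (washnitzer n))"
  have "\<psi> \<in> algebra_hom (washnitzer n) (washnitzer m)"
    by (rule washnitzer_homI[of _ _ _ ?y]) (use \<xi> y in \<open>auto simp: \<psi>_def\<close>)
  moreover have "\<psi> (washnitzer_var i) = F i" if "i < n" for i
    by (rule series_eqI[of _ m])
      (simp_all add: \<psi>_def \<xi> F(1) washnitzer_var_closed that eval_var)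
  ultimately show ?thesis using that by blast
qed

section \<open>Iterated differences of functions on a group\<close>

text \<open>
  This is the value of the linear extension of \<open>f\<close> to the group ring at
  \<open>u * (h\<^sub>1 - 1) * \<dots> * (h\<^sub>m - 1)\<close>.
\<close>

primrec word_diff ::
    "('g, 'm) monoid_scheme \<Rightarrow> ('g \<Rightarrow> 'p::prime_card padic) \<Rightarrow> 'g \<Rightarrow> 'g list \<Rightarrow> 'p padic" where
  "word_diff G f u [] = f u"
| "word_diff G f u (h # hs) = word_diff G f (u \<otimes>\<^bsub>G\<^esub> h) hs - word_diff G f u hs"

lemma word_diff_append:
  "word_diff G f u (hs @ ks) = word_diff G (\<lambda>v. word_diff G f v ks) u hs"
  by (induction hs arbitrary: u) simp_all

lemma word_diff_sum:
  "word_diff G (\<lambda>v. \<Sum>j\<in>J. c j * f j v) u hs = (\<Sum>j\<in>J. c j * word_diff G (f j) u hs)"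
  by (induction hs arbitrary: u) (simp_all add: sum_subtractf algebra_simps)

lemma word_diff_add: "word_diff G (\<lambda>v. f v + f' v) u hs = word_diff G f u hs + word_diff G f' u hs"
  by (induction hs arbitrary: u) simp_all

lemma word_diff_diff: "word_diff G (\<lambda>v. f v - f' v) u hs = word_diff G f u hs - word_diff G f' u hs"
  by (induction hs arbitrary: u) simp_all

lemma word_diff_cmult: "word_diff G (\<lambda>v. c * f v) u hs = c * word_diff G f u hs"
  by (induction hs arbitrary: u) (simp_all add: algebra_simps)

lemma pascal_sum:
  fixes a :: "nat \<Rightarrow> 'a::comm_semiring_1"
  shows "(\<Sum>j\<le>Suc n. of_nat (Suc n choose j) * a j) = (\<Sum>j\<le>n. of_nat (n choose j) * (a (Suc j) + a j))"
proof -
  have "(\<Sum>j\<le>Suc n. of_nat (Suc n choose j) * a j) =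
      a 0 + (\<Sum>j\<le>n. of_nat ((n choose j) + (n choose Suc j)) * a (Suc j))"
    by (subst sum.atMost_Suc_shift) simp
  also have "\<dots> = (\<Sum>j\<le>n. of_nat (n choose j) * a (Suc j)) + (a 0 + (\<Sum>j\<le>n. of_nat (n choose Suc j) * a (Suc j)))"
    by (simp add: sum.distrib algebra_simps)
  also have "a 0 + (\<Sum>j\<le>n. of_nat (n choose Suc j) * a (Suc j)) = (\<Sum>j\<le>Suc n. of_nat (n choose j) * a j)"
    by (subst sum.atMost_Suc_shift) simp
  also have "\<dots> = (\<Sum>j\<le>n. of_nat (n choose j) * a j)" by (simp add: binomial_eq_0)
  finally show ?thesis by (simp add: sum.distrib algebra_simps)
qed

context group
begin

lemma l_inv_cancel: "x \<in> carrier G \<Longrightarrow> y \<in> carrier G \<Longrightarrow> inv x \<otimes> (x \<otimes> y) = y"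
  and r_inv_cancel: "x \<in> carrier G \<Longrightarrow> y \<in> carrier G \<Longrightarrow> x \<otimes> (inv x \<otimes> y) = y"
  by (simp_all flip: m_assoc)

lemma word_diff_cong:
  assumes "\<And>v. v \<in> carrier G \<Longrightarrow> f v = f' v" "u \<in> carrier G" "set hs \<subseteq> carrier G"
  shows "word_diff G f u hs = word_diff G f' u hs"
  using assms(2,3) by (induction hs arbitrary: u) (simp_all add: assms(1))

lemma word_diff_norm_le:
  assumes "\<And>v. v \<in> carrier G \<Longrightarrow> padic_norm (f v) \<le> B" "u \<in> carrier G" "set hs \<subseteq> carrier G"
  shows "padic_norm (word_diff G f u hs) \<le> B"
  using assms(2,3) by (induction hs arbitrary: u) (simp_all add: assms(1) padic_norm_diff_le)

text \<open>In the group ring, hk - 1 = (h - 1) + (k - 1) + (h - 1)(k - 1).\<close>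

lemma word_diff_mult:
  assumes "u \<in> carrier G" "set A \<subseteq> carrier G" "h \<in> carrier G" "k \<in> carrier G" "set B \<subseteq> carrier G"
  shows "word_diff G f u (A @ (h \<otimes> k) # B) =
    word_diff G f u (A @ h # B) + word_diff G f u (A @ k # B) + word_diff G f u (A @ h # k # B)"
proof -
  have "word_diff G f u (A @ (h \<otimes> k) # B) = word_diff G (\<lambda>v. word_diff G f v (h # B) +
      word_diff G f v (k # B) + word_diff G f v (h # k # B)) u A"
    unfolding word_diff_append by (rule word_diff_cong) (use assms in \<open>auto simp: m_assoc\<close>)
  thus ?thesis by (simp only: word_diff_add word_diff_append)
qed

text \<open>With hk = c kh, the difference hk - kh is (c - 1) + (c - 1)(kh - 1) in the group
  ring.\<close>

lemma word_diff_swap: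
  assumes "u \<in> carrier G" "set A \<subseteq> carrier G" "h \<in> carrier G" "k \<in> carrier G" "set B \<subseteq> carrier G"
  defines "c \<equiv> h \<otimes> k \<otimes> inv h \<otimes> inv k"
  shows "word_diff G f u (A @ h # k # B) = word_diff G f u (A @ k # h # B) +
    word_diff G f u (A @ c # B) + word_diff G f u (A @ c # (k \<otimes> h) # B)"
proof -
  have c: "c \<in> carrier G" "c \<otimes> (k \<otimes> h) = h \<otimes> k"
    using assms by (simp_all add: m_assoc l_inv_cancel)
  have "word_diff G f u (A @ h # k # B) = word_diff G (\<lambda>v. word_diff G f v (k # h # B) +
      word_diff G f v (c # B) + word_diff G f v (c # (k \<otimes> h) # B)) u A"
    unfolding word_diff_append
  proof (rule word_diff_cong)
    fix v assume v: "v \<in> carrier G"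
    have "v \<otimes> c \<otimes> (k \<otimes> h) = v \<otimes> h \<otimes> k" "v \<otimes> (k \<otimes> h) = v \<otimes> k \<otimes> h"
      using v c assms by (simp_all add: m_assoc)
    thus "word_diff G f v (h # k # B) = word_diff G f v (k # h # B) +
      word_diff G f v (c # B) + word_diff G f v (c # (k \<otimes> h) # B)" by simp
  qed (use assms in auto)
  thus ?thesis by (simp only: word_diff_add word_diff_append)
qed

text \<open>The binomial expansion of h^n = (1 + (h - 1))^n.\<close>

lemma newton_forward:
  assumes "v \<in> carrier G" "h \<in> carrier G"
  shows "F (v \<otimes> h [^] n) = (\<Sum>j\<le>n. of_nat (n choose j) * word_diff G F v (replicate j h))"
  using assms(1)
proof (induction n arbitrary: v)
  case (Suc n)
  have "F (v \<otimes> h [^] Suc n) = F ((v \<otimes> h) \<otimes> h [^] n)"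
    using Suc.prems assms(2) by (subst nat_pow_Suc2) (simp_all add: m_assoc)
  also have "\<dots> = (\<Sum>j\<le>n. of_nat (n choose j) * word_diff G F (v \<otimes> h) (replicate j h))"
    using Suc.prems assms(2) by (intro Suc.IH) simp
  also have "\<dots> = (\<Sum>j\<le>n. of_nat (n choose j) * (word_diff G F v (replicate (Suc j) h) + word_diff G F v (replicate j h)))"
    by simp
  finally show ?case by (simp only: pascal_sum)
qed simp

lemma word_diff_pow:
  assumes "u \<in> carrier G" "set A \<subseteq> carrier G" "h \<in> carrier G" "set B \<subseteq> carrier G"
  shows "word_diff G f u (A @ (h [^] n) # B) =
    (\<Sum>j\<in>{1..n}. of_nat (n choose j) * word_diff G f u (A @ replicate j h @ B))"
proof -
  have "word_diff G f u (A @ (h [^] n) # B) =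
      word_diff G (\<lambda>v. \<Sum>j\<in>{1..n}. of_nat (n choose j) * word_diff G f v (replicate j h @ B)) u A"
    unfolding word_diff_append[of G f u A]
  proof (rule word_diff_cong)
    fix v assume v: "v \<in> carrier G"
    have "word_diff G f v (h [^] n # B) = (\<lambda>w. word_diff G f w B) (v \<otimes> h [^] n) - word_diff G f v B" by simp
    also have "(\<lambda>w. word_diff G f w B) (v \<otimes> h [^] n) =
        (\<Sum>j\<le>n. of_nat (n choose j) * word_diff G (\<lambda>w. word_diff G f w B) v (replicate j h))"
      using newton_forward[OF v assms(3), of "\<lambda>w. word_diff G f w B" n] .
    also have "\<dots> = (\<Sum>j\<in>insert 0 {1..n}. of_nat (n choose j) * word_diff G f v (replicate j h @ B))"
      unfolding word_diff_append by (rule sum.cong) auto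
    finally show "word_diff G f v (h [^] n # B) =
        (\<Sum>j\<in>{1..n}. of_nat (n choose j) * word_diff G f v (replicate j h @ B))"
      by (simp del: sum.cl_ivl_Suc)
  qed (use assms in auto)
  thus ?thesis by (simp only: word_diff_sum word_diff_append)
qed

end

section \<open>p-valued groups\<close>

locale p_valued =
  fixes G :: "('g, 'm) monoid_scheme" (structure) and T :: "'g topology" and \<omega> :: "'g \<Rightarrow> ereal"
    and ptype :: "'p::prime_card itself"
  assumes p_valued: "p_valued_group CARD('p) G T \<omega>"
begin

lemma is_topological_group: "is_topological_group G T"
  and compact: "compact_space T" and hausdorff: "Hausdorff_space T"
  using p_valued by (auto simp: p_valued_group_def pro_p_group_def)

lemma group_G: "group G" and topspace_T [simp]: "topspace T = carrier G"
  and continuous_mult: "continuous_map (prod_topology T T) T (\<lambda>(x, y). x \<otimes> y)"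
  using is_topological_group by (auto simp: is_topological_group_def)

sublocale group G by (rule group_G)

lemma omega_one [simp]: "\<omega> \<one> = \<infinity>"
  and omega_finite: "h \<in> carrier G \<Longrightarrow> h \<noteq> \<one> \<Longrightarrow> 0 < \<omega> h \<and> \<omega> h < \<infinity>"
  and omega_gt: "h \<in> carrier G \<Longrightarrow> ereal (1 / (real CARD('p) - 1)) < \<omega> h"
  and omega_inv_mult: "h \<in> carrier G \<Longrightarrow> k \<in> carrier G \<Longrightarrow> min (\<omega> h) (\<omega> k) \<le> \<omega> (inv h \<otimes> k)"
  and omega_commutator: "h \<in> carrier G \<Longrightarrow> k \<in> carrier G \<Longrightarrow> \<omega> h + \<omega> k \<le> \<omega> (h \<otimes> k \<otimes> inv h \<otimes> inv k)"
  and omega_pow_p: "h \<in> carrier G \<Longrightarrow> \<omega> (h [^] CARD('p)) = \<omega> h + 1"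
  and omega_nhd: "0 < (\<nu>::real) \<Longrightarrow> \<exists>U. openin T U \<and> \<one> \<in> U \<and> U \<subseteq> {h\<in>carrier G. ereal \<nu> \<le> \<omega> h}"
  and nhd_omega: "openin T U \<Longrightarrow> \<one> \<in> U \<Longrightarrow> \<exists>\<nu>::real. 0 < \<nu> \<and> {h\<in>carrier G. ereal \<nu> \<le> \<omega> h} \<subseteq> U"
  using p_valued unfolding p_valued_group_def by auto

lemma p_gt_1: "1 < CARD('p)" "1 < real CARD('p)"
  using card_prime_gt_1[where 'p = 'p] by auto

lemma omega_pos: "h \<in> carrier G \<Longrightarrow> 0 < \<omega> h"
  using omega_gt[of h] p_gt_1 by (intro less_trans[OF _ omega_gt]) auto

lemma omega_inv [simp]: "h \<in> carrier G \<Longrightarrow> \<omega> (inv h) = \<omega> h"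
  using omega_inv_mult[of h \<one>] omega_inv_mult[of "inv h" \<one>] by (intro antisym) auto

lemma omega_mult: "h \<in> carrier G \<Longrightarrow> k \<in> carrier G \<Longrightarrow> min (\<omega> h) (\<omega> k) \<le> \<omega> (h \<otimes> k)"
  using omega_inv_mult[of "inv h" k] by simp

lemma omega_mult_ge: "h \<in> carrier G \<Longrightarrow> k \<in> carrier G \<Longrightarrow> c \<le> \<omega> h \<Longrightarrow> c \<le> \<omega> k \<Longrightarrow> c \<le> \<omega> (h \<otimes> k)"
  using omega_mult[of h k] by (metis min.bounded_iff order_trans)

lemma omega_commutator_ge_right:
  assumes "h \<in> carrier G" "k \<in> carrier G"
  shows "\<omega> k \<le> \<omega> (h \<otimes> k \<otimes> inv h \<otimes> inv k)"
  using omega_commutator[OF assms] omega_pos[OF assms(1)]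
  by (meson add_increasing less_imp_le order_refl order_trans)

text \<open>A conjugate of k is a commutator [h, k] times k, and the commutator has at least the
  weight of k. Thus the subgroups defined by \<omega> are normal.\<close>

lemma omega_conj:
  assumes "h \<in> carrier G" "k \<in> carrier G" "c \<le> \<omega> k"
  shows "c \<le> \<omega> (h \<otimes> k \<otimes> inv h)"
proof -
  have "c \<le> \<omega> (h \<otimes> k \<otimes> inv h \<otimes> inv k)"
    using omega_commutator_ge_right[OF assms(1,2)] assms(3) by (rule order_trans[rotated])
  hence "c \<le> \<omega> ((h \<otimes> k \<otimes> inv h \<otimes> inv k) \<otimes> k)"
    by (rule omega_mult_ge[OF _ assms(2) _ assms(3), rotated]) (use assms in simp)
  also have "(h \<otimes> k \<otimes> inv h \<otimes> inv k) \<otimes> k = h \<otimes> k \<otimes> inv h"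
    using assms by (simp add: m_assoc)
  finally show ?thesis .
qed

lemma omega_conj':
  assumes "h \<in> carrier G" "k \<in> carrier G" "c \<le> \<omega> k"
  shows "c \<le> \<omega> (inv h \<otimes> k \<otimes> h)"
  using omega_conj[of "inv h" k c] assms by simp

lemma omega_nat_pow_ge: "h \<in> carrier G \<Longrightarrow> c \<le> \<omega> h \<Longrightarrow> c \<le> \<omega> (h [^] (n::nat))"
  by (induction n) (auto intro: omega_mult_ge)

lemma omega_pow_p_power: "h \<in> carrier G \<Longrightarrow> \<omega> (h [^] (CARD('p) ^ j)) = \<omega> h + ereal (real j)"
proof (induction j)
  case (Suc j)
  have "h [^] (CARD('p) ^ Suc j) = (h [^] (CARD('p) ^ j)) [^] CARD('p)"
    using Suc.prems by (simp add: nat_pow_pow mult.commute)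
  hence "\<omega> (h [^] (CARD('p) ^ Suc j)) = \<omega> h + (ereal (real j) + ereal 1)"
    using Suc omega_pow_p[of "h [^] (CARD('p) ^ j)"] by (simp only: nat_pow_closed one_ereal_def add.assoc)
  thus ?case by (simp add: add.commute)
qed (simp add: zero_ereal_def)

lemma omega_int_pow_ge:
  assumes "h \<in> carrier G" "int (CARD('p) ^ j) dvd a"
  shows "\<omega> h + ereal (real j) \<le> \<omega> (h [^] (a::int))"
proof -
  obtain b where b: "a = int (CARD('p) ^ j) * b" using assms(2) by blast
  have "h [^] a = (h [^] (CARD('p) ^ j)) [^] b"
    unfolding b int_pow_pow[OF assms(1), symmetric] int_pow_int ..
  moreover have "\<omega> h + ereal (real j) \<le> \<omega> ((h [^] (CARD('p) ^ j)) [^] n)" for n :: nat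
    by (rule omega_nat_pow_ge) (use assms(1) in \<open>simp_all add: omega_pow_p_power\<close>)
  ultimately show ?thesis using assms(1) by (cases b rule: int_cases2) (simp_all add: int_pow_int int_pow_neg_int)
qed

lemma padic_norm_of_int_le_iff:
  "padic_norm (of_int a :: 'p padic) \<le> 1 / real CARD('p) ^ j \<longleftrightarrow> int (CARD('p) ^ j) dvd a"
proof (cases a rule: int_cases2)
  case (nonneg n)
  thus ?thesis using padic_norm_of_nat_le_iff[of n j, where 'p = 'p] by (simp flip: of_nat_power)
next
  case (nonpos n)
  thus ?thesis using padic_norm_of_nat_le_iff[of n j, where 'p = 'p] by (simp add: padic_norm_minus flip: of_nat_power)
qed

lemma omega_int_pow_diff:
  assumes "h \<in> carrier G" "padic_norm (of_int a - of_int b :: 'p padic) \<le> 1 / real CARD('p) ^ j"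
  shows "\<omega> h + ereal (real j) \<le> \<omega> (inv (h [^] a) \<otimes> h [^] b)"
proof -
  have "int (CARD('p) ^ j) dvd b - a"
    using assms(2) padic_norm_of_int_le_iff[of "b - a" j] by (simp add: padic_norm_diff_commute)
  moreover have "inv (h [^] a) \<otimes> h [^] b = h [^] (b - a)"
    using assms(1) by (simp add: int_pow_neg[symmetric] int_pow_mult[symmetric])
  ultimately show ?thesis using omega_int_pow_ge[OF assms(1)] by simp
qed

lemma eq_if_omega_unbounded:
  assumes "h \<in> carrier G" "k \<in> carrier G" "\<And>j::nat. ereal (real j) \<le> \<omega> (inv h \<otimes> k)"
  shows "h = k"
proof -
  have "\<omega> (inv h \<otimes> k) = \<infinity>"
    using assms(3) by (meson ereal_top less_eq_ereal_def order_trans real_arch_simple ereal_less_eq(3))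
  hence "inv h \<otimes> k = \<one>" using omega_finite[of "inv h \<otimes> k"] assms by auto
  thus ?thesis using assms by (metis inv_equality inv_inv inv_closed)
qed

section \<open>Powers with p-adic exponents\<close>

lemma omega_subgroup_closedin:
  assumes "h \<in> carrier G" "0 < (\<nu>::real)"
  shows "closedin T {k \<in> carrier G. ereal \<nu> \<le> \<omega> (inv h \<otimes> k)}" (is "closedin T ?C")
proof -
  \<comment> \<open>The complement is a union of cosets of the same subgroup, and around each of its
    points a translated neighbourhood of 1 stays in the coset.\<close>
  have "openin T (carrier G - ?C)"
  proof (subst openin_subopen, intro ballI)
    fix k assume k: "k \<in> carrier G - ?C"
    obtain U where U: "openin T U" "\<one> \<in> U" "U \<subseteq> {h\<in>carrier G. ereal \<nu> \<le> \<omega> h}"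
      using omega_nhd[OF assms(2)] by blast
    define V where "V = {l \<in> topspace T. inv k \<otimes> l \<in> U}"
    have "continuous_map T T (\<lambda>l. (\<lambda>(x, y). x \<otimes> y) (inv k, l))"
      using k by (intro continuous_map_compose[OF _ continuous_mult, unfolded o_def]
          continuous_map_pairedI) auto
    hence V: "openin T V" unfolding V_def by (auto dest: openin_continuous_map_preimage[OF _ U(1)])
    have kV: "k \<in> V" using k U(2) by (simp add: V_def)
    have "V \<subseteq> carrier G - ?C"
    proof (intro subsetI DiffI notI)
      fix l assume l: "l \<in> V"
      show "l \<in> carrier G" using l by (simp add: V_def)
      assume lC: "l \<in> ?C"
      have "ereal \<nu> \<le> \<omega> (inv k \<otimes> l)" using l U(3) by (auto simp: V_def)
      hence "ereal \<nu> \<le> \<omega> (inv h \<otimes> l \<otimes> inv (inv k \<otimes> l))"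
        by (intro omega_mult_ge[of "inv h \<otimes> l"]) (use lC k assms(1) in auto)
      also have "inv h \<otimes> l \<otimes> inv (inv k \<otimes> l) = inv h \<otimes> k"
        using lC k assms(1) by (simp add: inv_mult_group m_assoc r_inv_cancel)
      finally show False using k by simp
    qed
    thus "\<exists>V. openin T V \<and> k \<in> V \<and> V \<subseteq> carrier G - ?C" using V kV by blast
  qed
  thus ?thesis by (simp add: closedin_def)
qed

text \<open>Compactness replaces completeness of G: the cosets of shrinking subgroups around the
  powers h^b, with b running through integer approximations of x, are closed and nested, hence have
  a common point.\<close>

lemma padic_pow_limit_exists:
  assumes h: "h \<in> carrier G" and x: "x \<in> (padic_ints :: 'p padic set)"
  shows "\<exists>y\<in>carrier G. \<forall>j a. padic_norm (x - of_int a) \<le> 1 / real CARD('p) ^ j \<longrightarrow>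
    ereal (real j) \<le> \<omega> (inv (h [^] a) \<otimes> y)"
proof -
  have "\<forall>j. \<exists>b. padic_norm (x - of_nat b) \<le> 1 / real CARD('p) ^ j" using padic_ints_approx_nat[OF x] by blast
  then obtain b where b: "\<And>j. padic_norm (x - of_nat (b j)) \<le> 1 / real CARD('p) ^ j" by metis
  have cmp: "ereal (real j) \<le> \<omega> (inv (h [^] c) \<otimes> h [^] c')"
    if "padic_norm (x - of_int c) \<le> 1 / real CARD('p) ^ j" "padic_norm (x - of_int c') \<le> 1 / real CARD('p) ^ j" for c c' :: int and j
  proof -
    have "padic_norm (of_int c - of_int c' :: 'p padic) \<le> 1 / real CARD('p) ^ j"
      using padic_norm_diff_le[OF that(2,1)] by simp
    from omega_int_pow_diff[OF h this] omega_pos[OF h] show ?thesis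
      by (meson add_increasing less_imp_le order_refl order_trans)
  qed
  \<comment> \<open>\<open>Suc j\<close> keeps the level positive, as closedness requires.\<close>
  define C where "C j = {k \<in> carrier G. ereal (real (Suc j)) \<le> \<omega> (inv (h [^] int (b (Suc j))) \<otimes> k)}" for j
  have mono: "1 / real CARD('p) ^ n \<le> 1 / real CARD('p) ^ m" if "m \<le> n" for m n
    using p_gt_1 that by (simp add: frac_le power_increasing)
  have "(\<Inter>j. C j) \<noteq> {}"
  proof (rule compact_space_imp_nest[OF compact])
    show "closedin T (C j)" for j
      unfolding C_def using h by (intro omega_subgroup_closedin) auto
    have "h [^] int (b (Suc j)) \<in> C j" for j
      using h by (simp add: C_def)
    thus "C j \<noteq> {}" for j by blast
    show "decseq C"
    proof (rule decseq_SucI, rule subsetI)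
      fix j k assume k: "k \<in> C (Suc j)"
      have kG: "k \<in> carrier G" using k by (simp add: C_def)
      let ?u = "h [^] int (b (Suc j))" and ?v = "h [^] int (b (Suc (Suc j)))"
      have "ereal (real (Suc j)) \<le> \<omega> (inv ?u \<otimes> ?v)"
        using b[of "Suc j"] b[of "Suc (Suc j)"] mono[of "Suc j" "Suc (Suc j)"] by (intro cmp) auto
      moreover have "ereal (real (Suc j)) \<le> \<omega> (inv ?v \<otimes> k)"
        using k by (auto simp: C_def intro: order_trans[rotated])
      ultimately have "ereal (real (Suc j)) \<le> \<omega> ((inv ?u \<otimes> ?v) \<otimes> (inv ?v \<otimes> k))"
        by (rule omega_mult_ge[rotated 2]) (use h kG in auto)
      also have "(inv ?u \<otimes> ?v) \<otimes> (inv ?v \<otimes> k) = inv ?u \<otimes> k"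
        using h kG by (simp add: m_assoc r_inv_cancel)
      finally show "k \<in> C j" using kG by (simp add: C_def)
    qed
  qed
  then obtain y where y: "\<And>j. y \<in> C j" by blast
  have yG: "y \<in> carrier G" using y[of 0] by (simp add: C_def)
  show ?thesis
  proof (intro bexI[OF _ yG] allI impI)
    fix j and a :: int assume a: "padic_norm (x - of_int a) \<le> 1 / real CARD('p) ^ j"
    let ?v = "h [^] int (b (Suc j))"
    have "padic_norm (x - of_int (int (b (Suc j)))) \<le> 1 / real CARD('p) ^ j"
      using b[of "Suc j"] mono[of j "Suc j"] by simp
    hence "ereal (real j) \<le> \<omega> (inv (h [^] a) \<otimes> ?v)" using a by (intro cmp)
    moreover have "ereal (real j) \<le> \<omega> (inv ?v \<otimes> y)"
      using y[of j] by (auto simp: C_def intro: order_trans[rotated])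
    ultimately have "ereal (real j) \<le> \<omega> ((inv (h [^] a) \<otimes> ?v) \<otimes> (inv ?v \<otimes> y))"
      by (rule omega_mult_ge[rotated 2]) (use h yG in auto)
    also have "(inv (h [^] a) \<otimes> ?v) \<otimes> (inv ?v \<otimes> y) = inv (h [^] a) \<otimes> y"
      using h yG by (simp add: m_assoc r_inv_cancel)
    finally show "ereal (real j) \<le> \<omega> (inv (h [^] a) \<otimes> y)" .
  qed
qed

text \<open>The point found by compactness is the limit along every integer sequence tending to x.
  Such sequences exist and T is Hausdorff, so it alone satisfies the description in
  \<open>padic_pow\<close>.\<close>

lemma
  assumes h: "h \<in> carrier G" and x: "x \<in> (padic_ints :: 'p padic set)"
  shows padic_pow_closed: "padic_pow G T h x \<in> carrier G"
    and padic_pow_approx: "padic_norm (x - of_int a) \<le> 1 / real CARD('p) ^ j \<Longrightarrow>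
      ereal (real j) \<le> \<omega> (inv (h [^] a) \<otimes> padic_pow G T h x)"
proof -
  obtain y where y: "y \<in> carrier G" "\<And>j a. padic_norm (x - of_int a) \<le> 1 / real CARD('p) ^ j \<Longrightarrow>
    ereal (real j) \<le> \<omega> (inv (h [^] a) \<otimes> y)"
    using padic_pow_limit_exists[OF h x] by blast
  have lim: "limitin T (\<lambda>n. h [^] a n) y sequentially" if a: "(\<lambda>n. of_int (a n)) \<longlonglongrightarrow> x" for a :: "nat \<Rightarrow> int"
    unfolding limitin_def
  proof (intro conjI allI impI)
    show "y \<in> topspace T" using y by simp
    fix U assume U: "openin T U \<and> y \<in> U"
    define V where "V = {l \<in> topspace T. y \<otimes> l \<in> U}"
    have "continuous_map T T (\<lambda>l. (\<lambda>(x, y). x \<otimes> y) (y, l))"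
      using y by (intro continuous_map_compose[OF _ continuous_mult, unfolded o_def] continuous_map_pairedI) auto
    hence "openin T V" unfolding V_def using openin_continuous_map_preimage[of T T _ U] U by auto
    moreover have "\<one> \<in> V" using y U by (simp add: V_def)
    ultimately obtain \<nu> :: real where \<nu>: "{h\<in>carrier G. ereal \<nu> \<le> \<omega> h} \<subseteq> V" using nhd_omega by blast
    obtain j :: nat where j: "\<nu> \<le> real j" using real_arch_simple by blast
    have "0 < 1 / real CARD('p) ^ j" using p_gt_1 by simp
    hence "\<forall>\<^sub>F n in sequentially. dist (of_int (a n)) x < 1 / real CARD('p) ^ j"
      using a tendstoD by blast
    thus "\<forall>\<^sub>F n in sequentially. h [^] a n \<in> U"
    proof eventually_elim
      case (elim n)
      have "ereal (real j) \<le> \<omega> (inv (h [^] a n) \<otimes> y)"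
        using elim by (intro y(2)) (simp add: dist_padic_def padic_norm_diff_commute)
      hence "ereal \<nu> \<le> \<omega> (inv (inv (h [^] a n) \<otimes> y))"
        using j h y(1) by (simp add: order_trans[of "ereal \<nu>" "ereal (real j)"])
      hence "inv (inv (h [^] a n) \<otimes> y) \<in> V" using \<nu> h y(1) by auto
      moreover have "y \<otimes> inv (inv (h [^] a n) \<otimes> y) = h [^] a n"
        using h y(1) by (simp add: inv_mult_group r_inv_cancel)
      ultimately show ?case by (simp add: V_def)
    qed
  qed
  have "padic_pow G T h x = y"
    unfolding padic_pow_def
  proof (rule the_equality)
    show "y \<in> carrier G \<and> (\<forall>a. (\<lambda>n. of_int (a n)) \<longlonglongrightarrow> x \<longrightarrow> limitin T (\<lambda>n. h [^] a n) y sequentially)"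
      using y(1) lim by blast
    fix y' assume y': "y' \<in> carrier G \<and> (\<forall>a. (\<lambda>n. of_int (a n)) \<longlonglongrightarrow> x \<longrightarrow> limitin T (\<lambda>n. h [^] a n) y' sequentially)"
    obtain a :: "nat \<Rightarrow> nat" where a: "(\<lambda>n. of_nat (a n)) \<longlonglongrightarrow> x" using padic_ints_limit_nat[OF x] .
    hence "(\<lambda>n. of_int (int (a n))) \<longlonglongrightarrow> x" by simp
    hence "limitin T (\<lambda>n. h [^] int (a n)) y' sequentially" "limitin T (\<lambda>n. h [^] int (a n)) y sequentially"
      using y' lim[of "\<lambda>n. int (a n)"] by auto
    thus "y' = y" by (rule limitin_Hausdorff_unique[OF _ _ _ hausdorff]) simp
  qed
  thus "padic_pow G T h x \<in> carrier G"
    and "padic_norm (x - of_int a) \<le> 1 / real CARD('p) ^ j \<Longrightarrow> ereal (real j) \<le> \<omega> (inv (h [^] a) \<otimes> padic_pow G T h x)"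
    using y by auto
qed

lemma padic_pow_eqI:
  assumes h: "h \<in> carrier G" and x: "x \<in> (padic_ints :: 'p padic set)" and y: "y \<in> carrier G"
    and a: "\<And>j. \<exists>a. padic_norm (x - of_int a) \<le> 1 / real CARD('p) ^ j \<and> ereal (real j) \<le> \<omega> (inv (h [^] a) \<otimes> y)"
  shows "padic_pow G T h x = y"
proof (rule eq_if_omega_unbounded[OF padic_pow_closed[OF h x] y])
  fix j :: nat
  let ?z = "padic_pow G T h x"
  have z: "?z \<in> carrier G" by (rule padic_pow_closed[OF h x])
  obtain a where a: "padic_norm (x - of_int a) \<le> 1 / real CARD('p) ^ j" "ereal (real j) \<le> \<omega> (inv (h [^] a) \<otimes> y)"
    using a by blast
  have "ereal (real j) \<le> \<omega> (inv (inv (h [^] a) \<otimes> ?z) \<otimes> (inv (h [^] a) \<otimes> y))"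
    by (rule omega_mult_ge[OF _ _ _ a(2)]) (use h y z padic_pow_approx[OF h x a(1)] in auto)
  also have "inv (inv (h [^] a) \<otimes> ?z) \<otimes> (inv (h [^] a) \<otimes> y) = inv ?z \<otimes> y"
    using h y z by (simp add: inv_mult_group m_assoc r_inv_cancel)
  finally show "ereal (real j) \<le> \<omega> (inv ?z \<otimes> y)" .
qed

lemma padic_ints_approx_int:
  assumes "x \<in> (padic_ints :: 'p padic set)"
  obtains a :: int where "padic_norm (x - of_int a) \<le> 1 / real CARD('p) ^ j"
  using padic_ints_approx_nat[OF assms, of j] by (metis of_int_of_nat_eq)

lemma padic_pow_of_nat: "h \<in> carrier G \<Longrightarrow> padic_pow G T h (of_nat n :: 'p padic) = h [^] n"
  using p_gt_1 by (intro padic_pow_eqI exI[of _ "int n"]) (simp_all add: int_pow_int)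

lemma padic_pow_0: "h \<in> carrier G \<Longrightarrow> padic_pow G T h (0 :: 'p padic) = \<one>"
  using padic_pow_of_nat[of h 0] by simp

text \<open>The error of the first factor is moved past h^b by conjugation, which does not lower
  \<omega>.\<close>

lemma padic_pow_add:
  assumes h: "h \<in> carrier G" and x: "x \<in> (padic_ints :: 'p padic set)" and y: "y \<in> padic_ints"
  shows "padic_pow G T h (x + y) = padic_pow G T h x \<otimes> padic_pow G T h y"
proof (rule padic_pow_eqI[OF h padic_ints_add[OF x y]])
  let ?X = "padic_pow G T h x" and ?Y = "padic_pow G T h y"
  have c: "?X \<in> carrier G" "?Y \<in> carrier G" using padic_pow_closed h x y by auto
  thus "?X \<otimes> ?Y \<in> carrier G" by simp
  fix j
  obtain a :: int where a: "padic_norm (x - of_int a) \<le> 1 / real CARD('p) ^ j" using padic_ints_approx_int[OF x] .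
  obtain b :: int where b: "padic_norm (y - of_int b) \<le> 1 / real CARD('p) ^ j" using padic_ints_approx_int[OF y] .
  let ?A = "h [^] a" and ?B = "h [^] b"
  have ab: "?A \<in> carrier G" "?B \<in> carrier G" using h by auto
  have 1: "ereal (real j) \<le> \<omega> (inv ?A \<otimes> ?X)" by (rule padic_pow_approx[OF h x a])
  have 2: "ereal (real j) \<le> \<omega> (inv ?B \<otimes> ?Y)" by (rule padic_pow_approx[OF h y b])
  have "ereal (real j) \<le> \<omega> ((inv ?B \<otimes> (inv ?A \<otimes> ?X) \<otimes> ?B) \<otimes> (inv ?B \<otimes> ?Y))"
    by (rule omega_mult_ge[OF _ _ omega_conj'[OF _ _ 1] 2]) (use ab c in auto)
  also have "(inv ?B \<otimes> (inv ?A \<otimes> ?X) \<otimes> ?B) \<otimes> (inv ?B \<otimes> ?Y) = inv (?A \<otimes> ?B) \<otimes> (?X \<otimes> ?Y)"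
    using ab c by (simp add: inv_mult_group m_assoc r_inv_cancel)
  also have "?A \<otimes> ?B = h [^] (a + b)" using h by (simp add: int_pow_mult)
  finally have "ereal (real j) \<le> \<omega> (inv (h [^] (a + b)) \<otimes> (?X \<otimes> ?Y))" .
  moreover have "padic_norm (x + y - of_int (a + b)) \<le> 1 / real CARD('p) ^ j"
    using padic_norm_add_le[OF a b] by (simp add: algebra_simps)
  ultimately show "\<exists>a. padic_norm (x + y - of_int a) \<le> 1 / real CARD('p) ^ j \<and>
    ereal (real j) \<le> \<omega> (inv (h [^] a) \<otimes> (?X \<otimes> ?Y))" by blast
qed

lemma padic_pow_inv:
  assumes h: "h \<in> carrier G" and x: "x \<in> (padic_ints :: 'p padic set)"
  shows "padic_pow G T (inv h) x = inv (padic_pow G T h x)"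
proof (rule padic_pow_eqI[OF _ x])
  let ?X = "padic_pow G T h x"
  have c: "?X \<in> carrier G" using padic_pow_closed h x by auto
  show "inv h \<in> carrier G" "inv ?X \<in> carrier G" using h c by auto
  fix j
  obtain a :: int where a: "padic_norm (x - of_int a) \<le> 1 / real CARD('p) ^ j" using padic_ints_approx_int[OF x] .
  let ?A = "h [^] a"
  have A: "?A \<in> carrier G" using h by auto
  have 1: "ereal (real j) \<le> \<omega> (inv ?A \<otimes> ?X)" by (rule padic_pow_approx[OF h x a])
  have "ereal (real j) \<le> \<omega> (?A \<otimes> inv (inv ?A \<otimes> ?X) \<otimes> inv ?A)"
    by (rule omega_conj) (use A c 1 in auto)
  also have "?A \<otimes> inv (inv ?A \<otimes> ?X) \<otimes> inv ?A = inv (inv h [^] a) \<otimes> inv ?X"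
    using A c h by (simp add: inv_mult_group m_assoc int_pow_inv)
  finally show "\<exists>a. padic_norm (x - of_int a) \<le> 1 / real CARD('p) ^ j \<and> ereal (real j) \<le> \<omega> (inv (inv h [^] a) \<otimes> inv ?X)"
    using a by blast
qed

end

section \<open>Nilpotence of the augmentation ideal modulo powers of p\<close>

context p_valued
begin

text \<open>The step 1 / p is at most 1 / (p - 1), the lower bound for \<omega>, and at most 1. So
  commutators with G and p-th powers both move down one step: each layer of \<open>filt n\<close>
  over \<open>filt (Suc n)\<close> is central of exponent p.\<close>

definition filt :: "nat \<Rightarrow> 'g set" where
  "filt n = {h \<in> carrier G. ereal (real n / real CARD('p)) \<le> \<omega> h}"

lemma filt_carrier: "h \<in> filt n \<Longrightarrow> h \<in> carrier G"
  by (simp add: filt_def)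

lemma filt_subset: "filt n \<subseteq> carrier G"
  by (auto simp: filt_def)

lemma filt_0 [simp]: "filt 0 = carrier G"
  using omega_pos by (auto simp: filt_def less_imp_le simp flip: zero_ereal_def)

lemma filt_mult: "h \<in> filt n \<Longrightarrow> k \<in> filt n \<Longrightarrow> h \<otimes> k \<in> filt n"
  by (auto simp: filt_def intro: omega_mult_ge)

lemma filt_inv: "h \<in> filt n \<Longrightarrow> inv h \<in> filt n"
  by (simp add: filt_def)

lemma filt_conj: "h \<in> carrier G \<Longrightarrow> k \<in> filt n \<Longrightarrow> inv h \<otimes> k \<otimes> h \<in> filt n"
  by (auto simp: filt_def intro: omega_conj')

lemma filt_mono: "m \<le> n \<Longrightarrow> filt n \<subseteq> filt m"
  by (auto simp: filt_def divide_right_mono elim!: order_trans[rotated])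

lemma omega_ge_inverse_p:
  assumes "h \<in> carrier G" shows "ereal (1 / real CARD('p)) \<le> \<omega> h"
proof -
  have "1 / real CARD('p) \<le> 1 / (real CARD('p) - 1)" using p_gt_1 by (intro divide_left_mono) auto
  hence "ereal (1 / real CARD('p)) \<le> ereal (1 / (real CARD('p) - 1))" by simp
  thus ?thesis using omega_gt[OF assms] by (meson less_imp_le order_trans)
qed

lemma filt_Suc_eq: "ereal (real (Suc n) / real CARD('p)) = ereal (real n / real CARD('p)) + ereal (1 / real CARD('p))"
  by (simp add: add_divide_distrib)

lemma filt_commutator:
  assumes "c \<in> filt n" "h \<in> carrier G"
  shows "inv c \<otimes> inv h \<otimes> c \<otimes> h \<in> filt (Suc n)"
proof -
  have c: "c \<in> carrier G" "ereal (real n / real CARD('p)) \<le> \<omega> c" using assms(1) by (auto simp: filt_def)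
  have "ereal (real (Suc n) / real CARD('p)) \<le> \<omega> (inv c) + \<omega> (inv h)"
    unfolding filt_Suc_eq using c assms omega_ge_inverse_p by (intro add_mono) auto
  also have "\<dots> \<le> \<omega> (inv c \<otimes> inv h \<otimes> inv (inv c) \<otimes> inv (inv h))"
    using c assms by (intro omega_commutator) auto
  finally show ?thesis using c assms by (simp add: filt_def)
qed

lemma filt_pow_p:
  assumes "c \<in> filt n" shows "c [^] CARD('p) \<in> filt (Suc n)"
proof -
  have c: "c \<in> carrier G" "ereal (real n / real CARD('p)) \<le> \<omega> c" using assms by (auto simp: filt_def)
  have "ereal (1 / real CARD('p)) \<le> 1" using p_gt_1 by (simp add: one_ereal_def)
  hence "ereal (real (Suc n) / real CARD('p)) \<le> \<omega> c + 1"
    unfolding filt_Suc_eq using c by (intro add_mono) auto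
  thus ?thesis using c by (simp add: filt_def omega_pow_p)
qed

lemma translate_open:
  assumes "openin T U" "h \<in> carrier G"
  shows "openin T {l \<in> carrier G. h \<otimes> l \<in> U}"
proof -
  have "continuous_map T T (\<lambda>l. (\<lambda>(x, y). x \<otimes> y) (h, l))"
    using assms(2) by (intro continuous_map_compose[OF _ continuous_mult, unfolded o_def] continuous_map_pairedI) auto
  thus ?thesis by (auto dest: openin_continuous_map_preimage[OF _ assms(1)])
qed

lemma filt_nhd: "\<exists>U. openin T U \<and> \<one> \<in> U \<and> U \<subseteq> filt n"
proof (cases "n = 0")
  case True
  thus ?thesis using openin_topspace[of T] by (intro exI[of _ "topspace T"]) auto
next
  case False
  thus ?thesis using omega_nhd[of "real n / real CARD('p)"] p_gt_1 by (simp add: filt_def)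
qed

lemma nhd_filt:
  assumes "openin T U" "\<one> \<in> U"
  shows "\<exists>n. filt n \<subseteq> U"
proof -
  obtain \<nu> :: real where \<nu>: "{h\<in>carrier G. ereal \<nu> \<le> \<omega> h} \<subseteq> U" using nhd_omega[OF assms] by blast
  obtain n :: nat where n: "\<nu> * real CARD('p) \<le> real n" using real_arch_simple by blast
  have "\<nu> \<le> real n / real CARD('p)" using n p_gt_1 by (simp add: field_simps)
  hence "ereal \<nu> \<le> \<omega> h" if "ereal (real n / real CARD('p)) \<le> \<omega> h" for h
    using that by (meson ereal_less_eq(3) order_trans)
  thus ?thesis using \<nu> by (auto simp: filt_def)
qed

lemma compact_cover:
  assumes "\<And>h. h \<in> carrier G \<Longrightarrow> openin T (V h)" "\<And>h. h \<in> carrier G \<Longrightarrow> h \<in> V h"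
  shows "\<exists>D. finite D \<and> D \<subseteq> carrier G \<and> carrier G \<subseteq> \<Union> (V ` D)"
proof -
  have "(\<forall>U\<in>V ` carrier G. openin T U) \<and> topspace T \<subseteq> \<Union> (V ` carrier G)"
    using assms by auto
  then obtain F where F: "finite F" "F \<subseteq> V ` carrier G" "topspace T \<subseteq> \<Union>F"
    using compact unfolding compact_space_alt by meson
  then obtain D where "D \<subseteq> carrier G" "finite D" "F = V ` D"
    using finite_subset_image[OF F(1,2)] by blast
  thus ?thesis using F(3) by auto
qed

text \<open>By compactness finitely many translates of a neighbourhood of 1 inside
  \<open>filt (Suc n)\<close> cover G, and the centres lying in \<open>filt n\<close> serve as
  representatives.\<close>

lemma filt_cosets_finite:
  "\<exists>C. finite C \<and> C \<subseteq> filt n \<and> (\<forall>c\<in>filt n. \<exists>c0\<in>C. \<exists>k\<in>filt (Suc n). c = c0 \<otimes> k)"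
proof -
  obtain U where U: "openin T U" "\<one> \<in> U" "U \<subseteq> filt (Suc n)" using filt_nhd by blast
  define V where "V h = {l \<in> carrier G. inv h \<otimes> l \<in> U}" for h
  have V: "openin T (V h)" "h \<in> V h" if "h \<in> carrier G" for h
    using translate_open[OF U(1), of "inv h"] that U(2) by (auto simp: V_def)
  obtain D where D: "finite D" "D \<subseteq> carrier G" "carrier G \<subseteq> \<Union> (V ` D)"
    using compact_cover[of V] V(1,2) by blast
  show ?thesis
  proof (intro exI[of _ "D \<inter> filt n"] conjI ballI)
    show "finite (D \<inter> filt n)" "D \<inter> filt n \<subseteq> filt n" using D by auto
    fix c assume c: "c \<in> filt n"
    then obtain c0 where c0: "c0 \<in> D" "c \<in> V c0" using D(3) filt_carrier by blast
    have k: "inv c0 \<otimes> c \<in> filt (Suc n)" using c0(2) U(3) by (auto simp: V_def)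
    have G: "c \<in> carrier G" "c0 \<in> carrier G" using c c0 D filt_carrier by auto
    have "c \<otimes> inv (inv c0 \<otimes> c) \<in> filt n"
      using k filt_mono[of n "Suc n"] by (intro filt_mult[OF c] filt_inv) auto
    hence "c0 \<in> filt n" using G by (simp add: inv_mult_group r_inv_cancel)
    moreover have "c = c0 \<otimes> (inv c0 \<otimes> c)" using G by (simp add: r_inv_cancel)
    ultimately show "\<exists>c0\<in>D \<inter> filt n. \<exists>k\<in>filt (Suc n). c = c0 \<otimes> k" using c0(1) k by blast
  qed
qed

text \<open>Modulo p^N the function lives on the cosets of the normal subgroup
  \<open>filt n\<close>.\<close>

definition inv_mod :: "('g \<Rightarrow> 'p padic) \<Rightarrow> nat \<Rightarrow> nat \<Rightarrow> bool" where
  "inv_mod f n N \<longleftrightarrow> (\<forall>u\<in>carrier G. \<forall>h\<in>filt n. padic_norm (f (u \<otimes> h) - f u) \<le> 1 / real CARD('p) ^ N)"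

text \<open>Uniform continuity on a compact group, for right translation: the local levels are
  finitely many after passing to a finite subcover, and their maximum serves everywhere.\<close>

lemma continuous_inv_mod:
  assumes "continuous_map T euclidean f"
  shows "\<exists>n. inv_mod f n N"
proof -
  define e where "e = 1 / real CARD('p) ^ N"
  have e: "e > 0" unfolding e_def using p_gt_1 by simp
  have "\<exists>n V. openin T V \<and> u \<in> V \<and> (\<forall>v\<in>V. \<forall>h\<in>filt n. padic_norm (f (v \<otimes> h) - f v) \<le> e)"
    if u: "u \<in> carrier G" for u
  proof -
    have "openin T {v \<in> topspace T. f v \<in> ball (f u) e}"
      by (rule openin_continuous_map_preimage[OF assms]) auto
    from translate_open[OF this u]
    have "openin T {l \<in> carrier G. u \<otimes> l \<in> {v \<in> topspace T. f v \<in> ball (f u) e}}" .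
    then obtain n where n: "filt n \<subseteq> {l \<in> carrier G. u \<otimes> l \<in> {v \<in> topspace T. f v \<in> ball (f u) e}}"
      using nhd_filt e u by fastforce
    obtain U where U: "openin T U" "\<one> \<in> U" "U \<subseteq> filt n" using filt_nhd by blast
    let ?V = "{l \<in> carrier G. inv u \<otimes> l \<in> U}"
    have "padic_norm (f (v \<otimes> h) - f v) \<le> e" if v: "v \<in> ?V" and h: "h \<in> filt n" for v h
    proof -
      have k: "inv u \<otimes> v \<in> filt n" using v U(3) by auto
      have G: "v \<in> carrier G" "h \<in> carrier G" using v h filt_carrier by auto
      have "u \<otimes> (inv u \<otimes> v) = v" "u \<otimes> ((inv u \<otimes> v) \<otimes> h) = v \<otimes> h"
        using u G by (simp_all add: r_inv_cancel m_assoc)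
      hence "f v \<in> ball (f u) e" "f (v \<otimes> h) \<in> ball (f u) e"
        using subsetD[OF n k] subsetD[OF n filt_mult[OF k h]] by auto
      thus ?thesis
        using padic_norm_diff_le[of "f u - f v" e "f u - f (v \<otimes> h)"] by (simp add: dist_padic_def)
    qed
    moreover have "openin T ?V" "u \<in> ?V" using translate_open[OF U(1), of "inv u"] u U(2) by auto
    ultimately show ?thesis by blast
  qed
  then obtain m V where V: "\<And>u. u \<in> carrier G \<Longrightarrow> openin T (V u)" "\<And>u. u \<in> carrier G \<Longrightarrow> u \<in> V u"
    "\<And>u v h. u \<in> carrier G \<Longrightarrow> v \<in> V u \<Longrightarrow> h \<in> filt (m u) \<Longrightarrow> padic_norm (f (v \<otimes> h) - f v) \<le> e"
    by metis
  obtain D where D: "finite D" "D \<subseteq> carrier G" "carrier G \<subseteq> \<Union> (V ` D)"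
    using compact_cover[of V] V(1,2) by blast
  define n where "n = Max (insert 0 (m ` D))"
  have "padic_norm (f (v \<otimes> h) - f v) \<le> e" if v: "v \<in> carrier G" and h: "h \<in> filt n" for v h
  proof -
    obtain u where u: "u \<in> D" "v \<in> V u" using v D(3) by blast
    have "m u \<le> n" unfolding n_def using u(1) D(1) by (intro Max_ge) auto
    thus ?thesis using V(3)[of u v h] u D(2) h filt_mono[of "m u" n] by blast
  qed
  thus ?thesis unfolding inv_mod_def e_def by blast
qed

text \<open>A right factor h passes the letter b as its conjugate under b, which stays in
  \<open>filt n\<close>.\<close>

lemma inv_mod_word_diff:
  assumes f: "inv_mod f n N" and B: "set B \<subseteq> carrier G"
  shows "inv_mod (\<lambda>v. word_diff G f v B) n N"
  unfolding inv_mod_def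
proof (intro ballI)
  fix u h assume "u \<in> carrier G" "h \<in> filt n"
  thus "padic_norm (word_diff G f (u \<otimes> h) B - word_diff G f u B) \<le> 1 / real CARD('p) ^ N"
    using B
  proof (induction B arbitrary: u h)
    case Nil thus ?case using f by (simp add: inv_mod_def)
  next
    case (Cons b B)
    have G: "b \<in> carrier G" "h \<in> carrier G" using Cons.prems filt_carrier by auto
    have e: "u \<otimes> h \<otimes> b = (u \<otimes> b) \<otimes> (inv b \<otimes> h \<otimes> b)"
      using G Cons.prems by (simp add: m_assoc r_inv_cancel)
    have "padic_norm (word_diff G f (u \<otimes> h \<otimes> b) B - word_diff G f (u \<otimes> b) B) \<le> 1 / real CARD('p) ^ N"
      unfolding e using Cons.prems G by (intro Cons.IH filt_conj) auto
    moreover have "padic_norm (word_diff G f (u \<otimes> h) B - word_diff G f u B) \<le> 1 / real CARD('p) ^ N"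
      using Cons.prems by (intro Cons.IH) auto
    ultimately show ?case
      using padic_norm_diff_le[of "word_diff G f (u \<otimes> h \<otimes> b) B - word_diff G f (u \<otimes> b) B"
          "1 / real CARD('p) ^ N" "word_diff G f (u \<otimes> h) B - word_diff G f u B"]
      by (simp add: algebra_simps)
  qed
qed

lemma word_diff_small_letter:
  assumes "inv_mod f n N" "u \<in> carrier G" "set A \<subseteq> carrier G" "h \<in> filt n" "set B \<subseteq> carrier G"
  shows "padic_norm (word_diff G f u (A @ h # B)) \<le> 1 / real CARD('p) ^ N"
  unfolding word_diff_append
proof (rule word_diff_norm_le[OF _ assms(2,3)])
  fix v assume "v \<in> carrier G"
  thus "padic_norm (word_diff G f v (h # B)) \<le> 1 / real CARD('p) ^ N"
    using inv_mod_word_diff[OF assms(1,5)] assms(4) by (simp add: inv_mod_def)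
qed

text \<open>The letter c is central modulo \<open>filt (Suc n)\<close>: the products c h and h c
  differ by a commutator on the right.\<close>

lemma word_diff_swap_mod:
  assumes f: "inv_mod f (Suc n) N" and u: "u \<in> carrier G" and A: "set A \<subseteq> carrier G" and c: "c \<in> filt n"
    and h: "h \<in> carrier G" and B: "set B \<subseteq> carrier G"
  shows "padic_norm (word_diff G f u (A @ c # h # B) - word_diff G f u (A @ h # c # B)) \<le> 1 / real CARD('p) ^ N"
  unfolding word_diff_append[of G f u A] word_diff_diff[symmetric]
proof (rule word_diff_norm_le[OF _ u A])
  fix v assume v: "v \<in> carrier G"
  have cG: "c \<in> carrier G" using c filt_carrier by blast
  have e: "v \<otimes> c \<otimes> h = (v \<otimes> h \<otimes> c) \<otimes> (inv c \<otimes> inv h \<otimes> c \<otimes> h)"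
    using v cG h by (simp add: m_assoc r_inv_cancel)
  have "padic_norm (word_diff G f (v \<otimes> c \<otimes> h) B - word_diff G f (v \<otimes> h \<otimes> c) B) \<le> 1 / real CARD('p) ^ N"
    unfolding e using inv_mod_word_diff[OF f B] filt_commutator[OF c h] v h cG by (simp add: inv_mod_def)
  thus "padic_norm (word_diff G f v (c # h # B) - word_diff G f v (h # c # B)) \<le> 1 / real CARD('p) ^ N"
    by simp
qed

lemma word_diff_move_mod:
  assumes f: "inv_mod f (Suc n) N" and u: "u \<in> carrier G" and c: "c \<in> filt n" and B: "set B \<subseteq> carrier G"
  shows "set A \<subseteq> carrier G \<Longrightarrow> set hs \<subseteq> carrier G \<Longrightarrow>
    padic_norm (word_diff G f u (A @ c # hs @ B) - word_diff G f u (A @ hs @ c # B)) \<le> 1 / real CARD('p) ^ N"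
proof (induction hs arbitrary: A)
  case (Cons h hs)
  have "padic_norm (word_diff G f u (A @ c # h # (hs @ B)) - word_diff G f u (A @ h # c # (hs @ B))) \<le> 1 / real CARD('p) ^ N"
    using Cons.prems B by (intro word_diff_swap_mod[OF f u _ c]) auto
  moreover have "padic_norm (word_diff G f u ((A @ [h]) @ c # hs @ B) - word_diff G f u ((A @ [h]) @ hs @ c # B)) \<le> 1 / real CARD('p) ^ N"
    using Cons.prems by (intro Cons.IH) auto
  ultimately show ?case
    using padic_norm_add_le[of "word_diff G f u (A @ c # h # (hs @ B)) - word_diff G f u (A @ h # c # (hs @ B))"
      "1 / real CARD('p) ^ N" "word_diff G f u ((A @ [h]) @ c # hs @ B) - word_diff G f u ((A @ [h]) @ hs @ c # B)"]
    by simp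
qed simp

text \<open>Letters from \<open>filt n\<close> commute modulo \<open>filt (Suc n)\<close>, so the
  copies of c can be collected in front.\<close>

lemma word_diff_partition_mod:
  assumes f: "inv_mod f (Suc n) N"
  shows "u \<in> carrier G \<Longrightarrow> set cs \<subseteq> filt n \<Longrightarrow>
    padic_norm (word_diff G f u cs - word_diff G f u (filter ((=) c) cs @ filter ((\<noteq>) c) cs)) \<le> 1 / real CARD('p) ^ N"
proof (induction cs arbitrary: u)
  case (Cons x xs)
  let ?P = "filter ((=) c) xs @ filter ((\<noteq>) c) xs"
  have x: "x \<in> carrier G" using Cons.prems filt_carrier by auto
  have "padic_norm (word_diff G f (u \<otimes> x) xs - word_diff G f (u \<otimes> x) ?P) \<le> 1 / real CARD('p) ^ N"
    "padic_norm (word_diff G f u xs - word_diff G f u ?P) \<le> 1 / real CARD('p) ^ N"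
    using Cons.prems x by (auto intro!: Cons.IH)
  from padic_norm_diff_le[OF this]
  have 1: "padic_norm (word_diff G f u (x # xs) - word_diff G f u (x # ?P)) \<le> 1 / real CARD('p) ^ N"
    by (simp add: algebra_simps)
  show ?case
  proof (cases "c = x")
    case True thus ?thesis using 1 by simp
  next
    case False
    have "set xs \<subseteq> carrier G" using Cons.prems(2) filt_subset[of n] by auto
    hence "padic_norm (word_diff G f u ([] @ x # filter ((=) c) xs @ filter ((\<noteq>) c) xs) -
        word_diff G f u ([] @ filter ((=) c) xs @ x # filter ((\<noteq>) c) xs)) \<le> 1 / real CARD('p) ^ N"
      using Cons.prems by (intro word_diff_move_mod[OF f, of u x]) auto
    from padic_norm_add_le[OF 1 this] False show ?thesis by (simp del: word_diff.simps)
  qed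
qed simp

lemma padic_norm_prime_choose:
  assumes "0 < j" "j < CARD('p)"
  shows "padic_norm (of_nat (CARD('p) choose j) :: 'p padic) \<le> 1 / real CARD('p)"
  using padic_norm_of_nat_le_iff[of "CARD('p) choose j" 1, where 'p = 'p] assms
    dvd_choose_prime[OF assms(2) _ _ prime_card[where 'a = 'p]] by simp

text \<open>Modulo p the binomial theorem gives (c - 1)^p = c^p - 1, and c^p lies in
  \<open>filt (Suc n)\<close>, where the function is invariant.\<close>

lemma word_diff_replicate_p_mod:
  assumes f: "inv_mod f (Suc n) 1" and i: "\<And>v. v \<in> carrier G \<Longrightarrow> padic_norm (f v) \<le> 1"
    and u: "u \<in> carrier G" and c: "c \<in> filt n" and B: "set B \<subseteq> carrier G"
  shows "padic_norm (word_diff G f u (replicate CARD('p) c @ B)) \<le> 1 / real CARD('p)"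
proof -
  let ?e = "1 / real CARD('p)"
  have cG: "c \<in> carrier G" using c filt_carrier by blast
  have "word_diff G f u ([] @ (c [^] CARD('p)) # B) =
      (\<Sum>j\<in>{1..CARD('p)}. of_nat (CARD('p) choose j) * word_diff G f u ([] @ replicate j c @ B))"
    using u cG B by (intro word_diff_pow) auto
  also have "{1..CARD('p)} = insert CARD('p) {1..<CARD('p)}" using p_gt_1 by auto
  also have "(\<Sum>j\<in>insert CARD('p) {1..<CARD('p)}. of_nat (CARD('p) choose j) * word_diff G f u ([] @ replicate j c @ B)) =
      word_diff G f u (replicate CARD('p) c @ B) +
      (\<Sum>j\<in>{1..<CARD('p)}. of_nat (CARD('p) choose j) * word_diff G f u (replicate j c @ B))"
    by simp
  finally have "word_diff G f u (replicate CARD('p) c @ B) = word_diff G f u ([] @ (c [^] CARD('p)) # B) -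
      (\<Sum>j\<in>{1..<CARD('p)}. of_nat (CARD('p) choose j) * word_diff G f u (replicate j c @ B))"
    by simp
  moreover have "padic_norm (word_diff G f u ([] @ (c [^] CARD('p)) # B)) \<le> ?e"
    using word_diff_small_letter[OF f u _ filt_pow_p[OF c] B, of "[]"] by simp
  moreover have "padic_norm (\<Sum>j\<in>{1..<CARD('p)}. of_nat (CARD('p) choose j) * word_diff G f u (replicate j c @ B)) \<le> ?e"
  proof (rule padic_norm_sum_le)
    fix j assume j: "j \<in> {1..<CARD('p)}"
    have "padic_norm (word_diff G f u (replicate j c @ B)) \<le> 1"
      using i u cG B by (intro word_diff_norm_le) (auto simp: set_replicate_conv_if)
    hence "padic_norm (of_nat (CARD('p) choose j) :: 'p padic) * padic_norm (word_diff G f u (replicate j c @ B)) \<le> ?e * 1"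
      using padic_norm_prime_choose[of j] j by (intro mult_mono) (auto simp: padic_norm_nonneg)
    thus "padic_norm (of_nat (CARD('p) choose j) * word_diff G f u (replicate j c @ B)) \<le> ?e"
      by (simp add: padic_norm_mult)
  qed simp
  ultimately show ?thesis by (simp add: padic_norm_diff_le)
qed

text \<open>In group ring terms: a product of R elements s - 1 with s in S vanishes in the group
  algebra of G modulo \<open>filt n\<close> over the field with p elements.\<close>

definition kills :: "nat \<Rightarrow> 'g set \<Rightarrow> nat \<Rightarrow> bool" where
  "kills R S n \<longleftrightarrow> (\<forall>f cs u. (\<forall>v\<in>carrier G. padic_norm (f v :: 'p padic) \<le> 1) \<longrightarrow> inv_mod f n 1 \<longrightarrow>
    set cs \<subseteq> S \<longrightarrow> R \<le> length cs \<longrightarrow> u \<in> carrier G \<longrightarrow> padic_norm (word_diff G f u cs) \<le> 1 / real CARD('p))"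

lemma killsD:
  assumes "kills R S n" "\<And>v. v \<in> carrier G \<Longrightarrow> padic_norm (f v :: 'p padic) \<le> 1" "inv_mod f n 1"
    "set cs \<subseteq> S" "R \<le> length cs" "u \<in> carrier G"
  shows "padic_norm (word_diff G f u cs) \<le> 1 / real CARD('p)"
  using assms unfolding kills_def by blast

text \<open>Collect the copies of c in front. Either there are p of them, which suffice by
  themselves, or fewer, and then at least R letters from S remain.\<close>

lemma kills_finite:
  assumes "finite S" "S \<subseteq> filt n"
  shows "\<exists>R. kills R S (Suc n)"
  using assms
proof (induction S)
  case empty
  show ?case by (rule exI[of _ 1]) (auto simp: kills_def)
next
  case (insert c S)
  then obtain R where R: "kills R S (Suc n)" by auto
  have c: "c \<in> filt n" "c \<in> carrier G" and S: "S \<subseteq> carrier G"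
    using insert.prems filt_carrier filt_subset[of n] by auto
  have "kills (R + CARD('p)) (insert c S) (Suc n)"
    unfolding kills_def
  proof (intro allI impI)
    fix f :: "'g \<Rightarrow> 'p padic" and cs u
    assume f: "\<forall>v\<in>carrier G. padic_norm (f v) \<le> 1" "inv_mod f (Suc n) 1"
      and cs: "set cs \<subseteq> insert c S" "R + CARD('p) \<le> length cs" and u: "u \<in> carrier G"
    let ?A = "filter ((=) c) cs" and ?B = "filter ((\<noteq>) c) cs"
    have 1: "padic_norm (word_diff G f u cs - word_diff G f u (?A @ ?B)) \<le> 1 / real CARD('p)"
      using word_diff_partition_mod[OF f(2) u, of cs c] cs(1) insert.prems by auto
    have len: "length ?A + length ?B = length cs" using sum_length_filter_compl[of "(=) c" cs] by simp
    have AC: "set ?A \<subseteq> carrier G" "set ?B \<subseteq> carrier G" using cs(1) c S by auto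
    have 2: "padic_norm (word_diff G f u (?A @ ?B)) \<le> 1 / real CARD('p)"
    proof (cases "CARD('p) \<le> length ?A")
      case True
      then obtain k where k: "length ?A = CARD('p) + k" using le_Suc_ex by blast
      have A: "?A = replicate CARD('p) c @ replicate k c"
        using replicate_length_filter[of c cs, unfolded k replicate_add] by (rule sym)
      have "padic_norm (word_diff G f u (replicate CARD('p) c @ (replicate k c @ ?B))) \<le> 1 / real CARD('p)"
        using f u c AC by (intro word_diff_replicate_p_mod[OF f(2)]) (auto simp: set_replicate_conv_if)
      thus ?thesis unfolding A append.assoc .
    next
      case False
      hence "R \<le> length ?B" using len cs(2) by linarith
      show ?thesis
        unfolding word_diff_append
      proof (rule word_diff_norm_le[OF _ u AC(1)])
        fix v assume v: "v \<in> carrier G"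
        show "padic_norm (word_diff G f v ?B) \<le> 1 / real CARD('p)"
          using f cs(1) \<open>R \<le> length ?B\<close> v by (intro killsD[OF R]) auto
      qed
    qed
    show "padic_norm (word_diff G f u cs) \<le> 1 / real CARD('p)"
      using padic_norm_add_le[OF 1 2] by simp
  qed
  thus ?case by blast
qed

text \<open>Modulo p only the cosets of the letters modulo \<open>filt (Suc n)\<close> matter, and
  these have finitely many representatives.\<close>

lemma kills_filt: "\<exists>R. kills R (filt n) (Suc n)"
proof -
  obtain C where C: "finite C" "C \<subseteq> filt n" "\<forall>c\<in>filt n. \<exists>c0\<in>C. \<exists>k\<in>filt (Suc n). c = c0 \<otimes> k"
    using filt_cosets_finite[of n] by blast
  obtain R where R: "kills R C (Suc n)" using kills_finite[OF C(1,2)] by blast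
  obtain r where r: "\<And>c. c \<in> filt n \<Longrightarrow> r c \<in> C \<and> (\<exists>k\<in>filt (Suc n). c = r c \<otimes> k)"
    using C(3) by metis
  have "kills R (filt n) (Suc n)"
    unfolding kills_def
  proof (intro allI impI)
    fix f :: "'g \<Rightarrow> 'p padic" and cs u
    assume f: "\<forall>v\<in>carrier G. padic_norm (f v) \<le> 1" "inv_mod f (Suc n) 1"
      and cs: "set cs \<subseteq> filt n" "R \<le> length cs" and u: "u \<in> carrier G"
    have 1: "padic_norm (word_diff G f v cs - word_diff G f v (map r cs)) \<le> 1 / real CARD('p)"
      if "v \<in> carrier G" "set cs \<subseteq> filt n" for v cs
      using that
    proof (induction cs arbitrary: v)
      case (Cons c cs)
      have rc: "r c \<in> carrier G" using r Cons.prems C(2) filt_carrier by auto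
      obtain k where k: "k \<in> filt (Suc n)" "c = r c \<otimes> k" using r[of c] Cons.prems by auto
      have cG: "c \<in> carrier G" using Cons.prems filt_carrier by auto
      have "set cs \<subseteq> carrier G" using Cons.prems(2) filt_subset[of n] by auto
      hence "padic_norm (word_diff G f ((v \<otimes> r c) \<otimes> k) cs - word_diff G f (v \<otimes> r c) cs) \<le> 1 / real CARD('p)"
        using inv_mod_word_diff[OF f(2)] k(1) Cons.prems(1) rc by (simp add: inv_mod_def)
      moreover have "(v \<otimes> r c) \<otimes> k = v \<otimes> c"
        using Cons.prems(1) rc k filt_carrier by (metis m_assoc)
      ultimately have a: "padic_norm (word_diff G f (v \<otimes> c) cs - word_diff G f (v \<otimes> r c) cs) \<le> 1 / real CARD('p)"
        by simp
      have b: "padic_norm (word_diff G f (v \<otimes> r c) cs - word_diff G f (v \<otimes> r c) (map r cs)) \<le> 1 / real CARD('p)"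
        "padic_norm (word_diff G f v cs - word_diff G f v (map r cs)) \<le> 1 / real CARD('p)"
        using Cons.prems rc by (auto intro!: Cons.IH)
      from padic_norm_diff_le[OF padic_norm_add_le[OF a b(1)] b(2)] show ?case
        by (simp add: algebra_simps)
    qed simp
    have 2: "padic_norm (word_diff G f u (map r cs)) \<le> 1 / real CARD('p)"
      using f cs r u by (intro killsD[OF R]) auto
    show "padic_norm (word_diff G f u cs) \<le> 1 / real CARD('p)"
      using padic_norm_add_le[OF 1[OF u cs(1)] 2] by simp
  qed
  thus ?thesis by blast
qed

text \<open>Nilpotence of the augmentation ideal of a p-group, by induction along the central
  filtration: passing from level n to the next multiplies the number of letters by the constant R of
  the layer \<open>filt n\<close>. At level 0 the function is constant modulo p, so one letter is
  enough.\<close>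

lemma kills_carrier: "\<exists>M. kills M (carrier G) n"
proof (induction n)
  case 0
  have "kills 1 (carrier G) 0"
    unfolding kills_def
  proof (intro allI impI)
    fix f :: "'g \<Rightarrow> 'p padic" and cs u
    assume f: "inv_mod f 0 1" and cs: "set cs \<subseteq> carrier G" "1 \<le> length cs" and u: "u \<in> carrier G"
    then obtain h hs where "cs = [] @ h # hs" by (cases cs) auto
    thus "padic_norm (word_diff G f u cs) \<le> 1 / real CARD('p)"
      using word_diff_small_letter[OF f u, of "[]" h hs] cs by auto
  qed
  thus ?case by blast
next
  case (Suc n)
  then obtain M where M: "kills M (carrier G) n" by blast
  obtain R where R: "kills R (filt n) (Suc n)" using kills_filt by blast
  text \<open>A function killed by \<open>r\<close> letters from \<open>filt n\<close> is killed by \<open>r * M\<close> letters from \<open>G\<close>.\<close>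
  have step: "padic_norm (word_diff G f u hs) \<le> 1 / real CARD('p)"
    if "\<And>v. v \<in> carrier G \<Longrightarrow> padic_norm (f v) \<le> 1" "inv_mod f (Suc n) 1"
      "\<And>cs v. set cs \<subseteq> filt n \<Longrightarrow> r \<le> length cs \<Longrightarrow> v \<in> carrier G \<Longrightarrow> padic_norm (word_diff G f v cs) \<le> 1 / real CARD('p)"
      "set hs \<subseteq> carrier G" "r * M \<le> length hs" "u \<in> carrier G"
    for r and f :: "'g \<Rightarrow> 'p padic" and hs u
    using that
  proof (induction r arbitrary: f hs u)
    case 0
    show ?case using 0(3)[of "[]"] 0(4-) by (intro word_diff_norm_le) auto
  next
    case (Suc r)
    define hs1 hs2 where "hs1 = take M hs" and "hs2 = drop M hs"
    have hs: "hs = hs1 @ hs2" "M \<le> length hs1" "r * M \<le> length hs2" "set hs1 \<subseteq> carrier G" "set hs2 \<subseteq> carrier G"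
      using Suc.prems(4,5) set_take_subset[of M hs] set_drop_subset[of M hs] by (auto simp: hs1_def hs2_def)
    define F where "F = (\<lambda>v. word_diff G f v hs2)"
    have "padic_norm (F v) \<le> 1" if "v \<in> carrier G" for v
      unfolding F_def by (rule word_diff_norm_le[OF Suc.prems(1) that hs(5)])
    \<comment> \<open>A right factor c from \<open>filt n\<close> can be carried past
      \<open>hs2\<close> to the end of the word. There it is one of the \<open>Suc r\<close> letters
      that kill f, so the function \<open>fc\<close> needs only r more and the induction hypothesis
      applies.\<close>
    moreover have "inv_mod F n 1"
      unfolding inv_mod_def
    proof (intro ballI)
      fix v c assume v: "v \<in> carrier G" and c: "c \<in> filt n"
      have cG: "c \<in> carrier G" using c filt_carrier by blast
      define fc where "fc = (\<lambda>v. word_diff G f v [c])"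
      have "padic_norm (word_diff G fc v hs2) \<le> 1 / real CARD('p)"
      proof (rule Suc.IH)
        show "padic_norm (fc w) \<le> 1" if "w \<in> carrier G" for w
          unfolding fc_def using cG by (intro word_diff_norm_le[OF Suc.prems(1) that]) auto
        show "inv_mod fc (Suc n) 1" unfolding fc_def using cG by (intro inv_mod_word_diff[OF Suc.prems(2)]) auto
        show "padic_norm (word_diff G fc w cs) \<le> 1 / real CARD('p)"
          if "set cs \<subseteq> filt n" "r \<le> length cs" "w \<in> carrier G" for cs w
          unfolding fc_def word_diff_append[symmetric] using that c by (intro Suc.prems(3)) auto
      qed (use hs v in auto)
      hence 1: "padic_norm (word_diff G f v ([] @ hs2 @ c # [])) \<le> 1 / real CARD('p)"
        by (simp add: fc_def word_diff_append)
      have 2: "padic_norm (word_diff G f v ([] @ c # hs2 @ []) - word_diff G f v ([] @ hs2 @ c # [])) \<le> 1 / real CARD('p)"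
        using word_diff_move_mod[OF Suc.prems(2) v c, of "[]" "[]" hs2] hs(5) by simp
      from padic_norm_add_le[OF 2 1] show "padic_norm (F (v \<otimes> c) - F v) \<le> 1 / real CARD('p) ^ 1"
        by (simp add: F_def)
    qed
    ultimately have "padic_norm (word_diff G F u hs1) \<le> 1 / real CARD('p)"
      using hs Suc.prems(6) by (intro killsD[OF M]) auto
    thus ?case by (simp add: hs(1) word_diff_append F_def)
  qed
  have "kills (R * M) (carrier G) (Suc n)"
    unfolding kills_def
  proof (intro allI impI)
    fix f :: "'g \<Rightarrow> 'p padic" and cs u
    assume f: "\<forall>v\<in>carrier G. padic_norm (f v) \<le> 1" "inv_mod f (Suc n) 1"
      and cs: "set cs \<subseteq> carrier G" "R * M \<le> length cs" and u: "u \<in> carrier G"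
    show "padic_norm (word_diff G f u cs) \<le> 1 / real CARD('p)"
      by (rule step[of f R cs u]) (use f cs u killsD[OF R, of f] in auto)
  qed
  thus ?case by blast
qed

text \<open>The last K letters make the function divisible by p. Dividing by p leaves an integral
  function that is invariant modulo one power of p less, and the first M letters are handled by
  induction. As the function changes in the induction, M must not depend on it.\<close>

lemma word_diff_long:
  "\<exists>M. \<forall>f u hs. (\<forall>v\<in>carrier G. padic_norm (f v :: 'p padic) \<le> 1) \<longrightarrow> inv_mod f n N \<longrightarrow> u \<in> carrier G \<longrightarrow>
    set hs \<subseteq> carrier G \<longrightarrow> M \<le> length hs \<longrightarrow> padic_norm (word_diff G f u hs) \<le> 1 / real CARD('p) ^ N"
proof (induction N)
  case 0
  show ?case by (intro exI[of _ 0] allI impI) (simp add: word_diff_norm_le)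
next
  case (Suc N)
  obtain M where M: "\<forall>f u hs. (\<forall>v\<in>carrier G. padic_norm (f v :: 'p padic) \<le> 1) \<longrightarrow> inv_mod f n N \<longrightarrow> u \<in> carrier G \<longrightarrow>
    set hs \<subseteq> carrier G \<longrightarrow> M \<le> length hs \<longrightarrow> padic_norm (word_diff G f u hs) \<le> 1 / real CARD('p) ^ N"
    using Suc by (rule exE)
  obtain K where K: "kills K (carrier G) n" using kills_carrier by blast
  show ?case
  proof (intro exI[of _ "M + K"] allI impI)
    fix f :: "'g \<Rightarrow> 'p padic" and u hs
    assume f: "\<forall>v\<in>carrier G. padic_norm (f v) \<le> 1" "inv_mod f n (Suc N)" and u: "u \<in> carrier G"
      and hs: "set hs \<subseteq> carrier G" "M + K \<le> length hs"
    define hs1 hs2 where "hs1 = take M hs" and "hs2 = drop M hs"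
    have h: "hs = hs1 @ hs2" "M \<le> length hs1" "K \<le> length hs2" "set hs1 \<subseteq> carrier G" "set hs2 \<subseteq> carrier G"
      using hs set_take_subset[of M hs] set_drop_subset[of M hs] by (auto simp: hs1_def hs2_def)
    have p: "real CARD('p) \<ge> 1" using p_gt_1 by simp
    have "1 / real CARD('p) ^ Suc N \<le> 1 / real CARD('p) ^ 1"
      using p by (intro divide_left_mono power_increasing) auto
    hence f1: "inv_mod f n 1" using f(2) unfolding inv_mod_def by (meson order_trans)
    define F where "F = (\<lambda>v. inverse (of_nat CARD('p)) * word_diff G f v hs2)"
    have np: "padic_norm (inverse (of_nat CARD('p)) :: 'p padic) = real CARD('p)"
      by (simp add: padic_norm_inverse padic_norm_p)
    have "padic_norm (F v) \<le> 1" if v: "v \<in> carrier G" for v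
      using killsD[OF K _ f1 h(5,3) v] f(1) p_gt_1 unfolding F_def padic_norm_mult np by (simp add: field_simps)
    moreover have "inv_mod F n N"
      unfolding inv_mod_def
    proof (intro ballI)
      fix v c assume v: "v \<in> carrier G" and c: "c \<in> filt n"
      have "padic_norm (word_diff G f (v \<otimes> c) hs2 - word_diff G f v hs2) \<le> 1 / real CARD('p) ^ Suc N"
        using inv_mod_word_diff[OF f(2) h(5)] v c by (simp add: inv_mod_def)
      hence "real CARD('p) * padic_norm (word_diff G f (v \<otimes> c) hs2 - word_diff G f v hs2) \<le> 1 / real CARD('p) ^ N"
        using p_gt_1 by (simp add: field_simps)
      thus "padic_norm (F (v \<otimes> c) - F v) \<le> 1 / real CARD('p) ^ N"
        by (simp add: F_def padic_norm_mult np flip: right_diff_distrib)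
    qed
    ultimately have "padic_norm (word_diff G F u hs1) \<le> 1 / real CARD('p) ^ N"
      using u h by (intro M[rule_format]) auto
    hence "real CARD('p) * padic_norm (word_diff G f u hs) \<le> 1 / real CARD('p) ^ N"
      by (simp add: F_def word_diff_cmult padic_norm_mult np h(1) word_diff_append)
    thus "padic_norm (word_diff G f u hs) \<le> 1 / real CARD('p) ^ Suc N"
      using p_gt_1 by (simp add: field_simps)
  qed
qed

end

section \<open>Coordinates of iterated differences\<close>

context p_valued
begin

lemma omega_padic_pow:
  assumes h: "h \<in> carrier G" "ereal s \<le> \<omega> h" and x: "x \<in> (padic_ints :: 'p padic set)"
    "padic_norm x \<le> 1 / real CARD('p) ^ j"
  shows "ereal (s + real j) \<le> \<omega> (padic_pow G T h x)"
proof -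
  \<comment> \<open>The precision J is at least j, so a is as divisible as x, and at least s + j, so
    the error term has enough weight.\<close>
  obtain J0 :: nat where J0: "s + real j \<le> real J0" using real_arch_simple by blast
  define J where "J = max j J0"
  obtain a :: int where a: "padic_norm (x - of_int a) \<le> 1 / real CARD('p) ^ J" using padic_ints_approx_int[OF x(1)] .
  let ?X = "padic_pow G T h x"
  have X: "?X \<in> carrier G" by (rule padic_pow_closed[OF h(1) x(1)])
  have "1 / real CARD('p) ^ J \<le> 1 / real CARD('p) ^ j"
    using p_gt_1 by (simp add: J_def frac_le power_increasing)
  hence "padic_norm (of_int a :: 'p padic) \<le> 1 / real CARD('p) ^ j"
    using padic_norm_diff_le[OF x(2), of "x - of_int a"] a by simp
  hence "\<omega> h + ereal (real j) \<le> \<omega> (h [^] a)"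
    using omega_int_pow_ge[OF h(1)] by (simp only: padic_norm_of_int_le_iff)
  moreover have "ereal s + ereal (real j) \<le> \<omega> h + ereal (real j)" using h(2) by (rule add_right_mono)
  ultimately have 1: "ereal (s + real j) \<le> \<omega> (h [^] a)" by (simp add: order_trans)
  have "ereal (s + real j) \<le> ereal (real J)" using J0 by (simp add: J_def)
  also have "\<dots> \<le> \<omega> (inv (h [^] a) \<otimes> ?X)" by (rule padic_pow_approx[OF h(1) x(1) a])
  finally have "ereal (s + real j) \<le> \<omega> (h [^] a \<otimes> (inv (h [^] a) \<otimes> ?X))"
    using 1 h X by (intro omega_mult_ge[OF _ _ 1]) auto
  thus ?thesis using h X by (simp add: r_inv_cancel)
qed

end

locale p_valued_basis = p_valued G T \<omega> ptype
  for G :: "('g, 'm) monoid_scheme" (structure) and T :: "'g topology" and \<omega> :: "'g \<Rightarrow> ereal"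
    and ptype :: "'p::prime_card itself" +
  fixes d :: nat and g :: "nat \<Rightarrow> 'g"
  assumes basis: "ordered_basis ptype G T \<omega> d g"
begin

abbreviation gprod :: "(nat \<Rightarrow> 'p padic) \<Rightarrow> 'g" where
  "gprod \<equiv> padic_pow_prod G T d g"

lemma g_closed: "i < d \<Longrightarrow> g i \<in> carrier G"
  using basis by (simp add: ordered_basis_def)

definition zbox :: "(nat \<Rightarrow> 'p padic) set" where
  "zbox = {..<d} \<rightarrow>\<^sub>E padic_ints"

definition coord :: "'g \<Rightarrow> nat \<Rightarrow> 'p padic" where
  "coord = inv_into zbox gprod"

lemma homeomorphism: "homeomorphic_map (product_topology (\<lambda>_. top_of_set (padic_ints :: 'p padic set)) {..<d}) T gprod"
  and omega_gprod: "x \<in> zbox \<Longrightarrow> \<omega> (gprod x) = (INF i\<in>{..<d}. \<omega> (g i) + padic_val (x i))"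
  using basis by (auto simp: ordered_basis_def zbox_def)

lemma gprod_bij: "bij_betw gprod zbox (carrier G)"
  using homeomorphic_imp_injective_map[OF homeomorphism] homeomorphic_imp_surjective_map[OF homeomorphism]
  by (simp add: bij_betw_def zbox_def PiE_def)

lemma gprod_cong: "(\<And>i. i < d \<Longrightarrow> x i = y i) \<Longrightarrow> gprod x = gprod y"
  unfolding padic_pow_prod_def by (intro foldr_cong) auto

lemma gprod_restrict: "gprod (restrict x {..<d}) = gprod x"
  by (rule gprod_cong) simp

lemma restrict_zbox: "x \<in> padic_points d \<Longrightarrow> restrict x {..<d} \<in> zbox"
  by (auto simp: zbox_def padic_points_def)

lemma zbox_points: "x \<in> zbox \<Longrightarrow> x \<in> padic_points d"
  by (auto simp: zbox_def padic_points_def)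

lemma gprod_closed: "x \<in> padic_points d \<Longrightarrow> gprod x \<in> carrier G"
  using bij_betwE[OF gprod_bij] restrict_zbox[of x] gprod_restrict[of x] by metis

lemma coord_zbox: "h \<in> carrier G \<Longrightarrow> coord h \<in> zbox"
  and gprod_coord: "h \<in> carrier G \<Longrightarrow> gprod (coord h) = h"
  using gprod_bij inv_into_into[of h gprod zbox] f_inv_into_f[of h gprod zbox]
  by (simp_all add: coord_def bij_betw_def)

lemma coord_points: "h \<in> carrier G \<Longrightarrow> coord h \<in> padic_points d"
  by (intro zbox_points coord_zbox)

lemma coord_gprod: "x \<in> padic_points d \<Longrightarrow> i < d \<Longrightarrow> coord (gprod x) i = x i"
proof -
  assume x: "x \<in> padic_points d" and i: "i < d"
  have "coord (gprod (restrict x {..<d})) = restrict x {..<d}"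
    unfolding coord_def using gprod_bij restrict_zbox[OF x] by (simp add: bij_betw_def inv_into_f_f)
  thus "coord (gprod x) i = x i" using i unfolding gprod_restrict by simp
qed

lemma gprod_inj:
  "x \<in> padic_points d \<Longrightarrow> y \<in> padic_points d \<Longrightarrow> gprod x = gprod y \<Longrightarrow> i < d \<Longrightarrow> x i = y i"
  using coord_gprod by metis

lemma coord_integral: "h \<in> carrier G \<Longrightarrow> i < d \<Longrightarrow> padic_norm (coord h i) \<le> 1"
  using coord_points by (auto simp: padic_points_def padic_ints_def)

lemma continuous_coord:
  assumes i: "i < d"
  shows "continuous_map T euclidean (\<lambda>h. coord h i)"
proof -
  let ?X = "product_topology (\<lambda>_. top_of_set (padic_ints :: 'p padic set)) {..<d}"
  obtain k where k: "homeomorphic_maps ?X T gprod k" using homeomorphism homeomorphic_map_maps by blast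
  have kc: "continuous_map T ?X k" "\<And>h. h \<in> carrier G \<Longrightarrow> k h \<in> zbox \<and> gprod (k h) = h"
    using k by (auto simp: homeomorphic_maps_def zbox_def continuous_map_def PiE_def)
  have "coord h = k h" if "h \<in> carrier G" for h
    using kc(2)[OF that] gprod_bij coord_zbox[OF that] gprod_coord[OF that]
    by (metis bij_betw_imp_inj_on inj_onD)
  moreover have "continuous_map T (top_of_set (padic_ints :: 'p padic set)) (\<lambda>h. k h i)"
    using continuous_map_compose[OF kc(1) continuous_map_product_projection[of i "{..<d}"]] i
    by (simp add: o_def)
  hence "continuous_map T euclidean (\<lambda>h. k h i)" by (rule continuous_map_into_fulltopology)
  ultimately show ?thesis by (subst continuous_map_eq[of T euclidean "\<lambda>h. k h i"]) auto
qed

lemma gprod_foldr_one: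
  "(\<And>i. i \<in> set is \<Longrightarrow> i < d) \<Longrightarrow>
    foldr (\<lambda>i h. padic_pow G T (g i) (0 :: 'p padic) \<otimes> h) is \<one> = \<one>"
  by (induction "is") (auto simp: padic_pow_0 g_closed)

lemma gprod_0: "gprod (\<lambda>_. 0) = \<one>"
  unfolding padic_pow_prod_def by (rule gprod_foldr_one) simp

lemma coord_one: "i < d \<Longrightarrow> coord \<one> i = 0"
  using coord_gprod[of "\<lambda>_. 0" i] by (simp add: gprod_0 padic_points_def)

lemma gprod_single:
  assumes "i < d" "x \<in> padic_ints"
  shows "gprod (\<lambda>j. if j = i then x else 0) = padic_pow G T (g i) x"
proof -
  let ?F = "\<lambda>j. padic_pow G T (g j) (if j = i then x else 0)"
  have c: "padic_pow G T (g i) x \<in> carrier G" by (rule padic_pow_closed[OF g_closed[OF assms(1)] assms(2)])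
  have "foldr (\<lambda>j h. ?F j \<otimes> h) is \<one> = (if i \<in> set is then padic_pow G T (g i) x else \<one>)"
    if "distinct is" "\<And>j. j \<in> set is \<Longrightarrow> j < d" for "is"
    using that by (induction "is") (auto simp: padic_pow_0 g_closed c)
  from this[of "[0..<d]"] show ?thesis using assms(1) by (simp add: padic_pow_prod_def)
qed

lemma g_neq_one: "i < d \<Longrightarrow> g i \<noteq> \<one>"
proof
  assume i: "i < d" and g1: "g i = \<one>"
  have "gprod (\<lambda>j. if j = i then 1 else 0) = g i"
    using gprod_single[OF i, of 1] padic_pow_of_nat[OF g_closed[OF i], of 1] g_closed[OF i] by simp
  hence "gprod (\<lambda>j. if j = i then 1 else 0) = gprod (\<lambda>_. 0)" by (simp add: g1 gprod_0)
  moreover have "(\<lambda>j. if j = i then 1 else 0) \<in> padic_points d" "(\<lambda>_. 0) \<in> padic_points d"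
    by (auto simp: padic_points_def)
  ultimately show False using gprod_inj[OF _ _ _ i] by fastforce
qed

definition wt :: "nat \<Rightarrow> real" where
  "wt i = real_of_ereal (\<omega> (g i))"

lemma omega_g: "i < d \<Longrightarrow> \<omega> (g i) = ereal (wt i)"
  using omega_finite[OF g_closed g_neq_one, of i] by (cases "\<omega> (g i)") (auto simp: wt_def)

text \<open>For d = 0 the value is unspecified; positive lower bounds for it therefore carry
  \<open>0 < d\<close>.\<close>

definition min_wt :: real where
  "min_wt = Min (wt ` {..<d})"

lemma min_wt_le: "i < d \<Longrightarrow> min_wt \<le> wt i"
  unfolding min_wt_def by (intro Min_le) auto

lemma min_wt_gt: "0 < d \<Longrightarrow> 1 / (real CARD('p) - 1) < min_wt"
proof -
  assume "0 < d"
  hence "min_wt \<in> wt ` {..<d}" unfolding min_wt_def by (intro Min_in) auto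
  then obtain i where "i < d" "min_wt = wt i" by auto
  thus ?thesis using omega_gt[OF g_closed, of i] by (simp add: omega_g)
qed

text \<open>The minimum formula bounds \<omega>(h) by each single term wt l + v(x_l).\<close>

lemma omega_coord:
  assumes h: "h \<in> carrier G" "ereal s \<le> \<omega> h" and l: "l < d"
  shows "padic_norm (coord h l) \<le> real CARD('p) powr (- (s - wt l))"
proof (cases "coord h l = 0")
  case False
  have "ereal s \<le> (INF i\<in>{..<d}. \<omega> (g i) + padic_val (coord h i))"
    using omega_gprod[OF coord_zbox[OF h(1)]] h by (simp add: gprod_coord)
  also have "\<dots> \<le> \<omega> (g l) + padic_val (coord h l)" using l by (intro INF_lower) simp
  also have "\<dots> = ereal (wt l - log (real CARD('p)) (padic_norm (coord h l)))"
    using l False by (simp add: omega_g padic_val_def)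
  finally have "log (real CARD('p)) (padic_norm (coord h l)) \<le> - (s - wt l)" by simp
  moreover have "0 < padic_norm (coord h l)"
    using False padic_norm_nonneg[of "coord h l"] padic_norm_eq_0_iff[of "coord h l"] by simp
  ultimately show ?thesis using p_gt_1 by (subst (asm) log_le_iff) auto
qed simp

text \<open>Coordinates have valuation at least 0, so no term of the minimum formula falls below the
  least basis weight.\<close>

lemma omega_ge_min_wt:
  assumes "h \<in> carrier G"
  shows "ereal min_wt \<le> \<omega> h"
proof -
  have "ereal min_wt \<le> \<omega> (g i) + padic_val (coord h i)" if i: "i < d" for i
  proof (cases "coord h i = 0")
    case False
    have "0 < padic_norm (coord h i)"
      using False padic_norm_nonneg[of "coord h i"] padic_norm_eq_0_iff[of "coord h i"] by simp
    hence "log (real CARD('p)) (padic_norm (coord h i)) \<le> 0"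
      using coord_integral[OF assms i] p_gt_1 by (subst log_le_zero_cancel_iff) auto
    thus ?thesis using False min_wt_le[OF i] i by (simp add: omega_g padic_val_def)
  qed (simp add: padic_val_def)
  hence "ereal min_wt \<le> (INF i\<in>{..<d}. \<omega> (g i) + padic_val (coord h i))" by (intro INF_greatest) auto
  thus ?thesis using omega_gprod[OF coord_zbox[OF assms]] by (simp add: gprod_coord assms)
qed

subsection \<open>Sorted words\<close>

definition list_prod :: "nat list \<Rightarrow> 'g" where
  "list_prod js = foldr (\<lambda>j h. g j \<otimes> h) js \<one>"

lemma list_prod_closed: "set js \<subseteq> {..<d} \<Longrightarrow> list_prod js \<in> carrier G"
  by (induction js) (auto simp: list_prod_def g_closed)

lemma list_prod_snoc: "set js \<subseteq> {..<d} \<Longrightarrow> j < d \<Longrightarrow> list_prod (js @ [j]) = list_prod js \<otimes> g j"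
  using list_prod_closed by (induction js) (auto simp: list_prod_def g_closed m_assoc)

lemma sorted_split_min:
  "sorted js \<Longrightarrow> set js \<subseteq> {m..} \<Longrightarrow> js = replicate (count_list js m) m @ filter ((\<noteq>) m) js"
proof (induction js)
  case (Cons x xs)
  show ?case
  proof (cases "x = m")
    case True thus ?thesis using Cons by simp
  next
    case False
    hence "m \<notin> set xs" using Cons.prems by (force simp: )
    hence "filter ((\<noteq>) m) xs = xs" by (auto intro: filter_True)
    thus ?thesis using False \<open>m \<notin> set xs\<close> by simp
  qed
qed simp

text \<open>A sorted product of basis elements collects into powers in increasing order, that is,
  into \<open>gprod\<close> at the multiplicities.\<close>

lemma list_prod_sorted_aux:
  assumes "sorted js" "set js \<subseteq> {m..<d}" "m \<le> d"
  shows "list_prod js =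
    foldr (\<lambda>i h. padic_pow G T (g i) (of_nat (count_list js i) :: 'p padic) \<otimes> h) [m..<d] \<one>"
  using assms
proof (induction "d - m" arbitrary: m js)
  case 0
  thus ?case by (simp add: list_prod_def)
next
  case (Suc n)
  hence m: "m < d" by simp
  define c where "c = count_list js m"
  define ks where "ks = filter ((\<noteq>) m) js"
  have js: "js = replicate c m @ ks"
    unfolding c_def ks_def using Suc.prems by (intro sorted_split_min) auto
  have ks: "sorted ks" "set ks \<subseteq> {Suc m..<d}"
    using Suc.prems by (auto simp: ks_def sorted_filter[of id, simplified] le_neq_implies_less Suc_le_eq)
  have ksG: "list_prod ks \<in> carrier G" using ks by (intro list_prod_closed) auto
  have rep: "list_prod (replicate c m @ ks) = g m [^] c \<otimes> list_prod ks" for c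
  proof (induction c)
    case 0 thus ?case using ksG by simp
  next
    case (Suc c)
    have "list_prod (replicate (Suc c) m @ ks) = g m \<otimes> (g m [^] c \<otimes> list_prod ks)"
      using Suc by (simp add: list_prod_def)
    also have "\<dots> = g m [^] Suc c \<otimes> list_prod ks"
      using g_closed[OF m] ksG by (subst nat_pow_Suc2) (simp_all add: m_assoc)
    finally show ?case .
  qed
  have IH: "list_prod ks = foldr (\<lambda>i h. padic_pow G T (g i) (of_nat (count_list ks i) :: 'p padic) \<otimes> h) [Suc m..<d] \<one>"
    using ks m Suc by (intro Suc.hyps(1)) auto
  have "count_list ks i = count_list js i" if "i \<in> set [Suc m..<d]" for i
    using that by (simp add: js)
  hence "list_prod ks = foldr (\<lambda>i h. padic_pow G T (g i) (of_nat (count_list js i) :: 'p padic) \<otimes> h) [Suc m..<d] \<one>"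
    unfolding IH by (intro foldr_cong) auto
  moreover have "padic_pow G T (g m) (of_nat (count_list js m) :: 'p padic) = g m [^] c"
    unfolding c_def by (rule padic_pow_of_nat[OF g_closed[OF m]])
  ultimately show ?case using m rep[of c] by (simp add: upt_conv_Cons js[symmetric])
qed

lemma coord_sorted:
  assumes "sorted js" "set js \<subseteq> {..<d}" "i < d"
  shows "coord (list_prod js) i = of_nat (count_list js i)"
proof -
  have "list_prod js = gprod (\<lambda>i. of_nat (count_list js i))"
    using list_prod_sorted_aux[of js 0] assms by (simp add: padic_pow_prod_def atLeast0LessThan)
  thus ?thesis using assms(3) coord_gprod[of "\<lambda>i. of_nat (count_list js i)" i] by (simp add: padic_points_def)
qed

text \<open>On sorted words the i-th coordinate is the multiplicity of i, hence additive in the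
  letters: a first difference is 0 or 1 and higher ones vanish. Subwords of a sorted word are
  sorted, so this covers every term of the iterated difference.\<close>

lemma word_diff_sorted:
  assumes "i < d"
  shows "sorted (A @ js) \<Longrightarrow> set (A @ js) \<subseteq> {..<d} \<Longrightarrow>
    word_diff G (\<lambda>h. coord h i) (list_prod A) (map g js) =
      (if js = [] then of_nat (count_list A i) else if js = [i] then 1 else 0)"
proof (induction js arbitrary: A)
  case Nil
  thus ?case using coord_sorted[of A i] assms by simp
next
  case (Cons j js)
  have s: "sorted ((A @ [j]) @ js)" "sorted (A @ js)" using Cons.prems(1) by (auto simp: sorted_append)
  have "word_diff G (\<lambda>h. coord h i) (list_prod A) (map g (j # js)) =
      word_diff G (\<lambda>h. coord h i) (list_prod (A @ [j])) (map g js) - word_diff G (\<lambda>h. coord h i) (list_prod A) (map g js)"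
    using Cons.prems(2) by (simp add: list_prod_snoc)
  thus ?case using Cons.IH[OF s(1)] Cons.IH[OF s(2)] Cons.prems(2) by auto
qed

end

subsection \<open>Weighted words\<close>

definition word_wt :: "('g \<times> real) list \<Rightarrow> real" where
  "word_wt ws = sum_list (map snd ws)"

lemma word_wt_simps [simp]:
  "word_wt [] = 0" "word_wt (x # ws) = snd x + word_wt ws" "word_wt (ws @ vs) = word_wt ws + word_wt vs"
  "word_wt (replicate n x) = real n * snd x"
  by (simp_all add: word_wt_def sum_list_replicate)

context p_valued_basis
begin

text \<open>
  The second component of a letter is a real lower bound for \<open>\<omega>\<close>; unlike \<open>\<omega>\<close> itself,
  it stays finite for letters that may equal \<open>1\<close>.
\<close>

definition weighted :: "('g \<times> real) list \<Rightarrow> bool" where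
  "weighted ws \<longleftrightarrow> (\<forall>(h, s)\<in>set ws. h \<in> carrier G \<and> min_wt \<le> s \<and> ereal s \<le> \<omega> h)"

lemma weighted_simps [simp]:
  "weighted []" "weighted (x # ws) \<longleftrightarrow> fst x \<in> carrier G \<and> min_wt \<le> snd x \<and> ereal (snd x) \<le> \<omega> (fst x) \<and> weighted ws"
  "weighted (ws @ vs) \<longleftrightarrow> weighted ws \<and> weighted vs"
  by (auto simp: weighted_def)

lemma weighted_replicate: "weighted [(h, s)] \<Longrightarrow> weighted (replicate n (h, s))"
  by (induction n) auto

lemma weighted_carrier: "weighted ws \<Longrightarrow> set (map fst ws) \<subseteq> carrier G"
  by (auto simp: weighted_def)

definition letter :: "nat \<Rightarrow> 'g \<times> real" where
  "letter l = (g l, wt l)"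

lemma fst_letter [simp]: "fst (letter l) = g l" and snd_letter [simp]: "snd (letter l) = wt l"
  by (simp_all add: letter_def)

lemma weighted_letters: "set js \<subseteq> {..<d} \<Longrightarrow> weighted (map letter js)"
  by (induction js) (auto simp: g_closed min_wt_le omega_g)

text \<open>The gain in weight of every higher-order term met when a word is rewritten.\<close>

definition gain :: real where
  "gain = min_wt - 1 / (real CARD('p) - 1)"

text \<open>The factor p^k counts as k letters of weight 1, in step with \<omega>(h^p) = \<omega>(h)
  + 1. Without it the term p (h - 1) of h^p - 1 would lose weight.\<close>

definition scaled :: "nat \<Rightarrow> nat \<Rightarrow> 'g list \<Rightarrow> 'p padic" where
  "scaled i k hs = of_nat CARD('p) ^ k * word_diff G (\<lambda>h. coord h i) \<one> hs"

lemma scaled_le_1: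
  assumes "i < d" "set hs \<subseteq> carrier G"
  shows "padic_norm (scaled i k hs) \<le> 1 / real CARD('p) ^ k"
proof -
  have "padic_norm (word_diff G (\<lambda>h. coord h i) \<one> hs) \<le> 1"
    using assms coord_integral by (intro word_diff_norm_le) auto
  hence "(1 / real CARD('p)) ^ k * padic_norm (word_diff G (\<lambda>h. coord h i) \<one> hs) \<le> (1 / real CARD('p)) ^ k * 1"
    by (intro mult_left_mono) auto
  thus ?thesis by (simp add: scaled_def padic_norm_mult padic_norm_power padic_norm_p power_one_over)
qed

lemma gain_pos: "0 < d \<Longrightarrow> 0 < gain"
  using min_wt_gt by (simp add: gain_def)

lemma gain_le_min_wt: "gain \<le> min_wt"
  using p_gt_1 by (simp add: gain_def)

text \<open>Replacing h^p by p copies of h turns weight s + 1 into p s. The surplus (p - 1) s - 1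
  equals p - 1 times s - 1 / (p - 1), hence is at least \<open>gain\<close>; this is where the lower
  bound 1 / (p - 1) for \<omega> enters.\<close>

lemma gain_le_p_power:
  assumes "0 < d" "min_wt \<le> s"
  shows "gain \<le> (real CARD('p) - 1) * s - 1"
proof -
  let ?q = "real CARD('p) - 1"
  have p2: "2 \<le> real CARD('p)" using p_gt_1(1) by simp
  have "?q * gain = ?q * min_wt - 1" using p2 by (simp add: gain_def right_diff_distrib)
  moreover have "1 * gain \<le> ?q * gain" using gain_pos[OF assms(1)] p2 by (intro mult_right_mono) auto
  moreover have "?q * min_wt \<le> ?q * s" using assms(2) p2 by (intro mult_left_mono) auto
  ultimately show ?thesis by simp
qed

text \<open>One step of the induction behind \<open>word_diff_coord_bound\<close>: descending in the weight, ascending in the length.\<close>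

context
  fixes i :: nat and t \<beta> :: real and m :: nat
  assumes i: "i < d"
    and heavy: "\<And>k ws. weighted ws \<Longrightarrow> t + gain \<le> real k + word_wt ws \<Longrightarrow> padic_norm (scaled i k (map fst ws)) \<le> \<beta>"
    and short: "\<And>k ws. weighted ws \<Longrightarrow> length ws < m \<Longrightarrow> t \<le> real k + word_wt ws \<Longrightarrow>
      padic_norm (scaled i k (map fst ws)) \<le> \<beta>"
    and \<beta>: "real CARD('p) powr (wt i - t) \<le> \<beta>"
begin

lemma \<beta>_nonneg: "0 \<le> \<beta>"
  using \<beta> by (meson order_trans powr_ge_zero)

text \<open>The extra word with both letters h and k exceeds t by at least \<open>min_wt\<close>,
  which is at least \<open>gain\<close>, so \<open>heavy\<close> covers it.\<close>

lemma scaled_good_mult: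
  assumes "weighted A" "weighted B" "h \<in> carrier G" "k \<in> carrier G" "min_wt \<le> s" "ereal s \<le> \<omega> h" "ereal s \<le> \<omega> k"
    "t \<le> real n + word_wt A + s + word_wt B"
    "padic_norm (scaled i n (map fst A @ h # map fst B)) \<le> \<beta>" "padic_norm (scaled i n (map fst A @ k # map fst B)) \<le> \<beta>"
  shows "padic_norm (scaled i n (map fst A @ (h \<otimes> k) # map fst B)) \<le> \<beta>"
proof -
  have "padic_norm (scaled i n (map fst (A @ (h, s) # (k, s) # B))) \<le> \<beta>"
    by (rule heavy) (use assms gain_le_min_wt in auto)
  moreover have "scaled i n (map fst A @ (h \<otimes> k) # map fst B) = scaled i n (map fst A @ h # map fst B) +
      scaled i n (map fst A @ k # map fst B) + scaled i n (map fst (A @ (h, s) # (k, s) # B))"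
    unfolding scaled_def
    using weighted_carrier[OF assms(1)] weighted_carrier[OF assms(2)] assms(3,4)
    by (subst word_diff_mult) (auto simp: algebra_simps)
  ultimately show ?thesis using assms by (simp add: padic_norm_add_le)
qed

lemma scaled_one: "weighted A \<Longrightarrow> weighted B \<Longrightarrow> scaled i n (map fst A @ \<one> # map fst B) = 0"
  unfolding scaled_def
  using word_diff_mult[of \<one> "map fst A" \<one> \<one> "map fst B" "\<lambda>h. coord h i"] weighted_carrier[of A] weighted_carrier[of B]
    word_diff_pow[of \<one> "map fst A" \<one> "map fst B" "\<lambda>h. coord h i" 0]
  by simp

text \<open>Expand h^p - 1 for h = g_l^(p^j). The term with p letters is heavier by
  \<open>gain_le_p_power\<close>. For 1 < q < p the binomial coefficient supplies a factor p and the
  additional letters supply weight. The term q = 1 is p (h - 1): the induction hypothesis at scale n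
  + 1, which is why the scale is arbitrary.\<close>

lemma scaled_good_p_power:
  assumes AB: "weighted A" "weighted B" and l: "l < d"
    and base: "\<And>n. t \<le> real n + word_wt A + wt l + word_wt B \<Longrightarrow> padic_norm (scaled i n (map fst A @ g l # map fst B)) \<le> \<beta>"
  shows "t \<le> real n + word_wt A + (wt l + real j) + word_wt B \<Longrightarrow>
    padic_norm (scaled i n (map fst A @ (g l [^] (CARD('p) ^ j)) # map fst B)) \<le> \<beta>"
proof (induction j arbitrary: n)
  case 0
  thus ?case using base[of n] g_closed[OF l] by simp
next
  case (Suc j)
  let ?P = "CARD('p)"
  define h where "h = g l [^] (?P ^ j)"
  have h: "h \<in> carrier G" using g_closed[OF l] by (simp add: h_def)
  have wh: "weighted [(h, wt l + real j)]"
    using h min_wt_le[OF l] by (simp add: h_def omega_pow_p_power g_closed[OF l] omega_g[OF l])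
  have IH: "padic_norm (scaled i (Suc n) (map fst A @ h # map fst B)) \<le> \<beta>"
    unfolding h_def by (rule Suc.IH) (use Suc.prems in simp)
  define L where "L q = word_diff G (\<lambda>h. coord h i) \<one> (map fst A @ replicate q h @ map fst B)" for q
  have sc: "scaled i k (map fst (A @ replicate q (h, wt l + real j) @ B)) = of_nat ?P ^ k * L q" for k q
    by (simp add: scaled_def L_def)
  have "scaled i n (map fst A @ (h [^] ?P) # map fst B) = of_nat ?P ^ n * (\<Sum>q\<in>{1..?P}. of_nat (?P choose q) * L q)"
    unfolding scaled_def L_def using h weighted_carrier[OF AB(1)] weighted_carrier[OF AB(2)]
    by (subst word_diff_pow) auto
  also have "\<dots> = (\<Sum>q\<in>{1..?P}. of_nat ?P ^ n * (of_nat (?P choose q) * L q))" by (rule sum_distrib_left)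
  also have "padic_norm \<dots> \<le> \<beta>"
  proof (rule padic_norm_sum_le[OF _ \<beta>_nonneg])
    fix q assume q: "q \<in> {1..?P}"
    have s: "min_wt \<le> wt l + real j" using min_wt_le[OF l] by simp
    have W: "weighted (A @ replicate q (h, wt l + real j) @ B)"
      using AB weighted_replicate[OF wh] by simp
    show "padic_norm (of_nat ?P ^ n * (of_nat (?P choose q) * L q)) \<le> \<beta>"
    proof (cases "q = ?P")
      case True
      have "padic_norm (of_nat ?P ^ n * L q) \<le> \<beta>"
        unfolding sc[symmetric]
      proof (rule heavy[OF W])
        have "gain \<le> (real ?P - 1) * (wt l + real j) - 1" using i s by (intro gain_le_p_power) auto
        hence "gain + 1 + (wt l + real j) \<le> real ?P * (wt l + real j)" by (simp add: left_diff_distrib)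
        thus "t + gain \<le> real n + word_wt (A @ replicate q (h, wt l + real j) @ B)"
          using Suc.prems True by simp
      qed
      thus ?thesis using True by simp
    next
      case False
      hence "?P dvd (?P choose q)"
        using q by (intro dvd_choose_prime[OF _ _ _ prime_card[where 'a = 'p]]) auto
      then obtain c where c: "?P choose q = ?P * c" by blast
      have eq: "of_nat ?P ^ n * (of_nat (?P choose q) * L q) = of_nat c * (of_nat ?P ^ Suc n * L q)"
        by (simp add: c algebra_simps)
      have "padic_norm (of_nat ?P ^ Suc n * L q) \<le> \<beta>"
      proof (cases "q = 1")
        case True
        thus ?thesis using IH by (simp add: scaled_def L_def)
      next
        case False
        hence q2: "2 \<le> real q" using q by auto
        show ?thesis
          unfolding sc[symmetric]
        proof (rule heavy[OF W])
          have "0 \<le> min_wt" using gain_pos gain_le_min_wt i by linarith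
          hence "2 * (wt l + real j) \<le> real q * (wt l + real j)" using q2 s by (intro mult_right_mono) auto
          thus "t + gain \<le> real (Suc n) + word_wt (A @ replicate q (h, wt l + real j) @ B)"
            using Suc.prems gain_le_min_wt s by simp
        qed
      qed
      moreover have "padic_norm (of_nat c * (of_nat ?P ^ Suc n * L q)) \<le> 1 * padic_norm (of_nat ?P ^ Suc n * L q)"
        unfolding padic_norm_mult[of "of_nat c"] by (intro mult_right_mono) (auto simp: padic_norm_nonneg)
      ultimately show ?thesis unfolding eq by linarith
    qed
  qed
  also have "h [^] ?P = g l [^] (?P ^ Suc j)"
    using g_closed[OF l] by (simp add: h_def nat_pow_pow mult.commute)
  finally show ?case .
qed

lemma scaled_good_nat_power:
  assumes AB: "weighted A" "weighted B" and h: "h \<in> carrier G" "min_wt \<le> s" "ereal s \<le> \<omega> h"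
    and t: "t \<le> real n + word_wt A + s + word_wt B"
    and base: "padic_norm (scaled i n (map fst A @ h # map fst B)) \<le> \<beta>"
  shows "padic_norm (scaled i n (map fst A @ (h [^] (u::nat)) # map fst B)) \<le> \<beta>"
proof (induction u)
  case 0
  thus ?case using AB \<beta>_nonneg by (simp add: scaled_one)
next
  case (Suc u)
  thus ?case using AB h t base omega_nat_pow_ge[OF h(1,3)] by (simp add: scaled_good_mult[where s = s])
qed

text \<open>Split x into a natural number a, divisible by p^j, and a remainder. The first gives a
  natural power of g_l^(p^j); the remainder is so small that \<open>heavy\<close> applies to its
  power.\<close>

lemma scaled_good_padic_pow:
  fixes x :: "'p padic"
  assumes AB: "weighted A" "weighted B" and l: "l < d"
    and base: "\<And>n. t \<le> real n + word_wt A + wt l + word_wt B \<Longrightarrow> padic_norm (scaled i n (map fst A @ g l # map fst B)) \<le> \<beta>"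
    and s: "min_wt \<le> s" and t: "t \<le> real n + word_wt A + s + word_wt B"
    and x: "x \<in> padic_ints" "padic_norm x \<le> real CARD('p) powr (- (s - wt l))"
  shows "ereal s \<le> \<omega> (padic_pow G T (g l) x)"
    "padic_norm (scaled i n (map fst A @ padic_pow G T (g l) x # map fst B)) \<le> \<beta>"
proof -
  let ?P = "CARD('p)"
  \<comment> \<open>The least natural exponent for which g_l^(p^j) is certain to have weight s.
    Rounding up costs nothing, as norms are powers of p.\<close>
  define j where "j = nat \<lceil>s - wt l\<rceil>"
  have js: "s \<le> wt l + real j" unfolding j_def by linarith
  have xj: "padic_norm x \<le> 1 / real ?P ^ j"
  proof (cases "\<lceil>s - wt l\<rceil> \<ge> 0")
    case True
    have "padic_norm x \<le> real ?P powr (- of_int \<lceil>s - wt l\<rceil>)" by (rule padic_norm_le_powr_ceiling[OF x(2)])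
    also have "- of_int \<lceil>s - wt l\<rceil> = - real j" using True by (simp add: j_def)
    finally show ?thesis using p_gt_1 by (simp add: powr_minus powr_realpow inverse_eq_divide)
  next
    case False
    thus ?thesis using x(1) by (simp add: j_def padic_ints_def)
  qed
  \<comment> \<open>A remainder divisible by p^J has a power of weight at least wt l + J, hence at
    least s + \<open>gain\<close>.\<close>
  obtain J0 :: nat where J0: "s + gain - wt l \<le> real J0" using real_arch_simple by blast
  define J where "J = max j J0"
  obtain a where a: "padic_norm (x - of_nat a) \<le> 1 / real ?P ^ J" using padic_ints_approx_nat[OF x(1)] by blast
  have "1 / real ?P ^ J \<le> 1 / real ?P ^ j" using p_gt_1 by (simp add: J_def frac_le power_increasing)
  hence "padic_norm (of_nat a :: 'p padic) \<le> 1 / real ?P ^ j"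
    using padic_norm_diff_le[OF xj, of "x - of_nat a"] a by simp
  hence "?P ^ j dvd a" by (simp only: padic_norm_of_nat_le_iff)
  then obtain u where u: "a = ?P ^ j * u" by blast
  note gl = g_closed[OF l]
  let ?h = "g l [^] (?P ^ j)"
  define y where "y = padic_pow G T (g l) (x - of_nat a)"
  have xa: "x - of_nat a \<in> padic_ints" using x(1) by (intro padic_ints_diff) auto
  have yG: "y \<in> carrier G" unfolding y_def by (rule padic_pow_closed[OF gl xa])
  have eq: "padic_pow G T (g l) x = (?h [^] u) \<otimes> y"
    using padic_pow_add[OF gl padic_ints_of_nat[of a] xa] padic_pow_of_nat[OF gl, of a] gl
    by (simp add: y_def u nat_pow_pow)
  have wh: "ereal (wt l + real j) \<le> \<omega> ?h" using gl by (simp add: omega_pow_p_power omega_g[OF l])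
  have min: "min_wt \<le> wt l + real j" using min_wt_le[OF l] by simp
  have hu: "ereal s \<le> \<omega> (?h [^] u)"
    using omega_nat_pow_ge[OF _ wh, of u] gl js by (meson ereal_less_eq(3) nat_pow_closed order_trans)
  have "ereal (wt l + real J) \<le> \<omega> y"
    unfolding y_def by (rule omega_padic_pow[OF gl _ xa a]) (simp add: omega_g[OF l])
  moreover have "s + gain \<le> wt l + real J" using J0 by (simp add: J_def)
  ultimately have yw: "ereal (s + gain) \<le> \<omega> y" by (meson ereal_less_eq(3) order_trans)
  have gain0: "0 \<le> gain" using gain_pos i by (simp add: less_imp_le)
  hence ys: "ereal s \<le> \<omega> y" using yw by (meson ereal_less_eq(3) le_add_same_cancel1 order_trans)
  show "ereal s \<le> \<omega> (padic_pow G T (g l) x)"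
    unfolding eq using gl yG hu ys by (intro omega_mult_ge[of "?h [^] u" y]) auto
  have "padic_norm (scaled i n (map fst A @ (?h [^] u) # map fst B)) \<le> \<beta>"
  proof (rule scaled_good_nat_power[OF AB _ min wh])
    show "?h \<in> carrier G" using gl by simp
    show t': "t \<le> real n + word_wt A + (wt l + real j) + word_wt B" using t js by simp
    show "padic_norm (scaled i n (map fst A @ ?h # map fst B)) \<le> \<beta>"
      by (rule scaled_good_p_power[OF AB l _ t']) (rule base)
  qed
  moreover have "padic_norm (scaled i n (map fst A @ y # map fst B)) \<le> \<beta>"
  proof -
    have "padic_norm (scaled i n (map fst (A @ (y, s + gain) # B))) \<le> \<beta>"
      by (rule heavy) (use AB yG yw s gain0 t in auto)
    thus ?thesis by simp
  qed
  ultimately show "padic_norm (scaled i n (map fst A @ padic_pow G T (g l) x # map fst B)) \<le> \<beta>"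
    unfolding eq using AB gl yG s hu ys t by (intro scaled_good_mult[where s = s]) auto
qed

text \<open>Write h through its coordinates. By the formula for \<omega> on an ordered basis each
  factor has weight at least s, so multiplying the factors together again loses nothing.\<close>

lemma scaled_good_expand:
  assumes AB: "weighted A" "weighted B"
    and base: "\<And>l n. l < d \<Longrightarrow> t \<le> real n + word_wt A + wt l + word_wt B \<Longrightarrow>
      padic_norm (scaled i n (map fst A @ g l # map fst B)) \<le> \<beta>"
    and h: "h \<in> carrier G" "min_wt \<le> s" "ereal s \<le> \<omega> h" and t: "t \<le> real n + word_wt A + s + word_wt B"
  shows "padic_norm (scaled i n (map fst A @ h # map fst B)) \<le> \<beta>"
proof -
  have "foldr (\<lambda>l k. padic_pow G T (g l) (coord h l) \<otimes> k) ls \<one> \<in> carrier G \<and>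
      ereal s \<le> \<omega> (foldr (\<lambda>l k. padic_pow G T (g l) (coord h l) \<otimes> k) ls \<one>) \<and>
      padic_norm (scaled i n (map fst A @ foldr (\<lambda>l k. padic_pow G T (g l) (coord h l) \<otimes> k) ls \<one> # map fst B)) \<le> \<beta>"
    if "set ls \<subseteq> {..<d}" for ls
    using that
  proof (induction ls)
    case Nil
    thus ?case using AB \<beta>_nonneg by (simp add: scaled_one)
  next
    case (Cons l ls)
    have l: "l < d" using Cons.prems by simp
    have x: "coord h l \<in> padic_ints" using coord_points[OF h(1)] l by (simp add: padic_points_def)
    have E1: "ereal s \<le> \<omega> (padic_pow G T (g l) (coord h l))"
      by (rule scaled_good_padic_pow(1)[OF AB l _ h(2) t x omega_coord[OF h(1,3) l]]) (rule base[OF l])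
    have E2: "padic_norm (scaled i n (map fst A @ padic_pow G T (g l) (coord h l) # map fst B)) \<le> \<beta>"
      by (rule scaled_good_padic_pow(2)[OF AB l _ h(2) t x omega_coord[OF h(1,3) l]]) (rule base[OF l])
    have c: "padic_pow G T (g l) (coord h l) \<in> carrier G" by (rule padic_pow_closed[OF g_closed[OF l] x])
    show ?case using Cons AB E1 E2 c h t by (simp add: omega_mult_ge scaled_good_mult[where s = s])
  qed
  from this[of "[0..<d]"] show ?thesis
    using gprod_coord[OF h(1)] by (simp add: padic_pow_prod_def atLeast0LessThan)
qed

text \<open>The commutator replaces two letters by one of weight r + s: same weight, shorter word,
  so \<open>short\<close> applies. The other correction term has a further letter kh and is covered
  by \<open>heavy\<close>.\<close>

lemma scaled_swap_good:
  assumes "weighted (A @ (h, r) # (k, s) # B)" "length (A @ (h, r) # (k, s) # B) = m"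
    "t \<le> real n + word_wt (A @ (h, r) # (k, s) # B)"
  shows "padic_norm (scaled i n (map fst (A @ (h, r) # (k, s) # B)) - scaled i n (map fst (A @ (k, s) # (h, r) # B))) \<le> \<beta>"
proof -
  define c where "c = h \<otimes> k \<otimes> inv h \<otimes> inv k"
  have hk: "h \<in> carrier G" "k \<in> carrier G" using assms by auto
  have cG: "c \<in> carrier G" using hk by (simp add: c_def)
  have "ereal (r + s) \<le> \<omega> h + \<omega> k" using assms by (simp flip: plus_ereal.simps(1) add: add_mono)
  hence cw: "ereal (r + s) \<le> \<omega> c" unfolding c_def using omega_commutator[OF hk] by (rule order_trans)
  have m0: "0 \<le> min_wt" using gain_pos gain_le_min_wt i by linarith
  have 1: "padic_norm (scaled i n (map fst (A @ (c, r + s) # B))) \<le> \<beta>"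
    by (rule short) (use assms cG cw m0 in auto)
  have 2: "padic_norm (scaled i n (map fst (A @ (c, r + s) # (k \<otimes> h, min_wt) # B))) \<le> \<beta>"
    by (rule heavy) (use assms cG cw m0 hk omega_ge_min_wt gain_le_min_wt in auto)
  have "scaled i n (map fst (A @ (h, r) # (k, s) # B)) - scaled i n (map fst (A @ (k, s) # (h, r) # B)) =
      scaled i n (map fst (A @ (c, r + s) # B)) + scaled i n (map fst (A @ (c, r + s) # (k \<otimes> h, min_wt) # B))"
    unfolding scaled_def c_def
    using weighted_carrier[of A] weighted_carrier[of B] assms(1) hk
      word_diff_swap[of \<one> "map fst A" h k "map fst B" "\<lambda>h. coord h i"]
    by (simp add: algebra_simps)
  thus ?thesis using 1 2 by (simp add: padic_norm_add_le)
qed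

lemma scaled_insort_good:
  assumes "weighted A" "set (j # js) \<subseteq> {..<d}" "length A + length (j # js) = m"
    "t \<le> real n + word_wt A + word_wt (map letter (j # js))"
  shows "padic_norm (scaled i n (map fst (A @ map letter (j # js))) - scaled i n (map fst (A @ map letter (insort j js)))) \<le> \<beta>"
  using assms
proof (induction js arbitrary: A)
  case (Cons x xs)
  show ?case
  proof (cases "j \<le> x")
    case True thus ?thesis using \<beta>_nonneg by simp
  next
    case False
    have w: "weighted (map letter (j # x # xs))" using Cons.prems by (intro weighted_letters)
    have 1: "padic_norm (scaled i n (map fst (A @ letter j # letter x # map letter xs)) -
        scaled i n (map fst (A @ letter x # letter j # map letter xs))) \<le> \<beta>"
      unfolding letter_def[of j] letter_def[of x]
      using Cons.prems w by (intro scaled_swap_good) auto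
    have 2: "padic_norm (scaled i n (map fst ((A @ [letter x]) @ map letter (j # xs))) -
        scaled i n (map fst ((A @ [letter x]) @ map letter (insort j xs)))) \<le> \<beta>"
      using Cons.prems w by (intro Cons.IH) auto
    from padic_norm_add_le[OF 1 2] show ?thesis using False by simp
  qed
qed (use \<beta>_nonneg in simp)

lemma word_wt_insort: "word_wt (map letter (insort j js)) = wt j + word_wt (map letter js)"
  by (induction js) auto

lemma word_wt_sort: "word_wt (map letter (sort js)) = word_wt (map letter js)"
  by (induction js) (simp_all add: word_wt_insort)

lemma scaled_sort_good:
  assumes "weighted A" "set js \<subseteq> {..<d}" "length A + length js = m"
    "t \<le> real n + word_wt A + word_wt (map letter js)"
  shows "padic_norm (scaled i n (map fst (A @ map letter js)) - scaled i n (map fst (A @ map letter (sort js)))) \<le> \<beta>"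
  using assms
proof (induction js arbitrary: A)
  case (Cons j js)
  have w: "weighted [letter j]" using weighted_letters[of "[j]"] Cons.prems by simp
  have 1: "padic_norm (scaled i n (map fst ((A @ [letter j]) @ map letter js)) -
      scaled i n (map fst ((A @ [letter j]) @ map letter (sort js)))) \<le> \<beta>"
    using Cons.prems w by (intro Cons.IH) auto
  have 2: "padic_norm (scaled i n (map fst (A @ map letter (j # sort js))) -
      scaled i n (map fst (A @ map letter (insort j (sort js))))) \<le> \<beta>"
    using Cons.prems by (intro scaled_insort_good) (auto simp: word_wt_sort)
  from padic_norm_add_le[OF 1 2] show ?case by simp
qed (use \<beta>_nonneg in simp)

text \<open>After sorting, only the word with the single letter i has a nonzero value, namely p^n.
  Its weight n + wt i is at least t, which is the case that the hypothesis on \<beta> provides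
  for.\<close>

lemma scaled_basis_word_good:
  assumes js: "set js \<subseteq> {..<d}" "length js = m" and t: "t \<le> real n + word_wt (map letter js)"
  shows "padic_norm (scaled i n (map fst (map letter js))) \<le> \<beta>"
proof -
  have 1: "padic_norm (scaled i n (map fst ([] @ map letter js)) - scaled i n (map fst ([] @ map letter (sort js)))) \<le> \<beta>"
    using assms by (intro scaled_sort_good) auto
  have v: "word_diff G (\<lambda>h. coord h i) \<one> (map g (sort js)) = (if sort js = [] then 0 else if sort js = [i] then 1 else 0)"
    using word_diff_sorted[OF i, of "[]" "sort js"] js by (simp add: list_prod_def)
  have "padic_norm (scaled i n (map g (sort js))) \<le> \<beta>"
  proof (cases "sort js = [i]")
    case True
    hence "t \<le> real n + wt i" using t word_wt_sort[of js] by simp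
    hence "real CARD('p) powr (- real n) \<le> real CARD('p) powr (wt i - t)" using p_gt_1 by (intro powr_mono) auto
    moreover have "padic_norm (scaled i n (map g (sort js))) = real CARD('p) powr (- real n)"
      unfolding scaled_def v using True p_gt_1
      by (simp add: padic_norm_power padic_norm_p powr_minus powr_realpow power_one_over inverse_eq_divide)
    ultimately show ?thesis using \<beta> by linarith
  next
    case False
    thus ?thesis using \<beta>_nonneg unfolding scaled_def v by simp
  qed
  hence 2: "padic_norm (scaled i n (map fst ([] @ map letter (sort js)))) \<le> \<beta>" by (simp add: o_def)
  from padic_norm_add_le[OF 1 2] show ?thesis by simp
qed

text \<open>Letters are expanded from right to left, so that the tail already consists of basis
  letters. Each expansion may change the scale, hence n is arbitrary in the induction.\<close>

lemma scaled_word_good: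
  assumes "weighted A" "set js \<subseteq> {..<d}" "length A + length js = m"
    "t \<le> real n + word_wt A + word_wt (map letter js)"
  shows "padic_norm (scaled i n (map fst (A @ map letter js))) \<le> \<beta>"
  using assms
proof (induction A arbitrary: js n rule: rev_induct)
  case Nil
  thus ?case using scaled_basis_word_good[of js n] by simp
next
  case (snoc x A)
  obtain h s where x: "x = (h, s)" by fastforce
  have "padic_norm (scaled i n (map fst A @ h # map fst (map letter js))) \<le> \<beta>"
  proof (rule scaled_good_expand[where s = s])
    fix l n' assume l: "l < d" and t: "t \<le> real n' + word_wt A + wt l + word_wt (map letter js)"
    have "padic_norm (scaled i n' (map fst (A @ map letter (l # js)))) \<le> \<beta>"
      using snoc.prems l t by (intro snoc.IH) auto
    thus "padic_norm (scaled i n' (map fst A @ g l # map fst (map letter js))) \<le> \<beta>" by simp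
  qed (use snoc.prems weighted_letters[of js] x in auto)
  thus ?case by (simp add: x)
qed

end

lemma word_diff_coord_bound:
  assumes i: "i < d" and ws: "weighted ws"
  shows "padic_norm (word_diff G (\<lambda>h. coord h i) \<one> (map fst ws)) \<le> real CARD('p) powr (wt i - word_wt ws)"
proof -
  let ?P = "real CARD('p)"
  have key: "padic_norm (scaled i k (map fst ws)) \<le> max (1 / ?P ^ N) (?P powr (wt i - (real k + word_wt ws)))"
    if ws: "weighted ws" for N k ws
  proof -
    obtain n where n: "inv_mod (\<lambda>h. coord h i) n N" using continuous_inv_mod[OF continuous_coord[OF i]] by blast
    obtain M where M': "\<forall>f u hs. (\<forall>v\<in>carrier G. padic_norm (f v :: 'p padic) \<le> 1) \<longrightarrow> inv_mod f n N \<longrightarrow> u \<in> carrier G \<longrightarrow>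
      set hs \<subseteq> carrier G \<longrightarrow> M \<le> length hs \<longrightarrow> padic_norm (word_diff G f u hs) \<le> 1 / ?P ^ N"
      using word_diff_long[of n N] by (rule exE)
    have M: "padic_norm (word_diff G (\<lambda>h. coord h i) \<one> hs) \<le> 1 / ?P ^ N"
      if "set hs \<subseteq> carrier G" "M \<le> length hs" for hs
      using that coord_integral i n by (intro M'[rule_format]) auto
    \<comment> \<open>A word reaching C has scale at least N, or a letter in \<open>filt n\<close>,
      or at least M letters: letters outside \<open>filt n\<close> weigh less than n / p
      each.\<close>
    define C where "C = real N + real M * (real n / ?P)"
    have base: "padic_norm (scaled i k (map fst ws)) \<le> 1 / ?P ^ N" if ws: "weighted ws" and C: "C \<le> real k + word_wt ws" for k ws
    proof (cases "N \<le> k")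
      case True
      have "padic_norm (scaled i k (map fst ws)) \<le> 1 / ?P ^ k" by (rule scaled_le_1[OF i weighted_carrier[OF ws]])
      also have "\<dots> \<le> 1 / ?P ^ N" using True p_gt_1 by (simp add: frac_le power_increasing)
      finally show ?thesis .
    next
      case False
      have "padic_norm (word_diff G (\<lambda>h. coord h i) \<one> (map fst ws)) \<le> 1 / ?P ^ N"
      proof (cases "\<exists>h\<in>set (map fst ws). h \<in> filt n")
        case True
        then obtain h A B where h: "map fst ws = A @ h # B" "h \<in> filt n" by (metis split_list)
        thus ?thesis using weighted_carrier[OF ws] by (auto intro!: word_diff_small_letter[OF n])
      next
        case no: False
        have "word_wt ws \<le> real (length ws) * (real n / ?P)"
          using ws no
        proof (induction ws)
          case (Cons x ws)
          obtain h s where x: "x = (h, s)" by fastforce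
          have "ereal s \<le> \<omega> h" "\<omega> h < ereal (real n / ?P)" using Cons.prems x by (auto simp: filt_def not_le)
          hence "ereal s < ereal (real n / ?P)" by (rule le_less_trans)
          hence "s \<le> real n / ?P" by simp
          moreover have "word_wt ws \<le> real (length ws) * (real n / ?P)" using Cons x by auto
          ultimately show ?case by (simp add: x distrib_right add_divide_distrib)
        qed simp
        hence "real M * (real n / ?P) < real (length ws) * (real n / ?P)" using C False by (simp add: C_def)
        hence "M \<le> length ws" using p_gt_1 by (auto dest: mult_right_less_imp_less simp: divide_less_cancel split: if_splits)
        thus ?thesis using M weighted_carrier[OF ws] by simp
      qed
      moreover have "padic_norm (scaled i k (map fst ws)) \<le> 1 * padic_norm (word_diff G (\<lambda>h. coord h i) \<one> (map fst ws))"
        unfolding scaled_def padic_norm_mult padic_norm_power padic_norm_p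
        using p_gt_1 by (intro mult_right_mono power_le_one) (auto simp: padic_norm_nonneg)
      ultimately show ?thesis by simp
    qed
    have mono: "?P powr (wt i - b) \<le> ?P powr (wt i - a)" if "a \<le> b" for a b
      using that p_gt_1 by (intro powr_mono) auto
    have step: "padic_norm (scaled i k (map fst ws)) \<le> max (1 / ?P ^ N) (?P powr (wt i - (real k + word_wt ws)))"
      if "weighted ws" "C - real q * gain \<le> real k + word_wt ws" for q k ws
      using that
    proof (induction q arbitrary: k ws)
      case 0
      thus ?case using base[of ws k] by simp
    next
      case (Suc q)
      define t where "t = real k + word_wt ws"
      define \<beta> where "\<beta> = max (1 / ?P ^ N) (?P powr (wt i - t))"
      have heavy: "padic_norm (scaled i k' (map fst ws')) \<le> \<beta>" if "weighted ws'" "t + gain \<le> real k' + word_wt ws'" for k' ws'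
      proof -
        have "C - real q * gain \<le> real k' + word_wt ws'"
          using that(2) Suc.prems(2) by (simp add: t_def algebra_simps)
        from Suc.IH[OF that(1) this] show ?thesis
          using mono[of t "real k' + word_wt ws'"] that(2) gain_pos i by (simp add: \<beta>_def)
      qed
      have "padic_norm (scaled i k' (map fst ws')) \<le> \<beta>" if "weighted ws'" "t \<le> real k' + word_wt ws'" for k' ws'
        using that
      proof (induction "length ws'" arbitrary: k' ws' rule: less_induct)
        case less
        \<comment> \<open>The tail of basis letters starts empty; \<open>short\<close> is the
          induction hypothesis on the length at the same level t.\<close>
        have "padic_norm (scaled i k' (map fst (ws' @ map letter []))) \<le> \<beta>"
          by (rule scaled_word_good[OF i heavy less.hyps, where m = "length ws'"])
            (use less.prems in \<open>auto simp: \<beta>_def\<close>)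
        thus ?case by simp
      qed
      from this[OF Suc.prems(1), of k] show ?case by (simp add: t_def \<beta>_def)
    qed
    obtain q :: nat where "(C - (real k + word_wt ws)) / gain \<le> real q" using real_arch_simple by blast
    hence "C - real q * gain \<le> real k + word_wt ws" using gain_pos i by (simp add: field_simps)
    from step[OF ws this] show ?thesis .
  qed
  have "0 < ?P powr (wt i - word_wt ws)" using p_gt_1 by simp
  \<comment> \<open>N is chosen so that p^(-N) lies below the asserted bound, which then is the
    maximum in \<open>key\<close>.\<close>
  from order_tendstoD(2)[OF prime_powers_tendsto_0[where 'p = 'p] this]
  obtain N where N: "1 / ?P ^ N < ?P powr (wt i - word_wt ws)"
    by (auto simp: eventually_sequentially)
  show ?thesis using key[OF ws, of 0 N] N by (simp add: scaled_def max_def split: if_splits)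
qed

end

section \<open>Mahler series\<close>

lemma padic_norm_of_nat_unit:
  assumes "\<not> CARD('p::prime_card) dvd n"
  shows "padic_norm (of_nat n :: 'p padic) = 1"
proof -
  have "n \<noteq> 0" using assms by (metis dvd_0_right)
  thus ?thesis using assms by (simp add: padic_norm_of_nat not_dvd_imp_multiplicity_0)
qed

lemma padic_norm_fact_add:
  assumes "r < CARD('p::prime_card)"
  shows "padic_norm (of_nat (fact (CARD('p) * q + r)) :: 'p padic) = padic_norm (of_nat (fact (CARD('p) * q)) :: 'p padic)"
  using assms
proof (induction r)
  case (Suc r)
  have "\<not> CARD('p) dvd CARD('p) * q + Suc r"
    using Suc.prems by (subst dvd_add_right_iff) (auto dest: dvd_imp_le)
  hence "padic_norm (of_nat (CARD('p) * q + Suc r) :: 'p padic) = 1" by (rule padic_norm_of_nat_unit)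
  hence "padic_norm (of_nat ((CARD('p) * q + Suc r) * fact (CARD('p) * q + r)) :: 'p padic) =
      padic_norm (of_nat (fact (CARD('p) * q + r)) :: 'p padic)"
    by (simp only: of_nat_mult padic_norm_mult)
  thus ?case using Suc by (simp only: add_Suc_right fact_Suc of_nat_id Suc_lessD)
qed simp

text \<open>Among the factors of (pq)! only the multiples of p are non-units, and their product is
  p^q q!.\<close>

lemma padic_norm_fact_mult:
  "padic_norm (of_nat (fact (CARD('p) * q)) :: 'p::prime_card padic) =
    padic_norm (of_nat (fact q) :: 'p padic) / real CARD('p) ^ q"
proof (induction q)
  case (Suc q)
  let ?P = "CARD('p)"
  have P: "?P = Suc (?P - 1)" using card_prime_gt_1[where 'p = 'p] by simp
  have eq: "?P * Suc q = Suc (?P * q + (?P - 1))" using P by (simp add: algebra_simps)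
  have "fact (?P * Suc q) = (?P * Suc q) * fact (?P * q + (?P - 1))"
    unfolding eq by (simp only: fact_Suc of_nat_id)
  hence "padic_norm (of_nat (fact (?P * Suc q)) :: 'p padic) =
      padic_norm (of_nat ?P :: 'p padic) * padic_norm (of_nat (Suc q) :: 'p padic) *
      padic_norm (of_nat (fact (?P * q + (?P - 1))) :: 'p padic)"
    by (simp only: of_nat_mult padic_norm_mult)
  also have "padic_norm (of_nat (fact (?P * q + (?P - 1))) :: 'p padic) = padic_norm (of_nat (fact q) :: 'p padic) / real ?P ^ q"
    using padic_norm_fact_add[of "?P - 1" q, where 'p = 'p] P Suc.IH by simp
  also have "padic_norm (of_nat ?P :: 'p padic) * padic_norm (of_nat (Suc q) :: 'p padic) *
      (padic_norm (of_nat (fact q) :: 'p padic) / real ?P ^ q) =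
      padic_norm (of_nat (Suc q * fact q) :: 'p padic) / real ?P ^ Suc q"
    unfolding padic_norm_p of_nat_mult padic_norm_mult by simp
  finally show ?case by (simp only: fact_Suc of_nat_id)
qed simp

text \<open>Legendre's bound v(n!) <= (n - 1) / (p - 1). With n = p q + r the valuation is q plus
  that of q!, and (p q - 1) / (p - 1) = (q - 1) / (p - 1) + q.\<close>

lemma padic_norm_fact_ge:
  "0 < n \<Longrightarrow> real CARD('p) powr (- ((real n - 1) / (real CARD('p) - 1))) \<le>
    padic_norm (of_nat (fact n) :: 'p::prime_card padic)"
proof (induction n rule: less_induct)
  case (less n)
  let ?P = "CARD('p)" and ?N = "\<lambda>n. padic_norm (of_nat (fact n) :: 'p padic)"
  define q r where "q = n div ?P" and "r = n mod ?P"
  have P: "1 < ?P" by (rule card_prime_gt_1)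
  hence n: "n = ?P * q + r" and r: "r < ?P" by (simp_all add: q_def r_def)
  have N: "?N n = ?N q / real ?P ^ q"
    unfolding n using padic_norm_fact_add[OF r, of q] padic_norm_fact_mult[of q, where 'p = 'p] by simp
  have P1: "1 < real ?P" using P by simp
  show ?case
  proof (cases "q = 0")
    case True
    have "real ?P powr (- ((real n - 1) / (real ?P - 1))) \<le> real ?P powr 0"
      using less.prems P1 by (intro powr_mono) auto
    thus ?thesis using N True P1 by simp
  next
    case False
    have "q < n" using P less.prems by (simp add: q_def)
    hence IH: "real ?P powr (- ((real q - 1) / (real ?P - 1))) \<le> ?N q" using False by (intro less.IH) auto
    have "real n - 1 \<ge> real ?P * real q - 1" using n by (metis diff_right_mono le_add1 of_nat_le_iff of_nat_mult)
    hence "(real ?P * real q - 1) / (real ?P - 1) \<le> (real n - 1) / (real ?P - 1)"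
      using P1 by (intro divide_right_mono) auto
    moreover have "(real ?P * real q - 1) / (real ?P - 1) = (real q - 1) / (real ?P - 1) + real q"
      using P1 by (simp add: field_simps)
    ultimately have "real ?P powr (- ((real n - 1) / (real ?P - 1))) \<le>
        real ?P powr (- ((real q - 1) / (real ?P - 1)) - real q)"
      using P1 by (intro powr_mono) auto
    also have "\<dots> = real ?P powr (- ((real q - 1) / (real ?P - 1))) / real ?P ^ q"
      using P1 by (simp add: powr_diff powr_realpow)
    also have "\<dots> \<le> ?N n" unfolding N using IH P1 by (intro divide_right_mono) auto
    finally show ?thesis .
  qed
qed

definition multi_fact :: "nat \<Rightarrow> multi_index \<Rightarrow> nat" where
  "multi_fact m \<alpha> = (\<Prod>j<m. fact (Poly_Mapping.lookup \<alpha> j))"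

text \<open>Each nonzero exponent contributes a term -1 to Legendre's bound. One of them is kept; it
  becomes the margin 1 / (p - 1) that is set against the basis weights.\<close>

lemma padic_norm_multi_fact_ge:
  assumes "Poly_Mapping.keys \<alpha> \<subseteq> {..<m}" "\<alpha> \<noteq> 0"
  shows "real CARD('p) powr (- ((real (total_degree \<alpha>) - 1) / (real CARD('p) - 1))) \<le>
    padic_norm (of_nat (multi_fact m \<alpha>) :: 'p::prime_card padic)"
proof -
  let ?P = "real CARD('p)" and ?N = "\<lambda>n. padic_norm (of_nat (fact n) :: 'p padic)"
  let ?K = "Poly_Mapping.keys \<alpha>" and ?l = "Poly_Mapping.lookup \<alpha>"
  have P1: "1 < ?P" by (rule real_card_prime_gt_1)
  have "multi_fact m \<alpha> = (\<Prod>j\<in>?K. fact (?l j))"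
    unfolding multi_fact_def using assms(1)
    by (intro prod.mono_neutral_right) (auto simp: not_in_keys_iff_lookup_eq_zero)
  moreover have "padic_norm (of_nat (\<Prod>j\<in>S. fact (?l j)) :: 'p padic) = (\<Prod>j\<in>S. ?N (?l j))" if "finite S" for S
    using that by (induction S) (simp_all only: prod.empty prod.insert of_nat_1 padic_norm_1 of_nat_mult padic_norm_mult not_False_eq_True)
  ultimately have eq: "padic_norm (of_nat (multi_fact m \<alpha>) :: 'p padic) = (\<Prod>j\<in>?K. ?N (?l j))" by simp
  have "card ?K \<ge> 1" using assms(2) by (simp add: Suc_le_eq card_gt_0_iff)
  hence "(\<Sum>j\<in>?K. real (?l j) - 1) \<le> real (total_degree \<alpha>) - 1"
    by (simp add: sum_subtractf total_degree_def)
  hence "(\<Sum>j\<in>?K. real (?l j) - 1) / (?P - 1) \<le> (real (total_degree \<alpha>) - 1) / (?P - 1)"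
    using P1 by (intro divide_right_mono) auto
  hence "?P powr (- ((real (total_degree \<alpha>) - 1) / (?P - 1))) \<le> ?P powr (- ((\<Sum>j\<in>?K. real (?l j) - 1) / (?P - 1)))"
    using P1 by (intro powr_mono) auto
  also have "\<dots> = ?P powr (\<Sum>j\<in>?K. - ((real (?l j) - 1) / (?P - 1)))"
    by (simp add: sum_negf sum_divide_distrib)
  also have "\<dots> = (\<Prod>j\<in>?K. ?P powr (- ((real (?l j) - 1) / (?P - 1))))"
    using P1 by (intro powr_sum) auto
  also have "\<dots> \<le> (\<Prod>j\<in>?K. ?N (?l j))"
    by (intro prod_mono conjI padic_norm_fact_ge) (auto simp: in_keys_iff)
  finally show ?thesis unfolding eq .
qed

text \<open>This is \<alpha>! times the product of the binomials of x_j over \<alpha>_j. Leaving the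
  factorial in keeps the coefficients of the polynomial integral.\<close>

definition falling_val :: "nat \<Rightarrow> (nat \<Rightarrow> 'a::comm_ring_1) \<Rightarrow> multi_index \<Rightarrow> 'a" where
  "falling_val m x \<alpha> = (\<Prod>j<m. \<Prod>q<Poly_Mapping.lookup \<alpha> j. x j - of_nat q)"

lemma falling_val_add_single:
  assumes "j < m"
  shows "falling_val m x (\<alpha> + Poly_Mapping.single j 1) =
    falling_val m x \<alpha> * (x j - of_nat (Poly_Mapping.lookup \<alpha> j))"
proof -
  let ?F = "\<lambda>\<alpha> j. \<Prod>q<Poly_Mapping.lookup \<alpha> j. x j - of_nat q"
  have "falling_val m x (\<alpha> + Poly_Mapping.single j 1) =
      ?F (\<alpha> + Poly_Mapping.single j 1) j * (\<Prod>i\<in>{..<m} - {j}. ?F (\<alpha> + Poly_Mapping.single j 1) i)"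
    unfolding falling_val_def using assms by (intro prod.remove) auto
  also have "(\<Prod>i\<in>{..<m} - {j}. ?F (\<alpha> + Poly_Mapping.single j 1) i) = (\<Prod>i\<in>{..<m} - {j}. ?F \<alpha> i)"
    by (intro prod.cong) (auto simp: lookup_add lookup_single when_def)
  also have "?F (\<alpha> + Poly_Mapping.single j 1) j = ?F \<alpha> j * (x j - of_nat (Poly_Mapping.lookup \<alpha> j))"
    by (simp add: lookup_add)
  also have "?F \<alpha> j * (x j - of_nat (Poly_Mapping.lookup \<alpha> j)) * (\<Prod>i\<in>{..<m} - {j}. ?F \<alpha> i) =
      (?F \<alpha> j * (\<Prod>i\<in>{..<m} - {j}. ?F \<alpha> i)) * (x j - of_nat (Poly_Mapping.lookup \<alpha> j))" by (simp add: mult_ac)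
  also have "?F \<alpha> j * (\<Prod>i\<in>{..<m} - {j}. ?F \<alpha> i) = falling_val m x \<alpha>"
    unfolding falling_val_def using assms by (intro prod.remove[symmetric]) auto
  finally show ?thesis .
qed

text \<open>Each factor Z_j - a has integral coefficients in degrees 0 and 1, so it costs one factor
  1 / s against the rate s.\<close>

lemma falling_series:
  assumes s: "0 < s" "s \<le> 1"
  shows "Poly_Mapping.keys \<alpha> \<subseteq> {..<m} \<Longrightarrow> \<exists>P::'p::prime_card padic_series\<in>carrier (washnitzer m). coeff_bound P s ((1 / s) ^ total_degree \<alpha>) \<and>
    coeff_bound P 1 1 \<and> (\<forall>x\<in>padic_points m. eval_series P x = falling_val m x \<alpha>)"
proof (induction \<alpha> rule: multi_index_induct)
  case zero
  show ?case
    by (rule bexI[of _ "\<one>\<^bsub>washnitzer m\<^esub>"])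
      (use s in \<open>auto simp: eval_one coeff_bound_one washnitzer_one_closed falling_val_def\<close>)
next
  case (add \<alpha> j)
  hence j: "j < m" and k: "Poly_Mapping.keys \<alpha> \<subseteq> {..<m}" by (auto simp: keys_add_multi_index)
  obtain P :: "'p padic_series" where P: "P \<in> carrier (washnitzer m)" "coeff_bound P s ((1 / s) ^ total_degree \<alpha>)" "coeff_bound P 1 1"
    "\<And>x. x \<in> padic_points m \<Longrightarrow> eval_series P x = falling_val m x \<alpha>"
    using add.IH[OF k] by blast
  let ?a = "Poly_Mapping.lookup \<alpha> j"
  define F :: "'p padic_series" where "F = (\<lambda>\<beta>. washnitzer_var j \<beta> + const_series (- of_nat ?a) \<beta>)"
  have FW: "F \<in> carrier (washnitzer m)"
    unfolding F_def by (rule washnitzer_add_closed[OF washnitzer_var_closed[OF j] const_series_closed])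
  have F1: "coeff_bound F 1 1"
    unfolding coeff_bound_1 F_def using coeff_bound_var[of j] coeff_bound_const_series[OF padic_ints_minus[OF padic_ints_of_nat[of ?a]]]
    by (auto simp: coeff_bound_1 intro!: padic_norm_add_le)
  have Fs: "coeff_bound F s (1 / s)"
    unfolding coeff_bound_def
  proof
    fix \<beta> :: multi_index
    consider "\<beta> = 0" | "\<beta> = Poly_Mapping.single j 1" | "F \<beta> = 0"
      by (cases "\<beta> = 0"; cases "\<beta> = Poly_Mapping.single j 1") (simp_all add: F_def washnitzer_var_def const_series_def)
    thus "padic_norm (F \<beta>) \<le> 1 / s * s ^ total_degree \<beta>"
    proof cases
      case 1
      have "1 \<le> 1 / s" using s by simp
      thus ?thesis using F1 1 by (auto simp: coeff_bound_1 intro: order_trans)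
    next
      case 2 thus ?thesis using F1 s by (simp add: coeff_bound_1)
    next
      case 3 thus ?thesis using s by simp
    qed
  qed
  show ?case
  proof (intro bexI[of _ "P \<otimes>\<^bsub>washnitzer m\<^esub> F"] conjI ballI)
    show "coeff_bound (P \<otimes>\<^bsub>washnitzer m\<^esub> F) s ((1 / s) ^ total_degree (\<alpha> + Poly_Mapping.single j 1))"
      using coeff_bound_mult[OF P(2) Fs] s by (simp add: mult.commute)
    show "coeff_bound (P \<otimes>\<^bsub>washnitzer m\<^esub> F) 1 1" using coeff_bound_mult[OF P(3) F1] by simp
    show "P \<otimes>\<^bsub>washnitzer m\<^esub> F \<in> carrier (washnitzer m)" by (rule washnitzer_mult_closed[OF P(1) FW])
    fix x :: "nat \<Rightarrow> 'p padic" assume x: "x \<in> padic_points m"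
    have "eval_series F x = x j + - of_nat ?a"
      unfolding F_def by (simp only: eval_add[OF washnitzer_var_closed[OF j] const_series_closed x] eval_var eval_const_series)
    thus "eval_series (P \<otimes>\<^bsub>washnitzer m\<^esub> F) x = falling_val m x (\<alpha> + Poly_Mapping.single j 1)"
      by (simp add: eval_mult[OF P(1) FW x] P(4)[OF x] falling_val_add_single[OF j, simplified])
  qed
qed

lemma falling_val_of_nat:
  "falling_val m (\<lambda>j. of_nat (a j)) \<alpha> =
    of_nat (multi_fact m \<alpha>) * (\<Prod>j<m. of_nat (a j choose Poly_Mapping.lookup \<alpha> j) :: 'a::field_char_0)"
proof -
  have "(\<Prod>q<k. of_nat n - of_nat q) = of_nat (fact k) * (of_nat (n choose k) :: 'a)" for n k
    using gbinomial_mult_fact[of k "of_nat n :: 'a"] by (simp add: binomial_gbinomial atLeast0LessThan)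
  thus ?thesis unfolding falling_val_def multi_fact_def by (simp add: prod.distrib)
qed

text \<open>The decay q of the coefficients and the growth 1 / s of the falling factorials combine
  to the rate q / s = s for s = sqrt q, still below 1.\<close>

lemma mahler_series:
  fixes c :: "multi_index \<Rightarrow> 'p::prime_card padic"
  assumes q: "0 < q" "q < 1"
    and c: "\<And>\<alpha>. Poly_Mapping.keys \<alpha> \<subseteq> {..<m} \<Longrightarrow> padic_norm (c \<alpha>) \<le> C * q ^ total_degree \<alpha>"
      "\<And>\<alpha>. Poly_Mapping.keys \<alpha> \<subseteq> {..<m} \<Longrightarrow> padic_norm (c \<alpha>) \<le> 1"
  obtains S where "S \<in> carrier (washnitzer m)" "coeff_bound S 1 1"
    "\<And>x. x \<in> padic_points m \<Longrightarrow>
      ((\<lambda>\<alpha>. c \<alpha> * falling_val m x \<alpha>) has_sum eval_series S x) {\<alpha>. Poly_Mapping.keys \<alpha> \<subseteq> {..<m}}"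
proof -
  define s where "s = sqrt q"
  have s: "0 < s" "s < 1" "q * (1 / s) = s" using q by (auto simp: s_def real_div_sqrt)
  have C0: "0 \<le> C" using c(1)[of 0] padic_norm_nonneg[of "c 0"] by simp
  have "\<exists>P. Poly_Mapping.keys \<alpha> \<subseteq> {..<m} \<longrightarrow> P \<in> carrier (washnitzer m) \<and>
      coeff_bound P s ((1 / s) ^ total_degree \<alpha>) \<and> coeff_bound P 1 1 \<and>
      (\<forall>x\<in>padic_points m. eval_series P x = falling_val m (x :: nat \<Rightarrow> 'p padic) \<alpha>)" for \<alpha>
    using falling_series[of s \<alpha> m, where 'p = 'p] s by auto
  then obtain P :: "multi_index \<Rightarrow> 'p padic_series" where P:
    "\<And>\<alpha>. Poly_Mapping.keys \<alpha> \<subseteq> {..<m} \<Longrightarrow> P \<alpha> \<in> carrier (washnitzer m)"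
    "\<And>\<alpha>. Poly_Mapping.keys \<alpha> \<subseteq> {..<m} \<Longrightarrow> coeff_bound (P \<alpha>) s ((1 / s) ^ total_degree \<alpha>)"
    "\<And>\<alpha>. Poly_Mapping.keys \<alpha> \<subseteq> {..<m} \<Longrightarrow> coeff_bound (P \<alpha>) 1 1"
    "\<And>\<alpha> x. Poly_Mapping.keys \<alpha> \<subseteq> {..<m} \<Longrightarrow> x \<in> padic_points m \<Longrightarrow> eval_series (P \<alpha>) x = falling_val m x \<alpha>"
    by metis
  define H where "H \<alpha> = (if Poly_Mapping.keys \<alpha> \<subseteq> {..<m} then (\<lambda>\<beta>. c \<alpha> * P \<alpha> \<beta>) else (\<lambda>_. 0))" for \<alpha>
  define \<epsilon> where "\<epsilon> \<alpha> = (if Poly_Mapping.keys \<alpha> \<subseteq> {..<m} then C * s ^ total_degree \<alpha> else 0)" for \<alpha> :: multi_index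
  have H1: "coeff_bound (H \<alpha>) 1 1" for \<alpha>
    unfolding coeff_bound_1
  proof
    fix \<beta>
    show "padic_norm (H \<alpha> \<beta>) \<le> 1"
      using c(2)[of \<alpha>] P(3)[of \<alpha>] by (auto simp: H_def padic_norm_mult coeff_bound_1 padic_norm_nonneg intro: mult_le_one)
  qed
  obtain S where S: "S \<in> carrier (washnitzer m)"
    "\<And>x. x \<in> padic_points m \<Longrightarrow> ((\<lambda>k. eval_series (H k) x) has_sum eval_series S x) UNIV"
    "\<And>B. (\<And>k. coeff_bound (H k) 1 B) \<Longrightarrow> coeff_bound S 1 B"
  proof (rule family_sum[of m H s \<epsilon>])
    show "supported m (H \<alpha>)" for \<alpha> using P(1)[of \<alpha>] by (auto simp: H_def supported_def in_washnitzer_iff)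
    show "coeff_bound (H \<alpha>) s (\<epsilon> \<alpha>)" for \<alpha>
    proof (cases "Poly_Mapping.keys \<alpha> \<subseteq> {..<m}")
      case True
      have "padic_norm (c \<alpha>) * padic_norm (P \<alpha> \<beta>) \<le> (C * q ^ total_degree \<alpha>) * ((1 / s) ^ total_degree \<alpha> * s ^ total_degree \<beta>)" for \<beta>
        using c(1)[OF True] P(2)[OF True] C0 q unfolding coeff_bound_def
        by (intro mult_mono) (auto simp: padic_norm_nonneg)
      also have "(C * q ^ total_degree \<alpha>) * ((1 / s) ^ total_degree \<alpha> * s ^ total_degree \<beta>) =
          C * (q * (1 / s)) ^ total_degree \<alpha> * s ^ total_degree \<beta>" for \<beta>
        by (simp only: power_mult_distrib mult.assoc)
      finally show ?thesis using True unfolding s(3) by (simp add: coeff_bound_def H_def \<epsilon>_def padic_norm_mult)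
    qed (simp add: H_def \<epsilon>_def coeff_bound_def)
    fix e :: real assume e: "e > 0"
    have "{\<alpha>. e \<le> \<epsilon> \<alpha>} \<subseteq> {\<alpha>. Poly_Mapping.keys \<alpha> \<subseteq> {..<m} \<and> e \<le> C * s ^ total_degree \<alpha>}"
      using e by (auto simp: \<epsilon>_def split: if_splits)
    thus "finite {\<alpha>. e \<le> \<epsilon> \<alpha>}"
      by (rule finite_subset) (use s e in \<open>intro finite_multi_index_geometric, auto\<close>)
  qed (use s in auto)
  have "((\<lambda>\<alpha>. c \<alpha> * falling_val m x \<alpha>) has_sum eval_series S x) {\<alpha>. Poly_Mapping.keys \<alpha> \<subseteq> {..<m}}"
    if x: "x \<in> padic_points m" for x
  proof -
    have "((\<lambda>k. eval_series (H k) x) has_sum eval_series S x) UNIV" by (rule S(2)[OF x])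
    also have "?this \<longleftrightarrow> ?thesis"
    proof (rule has_sum_cong_neutral)
      fix \<alpha> :: multi_index assume "\<alpha> \<in> UNIV \<inter> {\<alpha>. Poly_Mapping.keys \<alpha> \<subseteq> {..<m}}"
      hence \<alpha>: "Poly_Mapping.keys \<alpha> \<subseteq> {..<m}" by simp
      thus "eval_series (H \<alpha>) x = c \<alpha> * falling_val m x \<alpha>"
        by (simp add: H_def eval_smult[OF P(1)[OF \<alpha>] x] P(4)[OF \<alpha> x])
    qed (auto simp: H_def eval_series_def)
    finally show ?thesis .
  qed
  thus ?thesis using that S(1) S(3)[OF H1] by blast
qed

text \<open>Differences of monomials telescope factor by factor. The estimate later carries an
  identity from natural exponents to p-adic ones.\<close>

lemma eval_lipschitz:
  assumes f: "f \<in> carrier (washnitzer n)" "coeff_bound f 1 1" and x: "x \<in> padic_points n" and y: "y \<in> padic_points n"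
    and e: "0 \<le> e" "\<And>i. i < n \<Longrightarrow> padic_norm (x i - y i) \<le> e"
  shows "padic_norm (eval_series f x - eval_series f y) \<le> e"
proof -
  have mon: "padic_norm (monom_val x \<alpha> - monom_val y \<alpha>) \<le> e" if "Poly_Mapping.keys \<alpha> \<subseteq> {..<n}" for \<alpha>
    using that
  proof (induction \<alpha> rule: multi_index_induct)
    case (add \<alpha> i)
    hence i: "i < n" and k: "Poly_Mapping.keys \<alpha> \<subseteq> {..<n}" by (auto simp: keys_add_multi_index)
    have "padic_norm (monom_val x \<alpha> - monom_val y \<alpha>) * padic_norm (x i) \<le> e * 1"
      using add.IH[OF k] x i e by (intro mult_mono) (auto simp: padic_points_def padic_ints_def padic_norm_nonneg)
    moreover have "padic_norm (monom_val y \<alpha>) * padic_norm (x i - y i) \<le> 1 * e"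
      using monom_val_norm_le_1[OF y k] e(2)[OF i] by (intro mult_mono) (auto simp: padic_norm_nonneg)
    moreover have "monom_val x (\<alpha> + Poly_Mapping.single i 1) - monom_val y (\<alpha> + Poly_Mapping.single i 1) =
        (monom_val x \<alpha> - monom_val y \<alpha>) * x i + monom_val y \<alpha> * (x i - y i)"
      unfolding monom_val_add monom_val_single by (simp add: algebra_simps)
    ultimately show ?case by (simp add: padic_norm_add_le padic_norm_mult)
  qed (use e in simp)
  have "((\<lambda>\<alpha>. - (f \<alpha> * monom_val y \<alpha>)) has_sum - eval_series f y) UNIV"
    by (subst has_sum_uminus) (use eval_has_sum[OF f(1) y] in simp)
  from has_sum_add[OF eval_has_sum[OF f(1) x] this]
  have "((\<lambda>\<alpha>. f \<alpha> * (monom_val x \<alpha> - monom_val y \<alpha>)) has_sum (eval_series f x - eval_series f y)) UNIV"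
    by (simp add: algebra_simps)
  thus ?thesis
  proof (rule padic_has_sum_norm_le[OF _ _ e(1)])
    fix \<alpha>
    show "padic_norm (f \<alpha> * (monom_val x \<alpha> - monom_val y \<alpha>)) \<le> e"
    proof (cases "Poly_Mapping.keys \<alpha> \<subseteq> {..<n}")
      case True
      have "padic_norm (f \<alpha>) * padic_norm (monom_val x \<alpha> - monom_val y \<alpha>) \<le> 1 * e"
        using f(2) mon[OF True] by (intro mult_mono) (auto simp: coeff_bound_1 padic_norm_nonneg)
      thus ?thesis by (simp add: padic_norm_mult)
    next
      case False
      hence "f \<alpha> = 0" using f(1) by (auto simp: in_washnitzer_iff supported_def)
      thus ?thesis using e by simp
    qed
  qed
qed

section \<open>Products of powers in coordinates\<close>

lemma lookup_beyond:
  assumes "Poly_Mapping.keys (\<alpha> :: multi_index) \<subseteq> {..<m}" "m \<le> j"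
  shows "Poly_Mapping.lookup \<alpha> j = 0"
proof -
  have "j \<notin> Poly_Mapping.keys \<alpha>" using assms by auto
  thus ?thesis by (simp add: in_keys_iff)
qed

definition power_word :: "(nat \<Rightarrow> 'g) \<Rightarrow> nat \<Rightarrow> multi_index \<Rightarrow> 'g list" where
  "power_word h m \<alpha> = concat (map (\<lambda>j. replicate (Poly_Mapping.lookup \<alpha> j) (h j)) [0..<m])"

lemma length_power_word: "Poly_Mapping.keys \<alpha> \<subseteq> {..<m} \<Longrightarrow> length (power_word h m \<alpha>) = total_degree \<alpha>"
  by (simp add: power_word_def length_concat o_def total_degree_eq_sum[of "{..<m}"]
      interv_sum_list_conv_sum_set_nat atLeast0LessThan)

lemma set_power_word: "set (power_word h m \<alpha>) \<subseteq> h ` {..<m}"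
  by (auto simp: power_word_def)

lemma power_word_add_single:
  assumes "Poly_Mapping.keys \<alpha> \<subseteq> {..<m}"
  shows "power_word h (Suc m) (\<alpha> + Poly_Mapping.single m k) = power_word h m \<alpha> @ replicate k (h m)"
proof -
  have "Poly_Mapping.lookup \<alpha> m = 0" using assms by (intro lookup_beyond[of _ m]) auto
  moreover have "map (\<lambda>j. replicate (Poly_Mapping.lookup (\<alpha> + Poly_Mapping.single m k) j) (h j)) [0..<m] =
      map (\<lambda>j. replicate (Poly_Mapping.lookup \<alpha> j) (h j)) [0..<m]"
    by (intro map_cong) (auto simp: lookup_add lookup_single when_def)
  ultimately show ?thesis
    unfolding power_word_def upt_Suc_append[OF le0] map_append concat_append by (simp only: list.map concat.simps lookup_add lookup_single_eq add_0 append_Nil2)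
qed

lemma power_word_0 [simp]: "power_word h m 0 = []"
  by (simp add: power_word_def concat_eq_Nil_conv)

definition bounded_index :: "nat \<Rightarrow> (nat \<Rightarrow> nat) \<Rightarrow> multi_index set" where
  "bounded_index m a = {\<alpha>. Poly_Mapping.keys \<alpha> \<subseteq> {..<m} \<and> (\<forall>j<m. Poly_Mapping.lookup \<alpha> j \<le> a j)}"

lemma bounded_index_Suc:
  "bij_betw (\<lambda>(k, \<alpha>). \<alpha> + Poly_Mapping.single m k) ({..a m} \<times> bounded_index m a) (bounded_index (Suc m) a)"
proof (rule bij_betw_imageI)
  have "{..a m} \<times> bounded_index m a \<subseteq> UNIV \<times> {\<alpha>. Poly_Mapping.keys \<alpha> \<subseteq> {..<m}}"
    by (auto simp: bounded_index_def)
  thus "inj_on (\<lambda>(k, \<alpha>). \<alpha> + Poly_Mapping.single m k) ({..a m} \<times> bounded_index m a)"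
    by (rule inj_on_subset[OF bij_betw_imp_inj_on[OF multi_index_last_variable]])
  show "(\<lambda>(k, \<alpha>). \<alpha> + Poly_Mapping.single m k) ` ({..a m} \<times> bounded_index m a) = bounded_index (Suc m) a"
  proof (intro equalityI subsetI)
    fix \<gamma> assume "\<gamma> \<in> (\<lambda>(k, \<alpha>). \<alpha> + Poly_Mapping.single m k) ` ({..a m} \<times> bounded_index m a)"
    then obtain k \<alpha> where \<gamma>: "\<gamma> = \<alpha> + Poly_Mapping.single m k" "k \<le> a m" "\<alpha> \<in> bounded_index m a" by auto
    have "Poly_Mapping.lookup \<alpha> m = 0"
      using \<gamma>(3) by (intro lookup_beyond[of _ m]) (auto simp: bounded_index_def)
    thus "\<gamma> \<in> bounded_index (Suc m) a"
      using \<gamma> by (auto simp: bounded_index_def keys_add_multi_index lookup_add lookup_single when_def less_Suc_eq split: if_splits)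
  next
    fix \<gamma> assume \<gamma>: "\<gamma> \<in> bounded_index (Suc m) a"
    hence "\<gamma> \<in> (\<lambda>(k, \<alpha>). \<alpha> + Poly_Mapping.single m k) ` (UNIV \<times> {\<alpha>. Poly_Mapping.keys \<alpha> \<subseteq> {..<m}})"
      using multi_index_last_variable[of m] by (simp add: bij_betw_def bounded_index_def)
    then obtain k \<alpha> where k: "\<gamma> = \<alpha> + Poly_Mapping.single m k" "Poly_Mapping.keys \<alpha> \<subseteq> {..<m}" by auto
    have "Poly_Mapping.lookup \<alpha> m = 0" using k(2) by (intro lookup_beyond[of _ m]) auto
    hence "k \<le> a m" using \<gamma> k(1) by (auto simp: bounded_index_def lookup_add)
    moreover have "Poly_Mapping.lookup \<alpha> j \<le> a j" if "j < m" for j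
      using \<gamma> that unfolding bounded_index_def k(1) by (auto simp: lookup_add dest: spec[of _ j])
    ultimately show "\<gamma> \<in> (\<lambda>(k, \<alpha>). \<alpha> + Poly_Mapping.single m k) ` ({..a m} \<times> bounded_index m a)"
      using k by (auto simp: bounded_index_def)
  qed
qed

text \<open>Peel off the last factor and expand it by \<open>newton_forward\<close>. The free right
  factor v leaves room for the peeled power in the induction hypothesis.\<close>

lemma (in group) newton_forward_product:
  assumes "\<And>j. j < m \<Longrightarrow> h j \<in> carrier G" "v \<in> carrier G"
  shows "F (foldr (\<lambda>j k. h j [^] (a j :: nat) \<otimes> k) [0..<m] v) =
    (\<Sum>\<alpha>\<in>bounded_index m a. (\<Prod>j<m. of_nat (a j choose Poly_Mapping.lookup \<alpha> j)) *
      word_diff G (\<lambda>u. F (u \<otimes> v)) \<one> (power_word h m \<alpha>) :: 'p::prime_card padic)"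
  using assms
proof (induction m arbitrary: v)
  case 0
  have "bounded_index 0 a = {0}" by (auto simp: bounded_index_def)
  thus ?case using 0 by (simp add: power_word_def)
next
  case (Suc m)
  let ?c = "\<lambda>m \<alpha>. \<Prod>j<m. of_nat (a j choose Poly_Mapping.lookup \<alpha> j) :: 'p padic"
  have hm: "h m \<in> carrier G" using Suc.prems by simp
  have hj: "\<And>j. j < m \<Longrightarrow> h j \<in> carrier G" using Suc.prems by simp
  have hs: "set (power_word h m \<alpha>) \<subseteq> carrier G" for \<alpha> using set_power_word[of h m \<alpha>] hj by auto
  have "F (foldr (\<lambda>j k. h j [^] a j \<otimes> k) [0..<Suc m] v) = F (foldr (\<lambda>j k. h j [^] a j \<otimes> k) [0..<m] (h m [^] a m \<otimes> v))"
    by simp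
  also have "\<dots> = (\<Sum>\<alpha>\<in>bounded_index m a. ?c m \<alpha> *
      word_diff G (\<lambda>u. F (u \<otimes> (h m [^] a m \<otimes> v))) \<one> (power_word h m \<alpha>))"
    using hj hm Suc.prems(2) by (intro Suc.IH) auto
  also have "\<dots> = (\<Sum>\<alpha>\<in>bounded_index m a. \<Sum>k\<le>a m. ?c m \<alpha> * (of_nat (a m choose k) *
      word_diff G (\<lambda>u. F (u \<otimes> v)) \<one> (power_word h m \<alpha> @ replicate k (h m))))"
  proof (rule sum.cong[OF refl])
    fix \<alpha>
    have "word_diff G (\<lambda>u. F (u \<otimes> (h m [^] a m \<otimes> v))) \<one> (power_word h m \<alpha>) =
        word_diff G (\<lambda>u. \<Sum>k\<le>a m. of_nat (a m choose k) * word_diff G (\<lambda>u. F (u \<otimes> v)) u (replicate k (h m))) \<one> (power_word h m \<alpha>)"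
    proof (rule word_diff_cong[OF _ one_closed hs])
      fix u assume u: "u \<in> carrier G"
      have "F (u \<otimes> (h m [^] a m \<otimes> v)) = (\<lambda>u. F (u \<otimes> v)) (u \<otimes> h m [^] a m)"
        using u hm Suc.prems(2) by (simp add: m_assoc)
      also have "\<dots> = (\<Sum>k\<le>a m. of_nat (a m choose k) * word_diff G (\<lambda>u. F (u \<otimes> v)) u (replicate k (h m)))"
        by (rule newton_forward[OF u hm])
      finally show "F (u \<otimes> (h m [^] a m \<otimes> v)) =
          (\<Sum>k\<le>a m. of_nat (a m choose k) * word_diff G (\<lambda>u. F (u \<otimes> v)) u (replicate k (h m)))" .
    qed
    thus "?c m \<alpha> * word_diff G (\<lambda>u. F (u \<otimes> (h m [^] a m \<otimes> v))) \<one> (power_word h m \<alpha>) =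
        (\<Sum>k\<le>a m. ?c m \<alpha> * (of_nat (a m choose k) * word_diff G (\<lambda>u. F (u \<otimes> v)) \<one> (power_word h m \<alpha> @ replicate k (h m))))"
      by (simp add: word_diff_sum word_diff_append sum_distrib_left)
  qed
  also have "\<dots> = (\<Sum>k\<le>a m. \<Sum>\<alpha>\<in>bounded_index m a. ?c m \<alpha> * (of_nat (a m choose k) *
      word_diff G (\<lambda>u. F (u \<otimes> v)) \<one> (power_word h m \<alpha> @ replicate k (h m))))"
    by (rule sum.swap)
  also have "\<dots> = (\<Sum>(k, \<alpha>)\<in>{..a m} \<times> bounded_index m a. ?c m \<alpha> * (of_nat (a m choose k) *
      word_diff G (\<lambda>u. F (u \<otimes> v)) \<one> (power_word h m \<alpha> @ replicate k (h m))))"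
    by (rule sum.cartesian_product)
  also have "\<dots> = (\<Sum>(k, \<alpha>)\<in>{..a m} \<times> bounded_index m a. ?c (Suc m) (\<alpha> + Poly_Mapping.single m k) *
      word_diff G (\<lambda>u. F (u \<otimes> v)) \<one> (power_word h (Suc m) (\<alpha> + Poly_Mapping.single m k)))"
  proof (rule sum.cong[OF refl], clarify)
    fix k \<alpha> assume "\<alpha> \<in> bounded_index m a"
    hence \<alpha>: "Poly_Mapping.keys \<alpha> \<subseteq> {..<m}" by (simp add: bounded_index_def)
    hence "Poly_Mapping.lookup \<alpha> m = 0" by (intro lookup_beyond[of _ m]) auto
    moreover have "?c m (\<alpha> + Poly_Mapping.single m k) = ?c m \<alpha>"
      by (intro prod.cong) (auto simp: lookup_add lookup_single when_def)
    ultimately show "?c m \<alpha> * (of_nat (a m choose k) * word_diff G (\<lambda>u. F (u \<otimes> v)) \<one> (power_word h m \<alpha> @ replicate k (h m))) =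
        ?c (Suc m) (\<alpha> + Poly_Mapping.single m k) *
        word_diff G (\<lambda>u. F (u \<otimes> v)) \<one> (power_word h (Suc m) (\<alpha> + Poly_Mapping.single m k))"
      by (simp add: power_word_add_single[OF \<alpha>] lookup_add mult.assoc)
  qed
  also have "\<dots> = (\<Sum>\<alpha>\<in>bounded_index (Suc m) a. ?c (Suc m) \<alpha> *
      word_diff G (\<lambda>u. F (u \<otimes> v)) \<one> (power_word h (Suc m) \<alpha>))"
    by (subst sum.reindex_bij_betw[OF bounded_index_Suc, symmetric]) (simp add: case_prod_unfold)
  finally show ?case .
qed

context p_valued
begin

lemma padic_pow_prod_closed:
  assumes "\<And>j. j < m \<Longrightarrow> h j \<in> carrier G" "x \<in> (padic_points m :: (nat \<Rightarrow> 'p padic) set)"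
  shows "padic_pow_prod G T m h x \<in> carrier G"
proof -
  have "foldr (\<lambda>j k. padic_pow G T (h j) (x j) \<otimes> k) is \<one> \<in> carrier G" if "set is \<subseteq> {..<m}" for "is"
    using that by (induction "is") (use assms in \<open>auto simp: padic_points_def padic_pow_closed\<close>)
  from this[of "[0..<m]"] show ?thesis by (simp add: padic_pow_prod_def atLeast0LessThan)
qed

text \<open>Errors in single factors are moved to the right by conjugation, under which the
  subgroups given by \<omega> are stable.\<close>

lemma padic_pow_prod_approx:
  assumes h: "\<And>j. j < m \<Longrightarrow> h j \<in> carrier G" and x: "x \<in> (padic_points m :: (nat \<Rightarrow> 'p padic) set)"
    and a: "\<And>j. j < m \<Longrightarrow> padic_norm (x j - of_nat (a j)) \<le> 1 / real CARD('p) ^ N"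
  shows "ereal (real N) \<le> \<omega> (inv (foldr (\<lambda>j k. h j [^] a j \<otimes> k) [0..<m] \<one>) \<otimes> padic_pow_prod G T m h x)"
proof -
  have "foldr (\<lambda>j k. h j [^] a j \<otimes> k) is \<one> \<in> carrier G \<and>
      foldr (\<lambda>j k. padic_pow G T (h j) (x j) \<otimes> k) is \<one> \<in> carrier G \<and>
      ereal (real N) \<le> \<omega> (inv (foldr (\<lambda>j k. h j [^] a j \<otimes> k) is \<one>) \<otimes>
        foldr (\<lambda>j k. padic_pow G T (h j) (x j) \<otimes> k) is \<one>)"
    if "set is \<subseteq> {..<m}" for "is"
    using that
  proof (induction "is")
    case (Cons j js)
    have j: "j < m" using Cons.prems by simp
    have xj: "x j \<in> padic_ints" using x j by (simp add: padic_points_def)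
    define A where "A = foldr (\<lambda>j k. h j [^] a j \<otimes> k) js \<one>"
    define X where "X = foldr (\<lambda>j k. padic_pow G T (h j) (x j) \<otimes> k) js \<one>"
    have IH: "A \<in> carrier G" "X \<in> carrier G" "ereal (real N) \<le> \<omega> (inv A \<otimes> X)"
      using Cons by (auto simp: A_def X_def)
    let ?b = "h j [^] a j" and ?y = "padic_pow G T (h j) (x j)"
    have c: "?b \<in> carrier G" "?y \<in> carrier G" using h[OF j] padic_pow_closed[OF h[OF j] xj] by auto
    have 1: "ereal (real N) \<le> \<omega> (inv ?b \<otimes> ?y)"
      using padic_pow_approx[OF h[OF j] xj, of "int (a j)" N] a[OF j] by (simp add: int_pow_int)
    have "ereal (real N) \<le> \<omega> ((inv A \<otimes> (inv ?b \<otimes> ?y) \<otimes> A) \<otimes> (inv A \<otimes> X))"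
      by (rule omega_mult_ge[OF _ _ omega_conj'[OF _ _ 1] IH(3)]) (use c IH in auto)
    also have "(inv A \<otimes> (inv ?b \<otimes> ?y) \<otimes> A) \<otimes> (inv A \<otimes> X) = inv (?b \<otimes> A) \<otimes> (?y \<otimes> X)"
      using c IH by (simp add: inv_mult_group m_assoc r_inv_cancel)
    finally show ?case using c IH by (simp add: A_def X_def)
  qed simp
  from this[of "[0..<m]"] show ?thesis by (simp add: padic_pow_prod_def atLeast0LessThan)
qed

end

context p_valued_basis
begin

text \<open>
  A basis element of weight greater than \<open>p / (p - 1)\<close> would be a \<open>p\<close>-th power,
  all of whose coordinates have norm less than \<open>1\<close>.
\<close>

lemma saturated_wt_le:
  assumes sat: "saturated CARD('p) G \<omega>" and i: "i < d"
  shows "wt i \<le> real CARD('p) / (real CARD('p) - 1)"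
proof (rule ccontr)
  let ?P = "CARD('p)"
  assume "\<not> ?thesis"
  hence w: "real ?P / (real ?P - 1) < wt i" by simp
  hence "ereal (real ?P / (real ?P - 1)) < \<omega> (g i)" by (simp add: omega_g[OF i])
  then obtain h where h: "h \<in> carrier G" "g i = h [^] ?P"
    using sat g_closed[OF i] unfolding saturated_def by blast
  have "ereal (wt i) = \<omega> h + 1" using omega_pow_p[OF h(1)] h(2) omega_g[OF i] by simp
  hence wh: "\<omega> h = ereal (wt i - 1)" by (cases "\<omega> h") (auto simp: one_ereal_def)
  define L where "L j = word_diff G (\<lambda>h. coord h i) \<one> (replicate j h)" for j
  have L1: "padic_norm (L j) \<le> 1" for j
    unfolding L_def using coord_integral[OF _ i] h(1) by (intro word_diff_norm_le) (auto simp: set_replicate_conv_if)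
  have "coord (g i) i = (\<Sum>j\<le>?P. of_nat (?P choose j) * L j)"
    using newton_forward[OF one_closed h(1), of "\<lambda>h. coord h i" ?P] h by (simp add: L_def)
  moreover have "padic_norm (\<Sum>j\<le>?P. of_nat (?P choose j) * L j) < 1"
  proof (rule padic_norm_sum_less)
    fix j assume "j \<in> {..?P}"
    then consider "j = 0" | "0 < j" "j < ?P" | "j = ?P" by force
    thus "padic_norm (of_nat (?P choose j) * L j) < 1"
    proof cases
      case 1 thus ?thesis using coord_one[OF i] by (simp add: L_def)
    next
      case 2
      have "padic_norm (of_nat (?P choose j) :: 'p padic) * padic_norm (L j) \<le> (1 / real ?P) * 1"
        using padic_norm_prime_choose[OF 2] L1 by (intro mult_mono) (auto simp: padic_norm_nonneg)
      also have "\<dots> < 1" using p_gt_1 by simp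
      finally show ?thesis by (simp add: padic_norm_mult)
    next
      \<comment> \<open>The p letters of weight wt i - 1 together outweigh wt i exactly when wt i >
        p / (p - 1).\<close>
      case 3
      have "weighted (replicate ?P (h, wt i - 1))"
        using omega_ge_min_wt[OF h(1)] by (intro weighted_replicate) (simp add: h wh)
      from word_diff_coord_bound[OF i this]
      have "padic_norm (L ?P) \<le> real ?P powr (wt i - real ?P * (wt i - 1))" by (simp add: L_def)
      also have "\<dots> < real ?P powr 0"
      proof (rule powr_less_mono)
        have "real ?P < wt i * (real ?P - 1)" using w p_gt_1 by (simp add: divide_less_eq)
        thus "wt i - real ?P * (wt i - 1) < 0" by (simp add: algebra_simps)
      qed (use p_gt_1 in simp)
      finally show ?thesis using 3 p_gt_1 by simp
    qed
  qed auto
  moreover have "coord (g i) i = 1"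
  proof -
    have "gprod (\<lambda>j. if j = i then 1 else 0) = g i"
      using gprod_single[OF i, of 1] padic_pow_of_nat[OF g_closed[OF i], of 1] g_closed[OF i] by simp
    moreover have "(\<lambda>j. if j = i then 1 else 0) \<in> padic_points d" by (auto simp: padic_points_def)
    ultimately show ?thesis using coord_gprod[OF _ i, of "\<lambda>j. if j = i then 1 else 0"] by simp
  qed
  ultimately show False by simp
qed

text \<open>\<open>A \<alpha>\<close> is the Mahler coefficient and \<open>c \<alpha>\<close> that
  of the falling factorial. In degree n the weight bound grows like n \<open>min_wt\<close> and the
  factorials cost (n - 1) / (p - 1), which leaves the rate \<open>gain\<close>. The series agrees
  with the coordinate at natural exponents, hence everywhere, since both sides are
  continuous.\<close>

lemma coordinate_series:
  assumes sat: "saturated CARD('p) G \<omega>" and h: "\<And>j. j < m \<Longrightarrow> h j \<in> carrier G" and i: "i < d"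
  obtains S where "S \<in> carrier (washnitzer m)" "coeff_bound S 1 1"
    "\<And>x. x \<in> padic_points m \<Longrightarrow> eval_series S x = coord (padic_pow_prod G T m h x) i"
proof -
  let ?P = "real CARD('p)" and ?z = "\<lambda>h. coord h i"
  define A where "A \<alpha> = word_diff G ?z \<one> (power_word h m \<alpha>)" for \<alpha>
  define c where "c \<alpha> = A \<alpha> / of_nat (multi_fact m \<alpha>)" for \<alpha>
  define q where "q = ?P powr (- gain)"
  have d: "0 < d" using i by simp
  have q: "0 < q" "q < 1" using p_gt_1 gain_pos[OF d] powr_less_mono[of "- gain" 0 ?P] by (auto simp: q_def)
  have hs: "set (power_word h m \<alpha>) \<subseteq> carrier G" for \<alpha> using set_power_word[of h m \<alpha>] h by auto
  have A_bound: "padic_norm (A \<alpha>) \<le> ?P powr (wt i - real (total_degree \<alpha>) * min_wt)"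
    if \<alpha>: "Poly_Mapping.keys \<alpha> \<subseteq> {..<m}" for \<alpha>
  proof -
    let ?ws = "map (\<lambda>h. (h, min_wt)) (power_word h m \<alpha>)"
    have "weighted ?ws" using hs omega_ge_min_wt by (auto simp: weighted_def)
    from word_diff_coord_bound[OF i this] show ?thesis
      by (simp add: A_def o_def word_wt_def sum_list_triv length_power_word[OF \<alpha>])
  qed
  have c_bound: "padic_norm (c \<alpha>) \<le> ?P powr (wt i - 1 / (?P - 1) - real (total_degree \<alpha>) * gain)"
    if \<alpha>: "Poly_Mapping.keys \<alpha> \<subseteq> {..<m}" "\<alpha> \<noteq> 0" for \<alpha>
  proof -
    let ?n = "real (total_degree \<alpha>)"
    have pos: "0 < ?P powr (- ((?n - 1) / (?P - 1)))" using p_gt_1 by simp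
    have "padic_norm (c \<alpha>) \<le> ?P powr (wt i - ?n * min_wt) / ?P powr (- ((?n - 1) / (?P - 1)))"
      unfolding c_def padic_norm_divide
      using A_bound[OF \<alpha>(1)] padic_norm_multi_fact_ge[OF \<alpha>, where 'p = 'p] pos
      by (intro frac_le) auto
    also have "\<dots> = ?P powr (wt i - ?n * min_wt + (?n - 1) / (?P - 1))" by (simp flip: powr_diff)
    \<comment> \<open>As the factorials cost n - 1 rather than n times 1 / (p - 1), the basis weight
      is reduced by 1 / (p - 1); by saturation what remains of it is at most 1.\<close>
    also have "wt i - ?n * min_wt + (?n - 1) / (?P - 1) = wt i - 1 / (?P - 1) - ?n * gain"
      by (simp add: gain_def diff_divide_distrib algebra_simps)
    finally show ?thesis .
  qed
  have c0: "c 0 = 0" using coord_one[OF i] by (simp add: c_def A_def)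
  have wti: "wt i - 1 / (?P - 1) \<le> 1"
    using saturated_wt_le[OF sat i] p_gt_1 by (simp add: field_simps)
  have c_le: "padic_norm (c \<alpha>) \<le> ?P * q ^ total_degree \<alpha>" if \<alpha>: "Poly_Mapping.keys \<alpha> \<subseteq> {..<m}" for \<alpha>
  proof (cases "\<alpha> = 0")
    case False
    have "padic_norm (c \<alpha>) \<le> ?P powr (1 + real (total_degree \<alpha>) * (- gain))"
      using wti p_gt_1 by (intro order_trans[OF c_bound[OF \<alpha> False]] powr_mono) auto
    also have "\<dots> = ?P * q ^ total_degree \<alpha>"
    proof -
      have "q ^ total_degree \<alpha> = q powr real (total_degree \<alpha>)" using q(1) by (simp add: powr_realpow)
      also have "\<dots> = ?P powr (real (total_degree \<alpha>) * (- gain))"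
        unfolding q_def by (simp add: powr_powr mult.commute)
      finally have "q ^ total_degree \<alpha> = ?P powr (real (total_degree \<alpha>) * (- gain))" .
      thus ?thesis unfolding powr_add using p_gt_1 by simp
    qed
    finally show ?thesis .
  qed (use c0 q in simp)
  have c_le_1: "padic_norm (c \<alpha>) \<le> 1" if \<alpha>: "Poly_Mapping.keys \<alpha> \<subseteq> {..<m}" for \<alpha>
  proof (cases "\<alpha> = 0")
    case False
    have "0 < total_degree \<alpha>"
    proof (rule ccontr)
      assume "\<not> ?thesis"
      hence "Poly_Mapping.lookup \<alpha> j = 0" for j using lookup_le_total_degree[of \<alpha> j] by simp
      thus False using False by (simp add: poly_mapping_eqI)
    qed
    \<comment> \<open>Positive degree makes the bound by p strict; discreteness of the norm lowers
      it to 1.\<close>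
    hence "q ^ total_degree \<alpha> < 1" using q by (simp add: power_less_one_iff)
    hence "?P * q ^ total_degree \<alpha> < ?P" using p_gt_1 by simp
    thus ?thesis using c_le[OF \<alpha>] by (intro padic_norm_less_p_imp_le_1) simp
  qed (use c0 in simp)
  obtain S where S: "S \<in> carrier (washnitzer m)" "coeff_bound S 1 1"
    "\<And>x. x \<in> padic_points m \<Longrightarrow>
      ((\<lambda>\<alpha>. c \<alpha> * falling_val m x \<alpha>) has_sum eval_series S x) {\<alpha>. Poly_Mapping.keys \<alpha> \<subseteq> {..<m}}"
    using mahler_series[OF q c_le c_le_1] by blast
  \<comment> \<open>At natural exponents the Mahler series is a finite Newton expansion, as the
    binomials vanish outside the box given by a.\<close>
  have nat_value: "eval_series S (\<lambda>j. of_nat (a j)) = ?z (foldr (\<lambda>j k. h j [^] a j \<otimes> k) [0..<m] \<one>)" for a :: "nat \<Rightarrow> nat"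
  proof -
    have x: "(\<lambda>j. of_nat (a j)) \<in> padic_points m" by (simp add: padic_points_def)
    have summand: "c \<alpha> * falling_val m (\<lambda>j. of_nat (a j)) \<alpha> =
        (\<Prod>j<m. of_nat (a j choose Poly_Mapping.lookup \<alpha> j)) * A \<alpha>" for \<alpha>
    proof -
      have "multi_fact m \<alpha> \<noteq> 0" by (simp add: multi_fact_def)
      hence "(of_nat (multi_fact m \<alpha>) :: 'p padic) \<noteq> 0" by (simp only: of_nat_eq_0_iff not_False_eq_True)
      thus ?thesis by (simp add: c_def falling_val_of_nat)
    qed
    have fin: "finite (bounded_index m a)"
    proof (rule finite_subset[OF _ finite_multi_index_degree[of m "\<Sum>j<m. a j"]])
      show "bounded_index m a \<subseteq> {\<alpha>. Poly_Mapping.keys \<alpha> \<subseteq> {..<m} \<and> total_degree \<alpha> \<le> (\<Sum>j<m. a j)}"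
        by (auto simp: bounded_index_def total_degree_eq_sum[of "{..<m}"] intro!: sum_mono)
    qed
    have "((\<lambda>\<alpha>. c \<alpha> * falling_val m (\<lambda>j. of_nat (a j)) \<alpha>) has_sum
        (\<Sum>\<alpha>\<in>bounded_index m a. (\<Prod>j<m. of_nat (a j choose Poly_Mapping.lookup \<alpha> j)) * A \<alpha>))
        {\<alpha>. Poly_Mapping.keys \<alpha> \<subseteq> {..<m}}"
      unfolding summand
      by (rule has_sum_finite_neutralI[OF fin]) (auto simp: bounded_index_def not_le binomial_eq_0)
    hence "eval_series S (\<lambda>j. of_nat (a j)) =
        (\<Sum>\<alpha>\<in>bounded_index m a. (\<Prod>j<m. of_nat (a j choose Poly_Mapping.lookup \<alpha> j)) * A \<alpha>)"
      using S(3)[OF x] has_sum_unique by blast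
    also have "\<dots> = (\<Sum>\<alpha>\<in>bounded_index m a. (\<Prod>j<m. of_nat (a j choose Poly_Mapping.lookup \<alpha> j)) *
        word_diff G (\<lambda>u. ?z (u \<otimes> \<one>)) \<one> (power_word h m \<alpha>))"
      unfolding A_def by (intro sum.cong refl arg_cong2[of _ _ _ _ "(*)"] word_diff_cong hs) auto
    also have "\<dots> = ?z (foldr (\<lambda>j k. h j [^] a j \<otimes> k) [0..<m] \<one>)"
      using newton_forward_product[where m = m and F = ?z and a = a, OF h one_closed] by simp
    finally show ?thesis .
  qed
  have "eval_series S x = ?z (padic_pow_prod G T m h x)" if x: "x \<in> padic_points m" for x
  proof -
    let ?X = "padic_pow_prod G T m h x"
    have XG: "?X \<in> carrier G" by (rule padic_pow_prod_closed[OF h x])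
    have "padic_norm (eval_series S x - ?z ?X) \<le> 1 / ?P ^ N" for N
    proof -
      obtain n where n: "inv_mod ?z n N" using continuous_inv_mod[OF continuous_coord[OF i]] by blast
      \<comment> \<open>N serves the Lipschitz bound for S; n puts the error in the group into
        \<open>filt n\<close>, under which the coordinate is invariant modulo p^N.\<close>
      define J where "J = max n N"
      have "\<forall>j. \<exists>b. j < m \<longrightarrow> padic_norm (x j - of_nat b) \<le> 1 / ?P ^ J"
        using padic_ints_approx_nat x by (metis (mono_tags, lifting) mem_Collect_eq padic_points_def)
      then obtain a where a: "\<And>j. j < m \<Longrightarrow> padic_norm (x j - of_nat (a j)) \<le> 1 / ?P ^ J" by metis
      define Y where "Y = foldr (\<lambda>j k. h j [^] a j \<otimes> k) [0..<m] \<one>"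
      have YG: "Y \<in> carrier G"
      proof -
        have "foldr (\<lambda>j k. h j [^] a j \<otimes> k) is \<one> \<in> carrier G" if "set is \<subseteq> {..<m}" for "is"
          using that by (induction "is") (use h in auto)
        from this[of "[0..<m]"] show ?thesis by (simp add: Y_def atLeast0LessThan)
      qed
      have JN: "1 / ?P ^ J \<le> 1 / ?P ^ N" using p_gt_1 by (simp add: J_def frac_le power_increasing)
      have "padic_norm (eval_series S x - eval_series S (\<lambda>j. of_nat (a j))) \<le> 1 / ?P ^ J"
        using a p_gt_1 by (intro eval_lipschitz[OF S(1,2) x]) (auto simp: padic_points_def)
      hence 1: "padic_norm (eval_series S x - ?z Y) \<le> 1 / ?P ^ N"
        using JN unfolding nat_value Y_def by linarith
      have "real n / ?P \<le> real J"
        using p_gt_1 by (simp add: J_def divide_le_eq order_trans[OF _ mult_left_mono[of 1]] mult_mono[of _ _ 1, simplified])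
      moreover have "ereal (real J) \<le> \<omega> (inv Y \<otimes> ?X)"
        unfolding Y_def by (rule padic_pow_prod_approx[OF h x a])
      ultimately have "inv Y \<otimes> ?X \<in> filt n"
        using XG YG by (auto simp: filt_def intro: order_trans[of "ereal (real n / ?P)" "ereal (real J)"])
      hence "padic_norm (?z (Y \<otimes> (inv Y \<otimes> ?X)) - ?z Y) \<le> 1 / ?P ^ N"
        using n YG unfolding inv_mod_def by blast
      hence 2: "padic_norm (?z ?X - ?z Y) \<le> 1 / ?P ^ N" using XG YG by (simp add: r_inv_cancel)
      from padic_norm_diff_le[OF 1 2] show ?thesis by simp
    qed
    hence "padic_norm (eval_series S x - ?z ?X) \<le> 0"
      by (intro LIMSEQ_le_const[OF prime_powers_tendsto_0[where 'p = 'p]]) auto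
    thus ?thesis using padic_norm_nonneg[of "eval_series S x - ?z ?X"] padic_norm_eq_0_iff[of "eval_series S x - ?z ?X"] by simp
  qed
  thus ?thesis using that S(1,2) by blast
qed

end

section \<open>Dagger tensor products in terms of points\<close>

definition concat_points :: "nat \<Rightarrow> (nat \<Rightarrow> 'a) \<Rightarrow> (nat \<Rightarrow> 'a) \<Rightarrow> nat \<Rightarrow> 'a" where
  "concat_points m x y = (\<lambda>i. if i < m then x i else y (i - m))"

definition drop_points :: "nat \<Rightarrow> (nat \<Rightarrow> 'a) \<Rightarrow> nat \<Rightarrow> 'a" where
  "drop_points m x = (\<lambda>i. x (i + m))"

lemma concat_points_in: "x \<in> padic_points m \<Longrightarrow> y \<in> padic_points n \<Longrightarrow> concat_points m x y \<in> padic_points (m + n)"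
  by (auto simp: padic_points_def concat_points_def)

lemma drop_points_in: "x \<in> padic_points (m + n) \<Longrightarrow> drop_points m x \<in> padic_points n"
  by (auto simp: padic_points_def drop_points_def)

lemma padic_points_mono: "x \<in> padic_points n \<Longrightarrow> m \<le> n \<Longrightarrow> x \<in> padic_points m"
  by (auto simp: padic_points_def)

lemma drop_concat_points [simp]: "drop_points m (concat_points m x y) = y"
  by (simp add: drop_points_def concat_points_def)

text \<open>Moves the variables up by m. It inverts the \<open>map_key\<close> in
  \<open>dagger_inr\<close> on multi-indices supported from m on, and serves to reindex
  sums.\<close>

definition shift_index :: "nat \<Rightarrow> multi_index \<Rightarrow> multi_index" where
  "shift_index m \<alpha> = Abs_poly_mapping (\<lambda>i. if m \<le> i then Poly_Mapping.lookup \<alpha> (i - m) else 0)"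

lemma lookup_shift_index:
  "Poly_Mapping.lookup (shift_index m \<alpha>) = (\<lambda>i. if m \<le> i then Poly_Mapping.lookup \<alpha> (i - m) else 0)"
proof -
  have "{i. (if m \<le> i then Poly_Mapping.lookup \<alpha> (i - m) else 0) \<noteq> 0} \<subseteq> (\<lambda>i. i + m) ` Poly_Mapping.keys \<alpha>"
  proof
    fix i assume "i \<in> {i. (if m \<le> i then Poly_Mapping.lookup \<alpha> (i - m) else 0) \<noteq> 0}"
    hence "m \<le> i" "i - m \<in> Poly_Mapping.keys \<alpha>" by (auto simp: in_keys_iff split: if_splits)
    thus "i \<in> (\<lambda>i. i + m) ` Poly_Mapping.keys \<alpha>" by (intro image_eqI[of _ _ "i - m"]) auto
  qed
  hence "finite {i. (if m \<le> i then Poly_Mapping.lookup \<alpha> (i - m) else 0) \<noteq> 0}"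
    by (rule finite_subset) simp
  thus ?thesis unfolding shift_index_def by (rule lookup_Abs_poly_mapping)
qed

lemma keys_shift_index: "Poly_Mapping.keys (shift_index m \<alpha>) = (\<lambda>i. i + m) ` Poly_Mapping.keys \<alpha>"
proof (intro Set.set_eqI iffI)
  fix i assume "i \<in> Poly_Mapping.keys (shift_index m \<alpha>)"
  hence "m \<le> i" "i - m \<in> Poly_Mapping.keys \<alpha>" by (auto simp: in_keys_iff lookup_shift_index split: if_splits)
  thus "i \<in> (\<lambda>i. i + m) ` Poly_Mapping.keys \<alpha>" by (intro image_eqI[of _ _ "i - m"]) auto
next
  fix i assume "i \<in> (\<lambda>i. i + m) ` Poly_Mapping.keys \<alpha>"
  then obtain j where "j \<in> Poly_Mapping.keys \<alpha>" "i = j + m" by blast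
  thus "i \<in> Poly_Mapping.keys (shift_index m \<alpha>)" by (simp add: in_keys_iff lookup_shift_index)
qed

lemma lookup_map_key_add: "Poly_Mapping.lookup (Poly_Mapping.map_key (\<lambda>i. i + m) \<alpha>) i = Poly_Mapping.lookup (\<alpha> :: multi_index) (i + m)"
  by (subst map_key.rep_eq) simp_all

lemma map_key_shift_index: "Poly_Mapping.map_key (\<lambda>i. i + m) (shift_index m \<alpha>) = \<alpha>"
  by (rule poly_mapping_eqI) (simp add: lookup_map_key_add lookup_shift_index)

lemma shift_index_map_key:
  assumes "Poly_Mapping.keys \<alpha> \<subseteq> {m..}"
  shows "shift_index m (Poly_Mapping.map_key (\<lambda>i. i + m) \<alpha>) = \<alpha>"
proof (rule poly_mapping_eqI)
  fix i
  have "Poly_Mapping.lookup \<alpha> i = 0" if "\<not> m \<le> i"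
  proof -
    have "i \<notin> Poly_Mapping.keys \<alpha>" using assms that by auto
    thus ?thesis by (simp add: in_keys_iff)
  qed
  thus "Poly_Mapping.lookup (shift_index m (Poly_Mapping.map_key (\<lambda>i. i + m) \<alpha>)) i = Poly_Mapping.lookup \<alpha> i"
    by (simp add: lookup_map_key_add lookup_shift_index)
qed

lemma shift_index_bij: "bij_betw (shift_index m) UNIV {\<alpha>. Poly_Mapping.keys \<alpha> \<subseteq> {m..}}"
  by (rule bij_betwI[of _ _ _ "Poly_Mapping.map_key (\<lambda>i. i + m)"])
    (auto simp: keys_shift_index map_key_shift_index shift_index_map_key)

lemma total_degree_shift_index: "total_degree (shift_index m \<alpha>) = total_degree \<alpha>"
  unfolding total_degree_def keys_shift_index
  by (subst sum.reindex) (simp_all add: lookup_shift_index inj_on_def)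

lemma monom_val_shift_index: "monom_val x (shift_index m \<alpha>) = monom_val (drop_points m x) \<alpha>"
  unfolding monom_val_def keys_shift_index
  by (subst prod.reindex) (simp_all add: lookup_shift_index inj_on_def drop_points_def)

lemma dagger_inr_shift_index:
  assumes "f \<in> carrier (washnitzer n)"
  shows "dagger_inr m n f (shift_index m \<alpha>) = f \<alpha>"
    "\<not> Poly_Mapping.keys \<beta> \<subseteq> {m..} \<Longrightarrow> dagger_inr m n f \<beta> = 0"
  using assms by (auto simp: dagger_inr_def keys_shift_index map_key_shift_index)

lemma dagger_inr_closed:
  assumes f: "f \<in> carrier (washnitzer n)"
  shows "dagger_inr m n f \<in> carrier (washnitzer (m + n))"
proof -
  obtain A s where s: "supported n f" "0 < s" "s < 1" "coeff_bound f s A" using f by (rule in_washnitzerE)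
  have "supported (m + n) (dagger_inr m n f)"
    unfolding supported_def
  proof (intro allI impI)
    fix \<beta> :: multi_index assume \<beta>: "\<not> Poly_Mapping.keys \<beta> \<subseteq> {..<m + n}"
    show "dagger_inr m n f \<beta> = 0"
    proof (cases "Poly_Mapping.keys \<beta> \<subseteq> {m..}")
      case True
      then obtain \<alpha> where \<alpha>: "\<beta> = shift_index m \<alpha>" using shift_index_map_key by metis
      have "\<not> Poly_Mapping.keys \<alpha> \<subseteq> {..<n}" using \<beta> by (auto simp: \<alpha> keys_shift_index)
      thus ?thesis using s(1) by (simp add: \<alpha> dagger_inr_shift_index[OF f] supported_def)
    qed (rule dagger_inr_shift_index[OF f])
  qed
  moreover have "coeff_bound (dagger_inr m n f) s A"
    unfolding coeff_bound_def
  proof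
    fix \<beta> :: multi_index
    show "padic_norm (dagger_inr m n f \<beta>) \<le> A * s ^ total_degree \<beta>"
    proof (cases "Poly_Mapping.keys \<beta> \<subseteq> {m..}")
      case True
      then obtain \<alpha> where \<alpha>: "\<beta> = shift_index m \<alpha>" using shift_index_map_key by metis
      show ?thesis using s(4) by (simp add: \<alpha> dagger_inr_shift_index[OF f] total_degree_shift_index coeff_bound_def)
    next
      case False
      thus ?thesis using coeff_bound_nonneg[OF s(4)] s(2) by (simp add: dagger_inr_shift_index[OF f])
    qed
  qed
  ultimately show ?thesis using s(2,3) by (intro in_washnitzerI)
qed

lemma eval_dagger_inr:
  assumes f: "f \<in> carrier (washnitzer n)" and x: "x \<in> padic_points (m + n)"
  shows "eval_series (dagger_inr m n f) x = eval_series f (drop_points m x)"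
proof -
  have "((\<lambda>\<alpha>. dagger_inr m n f \<alpha> * monom_val x \<alpha>) has_sum eval_series (dagger_inr m n f) x) UNIV"
    by (rule eval_has_sum[OF dagger_inr_closed[OF f] x])
  also have "?this \<longleftrightarrow> ((\<lambda>\<alpha>. dagger_inr m n f \<alpha> * monom_val x \<alpha>) has_sum eval_series (dagger_inr m n f) x)
      {\<alpha>. Poly_Mapping.keys \<alpha> \<subseteq> {m..}}"
    by (rule has_sum_cong_neutral) (auto simp: dagger_inr_shift_index[OF f])
  also have "\<dots> \<longleftrightarrow> ((\<lambda>\<alpha>. dagger_inr m n f (shift_index m \<alpha>) * monom_val x (shift_index m \<alpha>)) has_sum
      eval_series (dagger_inr m n f) x) UNIV"
    by (rule has_sum_reindex_bij_betw[OF shift_index_bij, symmetric])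
  finally have "((\<lambda>\<alpha>. f \<alpha> * monom_val (drop_points m x) \<alpha>) has_sum eval_series (dagger_inr m n f) x) UNIV"
    by (simp add: dagger_inr_shift_index[OF f] monom_val_shift_index)
  thus ?thesis using eval_has_sum[OF f drop_points_in[OF x]] has_sum_unique by blast
qed

lemma carrier_washnitzer_mono: "f \<in> carrier (washnitzer m) \<Longrightarrow> f \<in> carrier (washnitzer (m + n))"
  by (force simp: in_washnitzer_iff supported_def)

lemma dagger_inl_apply: "f \<in> carrier (washnitzer m) \<Longrightarrow> dagger_inl m n f = f"
  by (simp add: dagger_inl_def)

lemma dagger_inl_hom: "dagger_inl m n \<in> algebra_hom (washnitzer m) (washnitzer (m + n))"
  by (rule washnitzer_homI[of _ _ _ "\<lambda>x. x"])
    (auto simp: dagger_inl_def carrier_washnitzer_mono padic_points_mono)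

lemma dagger_inr_hom: "dagger_inr m n \<in> algebra_hom (washnitzer n) (washnitzer (m + n))"
  by (rule washnitzer_homI[of _ _ _ "drop_points m"])
    (auto simp: dagger_inr_closed eval_dagger_inr drop_points_in, simp add: dagger_inr_def)

lemma dagger_inl_var: "i < m \<Longrightarrow> dagger_inl m n (washnitzer_var i) = washnitzer_var i"
  by (simp add: dagger_inl_apply washnitzer_var_closed)

lemma dagger_inr_var: "i < n \<Longrightarrow> dagger_inr m n (washnitzer_var i) = washnitzer_var (i + m)"
  by (rule series_eqI[OF dagger_inr_closed washnitzer_var_closed])
    (simp_all add: washnitzer_var_closed eval_dagger_inr eval_var drop_points_def)

lemma hom_point_map_inl: "i < m \<Longrightarrow> hom_point_map (dagger_inl m n) x i = x i"
  by (simp add: hom_point_map_def dagger_inl_var eval_var)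

lemma hom_point_map_inr: "i < n \<Longrightarrow> hom_point_map (dagger_inr m n) x i = drop_points m x i"
  by (simp add: hom_point_map_def dagger_inr_var eval_var drop_points_def)

lemma hom_point_map_compose:
  assumes "\<phi> \<in> algebra_hom (washnitzer n) (washnitzer m)" "\<psi> \<in> algebra_hom (washnitzer m) (washnitzer k)"
    "x \<in> padic_points k" "i < n"
  shows "hom_point_map (compose (carrier (washnitzer n)) \<psi> \<phi>) x i = hom_point_map \<phi> (hom_point_map \<psi> x) i"
  using hom_eval[OF assms(2,3) algebra_hom_closed[OF assms(1) washnitzer_var_closed[OF assms(4)]]] assms(4)
  by (simp add: hom_point_map_def compose_def washnitzer_var_closed)

lemma hom_point_map_cong:
  assumes "\<phi> \<in> algebra_hom (washnitzer n) (washnitzer m)" "i < n" "\<And>j. j < m \<Longrightarrow> x j = y j"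
  shows "hom_point_map \<phi> x i = hom_point_map \<phi> y i"
  unfolding hom_point_map_def
  by (rule eval_series_cong[OF algebra_hom_closed[OF assms(1) washnitzer_var_closed[OF assms(2)]] assms(3)])

text \<open>The description in \<open>dagger_copair\<close> needs a witness: the images of the
  variables are integral by \<open>hom_var_coeff_bound\<close>, so they may be prescribed together.
  Uniqueness is seen on points, where the copair is concatenation.\<close>

lemma
  assumes \<phi>: "\<phi> \<in> algebra_hom (washnitzer m) (washnitzer k)" and \<psi>: "\<psi> \<in> algebra_hom (washnitzer n) (washnitzer k)"
  shows dagger_copair_hom: "dagger_copair m n (washnitzer k) \<phi> \<psi> \<in> algebra_hom (washnitzer (m + n)) (washnitzer k)"
    and hom_point_map_copair: "x \<in> padic_points k \<Longrightarrow> i < m + n \<Longrightarrow>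
      hom_point_map (dagger_copair m n (washnitzer k) \<phi> \<psi>) x i = concat_points m (hom_point_map \<phi> x) (hom_point_map \<psi> x) i"
proof -
  let ?Q = "\<lambda>\<xi>. \<xi> \<in> algebra_hom (washnitzer (m + n)) (washnitzer k) \<and>
      compose (carrier (washnitzer m)) \<xi> (dagger_inl m n) = \<phi> \<and>
      compose (carrier (washnitzer n)) \<xi> (dagger_inr m n) = \<psi>"
  have pts: "hom_point_map \<xi> x i = concat_points m (hom_point_map \<phi> x) (hom_point_map \<psi> x) i"
    if \<xi>: "?Q \<xi>" and x: "x \<in> padic_points k" and i: "i < m + n" for \<xi> x i
  proof (cases "i < m")
    case True
    have "hom_point_map \<phi> x i = hom_point_map (compose (carrier (washnitzer m)) \<xi> (dagger_inl m n)) x i"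
      using \<xi> by simp
    also have "\<dots> = hom_point_map (dagger_inl m n) (hom_point_map \<xi> x) i"
      using \<xi> x True by (intro hom_point_map_compose[OF dagger_inl_hom]) auto
    finally show ?thesis using True by (simp add: hom_point_map_inl concat_points_def)
  next
    case False
    hence j: "i - m < n" using i by simp
    have "hom_point_map \<psi> x (i - m) = hom_point_map (compose (carrier (washnitzer n)) \<xi> (dagger_inr m n)) x (i - m)"
      using \<xi> by simp
    also have "\<dots> = hom_point_map (dagger_inr m n) (hom_point_map \<xi> x) (i - m)"
      using \<xi> x j by (intro hom_point_map_compose[OF dagger_inr_hom]) auto
    finally show ?thesis using False j by (simp add: hom_point_map_inr concat_points_def drop_points_def)
  qed
  define F where "F i = (if i < m then \<phi> (washnitzer_var i) else \<psi> (washnitzer_var (i - m)))" for i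
  have F: "F i \<in> carrier (washnitzer k)" "coeff_bound (F i) 1 1" if "i < m + n" for i
    using that algebra_hom_closed[OF \<phi> washnitzer_var_closed] algebra_hom_closed[OF \<psi> washnitzer_var_closed]
      hom_var_coeff_bound[OF \<phi>] hom_var_coeff_bound[OF \<psi>] by (auto simp: F_def)
  obtain \<xi> where \<xi>: "\<xi> \<in> algebra_hom (washnitzer (m + n)) (washnitzer k)"
    "\<And>i. i < m + n \<Longrightarrow> \<xi> (washnitzer_var i) = F i"
    using washnitzer_hom_exists[of "m + n" F k, OF F] by blast
  have "compose (carrier (washnitzer m)) \<xi> (dagger_inl m n) = \<phi>"
  proof (rule washnitzer_hom_eqI[OF compose_washnitzer_hom[OF dagger_inl_hom \<xi>(1)] \<phi>])
    fix x :: "nat \<Rightarrow> 'a padic" and i assume x: "x \<in> padic_points k" "i < m"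
    show "hom_point_map (compose (carrier (washnitzer m)) \<xi> (dagger_inl m n)) x i = hom_point_map \<phi> x i"
      unfolding hom_point_map_compose[OF dagger_inl_hom \<xi>(1) x] using x
      by (simp add: hom_point_map_inl) (simp add: hom_point_map_def \<xi>(2) F_def)
  qed
  moreover have "compose (carrier (washnitzer n)) \<xi> (dagger_inr m n) = \<psi>"
  proof (rule washnitzer_hom_eqI[OF compose_washnitzer_hom[OF dagger_inr_hom \<xi>(1)] \<psi>])
    fix x :: "nat \<Rightarrow> 'a padic" and i assume x: "x \<in> padic_points k" "i < n"
    show "hom_point_map (compose (carrier (washnitzer n)) \<xi> (dagger_inr m n)) x i = hom_point_map \<psi> x i"
      unfolding hom_point_map_compose[OF dagger_inr_hom \<xi>(1) x] using x
      by (simp add: hom_point_map_inr drop_points_def) (simp add: hom_point_map_def \<xi>(2) F_def)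
  qed
  ultimately have Q: "?Q \<xi>" using \<xi>(1) by simp
  have "?Q (dagger_copair m n (washnitzer k) \<phi> \<psi>)"
    unfolding dagger_copair_def
  proof (rule theI[of ?Q, OF Q])
    fix \<zeta> assume \<zeta>: "?Q \<zeta>"
    show "\<zeta> = \<xi>"
      by (rule washnitzer_hom_eqI[of _ "m + n" k]) (use \<zeta> \<xi>(1) pts[OF \<zeta>] pts[OF Q] in auto)
  qed
  thus "dagger_copair m n (washnitzer k) \<phi> \<psi> \<in> algebra_hom (washnitzer (m + n)) (washnitzer k)"
    "x \<in> padic_points k \<Longrightarrow> i < m + n \<Longrightarrow>
      hom_point_map (dagger_copair m n (washnitzer k) \<phi> \<psi>) x i = concat_points m (hom_point_map \<phi> x) (hom_point_map \<psi> x) i"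
    using pts by blast+
qed

text \<open>The witness is evaluation at the concatenated point.\<close>

lemma
  assumes \<phi>: "\<phi> \<in> algebra_hom (washnitzer m) padic_algebra" and \<psi>: "\<psi> \<in> algebra_hom (washnitzer n) padic_algebra"
  shows point_copair_hom: "dagger_copair m n padic_algebra \<phi> \<psi> \<in> algebra_hom (washnitzer (m + n)) padic_algebra"
    and point_copair_var: "i < m + n \<Longrightarrow> dagger_copair m n padic_algebra \<phi> \<psi> (washnitzer_var i) =
      concat_points m (\<lambda>i. \<phi> (washnitzer_var i)) (\<lambda>i. \<psi> (washnitzer_var i)) i"
proof -
  let ?Q = "\<lambda>\<xi>. \<xi> \<in> algebra_hom (washnitzer (m + n)) padic_algebra \<and>
      compose (carrier (washnitzer m)) \<xi> (dagger_inl m n) = \<phi> \<and>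
      compose (carrier (washnitzer n)) \<xi> (dagger_inr m n) = \<psi>"
  let ?z = "concat_points m (\<lambda>i. \<phi> (washnitzer_var i)) (\<lambda>i. \<psi> (washnitzer_var i))"
  have pts: "\<xi> (washnitzer_var i) = ?z i" if \<xi>: "?Q \<xi>" and i: "i < m + n" for \<xi> i
  proof (cases "i < m")
    case True
    have "\<phi> (washnitzer_var i) = compose (carrier (washnitzer m)) \<xi> (dagger_inl m n) (washnitzer_var i)"
      using \<xi> by simp
    thus ?thesis using True by (simp add: compose_def washnitzer_var_closed dagger_inl_var concat_points_def)
  next
    case False
    hence j: "i - m < n" using i by simp
    have "\<psi> (washnitzer_var (i - m)) = compose (carrier (washnitzer n)) \<xi> (dagger_inr m n) (washnitzer_var (i - m))"
      using \<xi> by simp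
    thus ?thesis using False j by (simp add: compose_def washnitzer_var_closed dagger_inr_var concat_points_def)
  qed
  have z: "?z \<in> padic_points (m + n)"
    by (rule concat_points_in[OF point_hom_points[OF \<phi>] point_hom_points[OF \<psi>]])
  define \<xi> where "\<xi> = (\<lambda>f\<in>carrier (washnitzer (m + n)). eval_series f ?z)"
  have \<xi>: "\<xi> \<in> algebra_hom (washnitzer (m + n)) padic_algebra" unfolding \<xi>_def by (rule point_hom[OF z])
  have \<xi>v: "\<xi> (washnitzer_var i) = ?z i" if "i < m + n" for i
    using that by (simp add: \<xi>_def washnitzer_var_closed eval_var)
  have "compose (carrier (washnitzer m)) \<xi> (dagger_inl m n) = \<phi>"
    by (rule point_hom_eqI[OF compose_washnitzer_hom[OF dagger_inl_hom \<xi>] \<phi>])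
      (simp add: compose_def washnitzer_var_closed dagger_inl_var \<xi>v concat_points_def)
  moreover have "compose (carrier (washnitzer n)) \<xi> (dagger_inr m n) = \<psi>"
    by (rule point_hom_eqI[OF compose_washnitzer_hom[OF dagger_inr_hom \<xi>] \<psi>])
      (simp add: compose_def washnitzer_var_closed dagger_inr_var \<xi>v concat_points_def)
  ultimately have Q: "?Q \<xi>" using \<xi> by simp
  have "?Q (dagger_copair m n padic_algebra \<phi> \<psi>)"
    unfolding dagger_copair_def
  proof (rule theI[of ?Q, OF Q])
    fix \<zeta> assume \<zeta>: "?Q \<zeta>"
    show "\<zeta> = \<xi>"
      by (rule point_hom_eqI[of _ "m + n"]) (use \<zeta> \<xi> pts[OF \<zeta>] pts[OF Q] in auto)
  qed
  thus "dagger_copair m n padic_algebra \<phi> \<psi> \<in> algebra_hom (washnitzer (m + n)) padic_algebra"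
    "i < m + n \<Longrightarrow> dagger_copair m n padic_algebra \<phi> \<psi> (washnitzer_var i) = ?z i"
    using pts by blast+
qed

lemma
  assumes \<phi>: "\<phi> \<in> algebra_hom (washnitzer m) (washnitzer m')" and \<psi>: "\<psi> \<in> algebra_hom (washnitzer n) (washnitzer n')"
  shows dagger_tensor_hom_hom: "dagger_tensor_hom m n m' n' \<phi> \<psi> \<in> algebra_hom (washnitzer (m + n)) (washnitzer (m' + n'))"
    and hom_point_map_tensor: "x \<in> padic_points (m' + n') \<Longrightarrow> i < m + n \<Longrightarrow>
      hom_point_map (dagger_tensor_hom m n m' n' \<phi> \<psi>) x i =
      concat_points m (hom_point_map \<phi> x) (hom_point_map \<psi> (drop_points m' x)) i"
proof -
  note c = compose_washnitzer_hom[OF \<phi> dagger_inl_hom[of m' n']] compose_washnitzer_hom[OF \<psi> dagger_inr_hom[of m' n']]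
  show "dagger_tensor_hom m n m' n' \<phi> \<psi> \<in> algebra_hom (washnitzer (m + n)) (washnitzer (m' + n'))"
    unfolding dagger_tensor_hom_def by (rule dagger_copair_hom[OF c])
  assume x: "x \<in> padic_points (m' + n')" and i: "i < m + n"
  have 1: "hom_point_map (compose (carrier (washnitzer m)) (dagger_inl m' n') \<phi>) x j = hom_point_map \<phi> x j" if "j < m" for j
    unfolding hom_point_map_compose[OF \<phi> dagger_inl_hom x that]
    by (rule hom_point_map_cong[OF \<phi> that]) (simp add: hom_point_map_inl)
  have 2: "hom_point_map (compose (carrier (washnitzer n)) (dagger_inr m' n') \<psi>) x j = hom_point_map \<psi> (drop_points m' x) j"
    if "j < n" for j
    unfolding hom_point_map_compose[OF \<psi> dagger_inr_hom x that]
    by (rule hom_point_map_cong[OF \<psi> that]) (simp add: hom_point_map_inr)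
  show "hom_point_map (dagger_tensor_hom m n m' n' \<phi> \<psi>) x i =
      concat_points m (hom_point_map \<phi> x) (hom_point_map \<psi> (drop_points m' x)) i"
    unfolding dagger_tensor_hom_def hom_point_map_copair[OF c x i] using 1 2 i by (simp add: concat_points_def)
qed

lemma id_hom: "(\<lambda>f\<in>carrier (washnitzer n). f) \<in> algebra_hom (washnitzer n) (washnitzer n)"
  by (rule washnitzer_homI[of _ _ _ "\<lambda>x. x"]) auto

lemma hom_point_map_id: "i < n \<Longrightarrow> hom_point_map (\<lambda>f\<in>carrier (washnitzer n). f) x i = x i"
  by (simp add: hom_point_map_def washnitzer_var_closed eval_var)

lemma smult_one: "c \<odot>\<^bsub>washnitzer n\<^esub> \<one>\<^bsub>washnitzer n\<^esub> = const_series c"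
  by (auto simp: const_series_def washnitzer_smult washnitzer_one)

text \<open>Comorphism of the constant map to the unit section, the \<open>trivA\<close> of
  \<open>is_dagger_group\<close>.\<close>

definition trivial_hom :: "nat \<Rightarrow> ('p::prime_card padic_series \<Rightarrow> 'p padic) \<Rightarrow> 'p padic_series \<Rightarrow> 'p padic_series" where
  "trivial_hom n \<epsilon> = compose (carrier (washnitzer n)) (\<lambda>c. c \<odot>\<^bsub>washnitzer n\<^esub> \<one>\<^bsub>washnitzer n\<^esub>) \<epsilon>"

lemma trivial_hom_hom:
  assumes "\<epsilon> \<in> algebra_hom (washnitzer n) padic_algebra"
  shows "trivial_hom n \<epsilon> \<in> algebra_hom (washnitzer n) (washnitzer n)"
  by (rule washnitzer_homI[of _ _ _ "\<lambda>_. \<lambda>i. \<epsilon> (washnitzer_var i)"])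
    (use assms point_hom_points in \<open>auto simp: trivial_hom_def compose_def smult_one const_series_closed point_hom_eval\<close>)

lemma hom_point_map_trivial: "i < n \<Longrightarrow> hom_point_map (trivial_hom n \<epsilon>) x i = \<epsilon> (washnitzer_var i)"
  by (simp add: hom_point_map_def trivial_hom_def compose_def washnitzer_var_closed smult_one)

lemma rational_points_mult:
  assumes "comult H \<in> algebra_hom (washnitzer d) (washnitzer (d + d))"
    "\<phi> \<in> carrier (rational_points d H)" "\<psi> \<in> carrier (rational_points d H)"
  shows "\<phi> \<otimes>\<^bsub>rational_points d H\<^esub> \<psi> \<in> carrier (rational_points d H)"
    "i < d \<Longrightarrow> (\<phi> \<otimes>\<^bsub>rational_points d H\<^esub> \<psi>) (washnitzer_var i) =
      hom_point_map (comult H) (concat_points d (\<lambda>i. \<phi> (washnitzer_var i)) (\<lambda>i. \<psi> (washnitzer_var i))) i"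
proof -
  have \<phi>: "\<phi> \<in> algebra_hom (washnitzer d) padic_algebra" and \<psi>: "\<psi> \<in> algebra_hom (washnitzer d) padic_algebra"
    using assms(2,3) by (auto simp: rational_points_def)
  note c = point_copair_hom[OF \<phi> \<psi>]
  show "\<phi> \<otimes>\<^bsub>rational_points d H\<^esub> \<psi> \<in> carrier (rational_points d H)"
    using compose_washnitzer_hom[OF assms(1) c] by (simp add: rational_points_def)
  assume i: "i < d"
  have v: "comult H (washnitzer_var i) \<in> carrier (washnitzer (d + d))"
    by (rule algebra_hom_closed[OF assms(1) washnitzer_var_closed[OF i]])
  have "(\<phi> \<otimes>\<^bsub>rational_points d H\<^esub> \<psi>) (washnitzer_var i) = dagger_copair d d padic_algebra \<phi> \<psi> (comult H (washnitzer_var i))"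
    using i by (simp add: rational_points_def compose_def washnitzer_var_closed)
  also have "\<dots> = eval_series (comult H (washnitzer_var i)) (\<lambda>i. dagger_copair d d padic_algebra \<phi> \<psi> (washnitzer_var i))"
    by (rule point_hom_eval[OF c v])
  also have "\<dots> = eval_series (comult H (washnitzer_var i))
      (concat_points d (\<lambda>i. \<phi> (washnitzer_var i)) (\<lambda>i. \<psi> (washnitzer_var i)))"
    by (rule eval_series_cong[OF v point_copair_var[OF \<phi> \<psi>]])
  finally show "(\<phi> \<otimes>\<^bsub>rational_points d H\<^esub> \<psi>) (washnitzer_var i) =
      hom_point_map (comult H) (concat_points d (\<lambda>i. \<phi> (washnitzer_var i)) (\<lambda>i. \<psi> (washnitzer_var i))) i"
    by (simp add: hom_point_map_def)
qed

section \<open>The dagger group of an ordered basis\<close>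

lemma (in group) foldr_mult_right:
  assumes "\<And>j. j \<in> set js \<Longrightarrow> a j \<in> carrier G" "v \<in> carrier G"
  shows "foldr (\<lambda>j k. a j \<otimes> k) js v = foldr (\<lambda>j k. a j \<otimes> k) js \<one> \<otimes> v" "foldr (\<lambda>j k. a j \<otimes> k) js \<one> \<in> carrier G"
  using assms by (induction js) (auto simp: m_assoc)

lemma (in group) inv_foldr_mult:
  assumes "\<And>j. j \<in> set js \<Longrightarrow> a j \<in> carrier G"
  shows "inv (foldr (\<lambda>j k. a j \<otimes> k) js \<one>) = foldr (\<lambda>j k. inv (a j) \<otimes> k) (rev js) \<one>"
  using assms
proof (induction js)
  case (Cons j js)
  have c: "a j \<in> carrier G" "foldr (\<lambda>j k. a j \<otimes> k) js \<one> \<in> carrier G"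
    using Cons.prems foldr_mult_right(2)[of js a] by auto
  have "foldr (\<lambda>j k. inv (a j) \<otimes> k) (rev js) (inv (a j)) = foldr (\<lambda>j k. inv (a j) \<otimes> k) (rev js) \<one> \<otimes> inv (a j)"
    using Cons.prems by (intro foldr_mult_right) auto
  thus ?case using c Cons by (simp add: inv_mult_group)
qed simp

context p_valued_basis
begin

lemma gprod_factor_closed: "x \<in> padic_points d \<Longrightarrow> j < d \<Longrightarrow> padic_pow G T (g j) (x j :: 'p padic) \<in> carrier G"
  by (intro padic_pow_closed g_closed) (auto simp: padic_points_def)

text \<open>A product of two elements is again an ordered product of powers, of the basis listed
  twice. So multiplication falls under \<open>coordinate_hom\<close>.\<close>

lemma padic_pow_prod_double:
  assumes z: "z \<in> (padic_points (d + d) :: (nat \<Rightarrow> 'p padic) set)"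
  shows "padic_pow_prod G T (d + d) (\<lambda>j. if j < d then g j else g (j - d)) z = gprod z \<otimes> gprod (drop_points d z)"
proof -
  let ?F = "\<lambda>j. padic_pow G T (if j < d then g j else g (j - d)) (z j)"
  have z1: "z \<in> padic_points d" "drop_points d z \<in> padic_points d"
    using padic_points_mono[OF z] drop_points_in[OF z] by auto
  have "[0..<d + d] = [0..<d] @ map (\<lambda>j. j + d) [0..<d]"
    using upt_add_eq_append[of 0 d d] map_add_upt[of d d] by simp
  hence "foldr (\<lambda>j k. ?F j \<otimes> k) [0..<d + d] \<one> =
      foldr (\<lambda>j k. ?F j \<otimes> k) [0..<d] (foldr (\<lambda>j k. ?F (j + d) \<otimes> k) [0..<d] \<one>)"
    by (simp add: foldr_map o_def)
  also have "foldr (\<lambda>j k. ?F (j + d) \<otimes> k) [0..<d] \<one> = gprod (drop_points d z)"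
    unfolding padic_pow_prod_def by (intro foldr_cong) (auto simp: drop_points_def)
  also have "foldr (\<lambda>j k. ?F j \<otimes> k) [0..<d] (gprod (drop_points d z)) =
      foldr (\<lambda>j k. ?F j \<otimes> k) [0..<d] \<one> \<otimes> gprod (drop_points d z)"
    using z1 gprod_factor_closed[OF z1(1)] by (intro foldr_mult_right gprod_closed) auto
  also have "foldr (\<lambda>j k. ?F j \<otimes> k) [0..<d] \<one> = gprod z"
    unfolding padic_pow_prod_def by (intro foldr_cong) auto
  finally show ?thesis by (simp add: padic_pow_prod_def)
qed

text \<open>Inverting reverses the order of the factors; numbering them backwards makes this an
  ordered product again, now of powers of inverses.\<close>

lemma padic_pow_prod_reverse:
  assumes x: "x \<in> (padic_points d :: (nat \<Rightarrow> 'p padic) set)"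
  shows "padic_pow_prod G T d (\<lambda>j. inv (g (d - 1 - j))) (\<lambda>j. x (d - 1 - j)) = inv (gprod x)"
proof -
  have r: "map (\<lambda>j. d - 1 - j) [0..<d] = rev [0..<d]" by (rule nth_equalityI) (auto simp: rev_nth)
  have "inv (gprod x) = foldr (\<lambda>j k. inv (padic_pow G T (g j) (x j)) \<otimes> k) (rev [0..<d]) \<one>"
    unfolding padic_pow_prod_def by (rule inv_foldr_mult) (use gprod_factor_closed[OF x] in auto)
  also have "\<dots> = foldr (\<lambda>j k. inv (padic_pow G T (g (d - 1 - j)) (x (d - 1 - j))) \<otimes> k) [0..<d] \<one>"
    unfolding r[symmetric] by (simp add: foldr_map o_def)
  also have "\<dots> = padic_pow_prod G T d (\<lambda>j. inv (g (d - 1 - j))) (\<lambda>j. x (d - 1 - j))"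
    unfolding padic_pow_prod_def
    by (intro foldr_cong) (use x in \<open>auto simp: padic_pow_inv g_closed padic_points_def\<close>)
  finally show ?thesis ..
qed

lemma coordinate_hom:
  assumes sat: "saturated CARD('p) G \<omega>" and h: "\<And>j. j < m \<Longrightarrow> h j \<in> carrier G"
  obtains \<psi> where "\<psi> \<in> algebra_hom (washnitzer d) (washnitzer m)"
    "\<And>x i. x \<in> padic_points m \<Longrightarrow> i < d \<Longrightarrow> hom_point_map \<psi> x i = coord (padic_pow_prod G T m h x) i"
proof -
  have "\<exists>S. i < d \<longrightarrow> S \<in> carrier (washnitzer m) \<and> coeff_bound S 1 1 \<and>
      (\<forall>x\<in>padic_points m. eval_series S x = coord (padic_pow_prod G T m h x) i)" for i
    using coordinate_series[OF sat, of m h i] h by metis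
  then obtain S where S: "\<And>i. i < d \<Longrightarrow> S i \<in> carrier (washnitzer m)" "\<And>i. i < d \<Longrightarrow> coeff_bound (S i) 1 1"
    "\<And>i x. i < d \<Longrightarrow> x \<in> padic_points m \<Longrightarrow> eval_series (S i) x = coord (padic_pow_prod G T m h x) i"
    by metis
  obtain \<psi> where "\<psi> \<in> algebra_hom (washnitzer d) (washnitzer m)" "\<And>i. i < d \<Longrightarrow> \<psi> (washnitzer_var i) = S i"
    using washnitzer_hom_exists[of d S m, OF S(1,2)] by blast
  thus ?thesis using that S(3) by (simp add: hom_point_map_def)
qed

section \<open>Structure maps prescribed by the group\<close>

definition mult_hom :: "('p padic_series \<Rightarrow> 'p padic_series) \<Rightarrow> bool" where
  "mult_hom \<mu> \<longleftrightarrow> \<mu> \<in> algebra_hom (washnitzer d) (washnitzer (d + d)) \<and>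
    (\<forall>z\<in>padic_points (d + d). \<forall>i<d. hom_point_map \<mu> z i = coord (gprod z \<otimes> gprod (drop_points d z)) i)"

definition inv_hom :: "('p padic_series \<Rightarrow> 'p padic_series) \<Rightarrow> bool" where
  "inv_hom \<iota> \<longleftrightarrow> \<iota> \<in> algebra_hom (washnitzer d) (washnitzer d) \<and>
    (\<forall>x\<in>padic_points d. \<forall>i<d. hom_point_map \<iota> x i = coord (inv (gprod x)) i)"

definition unit_hom :: "('p padic_series \<Rightarrow> 'p padic) \<Rightarrow> bool" where
  "unit_hom \<epsilon> \<longleftrightarrow> \<epsilon> \<in> algebra_hom (washnitzer d) padic_algebra \<and> (\<forall>i<d. \<epsilon> (washnitzer_var i) = 0)"

lemma mult_hom_exists: "saturated CARD('p) G \<omega> \<Longrightarrow> \<exists>\<mu>. mult_hom \<mu>"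
proof -
  assume sat: "saturated CARD('p) G \<omega>"
  obtain \<mu> where "\<mu> \<in> algebra_hom (washnitzer d) (washnitzer (d + d))"
    "\<And>x i. x \<in> padic_points (d + d) \<Longrightarrow> i < d \<Longrightarrow>
      hom_point_map \<mu> x i = coord (padic_pow_prod G T (d + d) (\<lambda>j. if j < d then g j else g (j - d)) x) i"
    by (rule coordinate_hom[OF sat, of "d + d" "\<lambda>j. if j < d then g j else g (j - d)"]) (auto intro: g_closed)
  thus ?thesis unfolding mult_hom_def by (auto simp: padic_pow_prod_double)
qed

lemma inv_hom_exists: "saturated CARD('p) G \<omega> \<Longrightarrow> \<exists>\<iota>. inv_hom \<iota>"
proof -
  assume sat: "saturated CARD('p) G \<omega>"
  obtain \<psi> where \<psi>: "\<psi> \<in> algebra_hom (washnitzer d) (washnitzer d)"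
    "\<And>x i. x \<in> padic_points d \<Longrightarrow> i < d \<Longrightarrow>
      hom_point_map \<psi> x i = coord (padic_pow_prod G T d (\<lambda>j. inv (g (d - 1 - j))) x) i"
    by (rule coordinate_hom[OF sat, of d "\<lambda>j. inv (g (d - 1 - j))"]) (simp add: g_closed, rule that)
  \<comment> \<open>The homomorphism \<psi> takes the exponents in reversed order; \<rho> permutes
    the variables back.\<close>
  obtain \<rho> :: "'p padic_series \<Rightarrow> 'p padic_series" where \<rho>: "\<rho> \<in> algebra_hom (washnitzer d) (washnitzer d)"
    "\<And>i. i < d \<Longrightarrow> \<rho> (washnitzer_var i) = washnitzer_var (d - 1 - i)"
  proof -
    have "washnitzer_var (d - 1 - i) \<in> carrier (washnitzer d)" if "i < d" for i
      using that by (intro washnitzer_var_closed) simp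
    thus ?thesis using that washnitzer_hom_exists[of d "\<lambda>i. washnitzer_var (d - 1 - i)" d] coeff_bound_var by blast
  qed
  let ?\<iota> = "compose (carrier (washnitzer d)) \<rho> \<psi>"
  have "hom_point_map ?\<iota> x i = coord (inv (gprod x)) i" if x: "x \<in> padic_points d" and i: "i < d" for x i
  proof -
    let ?y = "\<lambda>j. x (d - 1 - j)"
    have y: "?y \<in> padic_points d" using x by (auto simp: padic_points_def)
    have "hom_point_map ?\<iota> x i = hom_point_map \<psi> (hom_point_map \<rho> x) i"
      by (rule hom_point_map_compose[OF \<psi>(1) \<rho>(1) x i])
    also have "\<dots> = hom_point_map \<psi> ?y i"
      by (rule hom_point_map_cong[OF \<psi>(1) i]) (simp add: hom_point_map_def \<rho>(2) eval_var)
    finally show ?thesis unfolding \<psi>(2)[OF y i] padic_pow_prod_reverse[OF x] .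
  qed
  thus ?thesis using compose_washnitzer_hom[OF \<psi>(1) \<rho>(1)] unfolding inv_hom_def by blast
qed

lemma unit_hom_exists: "\<exists>\<epsilon>. unit_hom \<epsilon>"
proof
  have z: "(\<lambda>_. 0) \<in> padic_points d" by (simp add: padic_points_def)
  show "unit_hom (\<lambda>f\<in>carrier (washnitzer d). eval_series f (\<lambda>_. 0))"
    unfolding unit_hom_def using point_hom[OF z] by (simp add: washnitzer_var_closed eval_var)
qed

lemma gprod_mult_hom:
  assumes "mult_hom \<mu>" "z \<in> padic_points (d + d)"
  shows "gprod (hom_point_map \<mu> z) = gprod z \<otimes> gprod (drop_points d z)"
proof -
  have c: "gprod z \<otimes> gprod (drop_points d z) \<in> carrier G"
    using gprod_closed[OF padic_points_mono[OF assms(2)]] gprod_closed[OF drop_points_in[OF assms(2)]] by simp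
  have "gprod (hom_point_map \<mu> z) = gprod (coord (gprod z \<otimes> gprod (drop_points d z)))"
    using assms by (intro gprod_cong) (simp add: mult_hom_def)
  thus ?thesis using gprod_coord[OF c] by simp
qed

lemma gprod_concat_points [simp]: "gprod (concat_points d x y) = gprod x"
  by (rule gprod_cong) (simp add: concat_points_def)

lemma mult_hom_concat:
  assumes "mult_hom \<mu>" "x \<in> padic_points d" "y \<in> padic_points d" "i < d"
  shows "hom_point_map \<mu> (concat_points d x y) i = coord (gprod x \<otimes> gprod y) i"
  using assms concat_points_in[OF assms(2,3)] by (simp add: mult_hom_def)

lemma is_dagger_group_basis:
  assumes \<mu>: "mult_hom \<mu>" and \<epsilon>: "unit_hom \<epsilon>" and \<iota>: "inv_hom \<iota>"
  shows "is_dagger_group d \<lparr>comult = \<mu>, counit = \<epsilon>, antipode = \<iota>\<rparr>"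
proof -
  let ?A = "washnitzer d :: ('p padic, 'p padic_series) module" and ?id = "\<lambda>f\<in>carrier (washnitzer d). f :: 'p padic_series"
  note \<mu>h = \<mu>[unfolded mult_hom_def, THEN conjunct1] and \<epsilon>h = \<epsilon>[unfolded unit_hom_def, THEN conjunct1]
    and \<iota>h = \<iota>[unfolded inv_hom_def, THEN conjunct1]
  note th = trivial_hom_hom[OF \<epsilon>h]
  have e: "gprod (hom_point_map (trivial_hom d \<epsilon>) x) = \<one>" for x
  proof -
    have "gprod (hom_point_map (trivial_hom d \<epsilon>) x) = gprod (\<lambda>_. 0)"
      using \<epsilon> by (intro gprod_cong) (simp add: hom_point_map_trivial unit_hom_def)
    thus ?thesis by (simp add: gprod_0)
  qed
  have gid: "gprod (hom_point_map ?id x) = gprod x" for x :: "nat \<Rightarrow> 'p padic"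
    by (rule gprod_cong) (simp add: hom_point_map_id)
  have ginv: "gprod (hom_point_map \<iota> x) = inv (gprod x)" if "x \<in> padic_points d" for x
  proof -
    have "gprod (hom_point_map \<iota> x) = gprod (coord (inv (gprod x)))"
      using \<iota> that by (intro gprod_cong) (simp add: inv_hom_def)
    thus ?thesis using gprod_coord gprod_closed[OF that] by simp
  qed
  \<comment> \<open>The unit and inverse diagrams all compare a copair with a third homomorphism; on
    points each is one equation between three elements of G.\<close>
  have copair: "compose (carrier ?A) (dagger_copair d d ?A \<alpha> \<beta>) \<mu> = \<gamma>"
    if \<alpha>: "\<alpha> \<in> algebra_hom ?A ?A" and \<beta>: "\<beta> \<in> algebra_hom ?A ?A" and \<gamma>: "\<gamma> \<in> algebra_hom ?A ?A"
      and eq: "\<And>x. x \<in> padic_points d \<Longrightarrow>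
        gprod (hom_point_map \<alpha> x) \<otimes> gprod (hom_point_map \<beta> x) = gprod (hom_point_map \<gamma> x)" for \<alpha> \<beta> \<gamma>
  proof (rule washnitzer_hom_eqI[OF compose_washnitzer_hom[OF \<mu>h dagger_copair_hom[OF \<alpha> \<beta>]] \<gamma>])
    fix x :: "nat \<Rightarrow> 'p padic" and i assume x: "x \<in> padic_points d" and i: "i < d"
    note ab = hom_point_map_points[OF \<alpha> x] hom_point_map_points[OF \<beta> x]
    have "hom_point_map (compose (carrier ?A) (dagger_copair d d ?A \<alpha> \<beta>) \<mu>) x i =
        hom_point_map \<mu> (hom_point_map (dagger_copair d d ?A \<alpha> \<beta>) x) i"
      by (rule hom_point_map_compose[OF \<mu>h dagger_copair_hom[OF \<alpha> \<beta>] x i])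
    also have "\<dots> = hom_point_map \<mu> (concat_points d (hom_point_map \<alpha> x) (hom_point_map \<beta> x)) i"
      by (rule hom_point_map_cong[OF \<mu>h i]) (rule hom_point_map_copair[OF \<alpha> \<beta> x])
    also have "\<dots> = coord (gprod (hom_point_map \<gamma> x)) i"
      unfolding mult_hom_concat[OF \<mu> ab i] eq[OF x] ..
    also have "\<dots> = hom_point_map \<gamma> x i" by (rule coord_gprod[OF hom_point_map_points[OF \<gamma> x] i])
    finally show "hom_point_map (compose (carrier ?A) (dagger_copair d d ?A \<alpha> \<beta>) \<mu>) x i = hom_point_map \<gamma> x i" .
  qed
  have assoc: "compose (carrier ?A) (dagger_tensor_hom d d (d + d) d \<mu> ?id) \<mu> =
      compose (carrier ?A) (dagger_tensor_hom d d d (d + d) ?id \<mu>) \<mu>"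
  proof -
    let ?l = "dagger_tensor_hom d d (d + d) d \<mu> ?id" and ?r = "dagger_tensor_hom d d d (d + d) ?id \<mu>"
    note l = dagger_tensor_hom_hom[OF \<mu>h id_hom[of d]] and r = dagger_tensor_hom_hom[OF id_hom[of d] \<mu>h]
    \<comment> \<open>Both triple products are the same algebra by associativity of addition, so the
      two sides can be compared on the same points.\<close>
    have r': "?r \<in> algebra_hom (washnitzer (d + d)) (washnitzer (d + d + d))" using r by (simp add: add.assoc)
    show ?thesis
    proof (rule washnitzer_hom_eqI[OF compose_washnitzer_hom[OF \<mu>h l] compose_washnitzer_hom[OF \<mu>h r']])
      fix z :: "nat \<Rightarrow> 'p padic" and i assume z: "z \<in> padic_points (d + d + d)" and i: "i < d"
      have z': "z \<in> padic_points (d + (d + d))" using z by (simp add: add.assoc)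
      have z1: "z \<in> padic_points d" "z \<in> padic_points (d + d)" using padic_points_mono[OF z] by auto
      have z2: "drop_points d z \<in> padic_points (d + d)" by (rule drop_points_in[OF z'])
      have z3: "drop_points (d + d) z \<in> padic_points d" by (rule drop_points_in[OF z])
      have dd: "drop_points d (drop_points d z) = drop_points (d + d) z" by (simp add: drop_points_def add.assoc)
      have c: "gprod z \<in> carrier G" "gprod (drop_points d z) \<in> carrier G" "gprod (drop_points (d + d) z) \<in> carrier G"
        using gprod_closed z1 z3 padic_points_mono[OF z2] by auto
      have "hom_point_map (compose (carrier ?A) ?l \<mu>) z i = hom_point_map \<mu> (hom_point_map ?l z) i"
        by (rule hom_point_map_compose[OF \<mu>h l z i])
      also have "\<dots> = hom_point_map \<mu> (concat_points d (hom_point_map \<mu> z) (hom_point_map ?id (drop_points (d + d) z))) i"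
        by (rule hom_point_map_cong[OF \<mu>h i]) (rule hom_point_map_tensor[OF \<mu>h id_hom z])
      also have "\<dots> = coord (gprod z \<otimes> gprod (drop_points d z) \<otimes> gprod (drop_points (d + d) z)) i"
        using mult_hom_concat[OF \<mu> hom_point_map_points[OF \<mu>h z1(2)] hom_point_map_points[OF id_hom z3] i]
        by (simp only: gprod_mult_hom[OF \<mu> z1(2)] gid)
      also have "\<dots> = coord (gprod z \<otimes> (gprod (drop_points d z) \<otimes> gprod (drop_points (d + d) z))) i"
        using c by (simp add: m_assoc)
      also have "\<dots> = hom_point_map \<mu> (concat_points d (hom_point_map ?id z) (hom_point_map \<mu> (drop_points d z))) i"
        using mult_hom_concat[OF \<mu> hom_point_map_points[OF id_hom z1(1)] hom_point_map_points[OF \<mu>h z2] i]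
        by (simp only: gprod_mult_hom[OF \<mu> z2] gid dd)
      also have "\<dots> = hom_point_map \<mu> (hom_point_map ?r z) i"
        by (rule hom_point_map_cong[OF \<mu>h i]) (rule hom_point_map_tensor[OF id_hom \<mu>h z', symmetric])
      also have "\<dots> = hom_point_map (compose (carrier ?A) ?r \<mu>) z i"
        by (rule hom_point_map_compose[OF \<mu>h r' z i, symmetric])
      finally show "hom_point_map (compose (carrier ?A) ?l \<mu>) z i = hom_point_map (compose (carrier ?A) ?r \<mu>) z i" .
    qed
  qed
  have 1: "compose (carrier ?A) (dagger_copair d d ?A (trivial_hom d \<epsilon>) ?id) \<mu> = ?id"
    by (rule copair[OF th id_hom id_hom]) (simp add: e gid gprod_closed)
  have 2: "compose (carrier ?A) (dagger_copair d d ?A ?id (trivial_hom d \<epsilon>)) \<mu> = ?id"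
    by (rule copair[OF id_hom th id_hom]) (simp add: e gid gprod_closed)
  have 3: "compose (carrier ?A) (dagger_copair d d ?A \<iota> ?id) \<mu> = trivial_hom d \<epsilon>"
    by (rule copair[OF \<iota>h id_hom th]) (simp add: e gid ginv gprod_closed)
  have 4: "compose (carrier ?A) (dagger_copair d d ?A ?id \<iota>) \<mu> = trivial_hom d \<epsilon>"
    by (rule copair[OF id_hom \<iota>h th]) (simp add: e gid ginv gprod_closed)
  show ?thesis
    unfolding is_dagger_group_def Let_def
    using \<mu>h \<epsilon>h \<iota>h assoc 1 2 3 4 by (simp add: trivial_hom_def)
qed

lemma points_map_eq: "points_map G T d g \<phi> = gprod (\<lambda>i. \<phi> (washnitzer_var i))"
  by (simp add: points_map_def)

lemma point_of_coord:
  assumes "x \<in> padic_points d"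
  obtains \<phi> where "\<phi> \<in> algebra_hom (washnitzer d) padic_algebra" "\<And>i. i < d \<Longrightarrow> \<phi> (washnitzer_var i) = x i"
  by (rule that[OF point_hom[OF assms]]) (simp_all add: washnitzer_var_closed eval_var)

lemma points_map_iso:
  assumes \<mu>: "mult_hom (comult H)"
  shows "points_map G T d g \<in> iso (rational_points d H) G"
proof -
  note \<mu>h = \<mu>[unfolded mult_hom_def, THEN conjunct1]
  have car: "carrier (rational_points d H) = algebra_hom (washnitzer d) padic_algebra"
    by (simp add: rational_points_def)
  have closed: "points_map G T d g \<phi> \<in> carrier G" if "\<phi> \<in> carrier (rational_points d H)" for \<phi>
    using that unfolding car points_map_eq by (intro gprod_closed point_hom_points)
  have mult: "points_map G T d g (\<phi> \<otimes>\<^bsub>rational_points d H\<^esub> \<psi>) = points_map G T d g \<phi> \<otimes> points_map G T d g \<psi>"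
    if \<phi>: "\<phi> \<in> carrier (rational_points d H)" and \<psi>: "\<psi> \<in> carrier (rational_points d H)" for \<phi> \<psi>
  proof -
    let ?x = "\<lambda>i. \<phi> (washnitzer_var i)" and ?y = "\<lambda>i. \<psi> (washnitzer_var i)"
    have xy: "?x \<in> padic_points d" "?y \<in> padic_points d" using \<phi> \<psi> unfolding car by (auto intro: point_hom_points)
    have "points_map G T d g (\<phi> \<otimes>\<^bsub>rational_points d H\<^esub> \<psi>) = gprod (hom_point_map (comult H) (concat_points d ?x ?y))"
      unfolding points_map_eq by (rule gprod_cong) (rule rational_points_mult(2)[OF \<mu>h \<phi> \<psi>])
    also have "\<dots> = gprod ?x \<otimes> gprod ?y"
      using gprod_mult_hom[OF \<mu> concat_points_in[OF xy]] by simp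
    finally show ?thesis by (simp add: points_map_eq)
  qed
  have "bij_betw (points_map G T d g) (carrier (rational_points d H)) (carrier G)"
    unfolding bij_betw_def
  proof
    show "inj_on (points_map G T d g) (carrier (rational_points d H))"
    proof (rule inj_onI)
      fix \<phi> \<psi> assume a: "\<phi> \<in> carrier (rational_points d H)" "\<psi> \<in> carrier (rational_points d H)"
        "points_map G T d g \<phi> = points_map G T d g \<psi>"
      show "\<phi> = \<psi>"
        by (rule point_hom_eqI[of _ d])
          (use a gprod_inj[OF point_hom_points point_hom_points, of \<phi> \<psi>] in \<open>auto simp: car points_map_eq\<close>)
    qed
    show "points_map G T d g ` carrier (rational_points d H) = carrier G"
    proof (intro equalityI subsetI)
      fix h assume h: "h \<in> carrier G"
      obtain \<phi> where \<phi>: "\<phi> \<in> algebra_hom (washnitzer d) padic_algebra"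
        "\<And>i. i < d \<Longrightarrow> \<phi> (washnitzer_var i) = coord h i" by (rule point_of_coord[OF coord_points[OF h]], rule that)
      have "points_map G T d g \<phi> = gprod (coord h)" unfolding points_map_eq by (rule gprod_cong[OF \<phi>(2)])
      thus "h \<in> points_map G T d g ` carrier (rational_points d H)"
        using \<phi>(1) gprod_coord[OF h] by (metis car image_eqI)
    qed (use closed in auto)
  qed
  thus ?thesis using closed mult by (auto simp: iso_def hom_def)
qed

text \<open>The product of rational points is carried to that of G, and coordinates in G are unique,
  so the comultiplication is known at every point.\<close>

lemma associated_mult_hom:
  assumes "associated_dagger_group G T d g H"
  shows "mult_hom (comult H)"
proof -
  have \<mu>h: "comult H \<in> algebra_hom (washnitzer d) (washnitzer (d + d))"
    and iso: "points_map G T d g \<in> iso (rational_points d H) G"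
    using assms by (auto simp: associated_dagger_group_def is_dagger_group_def Let_def)
  have "hom_point_map (comult H) z i = coord (gprod z \<otimes> gprod (drop_points d z)) i"
    if z: "z \<in> padic_points (d + d)" and i: "i < d" for z i
  proof -
    have z1: "z \<in> padic_points d" "drop_points d z \<in> padic_points d"
      using padic_points_mono[OF z] drop_points_in[OF z] by auto
    obtain \<phi> where \<phi>: "\<phi> \<in> algebra_hom (washnitzer d) padic_algebra"
      "\<And>i. i < d \<Longrightarrow> \<phi> (washnitzer_var i) = z i" by (rule point_of_coord[OF z1(1)], rule that)
    obtain \<psi> where \<psi>: "\<psi> \<in> algebra_hom (washnitzer d) padic_algebra"
      "\<And>i. i < d \<Longrightarrow> \<psi> (washnitzer_var i) = drop_points d z i" by (rule point_of_coord[OF z1(2)], rule that)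
    have car: "\<phi> \<in> carrier (rational_points d H)" "\<psi> \<in> carrier (rational_points d H)"
      using \<phi> \<psi> by (auto simp: rational_points_def)
    let ?w = "concat_points d (\<lambda>i. \<phi> (washnitzer_var i)) (\<lambda>i. \<psi> (washnitzer_var i))"
    have w: "hom_point_map (comult H) ?w j = hom_point_map (comult H) z j" if "j < d" for j
      by (rule hom_point_map_cong[OF \<mu>h that]) (auto simp: concat_points_def \<phi>(2) \<psi>(2) drop_points_def)
    have "points_map G T d g (\<phi> \<otimes>\<^bsub>rational_points d H\<^esub> \<psi>) = points_map G T d g \<phi> \<otimes> points_map G T d g \<psi>"
      using iso car by (auto simp: iso_def hom_def)
    moreover have "points_map G T d g \<phi> = gprod z" "points_map G T d g \<psi> = gprod (drop_points d z)"
      unfolding points_map_eq by (rule gprod_cong, simp add: \<phi>(2) \<psi>(2))+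
    moreover have "points_map G T d g (\<phi> \<otimes>\<^bsub>rational_points d H\<^esub> \<psi>) = gprod (hom_point_map (comult H) z)"
      unfolding points_map_eq by (rule gprod_cong) (simp add: rational_points_mult(2)[OF \<mu>h car] w)
    ultimately have "gprod (hom_point_map (comult H) z) = gprod z \<otimes> gprod (drop_points d z)" by simp
    thus ?thesis using coord_gprod[OF hom_point_map_points[OF \<mu>h z] i] by simp
  qed
  thus ?thesis using \<mu>h by (simp add: mult_hom_def)
qed

text \<open>Evaluate the left unit diagram at the origin, which corresponds to 1 in G: the counit
  point times 1 is 1.\<close>

lemma associated_unit_hom:
  assumes H: "associated_dagger_group G T d g H"
  shows "unit_hom (counit H)"
proof -
  let ?A = "washnitzer d :: ('p padic, 'p padic_series) module" and ?id = "\<lambda>f\<in>carrier (washnitzer d). f :: 'p padic_series"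
  have \<epsilon>h: "counit H \<in> algebra_hom (washnitzer d) padic_algebra"
    and eq: "compose (carrier ?A) (dagger_copair d d ?A (trivial_hom d (counit H)) ?id) (comult H) = ?id"
    using H by (auto simp: associated_dagger_group_def is_dagger_group_def Let_def trivial_hom_def)
  note \<mu> = associated_mult_hom[OF H]
  note \<mu>h = \<mu>[unfolded mult_hom_def, THEN conjunct1] and th = trivial_hom_hom[OF \<epsilon>h]
  let ?e = "\<lambda>i. counit H (washnitzer_var i)"
  have e: "?e \<in> padic_points d" by (rule point_hom_points[OF \<epsilon>h])
  have z: "(\<lambda>_. 0) \<in> padic_points d" by (simp add: padic_points_def)
  have "coord (gprod ?e \<otimes> gprod (\<lambda>_. 0)) i = 0" if i: "i < d" for i
  proof -
    have "0 = hom_point_map ?id (\<lambda>_. 0) i" using i by (simp add: hom_point_map_id)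
    also have "\<dots> = hom_point_map (compose (carrier ?A) (dagger_copair d d ?A (trivial_hom d (counit H)) ?id) (comult H)) (\<lambda>_. 0) i"
      by (simp only: eq)
    also have "\<dots> = hom_point_map (comult H) (hom_point_map (dagger_copair d d ?A (trivial_hom d (counit H)) ?id) (\<lambda>_. 0)) i"
      by (rule hom_point_map_compose[OF \<mu>h dagger_copair_hom[OF th id_hom] z i])
    also have "\<dots> = hom_point_map (comult H) (concat_points d ?e (\<lambda>_. 0)) i"
      by (rule hom_point_map_cong[OF \<mu>h i])
        (simp add: hom_point_map_copair[OF th id_hom z] concat_points_def hom_point_map_trivial hom_point_map_id)
    also have "\<dots> = coord (gprod ?e \<otimes> gprod (\<lambda>_. 0)) i" by (rule mult_hom_concat[OF \<mu> e z i])
    finally show ?thesis by simp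
  qed
  thus ?thesis using \<epsilon>h coord_gprod[OF e] gprod_closed[OF e] by (simp add: unit_hom_def gprod_0)
qed

text \<open>The left inverse diagram turns the antipode into a left inverse in G, and inverses in a
  group are unique.\<close>

lemma associated_inv_hom:
  assumes H: "associated_dagger_group G T d g H"
  shows "inv_hom (antipode H)"
proof -
  let ?A = "washnitzer d :: ('p padic, 'p padic_series) module" and ?id = "\<lambda>f\<in>carrier (washnitzer d). f :: 'p padic_series"
  have \<iota>h: "antipode H \<in> algebra_hom ?A ?A"
    and eq: "compose (carrier ?A) (dagger_copair d d ?A (antipode H) ?id) (comult H) = trivial_hom d (counit H)"
    using H by (auto simp: associated_dagger_group_def is_dagger_group_def Let_def trivial_hom_def)
  note \<mu> = associated_mult_hom[OF H] and \<epsilon> = associated_unit_hom[OF H]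
  note \<mu>h = \<mu>[unfolded mult_hom_def, THEN conjunct1]
  have "hom_point_map (antipode H) x i = coord (inv (gprod x)) i" if x: "x \<in> padic_points d" and i: "i < d" for x i
  proof -
    let ?y = "hom_point_map (antipode H) x"
    have y: "?y \<in> padic_points d" by (rule hom_point_map_points[OF \<iota>h x])
    have c: "gprod ?y \<in> carrier G" "gprod x \<in> carrier G" using gprod_closed x y by auto
    have "coord (gprod ?y \<otimes> gprod x) j = 0" if j: "j < d" for j
    proof -
      have "coord (gprod ?y \<otimes> gprod x) j = hom_point_map (comult H) (concat_points d ?y x) j"
        by (rule mult_hom_concat[OF \<mu> y x j, symmetric])
      also have "\<dots> = hom_point_map (comult H) (hom_point_map (dagger_copair d d ?A (antipode H) ?id) x) j"
        by (rule hom_point_map_cong[OF \<mu>h j])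
          (simp add: hom_point_map_copair[OF \<iota>h id_hom x] concat_points_def hom_point_map_id)
      also have "\<dots> = hom_point_map (trivial_hom d (counit H)) x j"
        unfolding eq[symmetric] by (rule hom_point_map_compose[OF \<mu>h dagger_copair_hom[OF \<iota>h id_hom] x j, symmetric])
      also have "\<dots> = 0" using \<epsilon> j by (simp add: hom_point_map_trivial unit_hom_def)
      finally show ?thesis .
    qed
    hence "gprod (coord (gprod ?y \<otimes> gprod x)) = gprod (\<lambda>_. 0)" by (rule gprod_cong)
    hence "gprod ?y \<otimes> gprod x = \<one>" using c by (simp add: gprod_coord gprod_0)
    hence "inv (gprod x) = gprod ?y" using c(2,1) by (rule inv_equality)
    thus ?thesis using coord_gprod[OF y i] by simp
  qed
  thus ?thesis using \<iota>h by (simp add: inv_hom_def)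
qed

lemma mult_hom_unique: "mult_hom \<mu> \<Longrightarrow> mult_hom \<mu>' \<Longrightarrow> \<mu> = \<mu>'"
  unfolding mult_hom_def by (intro washnitzer_hom_eqI[of _ d "d + d"]) auto

lemma inv_hom_unique: "inv_hom \<iota> \<Longrightarrow> inv_hom \<iota>' \<Longrightarrow> \<iota> = \<iota>'"
  unfolding inv_hom_def by (intro washnitzer_hom_eqI[of _ d d]) auto

lemma unit_hom_unique: "unit_hom \<epsilon> \<Longrightarrow> unit_hom \<epsilon>' \<Longrightarrow> \<epsilon> = \<epsilon>'"
  unfolding unit_hom_def by (intro point_hom_eqI[of _ d]) auto

lemma associated_dagger_group_unique_exists:
  assumes "saturated CARD('p) G \<omega>"
  shows "\<exists>!H :: 'p dagger_group. associated_dagger_group G T d g H"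
proof -
  obtain \<mu> \<epsilon> \<iota> where s: "mult_hom \<mu>" "unit_hom \<epsilon>" "inv_hom \<iota>"
    using mult_hom_exists[OF assms] unit_hom_exists inv_hom_exists[OF assms] by blast
  show ?thesis
  proof (rule ex1I[of _ "\<lparr>comult = \<mu>, counit = \<epsilon>, antipode = \<iota>\<rparr>"])
    show "associated_dagger_group G T d g \<lparr>comult = \<mu>, counit = \<epsilon>, antipode = \<iota>\<rparr>"
      unfolding associated_dagger_group_def
      using is_dagger_group_basis[OF s] points_map_iso[of "\<lparr>comult = \<mu>, counit = \<epsilon>, antipode = \<iota>\<rparr>"] s(1) by simp
    fix H :: "'p dagger_group" assume "associated_dagger_group G T d g H"
    thus "H = \<lparr>comult = \<mu>, counit = \<epsilon>, antipode = \<iota>\<rparr>"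
      using mult_hom_unique[OF associated_mult_hom s(1), of H] unit_hom_unique[OF associated_unit_hom s(2), of H]
        inv_hom_unique[OF associated_inv_hom s(3), of H] by (cases H) simp
  qed
qed

end

section \<open>Change of ordered basis\<close>

locale p_valued_two_bases = B: p_valued_basis G T \<omega> ptype d g + B': p_valued_basis G T \<omega> ptype d' g'
  for G :: "('g, 'm) monoid_scheme" (structure) and T :: "'g topology" and \<omega> :: "'g \<Rightarrow> ereal"
    and ptype :: "'p::prime_card itself" and d g d' g'
begin

text \<open>A comorphism, hence from d' variables to d: on points it rewrites the element with
  coordinates x in the basis g in terms of g'.\<close>

definition change_hom :: "('p padic_series \<Rightarrow> 'p padic_series) \<Rightarrow> bool" where
  "change_hom \<theta> \<longleftrightarrow> \<theta> \<in> algebra_hom (washnitzer d') (washnitzer d) \<and>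
    (\<forall>x\<in>padic_points d. \<forall>i<d'. hom_point_map \<theta> x i = B'.coord (B.gprod x) i)"

lemma change_hom_exists: "saturated CARD('p) G \<omega> \<Longrightarrow> \<exists>\<theta>. change_hom \<theta>"
  unfolding change_hom_def using B'.coordinate_hom[of d g] B.g_closed by metis

lemma gprod_change_hom:
  assumes "change_hom \<theta>" "x \<in> padic_points d"
  shows "B'.gprod (hom_point_map \<theta> x) = B.gprod x"
proof -
  have "B'.gprod (hom_point_map \<theta> x) = B'.gprod (B'.coord (B.gprod x))"
    using assms by (intro B'.gprod_cong) (simp add: change_hom_def)
  thus ?thesis using B'.gprod_coord[OF B.gprod_closed[OF assms(2)]] by simp
qed

lemma change_hom_dagger_group_hom:
  assumes \<theta>: "change_hom \<theta>" and \<mu>: "B.mult_hom (comult H)" and \<mu>': "B'.mult_hom (comult H')"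
  shows "\<theta> \<in> dagger_group_hom d H d' H'"
proof -
  note \<theta>h = \<theta>[unfolded change_hom_def, THEN conjunct1] and \<mu>h = \<mu>[unfolded B.mult_hom_def, THEN conjunct1]
    and \<mu>h' = \<mu>'[unfolded B'.mult_hom_def, THEN conjunct1]
  note th = dagger_tensor_hom_hom[OF \<theta>h \<theta>h]
  have "compose (carrier (washnitzer d')) (comult H) \<theta> =
      compose (carrier (washnitzer d')) (dagger_tensor_hom d' d' d d \<theta> \<theta>) (comult H')"
  proof (rule washnitzer_hom_eqI[OF compose_washnitzer_hom[OF \<theta>h \<mu>h] compose_washnitzer_hom[OF \<mu>h' th]])
    fix z :: "nat \<Rightarrow> 'p padic" and i assume z: "z \<in> padic_points (d + d)" and i: "i < d'"
    have z1: "z \<in> padic_points d" "drop_points d z \<in> padic_points d"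
      using padic_points_mono[OF z] drop_points_in[OF z] by auto
    have "hom_point_map (compose (carrier (washnitzer d')) (comult H) \<theta>) z i =
        hom_point_map \<theta> (hom_point_map (comult H) z) i"
      by (rule hom_point_map_compose[OF \<theta>h \<mu>h z i])
    also have "\<dots> = B'.coord (B.gprod (hom_point_map (comult H) z)) i"
      using \<theta> hom_point_map_points[OF \<mu>h z] i by (simp add: change_hom_def)
    also have "\<dots> = B'.coord (B'.gprod (hom_point_map \<theta> z) \<otimes> B'.gprod (hom_point_map \<theta> (drop_points d z))) i"
      by (simp only: B.gprod_mult_hom[OF \<mu> z] gprod_change_hom[OF \<theta>] z1)
    also have "\<dots> = hom_point_map (comult H') (concat_points d' (hom_point_map \<theta> z) (hom_point_map \<theta> (drop_points d z))) i"
      by (rule B'.mult_hom_concat[OF \<mu>' hom_point_map_points[OF \<theta>h z1(1)] hom_point_map_points[OF \<theta>h z1(2)] i, symmetric])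
    also have "\<dots> = hom_point_map (comult H') (hom_point_map (dagger_tensor_hom d' d' d d \<theta> \<theta>) z) i"
      by (rule hom_point_map_cong[OF \<mu>h' i]) (rule hom_point_map_tensor[OF \<theta>h \<theta>h z, symmetric])
    also have "\<dots> = hom_point_map (compose (carrier (washnitzer d')) (dagger_tensor_hom d' d' d d \<theta> \<theta>) (comult H')) z i"
      by (rule hom_point_map_compose[OF \<mu>h' th z i, symmetric])
    finally show "hom_point_map (compose (carrier (washnitzer d')) (comult H) \<theta>) z i =
        hom_point_map (compose (carrier (washnitzer d')) (dagger_tensor_hom d' d' d d \<theta> \<theta>) (comult H')) z i" .
  qed
  thus ?thesis using \<theta>h by (simp add: dagger_group_hom_def)
qed

lemma points_map_change_hom:
  assumes "\<theta> \<in> algebra_hom (washnitzer d') (washnitzer d)" "\<phi> \<in> algebra_hom (washnitzer d) padic_algebra"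
  shows "points_map G T d' g' (compose (carrier (washnitzer d')) \<phi> \<theta>) =
    B'.gprod (hom_point_map \<theta> (\<lambda>i. \<phi> (washnitzer_var i)))"
  unfolding B'.points_map_eq
proof (rule B'.gprod_cong)
  fix i assume i: "i < d'"
  show "compose (carrier (washnitzer d')) \<phi> \<theta> (washnitzer_var i) = hom_point_map \<theta> (\<lambda>i. \<phi> (washnitzer_var i)) i"
    using point_hom_eval[OF assms(2) algebra_hom_closed[OF assms(1) washnitzer_var_closed[OF i]]]
    by (simp add: compose_def washnitzer_var_closed[OF i] hom_point_map_def)
qed

text \<open>The compatibility demanded of the isomorphism says that it carries coordinates in one
  basis to coordinates in the other. Existence and uniqueness are read off from this form.\<close>

lemma change_hom_iff_points:
  assumes \<theta>h: "\<theta> \<in> algebra_hom (washnitzer d') (washnitzer d)"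
  shows "change_hom \<theta> \<longleftrightarrow> (\<forall>\<phi>\<in>carrier (rational_points d H).
    points_map G T d' g' (compose (carrier (washnitzer d')) \<phi> \<theta>) = points_map G T d g \<phi>)"
proof
  assume \<theta>: "change_hom \<theta>"
  show "\<forall>\<phi>\<in>carrier (rational_points d H).
      points_map G T d' g' (compose (carrier (washnitzer d')) \<phi> \<theta>) = points_map G T d g \<phi>"
    by (auto simp: rational_points_def points_map_change_hom[OF \<theta>h] gprod_change_hom[OF \<theta>] point_hom_points B.points_map_eq)
next
  assume pt: "\<forall>\<phi>\<in>carrier (rational_points d H).
      points_map G T d' g' (compose (carrier (washnitzer d')) \<phi> \<theta>) = points_map G T d g \<phi>"
  have "hom_point_map \<theta> x i = B'.coord (B.gprod x) i" if x: "x \<in> padic_points d" and i: "i < d'" for x i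
  proof -
    obtain \<phi> where \<phi>: "\<phi> \<in> algebra_hom (washnitzer d) padic_algebra"
      "\<And>i. i < d \<Longrightarrow> \<phi> (washnitzer_var i) = x i" by (rule B.point_of_coord[OF x], rule that)
    have "B.gprod x = B.gprod (\<lambda>i. \<phi> (washnitzer_var i))" by (rule B.gprod_cong) (simp add: \<phi>(2))
    also have "\<dots> = B'.gprod (hom_point_map \<theta> (\<lambda>i. \<phi> (washnitzer_var i)))"
      using bspec[OF pt, of \<phi>] \<phi>(1) points_map_change_hom[OF \<theta>h \<phi>(1)]
      by (simp add: rational_points_def B.points_map_eq)
    also have "\<dots> = B'.gprod (hom_point_map \<theta> x)"
      by (rule B'.gprod_cong) (rule hom_point_map_cong[OF \<theta>h _ \<phi>(2)])
    finally show ?thesis using B'.coord_gprod[OF hom_point_map_points[OF \<theta>h x] i] by simp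
  qed
  thus "change_hom \<theta>" using \<theta>h by (simp add: change_hom_def)
qed

lemma change_hom_unique: "change_hom \<theta> \<Longrightarrow> change_hom \<theta>' \<Longrightarrow> \<theta> = \<theta>'"
  unfolding change_hom_def by (intro washnitzer_hom_eqI[of _ d' d]) auto

text \<open>Passing to the other coordinates and back is the identity on points. The opposite
  composite is the same lemma with the bases exchanged.\<close>

lemma change_hom_inverse:
  assumes \<theta>: "change_hom \<theta>" and \<eta>: "p_valued_two_bases.change_hom G T d' g' d g \<eta>"
    and two: "p_valued_two_bases G T \<omega> ptype d' g' d g"
  shows "compose (carrier (washnitzer d)) \<theta> \<eta> = (\<lambda>f\<in>carrier (washnitzer d). f)"
proof -
  interpret R: p_valued_two_bases G T \<omega> ptype d' g' d g by (rule two)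
  note \<theta>h = \<theta>[unfolded change_hom_def, THEN conjunct1] and \<eta>h = \<eta>[unfolded R.change_hom_def, THEN conjunct1]
  show ?thesis
  proof (rule washnitzer_hom_eqI[OF compose_washnitzer_hom[OF \<eta>h \<theta>h] id_hom])
    fix x :: "nat \<Rightarrow> 'p padic" and i assume x: "x \<in> padic_points d" and i: "i < d"
    have "hom_point_map (compose (carrier (washnitzer d)) \<theta> \<eta>) x i = hom_point_map \<eta> (hom_point_map \<theta> x) i"
      by (rule hom_point_map_compose[OF \<eta>h \<theta>h x i])
    also have "\<dots> = B.coord (B'.gprod (hom_point_map \<theta> x)) i"
      using \<eta> hom_point_map_points[OF \<theta>h x] i by (simp add: R.change_hom_def)
    also have "\<dots> = x i" by (simp add: gprod_change_hom[OF \<theta> x] B.coord_gprod[OF x i])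
    finally show "hom_point_map (compose (carrier (washnitzer d)) \<theta> \<eta>) x i =
        hom_point_map (\<lambda>f\<in>carrier (washnitzer d). f) x i"
      using i by (simp add: hom_point_map_id)
  qed
qed

lemma dagger_group_iso_unique_exists:
  assumes sat: "saturated CARD('p) G \<omega>"
    and H: "associated_dagger_group G T d g (H :: 'p dagger_group)" and H': "associated_dagger_group G T d' g' (H' :: 'p dagger_group)"
  shows "\<exists>!\<theta>. \<theta> \<in> dagger_group_iso d H d' H' \<and>
    (\<forall>\<phi>\<in>carrier (rational_points d H).
      points_map G T d' g' (compose (carrier (washnitzer d')) \<phi> \<theta>) = points_map G T d g \<phi>)"
proof -
  \<comment> \<open>The two bases exchanged, for the inverse homomorphism.\<close>
  interpret R: p_valued_two_bases G T \<omega> ptype d' g' d g ..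
  note \<mu> = B.associated_mult_hom[OF H] and \<mu>' = B'.associated_mult_hom[OF H']
  obtain \<theta> where \<theta>: "change_hom \<theta>" using change_hom_exists[OF sat] by blast
  obtain \<eta> where \<eta>: "R.change_hom \<eta>" using R.change_hom_exists[OF sat] by blast
  show ?thesis
  proof (rule ex1I[of _ \<theta>])
    have "\<theta> \<in> dagger_group_iso d H d' H'"
      unfolding dagger_group_iso_def
      using change_hom_dagger_group_hom[OF \<theta> \<mu> \<mu>'] R.change_hom_dagger_group_hom[OF \<eta> \<mu>' \<mu>]
        change_hom_inverse[OF \<theta> \<eta> R.p_valued_two_bases_axioms] R.change_hom_inverse[OF \<eta> \<theta> p_valued_two_bases_axioms]
      by blast
    thus "\<theta> \<in> dagger_group_iso d H d' H' \<and> (\<forall>\<phi>\<in>carrier (rational_points d H).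
        points_map G T d' g' (compose (carrier (washnitzer d')) \<phi> \<theta>) = points_map G T d g \<phi>)"
      using change_hom_iff_points[of \<theta> H] \<theta> by (simp add: change_hom_def)
  next
    fix \<zeta> assume \<zeta>: "\<zeta> \<in> dagger_group_iso d H d' H' \<and> (\<forall>\<phi>\<in>carrier (rational_points d H).
        points_map G T d' g' (compose (carrier (washnitzer d')) \<phi> \<zeta>) = points_map G T d g \<phi>)"
    hence "\<zeta> \<in> algebra_hom (washnitzer d') (washnitzer d)" by (simp add: dagger_group_iso_def dagger_group_hom_def)
    hence "change_hom \<zeta>" using change_hom_iff_points \<zeta> by blast
    thus "\<zeta> = \<theta>" using change_hom_unique \<theta> by blast
  qed
qed

end

theorem proposition5p4:
  fixes G :: "('g, 'm) monoid_scheme"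
    and T :: "'g topology"
    and \<omega> :: "'g \<Rightarrow> ereal"
    and d :: nat
    and g :: "nat \<Rightarrow> 'g"
  assumes "p_valued_group CARD('p::prime_card) G T \<omega>"
    and "saturated CARD('p) G \<omega>"
    and "ordered_basis TYPE('p) G T \<omega> d g"
  shows "(\<exists>!H :: 'p dagger_group. associated_dagger_group G T d g H) \<and>
         (\<forall>g' (H :: 'p dagger_group) (H' :: 'p dagger_group).
            ordered_basis TYPE('p) G T \<omega> d g' \<longrightarrow>
            associated_dagger_group G T d g H \<longrightarrow>
            associated_dagger_group G T d g' H' \<longrightarrow>
            (\<exists>!\<theta>. \<theta> \<in> dagger_group_iso d H d H' \<and>
               (\<forall>\<phi>\<in>carrier (rational_points d H).
                  points_map G T d g' (compose (carrier (washnitzer d)) \<phi> \<theta>) =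
                  points_map G T d g \<phi>)))"
proof (intro conjI allI impI)
  have basis: "p_valued_basis G T \<omega> TYPE('p) d g" if "ordered_basis TYPE('p) G T \<omega> d g" for g
    using assms(1) that by (intro p_valued_basis.intro p_valued.intro p_valued_basis_axioms.intro)
  show "\<exists>!H :: 'p dagger_group. associated_dagger_group G T d g H"
    by (rule p_valued_basis.associated_dagger_group_unique_exists[OF basis[OF assms(3)] assms(2)])
  fix g' and H H' :: "'p dagger_group"
  assume "ordered_basis TYPE('p) G T \<omega> d g'" "associated_dagger_group G T d g H" "associated_dagger_group G T d g' H'"
  thus "\<exists>!\<theta>. \<theta> \<in> dagger_group_iso d H d H' \<and>
      (\<forall>\<phi>\<in>carrier (rational_points d H).
        points_map G T d g' (compose (carrier (washnitzer d)) \<phi> \<theta>) = points_map G T d g \<phi>)"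
    by (intro p_valued_two_bases.dagger_group_iso_unique_exists[OF p_valued_two_bases.intro[OF basis basis] assms(2)] assms(3))
qed

end
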